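(* Let $E$ and $W$ be nonzero finite-rank free abelian groups, let $\mu:E\otimes E\otimes E\to W$ be surjective, let $T_\mu=E\oplus W$ be the associated two-step tensor system, and let $C_{\mathrm{vis}}(\mu)=\operatorname{coker}\Theta_\mu$. For every commutative $\mathbb Z$-algebra $S$ there is a natural exact sequence $$0\longrightarrow\mathfrak D(T_\mu,\mathbb Z)\otimes_{\mathbb Z}S\longrightarrow\mathfrak D(T_{\mu,S},S)\longrightarrow\operatorname{Tor}^{\mathbb Z}_1(C_{\mathrm{vis}}(\mu),S)\longrightarrow0.$$ Consequently the operator defect commutes with every flat base change, i.e. $\mathfrak D(T_\mu,\mathbb Z)\otimes_{\mathbb Z}S\to\mathfrak D(T_{\mu,S},S)$ is an isomorphism for every flat $S$. The middle-relation quotient always satisfies $Q_\mu\otimes_{\mathbb Z}S\cong Q_{\mu,S}$.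
   Context: Rings $S$ are unital. For a commutative ring $S$, finite-rank free $S$-modules $E,W$ and a surjective $S$-linear map $\mu:E^{\otimes_S3}\to W$, the two-step tensor system over $S$ is $T_\mu=E\oplus W$ with $\Gamma=S$ and product $(x+u)\,n\,(y+v)\,m\,(z+w)=nm\,\mu(x,y,z)$ ($x,y,z\in E$; $u,v,w\in W$; $n,m\in S$). With tensor products over $S$, define $\Theta_\mu:E\otimes E\to\operatorname{Hom}_S(E,W)$, $\Theta_\mu(a\otimes b)(c)=\mu(a,b,c)$; $B_\mu:E^{\otimes4}\to(W\otimes E)\oplus(E\otimes W)$, $B_\mu(a\otimes b\otimes c\otimes d)=\mu(a,b,c)\otimes d-a\otimes\mu(b,c,d)$; and $Q_\mu=\operatorname{coker}B_\mu$. Given $\mu$ over $\mathbb Z$, a subscript $S$ denotes tensoring the whole system with $S$: $T_{\mu,S}$ is the system of $\mu\otimes S:(E\otimes S)^{\otimes_S3}\to W\otimes S$, and $Q_{\mu,S}=\operatorname{coker}(B_{\mu\otimes S})$. The operator rng $\mathcal O_S(T,\Gamma)$ over $S$ is the quotient of $T\otimes_S\Gamma\otimes_ST\otimes_S\Gamma$, with multiplication $(a\otimes\alpha\otimes b\otimes\beta)(c\otimes\gamma\otimes d\otimes\delta)=(a\alpha b\beta c)\otimes\gamma\otimes d\otimes\delta$, by the two-sided ideal generated by all $(a\alpha b\beta c)\otimes\gamma\otimes d\otimes\delta-a\otimes\alpha\otimes(b\beta c\gamma d)\otimes\delta$. The (intrinsic) operator defect $\mathfrak D(T,\Gamma)$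 over $S$ is the kernel of the regular representation $\mathcal O_S(T,\Gamma)\to\operatorname{End}_S(T)$, $[a,\alpha,b,\beta]\mapsto(x\mapsto a\alpha b\beta x)$. There is a canonical isomorphism $\mathcal O_{\mathbb Z}(T,\Gamma)\otimes S\cong\mathcal O_S(T\otimes S,\Gamma\otimes S)$, through which the map $\mathfrak D(T_\mu,\mathbb Z)\otimes S\to\mathfrak D(T_{\mu,S},S)$ is induced. *)

theory Defs
  imports "HOL.Hull" "HOL-Algebra.Module" "HOL-Algebra.IntRing"
begin

text \<open>Modules are those of HOL-Algebra: records over the ring record, with an explicit base
  ring. The fields \<open>mult\<close> and \<open>one\<close> of such a record carry no meaning, except that the
  operator rng below stores its multiplication in \<open>mult\<close> (it has no unit).\<close>

definition plain_module ::
  "'a set \<Rightarrow> 'a \<Rightarrow> ('a \<Rightarrow> 'a \<Rightarrow> 'a) \<Rightarrow> ('r \<Rightarrow> 'a \<Rightarrow> 'a) \<Rightarrow> ('r, 'a) module" where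
  "plain_module C z a s =
     \<lparr>carrier = C, monoid.mult = (\<lambda>_ _. z), one = z, ring.zero = z, ring.add = a, smult = s\<rparr>"


section \<open>Linear maps, quotients and scalars\<close>

definition linear_maps ::
  "('r, 'x) ring_scheme \<Rightarrow> ('r, 'a, 'y) module_scheme \<Rightarrow> ('r, 'b, 'z) module_scheme \<Rightarrow> ('a \<Rightarrow> 'b) set"
  where
  "linear_maps R M N = {f \<in> carrier M \<rightarrow> carrier N.
     (\<forall>x\<in>carrier M. \<forall>y\<in>carrier M. f (x \<oplus>\<^bsub>M\<^esub> y) = f x \<oplus>\<^bsub>N\<^esub> f y) \<and>
     (\<forall>r\<in>carrier R. \<forall>x\<in>carrier M. f (r \<odot>\<^bsub>M\<^esub> x) = r \<odot>\<^bsub>N\<^esub> f x)}"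

definition module_iso ::
  "('r, 'x) ring_scheme \<Rightarrow> ('r, 'a, 'y) module_scheme \<Rightarrow> ('r, 'b, 'z) module_scheme \<Rightarrow> ('a \<Rightarrow> 'b) set"
  where
  "module_iso R M N =
     {f \<in> linear_maps R M N. module R M \<and> module R N \<and> bij_betw f (carrier M) (carrier N)}"

definition short_exact ::
  "('r, 'x) ring_scheme \<Rightarrow> ('r, 'a) module \<Rightarrow> ('a \<Rightarrow> 'b) \<Rightarrow> ('r, 'b) module \<Rightarrow> ('b \<Rightarrow> 'c) \<Rightarrow>
     ('r, 'c) module \<Rightarrow> bool" where
  "short_exact R A f B g C \<longleftrightarrow>
     module R A \<and> module R B \<and> module R C \<and>
     f \<in> linear_maps R A B \<and> g \<in> linear_maps R B C \<and>
     inj_on f (carrier A) \<and>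
     f ` carrier A = {y \<in> carrier B. g y = \<zero>\<^bsub>C\<^esub>} \<and>
     g ` carrier B = carrier C"

text \<open>Maps are taken extensional, so that equality in \<open>Hom\<close> is equality on the source.\<close>

definition Hom_module ::
  "('r, 'x) ring_scheme \<Rightarrow> ('r, 'a, 'y) module_scheme \<Rightarrow> ('r, 'b, 'z) module_scheme \<Rightarrow>
     ('r, 'a \<Rightarrow> 'b) module" where
  "Hom_module R M N = plain_module (linear_maps R M N \<inter> extensional (carrier M))
     (\<lambda>x\<in>carrier M. \<zero>\<^bsub>N\<^esub>)
     (\<lambda>f g. \<lambda>x\<in>carrier M. f x \<oplus>\<^bsub>N\<^esub> g x)
     (\<lambda>r f. \<lambda>x\<in>carrier M. r \<odot>\<^bsub>N\<^esub> f x)"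

definition direct_sum ::
  "('r, 'a, 'y) module_scheme \<Rightarrow> ('r, 'b, 'z) module_scheme \<Rightarrow> ('r, 'a \<times> 'b) module" where
  "direct_sum M N = plain_module (carrier M \<times> carrier N) (\<zero>\<^bsub>M\<^esub>, \<zero>\<^bsub>N\<^esub>)
     (\<lambda>p q. (fst p \<oplus>\<^bsub>M\<^esub> fst q, snd p \<oplus>\<^bsub>N\<^esub> snd q))
     (\<lambda>r p. (r \<odot>\<^bsub>M\<^esub> fst p, r \<odot>\<^bsub>N\<^esub> snd p))"

definition quot_module :: "('r, 'a, 'y) module_scheme \<Rightarrow> 'a set \<Rightarrow> ('r, 'a set) module" where
  "quot_module M N =
     ring.extend (M Quot N) (module.fields (\<lambda>r X. \<Union>x\<in>X. N +>\<^bsub>M\<^esub> (r \<odot>\<^bsub>M\<^esub> x)))"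

definition regular_module :: "('r, 'x) ring_scheme \<Rightarrow> ('r, 'r) module" where
  "regular_module R = ring.extend (ring.truncate R) (module.fields (monoid.mult R))"

definition restrict_scalars :: "('r \<Rightarrow> 's) \<Rightarrow> ('s, 'a, 'y) module_scheme \<Rightarrow> ('r, 'a) module" where
  "restrict_scalars h M =
     ring.extend (ring.truncate M) (module.fields (\<lambda>r. smult M (h r)))"

definition finite_free :: "('r, 'x) ring_scheme \<Rightarrow> ('r, 'a, 'y) module_scheme \<Rightarrow> bool" where
  "finite_free R M \<longleftrightarrow> module R M \<and>
     (\<exists>B. finite B \<and> B \<subseteq> carrier M \<and>
       (\<forall>x\<in>carrier M. \<exists>!c. c \<in> B \<rightarrow>\<^sub>E carrier R \<and> x = (\<Oplus>\<^bsub>M\<^esub>b\<in>B. c b \<odot>\<^bsub>M\<^esub> b)))"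


section \<open>Free modules and tensor products\<close>

definition free_module :: "('r, 'x) ring_scheme \<Rightarrow> 'a set \<Rightarrow> ('r, 'a \<Rightarrow> 'r) module" where
  "free_module R A = plain_module
     {f. (\<forall>a\<in>A. f a \<in> carrier R) \<and> (\<forall>a. a \<notin> A \<longrightarrow> f a = \<zero>\<^bsub>R\<^esub>) \<and> finite {a. f a \<noteq> \<zero>\<^bsub>R\<^esub>}}
     (\<lambda>_. \<zero>\<^bsub>R\<^esub>)
     (\<lambda>f g a. f a \<oplus>\<^bsub>R\<^esub> g a)
     (\<lambda>r f a. r \<otimes>\<^bsub>R\<^esub> f a)"

definition free_gen :: "('r, 'x) ring_scheme \<Rightarrow> 'a \<Rightarrow> 'a \<Rightarrow> 'r" where
  "free_gen R a = (\<lambda>b. if b = a then \<one>\<^bsub>R\<^esub> else \<zero>\<^bsub>R\<^esub>)"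

definition free_lift ::
  "('r, 'x) ring_scheme \<Rightarrow> ('r, 'p, 'y) module_scheme \<Rightarrow> ('a \<Rightarrow> 'p) \<Rightarrow> ('a \<Rightarrow> 'r) \<Rightarrow> 'p" where
  "free_lift R P f \<phi> = (\<Oplus>\<^bsub>P\<^esub>a\<in>{a. \<phi> a \<noteq> \<zero>\<^bsub>R\<^esub>}. \<phi> a \<odot>\<^bsub>P\<^esub> f a)"

definition tensor_rels ::
  "('r, 'x) ring_scheme \<Rightarrow> ('r, 'a, 'y) module_scheme \<Rightarrow> ('r, 'b, 'z) module_scheme \<Rightarrow>
     ('a \<times> 'b \<Rightarrow> 'r) set" where
  "tensor_rels R M N =
     (let F = free_module R (carrier M \<times> carrier N); e = (\<lambda>x y. free_gen R (x, y)) in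
      {e (x \<oplus>\<^bsub>M\<^esub> x') y \<ominus>\<^bsub>F\<^esub> (e x y \<oplus>\<^bsub>F\<^esub> e x' y) | x x' y.
         x \<in> carrier M \<and> x' \<in> carrier M \<and> y \<in> carrier N} \<union>
      {e x (y \<oplus>\<^bsub>N\<^esub> y') \<ominus>\<^bsub>F\<^esub> (e x y \<oplus>\<^bsub>F\<^esub> e x y') | x y y'.
         x \<in> carrier M \<and> y \<in> carrier N \<and> y' \<in> carrier N} \<union>
      {e (r \<odot>\<^bsub>M\<^esub> x) y \<ominus>\<^bsub>F\<^esub> (r \<odot>\<^bsub>F\<^esub> e x y) | r x y.
         r \<in> carrier R \<and> x \<in> carrier M \<and> y \<in> carrier N} \<union>
      {e x (r \<odot>\<^bsub>N\<^esub> y) \<ominus>\<^bsub>F\<^esub> (r \<odot>\<^bsub>F\<^esub> e x y) | r x y.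
         r \<in> carrier R \<and> x \<in> carrier M \<and> y \<in> carrier N})"

definition tensor_null ::
  "('r, 'x) ring_scheme \<Rightarrow> ('r, 'a, 'y) module_scheme \<Rightarrow> ('r, 'b, 'z) module_scheme \<Rightarrow>
     ('a \<times> 'b \<Rightarrow> 'r) set" where
  "tensor_null R M N =
     (\<lambda>K. submodule K R (free_module R (carrier M \<times> carrier N))) hull tensor_rels R M N"

definition tensor ::
  "('r, 'x) ring_scheme \<Rightarrow> ('r, 'a, 'y) module_scheme \<Rightarrow> ('r, 'b, 'z) module_scheme \<Rightarrow>
     ('r, ('a \<times> 'b \<Rightarrow> 'r) set) module" where
  "tensor R M N = quot_module (free_module R (carrier M \<times> carrier N)) (tensor_null R M N)"

definition pure ::
  "('r, 'x) ring_scheme \<Rightarrow> ('r, 'a, 'y) module_scheme \<Rightarrow> ('r, 'b, 'z) module_scheme \<Rightarrow>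
     'a \<Rightarrow> 'b \<Rightarrow> ('a \<times> 'b \<Rightarrow> 'r) set" where
  "pure R M N x y =
     tensor_null R M N +>\<^bsub>free_module R (carrier M \<times> carrier N)\<^esub> free_gen R (x, y)"

text \<open>The map out of a tensor product induced by a bilinear map \<open>f\<close> into \<open>P\<close>; it is constant on
  the cosets when \<open>f\<close> is bilinear, and is only used for such \<open>f\<close>.\<close>

definition tensor_lift ::
  "('r, 'x) ring_scheme \<Rightarrow> ('r, 'p, 'y) module_scheme \<Rightarrow> ('a \<Rightarrow> 'b \<Rightarrow> 'p) \<Rightarrow>
     ('a \<times> 'b \<Rightarrow> 'r) set \<Rightarrow> 'p" where
  "tensor_lift R P f X = the_elem (free_lift R P (\<lambda>(x, y). f x y) ` X)"

text \<open>\<open>f \<otimes> g\<close> as a map into \<open>M' \<otimes> N'\<close>.\<close>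

definition tensor_map ::
  "('r, 'x) ring_scheme \<Rightarrow> ('r, 'c, 'y) module_scheme \<Rightarrow> ('r, 'd, 'z) module_scheme \<Rightarrow>
     ('a \<Rightarrow> 'c) \<Rightarrow> ('b \<Rightarrow> 'd) \<Rightarrow> ('a \<times> 'b \<Rightarrow> 'r) set \<Rightarrow> ('c \<times> 'd \<Rightarrow> 'r) set" where
  "tensor_map R M' N' f g = tensor_lift R (tensor R M' N') (\<lambda>x y. pure R M' N' (f x) (g y))"

text \<open>Iterated tensor products associate to the left.\<close>

definition "tensor3 R A B C = tensor R (tensor R A B) C"
definition "tensor4 R A B C D = tensor R (tensor3 R A B C) D"
definition "pure3 R A B C a b c = pure R (tensor R A B) C (pure R A B a b) c"
definition "pure4 R A B C D a b c d = pure R (tensor3 R A B C) D (pure3 R A B C a b c) d"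
definition "tensor_lift3 R P f =
  tensor_lift R P (\<lambda>u c. tensor_lift R P (\<lambda>a b. f a b c) u)"
definition "tensor_lift4 R P f =
  tensor_lift R P (\<lambda>u d. tensor_lift3 R P (\<lambda>a b c. f a b c d) u)"

text \<open>Type variables cannot be quantified inside a definition, so flatness is tested on injections
  between modules whose elements lie in the type \<^typ>\<open>nat \<Rightarrow> 'r\<close>. Up to isomorphism these
  include all finitely generated modules and their submodules, on which flatness can be
  tested; as a hypothesis the condition is formally weaker than the one over all modules.\<close>

definition flat_module :: "('r, 'x) ring_scheme \<Rightarrow> ('r, 'a, 'y) module_scheme \<Rightarrow> bool" where
  "flat_module R N \<longleftrightarrow> module R N \<and>
     (\<forall>(M :: ('r, nat \<Rightarrow> 'r) module) (M' :: ('r, nat \<Rightarrow> 'r) module) f.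
        module R M \<and> module R M' \<and> f \<in> linear_maps R M M' \<and> inj_on f (carrier M) \<longrightarrow>
        inj_on (tensor_map R M' N f (\<lambda>y. y)) (carrier (tensor R M N)))"


section \<open>Base change from the integers\<close>

definition int_hom :: "('s, 'x) ring_scheme \<Rightarrow> int \<Rightarrow> 's" where
  "int_hom S n = [n] \<cdot>\<^bsub>S\<^esub> \<one>\<^bsub>S\<^esub>"

abbreviation int_alg :: "('s, 'x) ring_scheme \<Rightarrow> (int, 's) module" where
  "int_alg S \<equiv> restrict_scalars (int_hom S) (regular_module S)"

text \<open>\<open>M \<otimes> S\<close> over the integers, as an \<open>S\<close>-module through the second factor.\<close>

definition base_change ::
  "(int, 'a, 'y) module_scheme \<Rightarrow> ('s, 'x) ring_scheme \<Rightarrow> ('s, ('a \<times> 's \<Rightarrow> int) set) module" where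
  "base_change M S =
     (let T = tensor \<Z> M (int_alg S) in
      plain_module (carrier T) \<zero>\<^bsub>T\<^esub> (ring.add T)
        (\<lambda>s. tensor_map \<Z> M (int_alg S) (\<lambda>x. x) (\<lambda>t. s \<otimes>\<^bsub>S\<^esub> t)))"

text \<open>The map \<open>M \<otimes> S \<rightarrow> M \<otimes> S'\<close> induced by \<open>h : S \<rightarrow> S'\<close>.\<close>

definition base_change_hom ::
  "(int, 'a, 'y) module_scheme \<Rightarrow> ('s', 'x) ring_scheme \<Rightarrow> ('s \<Rightarrow> 's') \<Rightarrow>
     ('a \<times> 's \<Rightarrow> int) set \<Rightarrow> ('a \<times> 's' \<Rightarrow> int) set" where
  "base_change_hom M S' h = tensor_map \<Z> M (int_alg S') (\<lambda>x. x) h"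

text \<open>\<open>Tor\<^sub>1(C, S)\<close> over the integers: the first homology of \<open>P \<otimes> S\<close> for the standard free
  resolution \<open>0 \<rightarrow> K \<rightarrow> F \<rightarrow> C \<rightarrow> 0\<close>, with \<open>F\<close> free on the set \<open>C\<close>; the kernel \<open>K\<close> is free because
  a subgroup of a free abelian group is free. It is an \<open>S\<close>-module through the second factor,
  and functorial in \<open>S\<close> through \<^const>\<open>base_change_hom\<close>.\<close>

definition resolution_kernel ::
  "(int, 'c) module \<Rightarrow> (int, 'c \<Rightarrow> int) module" where
  "resolution_kernel C =
     (let F = free_module \<Z> (carrier C) in
      F\<lparr>carrier := {\<phi> \<in> carrier F. free_lift \<Z> C (\<lambda>x. x) \<phi> = \<zero>\<^bsub>C\<^esub>}\<rparr>)"

definition Tor1 ::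
  "(int, 'c) module \<Rightarrow> ('s, 'x) ring_scheme \<Rightarrow> ('s, (('c \<Rightarrow> int) \<times> 's \<Rightarrow> int) set) module" where
  "Tor1 C S =
     (let F = free_module \<Z> (carrier C); KS = base_change (resolution_kernel C) S in
      KS\<lparr>carrier := {X \<in> carrier KS.
        tensor_map \<Z> F (int_alg S) (\<lambda>x. x) (\<lambda>s. s) X = \<zero>\<^bsub>tensor \<Z> F (int_alg S)\<^esub>}\<rparr>)"

definition Tor1_hom ::
  "(int, 'c) module \<Rightarrow> ('s', 'x) ring_scheme \<Rightarrow> ('s \<Rightarrow> 's') \<Rightarrow>
     (('c \<Rightarrow> int) \<times> 's \<Rightarrow> int) set \<Rightarrow> (('c \<Rightarrow> int) \<times> 's' \<Rightarrow> int) set" where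
  "Tor1_hom C S' h = base_change_hom (resolution_kernel C) S' h"


section \<open>Tensor systems and their operator rngs\<close>

text \<open>\<open>tprod A a \<alpha> b \<beta> c\<close> is the product \<open>a\<alpha>b\<beta>c\<close>.\<close>

record ('r, 't, 'g) tensor_system =
  space :: "('r, 't) module"
  params :: "('r, 'g) module"
  tprod :: "'t \<Rightarrow> 'g \<Rightarrow> 't \<Rightarrow> 'g \<Rightarrow> 't \<Rightarrow> 't"

definition op_pure where
  "op_pure R A = pure4 R (space A) (params A) (space A) (params A)"

definition op_mult where
  "op_mult R A X Y =
     (let M = tensor4 R (space A) (params A) (space A) (params A) in
      tensor_lift4 R M (\<lambda>a \<alpha> b \<beta>.
        tensor_lift4 R M (\<lambda>c \<gamma> d \<delta>. op_pure R A (tprod A a \<alpha> b \<beta> c) \<gamma> d \<delta>) Y) X)"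

definition op_alg where
  "op_alg R A = (tensor4 R (space A) (params A) (space A) (params A))\<lparr>monoid.mult := op_mult R A\<rparr>"

definition op_rels where
  "op_rels R A =
     {op_pure R A (tprod A a \<alpha> b \<beta> c) \<gamma> d \<delta> \<ominus>\<^bsub>op_alg R A\<^esub> op_pure R A a \<alpha> (tprod A b \<beta> c \<gamma> d) \<delta>
       | a \<alpha> b \<beta> c \<gamma> d \<delta>.
         {a, b, c, d} \<subseteq> carrier (space A) \<and> {\<alpha>, \<beta>, \<gamma>, \<delta>} \<subseteq> carrier (params A)}"

text \<open>The generators are stable under scalars, so requiring the ideal to be a submodule
  rather than an additive subgroup does not enlarge it.\<close>

definition op_ideal where
  "op_ideal R A =
     (\<lambda>I. submodule I R (op_alg R A) \<and>
        (\<forall>x\<in>I. \<forall>y\<in>carrier (op_alg R A).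
           x \<otimes>\<^bsub>op_alg R A\<^esub> y \<in> I \<and> y \<otimes>\<^bsub>op_alg R A\<^esub> x \<in> I)) hull op_rels R A"

definition operator_rng where
  "operator_rng R A = quot_module (op_alg R A) (op_ideal R A)"

text \<open>The class \<open>[a, \<alpha>, b, \<beta>]\<close>, and the map on the operator rng determined by
  \<open>[a, \<alpha>, b, \<beta>] \<mapsto> f a \<alpha> b \<beta>\<close>.\<close>

definition op_class where
  "op_class R A a \<alpha> b \<beta> = op_ideal R A +>\<^bsub>op_alg R A\<^esub> op_pure R A a \<alpha> b \<beta>"

definition op_lift where
  "op_lift R P f X = the_elem (tensor_lift4 R P f ` X)"

definition regular_rep where
  "regular_rep R A = op_lift R (Hom_module R (space A) (space A))
     (\<lambda>a \<alpha> b \<beta>. \<lambda>x\<in>carrier (space A). tprod A a \<alpha> b \<beta> x)"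

definition operator_defect where
  "operator_defect R A = (operator_rng R A)\<lparr>carrier :=
     {X \<in> carrier (operator_rng R A).
        regular_rep R A X = \<zero>\<^bsub>Hom_module R (space A) (space A)\<^esub>}\<rparr>"

text \<open>The map from an operator rng over \<open>R\<close> to that of \<open>A'\<close> over \<open>R'\<close> induced by \<open>h : R \<rightarrow> R'\<close> and
  \<open>h\<close>-semilinear maps \<open>f\<close> on the spaces and \<open>g\<close> on the parameters:
  \<open>[a, \<alpha>, b, \<beta>] \<mapsto> [f a, g \<alpha>, f b, g \<beta>]\<close>.\<close>

definition operator_hom where
  "operator_hom R h f g R' A' = op_lift R (restrict_scalars h (operator_rng R' A'))
     (\<lambda>a \<alpha> b \<beta>. op_class R' A' (f a) (g \<alpha>) (f b) (g \<beta>))"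


section \<open>Two-step systems\<close>

type_synonym ('r, 'e) cube = "(('e \<times> 'e \<Rightarrow> 'r) set \<times> 'e \<Rightarrow> 'r) set"

definition tri ::
  "('r, 'x) ring_scheme \<Rightarrow> ('r, 'e) module \<Rightarrow> (('r, 'e) cube \<Rightarrow> 'w) \<Rightarrow> 'e \<Rightarrow> 'e \<Rightarrow> 'e \<Rightarrow> 'w" where
  "tri R E \<mu> x y z = \<mu> (pure3 R E E E x y z)"

definition two_step ::
  "('r, 'x) ring_scheme \<Rightarrow> ('r, 'e) module \<Rightarrow> ('r, 'w) module \<Rightarrow> (('r, 'e) cube \<Rightarrow> 'w) \<Rightarrow>
     ('r, 'e \<times> 'w, 'r) tensor_system" where
  "two_step R E W \<mu> =
     \<lparr>space = direct_sum E W, params = regular_module R,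
      tprod = (\<lambda>p n q m r. (\<zero>\<^bsub>E\<^esub>, (n \<otimes>\<^bsub>R\<^esub> m) \<odot>\<^bsub>W\<^esub> tri R E \<mu> (fst p) (fst q) (fst r)))\<rparr>"

definition Theta ::
  "('r, 'x) ring_scheme \<Rightarrow> ('r, 'e) module \<Rightarrow> ('r, 'w) module \<Rightarrow> (('r, 'e) cube \<Rightarrow> 'w) \<Rightarrow>
     ('e \<times> 'e \<Rightarrow> 'r) set \<Rightarrow> 'e \<Rightarrow> 'w" where
  "Theta R E W \<mu> = tensor_lift R (Hom_module R E W) (\<lambda>a b. \<lambda>c\<in>carrier E. tri R E \<mu> a b c)"

definition C_vis ::
  "('r, 'x) ring_scheme \<Rightarrow> ('r, 'e) module \<Rightarrow> ('r, 'w) module \<Rightarrow> (('r, 'e) cube \<Rightarrow> 'w) \<Rightarrow>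
     ('r, ('e \<Rightarrow> 'w) set) module" where
  "C_vis R E W \<mu> = quot_module (Hom_module R E W) (Theta R E W \<mu> ` carrier (tensor R E E))"

definition middle_map where
  "middle_map R E W \<mu> =
     tensor_lift4 R (direct_sum (tensor R W E) (tensor R E W))
       (\<lambda>a b c d. (pure R W E (tri R E \<mu> a b c) d,
                   \<ominus>\<^bsub>tensor R E W\<^esub> pure R E W a (tri R E \<mu> b c d)))"

definition middle_quotient where
  "middle_quotient R E W \<mu> =
     quot_module (direct_sum (tensor R W E) (tensor R E W))
       (middle_map R E W \<mu> ` carrier (tensor4 R E E E E))"

text \<open>\<open>\<mu> \<otimes> S\<close>, read as a map on the cube of \<open>E \<otimes> S\<close> over \<open>S\<close>:
  \<open>(x \<otimes> s) \<otimes> (y \<otimes> t) \<otimes> (z \<otimes> u) \<mapsto> \<mu>(x, y, z) \<otimes> stu\<close>.\<close>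

definition base_change_mu ::
  "(int, 'e) module \<Rightarrow> (int, 'w) module \<Rightarrow> ((int, 'e) cube \<Rightarrow> 'w) \<Rightarrow> ('s, 'x) ring_scheme \<Rightarrow>
     ('s, ('e \<times> 's \<Rightarrow> int) set) cube \<Rightarrow> ('w \<times> 's \<Rightarrow> int) set" where
  "base_change_mu E W \<mu> S =
     tensor_lift3 S (base_change W S) (\<lambda>X Y Z.
       let V = tensor \<Z> W (int_alg S) in
       tensor_lift \<Z> V (\<lambda>x s. tensor_lift \<Z> V (\<lambda>y t. tensor_lift \<Z> V (\<lambda>z u.
         pure \<Z> W (int_alg S) (tri \<Z> E \<mu> x y z) (s \<otimes>\<^bsub>S\<^esub> t \<otimes>\<^bsub>S\<^esub> u)) Z) Y) X)"

definition two_step_over ::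
  "(int, 'e) module \<Rightarrow> (int, 'w) module \<Rightarrow> ((int, 'e) cube \<Rightarrow> 'w) \<Rightarrow> ('s, 'x) ring_scheme \<Rightarrow>
     ('s, ('e \<times> 's \<Rightarrow> int) set \<times> ('w \<times> 's \<Rightarrow> int) set, 's) tensor_system" where
  "two_step_over E W \<mu> S =
     two_step S (base_change E S) (base_change W S) (base_change_mu E W \<mu> S)"

text \<open>The canonical map from the base change of the integral operator rng to the operator rng
  over \<open>S\<close>, \<open>[a, \<alpha>, b, \<beta>] \<otimes> s \<mapsto> s [a \<otimes> 1, \<alpha> 1, b \<otimes> 1, \<beta> 1]\<close>, where \<open>(E \<oplus> W) \<otimes> S\<close> is identified with
  \<open>(E \<otimes> S) \<oplus> (W \<otimes> S)\<close> and \<open>\<Gamma> \<otimes> S\<close> with \<open>S\<close>.\<close>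

definition operator_base_change where
  "operator_base_change E W \<mu> S =
     (let OS = operator_rng S (two_step_over E W \<mu> S);
          c = (\<lambda>p. (pure \<Z> E (int_alg S) (fst p) \<one>\<^bsub>S\<^esub>, pure \<Z> W (int_alg S) (snd p) \<one>\<^bsub>S\<^esub>)) in
      tensor_lift \<Z> (restrict_scalars (int_hom S) OS)
        (\<lambda>X s. s \<odot>\<^bsub>OS\<^esub>
           operator_hom \<Z> (int_hom S) c (int_hom S) S (two_step_over E W \<mu> S) X))"

definition defect_base_change where
  "defect_base_change E W \<mu> S =
     operator_base_change E W \<mu> S \<circ>
     tensor_map \<Z> (operator_rng \<Z> (two_step \<Z> E W \<mu>)) (int_alg S) (\<lambda>X. X) (\<lambda>s. s)"

text \<open>Functoriality in \<open>S\<close> of the operator rng over \<open>S\<close>, for \<open>h : S \<rightarrow> S'\<close>; it restricts to the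
  operator defects.\<close>

definition operator_scalar_hom where
  "operator_scalar_hom E W \<mu> S h S' =
     operator_hom S h (map_prod (base_change_hom E S' h) (base_change_hom W S' h)) h
       S' (two_step_over E W \<mu> S')"

end

theory Submission
  imports Defs
begin

text \<open>Products of elements of a two-step system lie in \<open>W\<close>, so the ideal of relations of the
  operator rng \<open>O\<close> is the span of its generators, and \<open>O\<close> represents quadrilinear maps that satisfy
  one balancing identity. This makes \<open>O\<close> compatible with base change, \<open>O \<otimes> S \<cong> O\<^sub>S\<close>, and the same
  argument applies to the middle-relation quotient. The regular representation factors through a
  map \<open>O \<rightarrow> Hom(E, W) \<cong> \<int>\<^sup>k\<close> whose image \<open>J\<close> is that of \<open>\<Theta>\<^sub>\<mu>\<close> and whose kernel is the defect \<open>D\<close>.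
  As a subgroup of \<open>\<int>\<^sup>k\<close>, \<open>J\<close> is projective, so \<open>0 \<rightarrow> D \<rightarrow> O \<rightarrow> J \<rightarrow> 0\<close> splits and stays exact after
  \<open>\<otimes> S\<close>. The defect over \<open>S\<close> is the kernel of \<open>O \<otimes> S \<rightarrow> J \<otimes> S \<rightarrow> Hom(E, W) \<otimes> S\<close>, and the kernel of the
  second map is \<open>Tor\<^sub>1(Hom(E, W)/J, S)\<close>. The connecting map is \<open>\<kappa> \<otimes> S\<close>, where \<open>\<kappa>\<close> lifts
  \<open>O \<rightarrow> Hom(E, W)\<close> to the standard free resolution of the cokernel; since \<open>\<kappa>\<close> does not involve \<open>S\<close>,
  naturality in \<open>S\<close> is immediate.\<close>

section \<open>Linear maps and submodules\<close>

text \<open>\<open>O\<close> is a quotient of a free module and is not known to be flat, so neither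
  the injectivity of \<open>D \<otimes> S\<close> into \<open>O \<otimes> S\<close> nor exactness in
  the middle comes for free. Projectivity of \<open>J\<close> supplies both, and all failure of
  exactness is concentrated in the single map from \<open>J \<otimes> S\<close> to
  \<open>\<int>\<^sup>k \<otimes> S\<close>. The group \<open>Tor1\<close> is defined through the
  resolution that is free on the underlying set of the cokernel, while the presentation at hand is
  the inclusion of \<open>J\<close> in \<open>\<int>\<^sup>k\<close>. Lifts \<open>\<psi>\<close>,
  \<open>\<phi>\<close> of the identity in both directions and the homotopies
  \<open>\<sigma>\<close>, \<open>\<tau>\<close> bridge the two. The inverse of the map from
  \<open>O \<otimes> S\<close> to the operator rng over \<open>S\<close> is written down explicitly.
  The two parameters are scalars, so it suffices to extend one integral bilinear map on
  \<open>T\<close> to \<open>S\<close>; each multilinear identity over \<open>S\<close> is then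
  reduced to vectors \<open>x \<otimes> 1\<close>, one argument at a time. The entries of
  \<open>Hom(E, W)\<close> are numbered by naturals because flatness is tested on modules whose
  elements are functions on \<open>nat\<close>.\<close>

lemma linear_mapsI:
  assumes "\<And>x. x \<in> carrier M \<Longrightarrow> f x \<in> carrier N"
    and "\<And>x y. x \<in> carrier M \<Longrightarrow> y \<in> carrier M \<Longrightarrow> f (x \<oplus>\<^bsub>M\<^esub> y) = f x \<oplus>\<^bsub>N\<^esub> f y"
    and "\<And>r x. r \<in> carrier R \<Longrightarrow> x \<in> carrier M \<Longrightarrow> f (r \<odot>\<^bsub>M\<^esub> x) = r \<odot>\<^bsub>N\<^esub> f x"
  shows "f \<in> linear_maps R M N"
  using assms by (auto simp: linear_maps_def)

lemma
  assumes "f \<in> linear_maps R M N"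
  shows lin_closed: "x \<in> carrier M \<Longrightarrow> f x \<in> carrier N"
    and lin_add: "x \<in> carrier M \<Longrightarrow> y \<in> carrier M \<Longrightarrow> f (x \<oplus>\<^bsub>M\<^esub> y) = f x \<oplus>\<^bsub>N\<^esub> f y"
    and lin_smult: "r \<in> carrier R \<Longrightarrow> x \<in> carrier M \<Longrightarrow> f (r \<odot>\<^bsub>M\<^esub> x) = r \<odot>\<^bsub>N\<^esub> f x"
  using assms by (auto simp: linear_maps_def)

lemma lin_zero:
  assumes "f \<in> linear_maps R M N" "module R M" "module R N"
  shows "f \<zero>\<^bsub>M\<^esub> = \<zero>\<^bsub>N\<^esub>"
proof -
  interpret M: module R M by fact
  interpret N: module R N by fact
  have "f \<zero>\<^bsub>M\<^esub> = f (\<zero>\<^bsub>R\<^esub> \<odot>\<^bsub>M\<^esub> \<zero>\<^bsub>M\<^esub>)" by simp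
  also have "\<dots> = \<zero>\<^bsub>N\<^esub>"
    by (subst lin_smult[OF assms(1)]) (auto simp: lin_closed[OF assms(1)])
  finally show ?thesis .
qed

lemma lin_neg:
  assumes "f \<in> linear_maps R M N" "module R M" "module R N" "x \<in> carrier M"
  shows "f (\<ominus>\<^bsub>M\<^esub> x) = \<ominus>\<^bsub>N\<^esub> f x"
proof -
  interpret M: module R M by fact
  interpret N: module R N by fact
  have "f (\<ominus>\<^bsub>M\<^esub> x) \<oplus>\<^bsub>N\<^esub> f x = \<zero>\<^bsub>N\<^esub>"
    using assms by (simp flip: lin_add[OF assms(1)] add: M.l_neg lin_zero)
  then show ?thesis
    using assms by (metis M.a_inv_closed N.minus_equality lin_closed)
qed

lemma lin_diff:
  assumes "f \<in> linear_maps R M N" "module R M" "module R N" "x \<in> carrier M" "y \<in> carrier M"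
  shows "f (x \<ominus>\<^bsub>M\<^esub> y) = f x \<ominus>\<^bsub>N\<^esub> f y"
proof -
  interpret M: module R M by fact
  show ?thesis using assms by (simp add: a_minus_def lin_add[OF assms(1)] lin_neg)
qed

lemma lin_comp:
  assumes "f \<in> linear_maps R M N" "g \<in> linear_maps R N P"
  shows "(\<lambda>x. g (f x)) \<in> linear_maps R M P"
  using assms by (auto simp: linear_maps_def Pi_iff)

lemma lin_id: "(\<lambda>x. x) \<in> linear_maps R M M"
  by (auto simp: linear_maps_def)

lemma lin_cong:
  assumes "f \<in> linear_maps R M N" "\<And>x. x \<in> carrier M \<Longrightarrow> g x = f x" "module R M"
  shows "g \<in> linear_maps R M N"
proof -
  interpret M: module R M by fact
  show ?thesis using assms(1) by (auto simp: linear_maps_def Pi_iff assms(2))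
qed

lemma lin_zero_map:
  assumes "module R N" shows "(\<lambda>x. \<zero>\<^bsub>N\<^esub>) \<in> linear_maps R M N"
proof -
  interpret N: module R N by fact
  show ?thesis by (auto simp: linear_maps_def)
qed

lemma lin_sum:
  assumes "module R N" "f \<in> linear_maps R M N" "g \<in> linear_maps R M N"
  shows "(\<lambda>x. f x \<oplus>\<^bsub>N\<^esub> g x) \<in> linear_maps R M N"
proof -
  interpret N: module R N by fact
  note f = lin_closed[OF assms(2)] lin_add[OF assms(2)] lin_smult[OF assms(2)]
  note g = lin_closed[OF assms(3)] lin_add[OF assms(3)] lin_smult[OF assms(3)]
  show ?thesis
    by (rule linear_mapsI) (simp_all add: f g N.a_ac N.smult_r_distr)
qed

lemma lin_scale:
  assumes "module R N" "f \<in> linear_maps R M N" "r \<in> carrier R"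
  shows "(\<lambda>x. r \<odot>\<^bsub>N\<^esub> f x) \<in> linear_maps R M N"
proof -
  interpret N: module R N by fact
  note f = lin_closed[OF assms(2)] lin_add[OF assms(2)] lin_smult[OF assms(2)]
  show ?thesis
    using assms(3)
    by (intro linear_mapsI) (simp_all add: f N.smult_r_distr N.R.m_comm flip: N.smult_assoc1)
qed

lemma lin_minus_map:
  assumes "module R N" "f \<in> linear_maps R M N"
  shows "(\<lambda>x. \<ominus>\<^bsub>N\<^esub> f x) \<in> linear_maps R M N"
proof -
  interpret N: module R N by fact
  note f = lin_closed[OF assms(2)] lin_add[OF assms(2)] lin_smult[OF assms(2)]
  show ?thesis
    by (intro linear_mapsI) (simp_all add: f N.smult_r_minus N.minus_add)
qed

lemma lin_diff_map:
  assumes "module R N" "f \<in> linear_maps R M N" "g \<in> linear_maps R M N"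
  shows "(\<lambda>x. f x \<ominus>\<^bsub>N\<^esub> g x) \<in> linear_maps R M N"
  unfolding a_minus_def by (intro lin_sum lin_minus_map assms)

lemma lin_finsum:
  assumes "f \<in> linear_maps R M N" "module R M" "module R N" "g \<in> A \<rightarrow> carrier M"
  shows "f (\<Oplus>\<^bsub>M\<^esub>a\<in>A. g a) = (\<Oplus>\<^bsub>N\<^esub>a\<in>A. f (g a))"
proof -
  interpret M: module R M by fact
  interpret N: module R N by fact
  show ?thesis using assms(4)
    by (induction A rule: infinite_finite_induct)
      (auto simp: lin_zero[OF assms(1-3)] lin_add[OF assms(1)] lin_closed[OF assms(1)] Pi_iff)
qed

lemma finsum_lin:
  assumes "module R N" and M: "module R M" and "\<And>a. a \<in> A \<Longrightarrow> f a \<in> linear_maps R M N"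
  shows "(\<lambda>x. \<Oplus>\<^bsub>N\<^esub>a\<in>A. f a x) \<in> linear_maps R M N"
proof -
  interpret N: module R N by fact
  show ?thesis using assms(3)
  proof (induction A rule: infinite_finite_induct)
    case (insert a A)
    have *: "f a \<in> linear_maps R M N" "(\<lambda>x. \<Oplus>\<^bsub>N\<^esub>a\<in>A. f a x) \<in> linear_maps R M N"
      using insert by simp_all
    have eq: "(\<Oplus>\<^bsub>N\<^esub>a\<in>insert a A. f a x) = f a x \<oplus>\<^bsub>N\<^esub> (\<Oplus>\<^bsub>N\<^esub>a\<in>A. f a x)"
      if "x \<in> carrier M" for x
      using insert that by (intro N.finsum_insert) (auto intro: lin_closed)
    show ?case by (rule lin_cong[OF lin_sum[OF assms(1) *] eq M])
  qed (auto simp: lin_zero_map assms)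
qed

lemma submodule_mem:
  assumes "submodule K R M"
  shows "\<zero>\<^bsub>M\<^esub> \<in> K" "\<And>x y. x \<in> K \<Longrightarrow> y \<in> K \<Longrightarrow> x \<oplus>\<^bsub>M\<^esub> y \<in> K"
    "\<And>r x. r \<in> carrier R \<Longrightarrow> x \<in> K \<Longrightarrow> r \<odot>\<^bsub>M\<^esub> x \<in> K"
    "K \<subseteq> carrier M" "\<And>x. x \<in> K \<Longrightarrow> \<ominus>\<^bsub>M\<^esub> x \<in> K"
proof -
  interpret subgroup K "add_monoid M" using assms by (simp add: submodule_def)
  show "\<zero>\<^bsub>M\<^esub> \<in> K" "\<And>x y. x \<in> K \<Longrightarrow> y \<in> K \<Longrightarrow> x \<oplus>\<^bsub>M\<^esub> y \<in> K" "K \<subseteq> carrier M"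
    "\<And>x. x \<in> K \<Longrightarrow> \<ominus>\<^bsub>M\<^esub> x \<in> K"
    using one_closed m_closed subset m_inv_closed by (auto simp: a_inv_def)
  show "\<And>r x. r \<in> carrier R \<Longrightarrow> x \<in> K \<Longrightarrow> r \<odot>\<^bsub>M\<^esub> x \<in> K"
    using submodule.smult_closed[OF assms] by auto
qed

text \<open>Negation is multiplication by the scalar -1, so closure under it follows from closure
  under scalars.\<close>

lemma submoduleI':
  assumes "module R M" "K \<subseteq> carrier M" "\<zero>\<^bsub>M\<^esub> \<in> K"
    "\<And>x y. x \<in> K \<Longrightarrow> y \<in> K \<Longrightarrow> x \<oplus>\<^bsub>M\<^esub> y \<in> K"
    "\<And>r x. r \<in> carrier R \<Longrightarrow> x \<in> K \<Longrightarrow> r \<odot>\<^bsub>M\<^esub> x \<in> K"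
  shows "submodule K R M"
proof -
  interpret M: module R M by fact
  have "\<ominus>\<^bsub>M\<^esub> x \<in> K" if "x \<in> K" for x
  proof -
    have "\<ominus>\<^bsub>M\<^esub> x = (\<ominus>\<^bsub>R\<^esub> \<one>\<^bsub>R\<^esub>) \<odot>\<^bsub>M\<^esub> x"
      using that assms(2) by (auto simp: M.smult_l_minus)
    then show ?thesis using that assms(5) by simp
  qed
  then show ?thesis using assms by (intro M.submoduleI)
qed

lemma submodule_kernel:
  assumes "f \<in> linear_maps R M N" "module R M" "module R N"
  shows "submodule {x \<in> carrier M. f x = \<zero>\<^bsub>N\<^esub>} R M"
proof -
  interpret M: module R M by fact
  interpret N: module R N by fact
  show ?thesis
    by (rule submoduleI') (auto simp: assms lin_zero[OF assms] lin_add[OF assms(1)] lin_smult[OF assms(1)])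
qed

lemma submodule_image:
  assumes "f \<in> linear_maps R M N" "module R M" "module R N"
  shows "submodule (f ` carrier M) R N"
proof -
  interpret M: module R M by fact
  interpret N: module R N by fact
  note f = lin_closed[OF assms(1)] lin_add[OF assms(1), symmetric] lin_smult[OF assms(1), symmetric]
  show ?thesis
  proof (rule submoduleI')
    show "\<zero>\<^bsub>N\<^esub> \<in> f ` carrier M" using lin_zero[OF assms] by (metis M.zero_closed image_eqI)
  qed (auto simp: assms f)
qed

lemma submodule_Inter:
  assumes "module R M" "\<And>K. K \<in> T \<Longrightarrow> submodule K R M" "T \<noteq> {}"
  shows "submodule (\<Inter>T) R M"
proof (rule submoduleI'[OF assms(1)])
  show "\<Inter>T \<subseteq> carrier M" using assms(2,3) submodule_mem(4) by fast
qed (use submodule_mem[OF assms(2)] in auto)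

lemma submodule_hull:
  assumes "module R M" "X \<subseteq> carrier M"
  shows "submodule ((\<lambda>K. submodule K R M) hull X) R M"
  unfolding hull_def
  by (rule submodule_Inter) (use assms module.carrier_is_submodule in auto)

lemma module_carrier_update:
  assumes "module R M" "submodule K R M"
  shows "module R (M\<lparr>carrier := K\<rparr>)"
  by (rule submodule.submodule_is_module[OF assms(2,1)])

lemma lin_into_sub:
  assumes "f \<in> linear_maps R M N" "\<And>x. x \<in> carrier M \<Longrightarrow> f x \<in> K"
  shows "f \<in> linear_maps R M (N\<lparr>carrier := K\<rparr>)"
  using assms by (auto simp: linear_maps_def)

lemma lin_from_sub:
  assumes "f \<in> linear_maps R M N" "K \<subseteq> carrier M"
  shows "f \<in> linear_maps R (M\<lparr>carrier := K\<rparr>) N"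
  using assms by (auto simp: linear_maps_def Pi_iff subset_eq)

text \<open>The module axioms are pulled back along the surjection \<open>p\<close>, so
  \<open>Q\<close> need only come with operations that \<open>p\<close> respects. For quotients this
  gives the module structure without any computation with cosets.\<close>

lemma module_image:
  assumes "module R M" "carrier Q = p ` carrier M" "p \<zero>\<^bsub>M\<^esub> = \<zero>\<^bsub>Q\<^esub>"
    and add: "\<And>x y. x \<in> carrier M \<Longrightarrow> y \<in> carrier M \<Longrightarrow> p x \<oplus>\<^bsub>Q\<^esub> p y = p (x \<oplus>\<^bsub>M\<^esub> y)"
    and smult: "\<And>r x. r \<in> carrier R \<Longrightarrow> x \<in> carrier M \<Longrightarrow> r \<odot>\<^bsub>Q\<^esub> p x = p (r \<odot>\<^bsub>M\<^esub> x)"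
  shows "module R Q" "p \<in> linear_maps R M Q"
proof -
  interpret M: module R M by fact
  have "abelian_group Q"
  proof (rule abelian_groupI)
    show "\<exists>y\<in>carrier Q. y \<oplus>\<^bsub>Q\<^esub> x = \<zero>\<^bsub>Q\<^esub>" if "x \<in> carrier Q" for x
    proof -
      obtain a where "a \<in> carrier M" "x = p a" using \<open>x \<in> carrier Q\<close> assms(2) by auto
      then show ?thesis using assms(2) by (intro bexI[of _ "p (\<ominus>\<^bsub>M\<^esub> a)"]) (auto simp: add M.l_neg assms(3))
    qed
  qed (auto simp: assms(2) assms(3)[symmetric] add M.a_ac)
  then show "module R Q"
    by (intro moduleI M.R.is_cring)
      (auto simp: assms(2) add smult M.smult_l_distr M.smult_r_distr M.smult_assoc1)
  show "p \<in> linear_maps R M Q"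
    by (rule linear_mapsI) (auto simp: add smult assms(2))
qed

lemma module_plainI:
  assumes "cring R" and "z \<in> C"
    and "\<And>x y. x \<in> C \<Longrightarrow> y \<in> C \<Longrightarrow> a x y \<in> C"
    and "\<And>x y. x \<in> C \<Longrightarrow> y \<in> C \<Longrightarrow> a x y = a y x"
    and "\<And>x y w. x \<in> C \<Longrightarrow> y \<in> C \<Longrightarrow> w \<in> C \<Longrightarrow> a (a x y) w = a x (a y w)"
    and "\<And>x. x \<in> C \<Longrightarrow> a z x = x"
    and "\<And>x. x \<in> C \<Longrightarrow> \<exists>y\<in>C. a y x = z"
    and "\<And>r x. r \<in> carrier R \<Longrightarrow> x \<in> C \<Longrightarrow> s r x \<in> C"
    and "\<And>q r x. q \<in> carrier R \<Longrightarrow> r \<in> carrier R \<Longrightarrow> x \<in> C \<Longrightarrow> s (q \<oplus>\<^bsub>R\<^esub> r) x = a (s q x) (s r x)"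
    and "\<And>r x y. r \<in> carrier R \<Longrightarrow> x \<in> C \<Longrightarrow> y \<in> C \<Longrightarrow> s r (a x y) = a (s r x) (s r y)"
    and "\<And>q r x. q \<in> carrier R \<Longrightarrow> r \<in> carrier R \<Longrightarrow> x \<in> C \<Longrightarrow> s (q \<otimes>\<^bsub>R\<^esub> r) x = s q (s r x)"
    and "\<And>x. x \<in> C \<Longrightarrow> s \<one>\<^bsub>R\<^esub> x = x"
  shows "module R (plain_module C z a s)"
  by (intro moduleI abelian_groupI) (use assms in \<open>auto simp: plain_module_def\<close>)

lemma plain_module_simps [simp]:
  "carrier (plain_module C z a s) = C" "\<zero>\<^bsub>plain_module C z a s\<^esub> = z"
  "x \<oplus>\<^bsub>plain_module C z a s\<^esub> y = a x y" "r \<odot>\<^bsub>plain_module C z a s\<^esub> x = s r x"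
  by (auto simp: plain_module_def)


section \<open>Quotient modules\<close>

context
  fixes R :: "('r, 'x) ring_scheme" and M :: "('r, 'a, 'y) module_scheme" and N
  assumes M: "module R M" and N: "submodule N R M"
begin

interpretation M: module R M by (rule M)
interpretation N: abelian_subgroup N M
  using N by (intro abelian_subgroupI3 additive_subgroupI module.axioms(2)[OF M]) (simp add: submodule_def)

lemma quot_proj_eq_iff:
  assumes "x \<in> carrier M" "y \<in> carrier M"
  shows "N +>\<^bsub>M\<^esub> x = N +>\<^bsub>M\<^esub> y \<longleftrightarrow> x \<ominus>\<^bsub>M\<^esub> y \<in> N"
  using assms by (metis N.a_rcos_module N.a_rcos_self N.a_repr_independence' a_minus_def)

lemma quot_carrier: "carrier (quot_module M N) = (\<lambda>x. N +>\<^bsub>M\<^esub> x) ` carrier M"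
  by (auto simp: quot_module_def ring.defs module.defs FactRing_def A_RCOSETS_def' a_r_coset_def')

lemma quot_zero: "\<zero>\<^bsub>quot_module M N\<^esub> = N +>\<^bsub>M\<^esub> \<zero>\<^bsub>M\<^esub>"
  using N.a_subset by (simp add: quot_module_def ring.defs module.defs FactRing_def)

lemma quot_add:
  assumes "x \<in> carrier M" "y \<in> carrier M"
  shows "(N +>\<^bsub>M\<^esub> x) \<oplus>\<^bsub>quot_module M N\<^esub> (N +>\<^bsub>M\<^esub> y) = N +>\<^bsub>M\<^esub> (x \<oplus>\<^bsub>M\<^esub> y)"
  using assms by (simp add: quot_module_def ring.defs module.defs FactRing_def N.a_rcos_sum)

text \<open>The scalar action on a coset is a union over all its representatives. Two
  representatives differ by some \<open>n\<close> in \<open>N\<close>, and \<open>r n\<close> stays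
  in \<open>N\<close>, so all the cosets in that union coincide.\<close>

lemma quot_smult:
  assumes "r \<in> carrier R" "x \<in> carrier M"
  shows "r \<odot>\<^bsub>quot_module M N\<^esub> (N +>\<^bsub>M\<^esub> x) = N +>\<^bsub>M\<^esub> (r \<odot>\<^bsub>M\<^esub> x)"
proof -
  have "N +>\<^bsub>M\<^esub> (r \<odot>\<^bsub>M\<^esub> y) = N +>\<^bsub>M\<^esub> (r \<odot>\<^bsub>M\<^esub> x)" if y: "y \<in> N +>\<^bsub>M\<^esub> x" for y
  proof -
    obtain n where n: "n \<in> N" "y = n \<oplus>\<^bsub>M\<^esub> x" using y by (auto simp: a_r_coset_def')
    have c: "n \<in> carrier M" using n N.a_subset by auto
    have "r \<odot>\<^bsub>M\<^esub> y \<ominus>\<^bsub>M\<^esub> r \<odot>\<^bsub>M\<^esub> x = r \<odot>\<^bsub>M\<^esub> n"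
      using assms c n by (simp add: M.smult_r_distr a_minus_def M.a_assoc M.r_neg)
    then show ?thesis
      using assms c n submodule_mem(3)[OF N] by (subst quot_proj_eq_iff) auto
  qed
  moreover have "x \<in> N +>\<^bsub>M\<^esub> x" using assms N.a_rcos_self by auto
  ultimately have "(\<Union>y\<in>N +>\<^bsub>M\<^esub> x. N +>\<^bsub>M\<^esub> (r \<odot>\<^bsub>M\<^esub> y)) = N +>\<^bsub>M\<^esub> (r \<odot>\<^bsub>M\<^esub> x)"
    by (intro UN_constant_eq ballI)
  then show ?thesis
    by (simp add: quot_module_def ring.defs module.defs)
qed

lemma quot_module: "module R (quot_module M N)"
  and quot_proj_lin: "(\<lambda>x. N +>\<^bsub>M\<^esub> x) \<in> linear_maps R M (quot_module M N)"
  by (rule module_image[OF M quot_carrier quot_zero[symmetric] quot_add quot_smult]; simp)+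

lemma quot_proj_zero_iff:
  assumes "x \<in> carrier M"
  shows "N +>\<^bsub>M\<^esub> x = \<zero>\<^bsub>quot_module M N\<^esub> \<longleftrightarrow> x \<in> N"
  using assms quot_proj_eq_iff[of x "\<zero>\<^bsub>M\<^esub>"] by (simp add: quot_zero a_minus_def M.minus_equality[of "\<zero>\<^bsub>M\<^esub>" "\<zero>\<^bsub>M\<^esub>"])

text \<open>A map that kills \<open>N\<close> is constant on each coset, so the image of the coset
  is a singleton. This is what gives a meaning to \<open>tensor_lift\<close>, \<open>op_lift\<close>
  and \<open>middle_lift\<close>, which all read off a common value with
  \<open>the_elem\<close>.\<close>

lemma the_elem_coset:
  assumes P: "module R P" and f: "f \<in> linear_maps R M P" and "\<And>x. x \<in> N \<Longrightarrow> f x = \<zero>\<^bsub>P\<^esub>"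
    and x: "x \<in> carrier M"
  shows "the_elem (f ` (N +>\<^bsub>M\<^esub> x)) = f x"
proof -
  interpret P: module R P by fact
  have "f y = f x" if y: "y \<in> N +>\<^bsub>M\<^esub> x" for y
  proof -
    obtain n where n: "n \<in> N" "y = n \<oplus>\<^bsub>M\<^esub> x" using y by (auto simp: a_r_coset_def')
    then have "n \<in> carrier M" using N.a_subset by auto
    then show ?thesis using n x assms(3) f by (simp add: lin_add lin_closed)
  qed
  then have "f ` (N +>\<^bsub>M\<^esub> x) = (\<lambda>_. f x) ` (N +>\<^bsub>M\<^esub> x)" by (rule image_cong[OF refl])
  also have "\<dots> = {f x}" using N.a_rcos_self[OF x] by (auto simp: image_constant_conv)
  finally have "f ` (N +>\<^bsub>M\<^esub> x) = {f x}" .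
  then show ?thesis by simp
qed

lemma quot_lift_lin:
  assumes P: "module R P" and f: "f \<in> linear_maps R M P" and "\<And>x. x \<in> N \<Longrightarrow> f x = \<zero>\<^bsub>P\<^esub>"
  shows "(\<lambda>X. the_elem (f ` X)) \<in> linear_maps R (quot_module M N) P"
  by (rule linear_mapsI)
    (auto simp: quot_carrier quot_add quot_smult the_elem_coset[OF assms] lin_closed[OF f] lin_add[OF f] lin_smult[OF f])

end

section \<open>Free modules\<close>

context
  fixes R :: "('r, 'x) ring_scheme" and A :: "'a set"
  assumes R: "cring R"
begin

interpretation R: cring R by (rule R)

lemma free_support_add:
  "{a. f a \<oplus>\<^bsub>R\<^esub> g a \<noteq> \<zero>\<^bsub>R\<^esub>} \<subseteq> {a. f a \<noteq> \<zero>\<^bsub>R\<^esub>} \<union> {a. g a \<noteq> \<zero>\<^bsub>R\<^esub>}"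
  by auto

lemma free_module: "module R (free_module R A)"
  unfolding free_module_def
proof (rule module_plainI[OF R])
  let ?C = "{f. (\<forall>a\<in>A. f a \<in> carrier R) \<and> (\<forall>a. a \<notin> A \<longrightarrow> f a = \<zero>\<^bsub>R\<^esub>) \<and> finite {a. f a \<noteq> \<zero>\<^bsub>R\<^esub>}}"
  have C: "f a \<in> carrier R" if "f \<in> ?C" for f a using that by (cases "a \<in> A") auto
  show "(\<lambda>a. f a \<oplus>\<^bsub>R\<^esub> g a) \<in> ?C" if "f \<in> ?C" "g \<in> ?C" for f g
    using that finite_subset[OF free_support_add[of f g]] by auto
  show sm: "(\<lambda>a. r \<otimes>\<^bsub>R\<^esub> f a) \<in> ?C" if "r \<in> carrier R" "f \<in> ?C" for r f
    using that by (auto elim!: rev_finite_subset)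
  show "\<exists>g\<in>?C. (\<lambda>a. g a \<oplus>\<^bsub>R\<^esub> f a) = (\<lambda>_. \<zero>\<^bsub>R\<^esub>)" if "f \<in> ?C" for f
  proof (rule bexI)
    show "(\<lambda>a. ((\<ominus>\<^bsub>R\<^esub> \<one>\<^bsub>R\<^esub>) \<otimes>\<^bsub>R\<^esub> f a) \<oplus>\<^bsub>R\<^esub> f a) = (\<lambda>_. \<zero>\<^bsub>R\<^esub>)"
      using C[OF that] by (auto simp: R.l_minus R.l_neg)
  qed (use sm[of "\<ominus>\<^bsub>R\<^esub> \<one>\<^bsub>R\<^esub>", OF _ that] in auto)
qed (auto simp: fun_eq_iff R.a_ac R.l_distr R.r_distr R.m_assoc; (metis R.a_comm R.a_assoc R.l_zero R.zero_closed R.l_one R.r_null R.l_distr R.r_distr R.m_assoc))+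

lemma free_carrier_D:
  assumes "\<phi> \<in> carrier (free_module R A)"
  shows "\<phi> a \<in> carrier R" "a \<notin> A \<Longrightarrow> \<phi> a = \<zero>\<^bsub>R\<^esub>" "finite {a. \<phi> a \<noteq> \<zero>\<^bsub>R\<^esub>}" "{a. \<phi> a \<noteq> \<zero>\<^bsub>R\<^esub>} \<subseteq> A"
  using assms by (cases "a \<in> A"; auto simp: free_module_def)+

lemma free_gen_closed [intro]: "a \<in> A \<Longrightarrow> free_gen R a \<in> carrier (free_module R A)"
  by (auto simp: free_module_def free_gen_def)

text \<open>The induction runs over a finite superset \<open>S\<close> of the support and not over
  the support itself: setting \<open>\<phi>\<close> to zero at \<open>a\<close> then lands in the
  smaller set whatever the old value was.\<close>

lemma free_induct [consumes 1, case_names zero step]: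
  assumes "\<phi> \<in> carrier (free_module R A)" and "P \<zero>\<^bsub>free_module R A\<^esub>"
    and step: "\<And>r a \<phi>. r \<in> carrier R \<Longrightarrow> a \<in> A \<Longrightarrow> \<phi> \<in> carrier (free_module R A) \<Longrightarrow> P \<phi> \<Longrightarrow>
      P (r \<odot>\<^bsub>free_module R A\<^esub> free_gen R a \<oplus>\<^bsub>free_module R A\<^esub> \<phi>)"
  shows "P \<phi>"
proof -
  have "P \<phi>" if "finite S" "\<phi> \<in> carrier (free_module R A)" "{a. \<phi> a \<noteq> \<zero>\<^bsub>R\<^esub>} \<subseteq> S" for S \<phi>
    using that
  proof (induction S arbitrary: \<phi> rule: finite_induct)
    case empty
    then have "\<phi> = (\<lambda>_. \<zero>\<^bsub>R\<^esub>)" by auto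
    then show ?case using assms(2) by (simp add: free_module_def)
  next
    case (insert a S)
    note D = free_carrier_D[OF insert.prems(1)]
    show ?case
    proof (cases "a \<in> A")
      case True
      have fu: "\<phi>(a := \<zero>\<^bsub>R\<^esub>) \<in> carrier (free_module R A)"
        using insert.prems(1) by (auto simp: free_module_def elim!: rev_finite_subset)
      then have "P (\<phi> a \<odot>\<^bsub>free_module R A\<^esub> free_gen R a \<oplus>\<^bsub>free_module R A\<^esub> (\<phi>(a := \<zero>\<^bsub>R\<^esub>)))"
        using insert.prems(2) by (intro step insert.IH fu True D(1)) auto
      also have "\<phi> a \<odot>\<^bsub>free_module R A\<^esub> free_gen R a \<oplus>\<^bsub>free_module R A\<^esub> (\<phi>(a := \<zero>\<^bsub>R\<^esub>)) = \<phi>"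
        using D(1) by (auto simp: free_module_def free_gen_def fun_eq_iff)
      finally show ?thesis .
    next
      case False
      then have "{a. \<phi> a \<noteq> \<zero>\<^bsub>R\<^esub>} \<subseteq> S" using insert.prems D(2) by auto
      then show ?thesis using insert by blast
    qed
  qed
  then show ?thesis using assms(1) free_carrier_D(3)[OF assms(1)] by blast
qed

lemma
  assumes P: "module R P" and f: "\<And>a. a \<in> A \<Longrightarrow> f a \<in> carrier P"
  shows free_lift_lin: "free_lift R P f \<in> linear_maps R (free_module R A) P"
    and free_lift_gen: "\<And>a. a \<in> A \<Longrightarrow> free_lift R P f (free_gen R a) = f a"
proof -
  interpret P: module R P by fact
  \<comment> \<open>The defining sum runs over the exact support, which changes under addition and
    scaling. Enlarging it to a finite \<open>S\<close> inside \<open>A\<close> puts two elements and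
    their sum over a common index set.\<close>
  have eq: "free_lift R P f \<phi> = (\<Oplus>\<^bsub>P\<^esub>a\<in>S. \<phi> a \<odot>\<^bsub>P\<^esub> f a)"
    if "\<phi> \<in> carrier (free_module R A)" "finite S" "S \<subseteq> A" "{a. \<phi> a \<noteq> \<zero>\<^bsub>R\<^esub>} \<subseteq> S" for \<phi> S
    unfolding free_lift_def using that f free_carrier_D[OF that(1)]
    by (intro P.add.finprod_mono_neutral_cong_left) (auto simp: subset_eq)
  show "free_lift R P f \<in> linear_maps R (free_module R A) P"
  proof (rule linear_mapsI)
    fix \<phi> assume \<phi>: "\<phi> \<in> carrier (free_module R A)"
    note D = free_carrier_D[OF \<phi>]
    show "free_lift R P f \<phi> \<in> carrier P"
      unfolding free_lift_def using D f by (intro P.finsum_closed) auto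
    have cl: "\<phi> a \<odot>\<^bsub>P\<^esub> f a \<in> carrier P" if "a \<in> A" for a using D f that by auto
    show "free_lift R P f (r \<odot>\<^bsub>free_module R A\<^esub> \<phi>) = r \<odot>\<^bsub>P\<^esub> free_lift R P f \<phi>" if r: "r \<in> carrier R" for r
    proof -
      have "r \<odot>\<^bsub>free_module R A\<^esub> \<phi> \<in> carrier (free_module R A)"
        using module.smult_closed[OF free_module r \<phi>] .
      moreover have "{a. (r \<odot>\<^bsub>free_module R A\<^esub> \<phi>) a \<noteq> \<zero>\<^bsub>R\<^esub>} \<subseteq> {a. \<phi> a \<noteq> \<zero>\<^bsub>R\<^esub>}"
        using r by (auto simp: free_module_def)
      ultimately have "free_lift R P f (r \<odot>\<^bsub>free_module R A\<^esub> \<phi>) =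
        (\<Oplus>\<^bsub>P\<^esub>a\<in>{a. \<phi> a \<noteq> \<zero>\<^bsub>R\<^esub>}. (r \<odot>\<^bsub>free_module R A\<^esub> \<phi>) a \<odot>\<^bsub>P\<^esub> f a)"
        using D(3,4) by (intro eq) auto
      also have "\<dots> = (\<Oplus>\<^bsub>P\<^esub>a\<in>{a. \<phi> a \<noteq> \<zero>\<^bsub>R\<^esub>}. r \<odot>\<^bsub>P\<^esub> (\<phi> a \<odot>\<^bsub>P\<^esub> f a))"
        using D f r by (intro P.finsum_cong') (auto simp: free_module_def P.smult_assoc1 subset_eq)
      also have "\<dots> = r \<odot>\<^bsub>P\<^esub> free_lift R P f \<phi>"
        unfolding free_lift_def using D r f by (intro P.finsum_smult_ldistr[symmetric]) auto
      finally show ?thesis .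
    qed
    fix \<psi> assume \<psi>: "\<psi> \<in> carrier (free_module R A)"
    note D' = free_carrier_D[OF \<psi>]
    have cl': "\<psi> a \<odot>\<^bsub>P\<^esub> f a \<in> carrier P" if "a \<in> A" for a using D' f that by auto
    define S where "S = {a. \<phi> a \<noteq> \<zero>\<^bsub>R\<^esub>} \<union> {a. \<psi> a \<noteq> \<zero>\<^bsub>R\<^esub>}"
    have S: "finite S" "{a. \<phi> a \<noteq> \<zero>\<^bsub>R\<^esub>} \<subseteq> S" "{a. \<psi> a \<noteq> \<zero>\<^bsub>R\<^esub>} \<subseteq> S" "S \<subseteq> A"
      "{a. \<phi> a \<oplus>\<^bsub>R\<^esub> \<psi> a \<noteq> \<zero>\<^bsub>R\<^esub>} \<subseteq> S"
      unfolding S_def using D(3,4) D'(3,4) free_support_add by (auto simp del: Collect_subset)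
    interpret F: module R "free_module R A" by (rule free_module)
    have sum: "\<phi> \<oplus>\<^bsub>free_module R A\<^esub> \<psi> \<in> carrier (free_module R A)" using \<phi> \<psi> by simp
    have val: "(\<phi> \<oplus>\<^bsub>free_module R A\<^esub> \<psi>) a = \<phi> a \<oplus>\<^bsub>R\<^esub> \<psi> a" for a by (simp add: free_module_def)
    have "free_lift R P f (\<phi> \<oplus>\<^bsub>free_module R A\<^esub> \<psi>) =
        (\<Oplus>\<^bsub>P\<^esub>a\<in>S. (\<phi> \<oplus>\<^bsub>free_module R A\<^esub> \<psi>) a \<odot>\<^bsub>P\<^esub> f a)"
      using S by (intro eq sum) (simp_all add: val)
    also have "\<dots> = (\<Oplus>\<^bsub>P\<^esub>a\<in>S. \<phi> a \<odot>\<^bsub>P\<^esub> f a \<oplus>\<^bsub>P\<^esub> \<psi> a \<odot>\<^bsub>P\<^esub> f a)"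
      using S(4) cl cl' D(1) D'(1) f
      by (intro P.finsum_cong' refl) (auto simp: val P.smult_l_distr subset_eq)
    also have "\<dots> = (\<Oplus>\<^bsub>P\<^esub>a\<in>S. \<phi> a \<odot>\<^bsub>P\<^esub> f a) \<oplus>\<^bsub>P\<^esub> (\<Oplus>\<^bsub>P\<^esub>a\<in>S. \<psi> a \<odot>\<^bsub>P\<^esub> f a)"
      using S(4) cl cl' by (intro P.finsum_addf) auto
    also have "(\<Oplus>\<^bsub>P\<^esub>a\<in>S. \<phi> a \<odot>\<^bsub>P\<^esub> f a) = free_lift R P f \<phi>"
      using \<phi> S by (intro eq[symmetric]) auto
    also have "(\<Oplus>\<^bsub>P\<^esub>a\<in>S. \<psi> a \<odot>\<^bsub>P\<^esub> f a) = free_lift R P f \<psi>"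
      using \<psi> S by (intro eq[symmetric]) auto
    finally show "free_lift R P f (\<phi> \<oplus>\<^bsub>free_module R A\<^esub> \<psi>) = free_lift R P f \<phi> \<oplus>\<^bsub>P\<^esub> free_lift R P f \<psi>" .
  qed
  show "free_lift R P f (free_gen R a) = f a" if a: "a \<in> A" for a
  proof -
    have "free_lift R P f (free_gen R a) = (\<Oplus>\<^bsub>P\<^esub>b\<in>{a}. free_gen R a b \<odot>\<^bsub>P\<^esub> f b)"
      using a by (intro eq free_gen_closed[OF a]) (auto simp: free_gen_def)
    also have "\<dots> = f a" using f[OF a] by (simp add: free_gen_def)
    finally show ?thesis .
  qed
qed

lemma free_lin_eqI:
  assumes "f \<in> linear_maps R (free_module R A) P" "g \<in> linear_maps R (free_module R A) P" "module R P"
    and "\<And>a. a \<in> A \<Longrightarrow> f (free_gen R a) = g (free_gen R a)" and "\<phi> \<in> carrier (free_module R A)"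
  shows "f \<phi> = g \<phi>"
proof -
  interpret F: module R "free_module R A" by (rule free_module)
  note [simp] = lin_add[OF assms(1)] lin_add[OF assms(2)] lin_smult[OF assms(1)] lin_smult[OF assms(2)]
  show ?thesis using assms(5)
    by (induction rule: free_induct) (use assms in \<open>auto simp: lin_zero free_module free_gen_closed\<close>)
qed

end


section \<open>Tensor products\<close>

definition bilinear_map ::
  "('r, 'x) ring_scheme \<Rightarrow> ('r, 'a, 'y) module_scheme \<Rightarrow> ('r, 'b, 'z) module_scheme \<Rightarrow>
     ('r, 'p, 'w) module_scheme \<Rightarrow> ('a \<Rightarrow> 'b \<Rightarrow> 'p) \<Rightarrow> bool" where
  "bilinear_map R M N P f \<longleftrightarrow>
     (\<forall>x\<in>carrier M. (\<lambda>y. f x y) \<in> linear_maps R N P) \<and> (\<forall>y\<in>carrier N. (\<lambda>x. f x y) \<in> linear_maps R M P)"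

lemma bilinear_mapI:
  assumes "\<And>x. x \<in> carrier M \<Longrightarrow> (\<lambda>y. f x y) \<in> linear_maps R N P"
    and "\<And>y. y \<in> carrier N \<Longrightarrow> (\<lambda>x. f x y) \<in> linear_maps R M P"
  shows "bilinear_map R M N P f"
  using assms by (auto simp: bilinear_map_def)

lemma
  assumes "bilinear_map R M N P f"
  shows bilin_right: "x \<in> carrier M \<Longrightarrow> (\<lambda>y. f x y) \<in> linear_maps R N P"
    and bilin_left: "y \<in> carrier N \<Longrightarrow> (\<lambda>x. f x y) \<in> linear_maps R M P"
    and bilin_closed: "x \<in> carrier M \<Longrightarrow> y \<in> carrier N \<Longrightarrow> f x y \<in> carrier P"
  using assms by (auto simp: bilinear_map_def linear_maps_def)

context
  fixes R :: "('r, 'x) ring_scheme" and M :: "('r, 'a, 'y) module_scheme"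
    and N :: "('r, 'b, 'z) module_scheme"
  assumes M: "module R M" and N: "module R N"
begin

interpretation M: module R M by (rule M)
interpretation N: module R N by (rule N)

private abbreviation (input) "free_pairs \<equiv> free_module R (carrier M \<times> carrier N)"

private lemma free_pairs: "module R free_pairs"
  by (rule free_module) (rule M.R.is_cring)

interpretation F: module R free_pairs by (rule free_pairs)

lemma free_pairs_gen: "x \<in> carrier M \<Longrightarrow> y \<in> carrier N \<Longrightarrow> free_gen R (x, y) \<in> carrier free_pairs"
  by (rule free_gen_closed) (auto intro: M.R.is_cring)

lemma tensor_rels_subset: "tensor_rels R M N \<subseteq> carrier free_pairs"
  unfolding tensor_rels_def Let_def by (auto intro!: F.minus_closed F.a_closed F.smult_closed free_pairs_gen)+

lemma tensor_null: "submodule (tensor_null R M N) R free_pairs"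
  unfolding tensor_null_def by (rule submodule_hull[OF free_pairs tensor_rels_subset])

lemma tensor_rels_null: "u \<in> tensor_rels R M N \<Longrightarrow> u \<in> tensor_null R M N"
  unfolding tensor_null_def by (rule hull_inc)

lemma tensor_module: "module R (tensor R M N)"
  unfolding tensor_def by (rule quot_module[OF free_pairs tensor_null])

interpretation T: module R "tensor R M N" by (rule tensor_module)

lemma tensor_proj_lin: "(\<lambda>u. tensor_null R M N +>\<^bsub>free_pairs\<^esub> u) \<in> linear_maps R free_pairs (tensor R M N)"
  unfolding tensor_def by (rule quot_proj_lin[OF free_pairs tensor_null])

lemma tensor_proj_eqI:
  assumes "u \<ominus>\<^bsub>free_pairs\<^esub> v \<in> tensor_rels R M N" "u \<in> carrier free_pairs" "v \<in> carrier free_pairs"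
  shows "tensor_null R M N +>\<^bsub>free_pairs\<^esub> u = tensor_null R M N +>\<^bsub>free_pairs\<^esub> v"
  using assms tensor_rels_null by (simp add: quot_proj_eq_iff[OF free_pairs tensor_null])

lemma tensor_relsI:
  assumes "x \<in> carrier M" "y \<in> carrier N"
  shows "x' \<in> carrier M \<Longrightarrow> free_gen R (x \<oplus>\<^bsub>M\<^esub> x', y) \<ominus>\<^bsub>free_pairs\<^esub>
      (free_gen R (x, y) \<oplus>\<^bsub>free_pairs\<^esub> free_gen R (x', y)) \<in> tensor_rels R M N"
    and "y' \<in> carrier N \<Longrightarrow> free_gen R (x, y \<oplus>\<^bsub>N\<^esub> y') \<ominus>\<^bsub>free_pairs\<^esub>
      (free_gen R (x, y) \<oplus>\<^bsub>free_pairs\<^esub> free_gen R (x, y')) \<in> tensor_rels R M N"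
    and "r \<in> carrier R \<Longrightarrow> free_gen R (r \<odot>\<^bsub>M\<^esub> x, y) \<ominus>\<^bsub>free_pairs\<^esub>
      (r \<odot>\<^bsub>free_pairs\<^esub> free_gen R (x, y)) \<in> tensor_rels R M N"
    and "r \<in> carrier R \<Longrightarrow> free_gen R (x, r \<odot>\<^bsub>N\<^esub> y) \<ominus>\<^bsub>free_pairs\<^esub>
      (r \<odot>\<^bsub>free_pairs\<^esub> free_gen R (x, y)) \<in> tensor_rels R M N"
  unfolding tensor_rels_def Let_def Un_iff mem_Collect_eq using assms by blast+

lemma pure_bilinear: "bilinear_map R M N (tensor R M N) (pure R M N)"
proof (rule bilinear_mapI)
  note p = tensor_proj_lin
  show "(\<lambda>y. pure R M N x y) \<in> linear_maps R N (tensor R M N)" if x: "x \<in> carrier M" for x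
  proof (rule linear_mapsI)
    show "pure R M N x y \<in> carrier (tensor R M N)" if "y \<in> carrier N" for y
      unfolding pure_def using x that by (intro lin_closed[OF p] free_pairs_gen)
    show "pure R M N x (y \<oplus>\<^bsub>N\<^esub> y') = pure R M N x y \<oplus>\<^bsub>tensor R M N\<^esub> pure R M N x y'"
      if "y \<in> carrier N" "y' \<in> carrier N" for y y'
      unfolding pure_def using x that
      by (subst lin_add[OF p, symmetric])
        (assumption | intro tensor_proj_eqI tensor_relsI M.smult_closed N.smult_closed M.a_closed N.a_closed F.a_closed F.smult_closed free_pairs_gen)+
    show "pure R M N x (r \<odot>\<^bsub>N\<^esub> y) = r \<odot>\<^bsub>tensor R M N\<^esub> pure R M N x y"
      if "r \<in> carrier R" "y \<in> carrier N" for r y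
      unfolding pure_def using x that
      by (subst lin_smult[OF p, symmetric])
        (assumption | intro tensor_proj_eqI tensor_relsI M.smult_closed N.smult_closed M.a_closed N.a_closed F.a_closed F.smult_closed free_pairs_gen)+
  qed
  show "(\<lambda>x. pure R M N x y) \<in> linear_maps R M (tensor R M N)" if y: "y \<in> carrier N" for y
  proof (rule linear_mapsI)
    show "pure R M N x y \<in> carrier (tensor R M N)" if "x \<in> carrier M" for x
      unfolding pure_def using y that by (intro lin_closed[OF p] free_pairs_gen)
    show "pure R M N (x \<oplus>\<^bsub>M\<^esub> x') y = pure R M N x y \<oplus>\<^bsub>tensor R M N\<^esub> pure R M N x' y"
      if "x \<in> carrier M" "x' \<in> carrier M" for x x'
      unfolding pure_def using y that
      by (subst lin_add[OF p, symmetric])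
        (assumption | intro tensor_proj_eqI tensor_relsI M.smult_closed N.smult_closed M.a_closed N.a_closed F.a_closed F.smult_closed free_pairs_gen)+
    show "pure R M N (r \<odot>\<^bsub>M\<^esub> x) y = r \<odot>\<^bsub>tensor R M N\<^esub> pure R M N x y"
      if "r \<in> carrier R" "x \<in> carrier M" for r x
      unfolding pure_def using y that
      by (subst lin_smult[OF p, symmetric])
        (assumption | intro tensor_proj_eqI tensor_relsI M.smult_closed N.smult_closed M.a_closed N.a_closed F.a_closed F.smult_closed free_pairs_gen)+
  qed
qed

lemmas pure_closed = bilin_closed[OF pure_bilinear]
  and pure_lin_left = bilin_left[OF pure_bilinear]
  and pure_lin_right = bilin_right[OF pure_bilinear]

text \<open>Neither zero nor scalars need a case of their own: zero is the pure tensor of two zeros,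
  and a coefficient is absorbed by the left factor.\<close>

lemma tensor_induct [consumes 1, case_names pure add]:
  assumes u: "u \<in> carrier (tensor R M N)"
    and pure: "\<And>x y. x \<in> carrier M \<Longrightarrow> y \<in> carrier N \<Longrightarrow> P (pure R M N x y)"
    and add: "\<And>u v. u \<in> carrier (tensor R M N) \<Longrightarrow> v \<in> carrier (tensor R M N) \<Longrightarrow> P u \<Longrightarrow> P v \<Longrightarrow>
      P (u \<oplus>\<^bsub>tensor R M N\<^esub> v)"
  shows "P u"
proof -
  let ?p = "\<lambda>u. tensor_null R M N +>\<^bsub>free_pairs\<^esub> u"
  note p = tensor_proj_lin
  obtain \<phi> where \<phi>: "\<phi> \<in> carrier free_pairs" "u = ?p \<phi>"
    using u unfolding tensor_def quot_carrier[OF free_pairs tensor_null] by auto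
  have "P (?p \<phi>)" using \<phi>(1)
  proof (induction \<phi> rule: free_induct[OF M.R.is_cring, consumes 1, case_names zero step])
    case zero
    have "P (pure R M N \<zero>\<^bsub>M\<^esub> \<zero>\<^bsub>N\<^esub>)" by (rule pure) auto
    then show ?case
      using lin_zero[OF pure_lin_right[OF M.zero_closed] N tensor_module] lin_zero[OF p free_pairs tensor_module]
      by simp
  next
    case (step r a \<phi>)
    then obtain x y where a: "a = (x, y)" "x \<in> carrier M" "y \<in> carrier N" by auto
    have "P (pure R M N (r \<odot>\<^bsub>M\<^esub> x) y \<oplus>\<^bsub>tensor R M N\<^esub> ?p \<phi>)"
      using step a by (intro add pure pure_closed lin_closed[OF p]) auto
    then show ?case
      using step a lin_smult[OF pure_lin_left[OF a(3)] step(1) a(2)]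
      by (simp add: lin_add[OF p] lin_smult[OF p] pure_def free_pairs_gen)
  qed
  then show ?thesis using \<phi> by simp
qed

lemma tensor_lin_eqI:
  assumes "f \<in> linear_maps R (tensor R M N) P" "g \<in> linear_maps R (tensor R M N) P"
    and "\<And>x y. x \<in> carrier M \<Longrightarrow> y \<in> carrier N \<Longrightarrow> f (pure R M N x y) = g (pure R M N x y)"
    and "u \<in> carrier (tensor R M N)"
  shows "f u = g u"
  using assms(4) by (induction rule: tensor_induct) (simp_all add: assms(3) lin_add[OF assms(1)] lin_add[OF assms(2)])

lemma
  assumes P: "module R P" and f: "bilinear_map R M N P f"
  shows tensor_lift_lin: "tensor_lift R P f \<in> linear_maps R (tensor R M N) P"
    and tensor_lift_pure: "\<And>x y. x \<in> carrier M \<Longrightarrow> y \<in> carrier N \<Longrightarrow> tensor_lift R P f (pure R M N x y) = f x y"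
proof -
  interpret P: module R P by fact
  let ?f = "free_lift R P (\<lambda>(x, y). f x y)"
  have lin: "?f \<in> linear_maps R free_pairs P"
    by (rule free_lift_lin[OF M.R.is_cring P]) (auto simp: bilin_closed[OF f])
  have gen: "?f (free_gen R (x, y)) = f x y" if "x \<in> carrier M" "y \<in> carrier N" for x y
    using free_lift_gen[OF M.R.is_cring P, of "carrier M \<times> carrier N" "\<lambda>(x, y). f x y" "(x, y)"] that
    by (auto simp: bilin_closed[OF f])
  note [simp] = lin_diff[OF lin free_pairs P] lin_add[OF lin] lin_smult[OF lin] gen free_pairs_gen
    bilin_closed[OF f] P.r_neg
  \<comment> \<open>The kernel of the free lift is a submodule, and bilinearity of \<open>f\<close>
    puts the four families of relations into it. Hence it contains their hull, and the lift is
    constant on cosets of \<open>tensor_null\<close>.\<close>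
  have "tensor_rels R M N \<subseteq> {u \<in> carrier free_pairs. ?f u = \<zero>\<^bsub>P\<^esub>}"
    unfolding tensor_rels_def Let_def
    by (auto simp: lin_add[OF bilin_left[OF f]] lin_add[OF bilin_right[OF f]]
      lin_smult[OF bilin_left[OF f]] lin_smult[OF bilin_right[OF f]] a_minus_def[of P])
  then have null: "?f u = \<zero>\<^bsub>P\<^esub>" if "u \<in> tensor_null R M N" for u
    using that hull_minimal[where S = "\<lambda>K. submodule K R free_pairs", OF _ submodule_kernel[OF lin free_pairs P]]
    unfolding tensor_null_def by blast
  show "tensor_lift R P f \<in> linear_maps R (tensor R M N) P"
    using quot_lift_lin[OF free_pairs tensor_null P lin null] unfolding tensor_lift_def[abs_def] tensor_def by simp
  show "tensor_lift R P f (pure R M N x y) = f x y" if "x \<in> carrier M" "y \<in> carrier N" for x y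
    using the_elem_coset[OF free_pairs tensor_null P lin null] that unfolding tensor_lift_def pure_def by simp
qed

end

context
  fixes R :: "('r, 'x) ring_scheme" and M :: "('r, 'a, 'y) module_scheme"
    and N :: "('r, 'b, 'z) module_scheme"
    and D :: "('r, 'd, 'v) module_scheme" and P :: "('r, 'p, 'w) module_scheme"
  assumes M: "module R M" and N: "module R N" and D: "module R D" and P: "module R P"
begin

text \<open>For a pure tensor \<open>u\<close> this is linearity of \<open>f\<close> in the
  parameter, and sums of linear maps are linear. It is the step that turns a map of several
  variables into nested lifts, one tensor factor after another.\<close>

lemma tensor_lift_lin_param:
  assumes f: "\<And>d. d \<in> carrier D \<Longrightarrow> bilinear_map R M N P (\<lambda>x y. f x y d)"
    and fd: "\<And>x y. x \<in> carrier M \<Longrightarrow> y \<in> carrier N \<Longrightarrow> (\<lambda>d. f x y d) \<in> linear_maps R D P"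
    and u: "u \<in> carrier (tensor R M N)"
  shows "(\<lambda>d. tensor_lift R P (\<lambda>x y. f x y d) u) \<in> linear_maps R D P"
  using u
proof (induction rule: tensor_induct[OF M N, consumes 1, case_names pure add])
  case (pure x y)
  show ?case
    by (rule lin_cong[OF fd[OF pure] _ D]) (simp add: tensor_lift_pure[OF M N P f] pure)
next
  case (add u v)
  show ?case
    by (rule lin_cong[OF lin_sum[OF P add(3,4)] _ D]) (simp add: lin_add[OF tensor_lift_lin[OF M N P f]] add)
qed

lemma bilinear_tensor_lift:
  assumes f: "\<And>d. d \<in> carrier D \<Longrightarrow> bilinear_map R M N P (\<lambda>x y. f x y d)"
    and fd: "\<And>x y. x \<in> carrier M \<Longrightarrow> y \<in> carrier N \<Longrightarrow> (\<lambda>d. f x y d) \<in> linear_maps R D P"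
  shows "bilinear_map R (tensor R M N) D P (\<lambda>u d. tensor_lift R P (\<lambda>x y. f x y d) u)"
  by (rule bilinear_mapI[OF tensor_lift_lin_param[OF f fd]]) (auto intro!: tensor_lift_lin[OF M N P f])

end

lemma tensor_zero:
  assumes "module R M" "module R N" "x \<in> carrier M" "y \<in> carrier N"
  shows "pure R M N x \<zero>\<^bsub>N\<^esub> = \<zero>\<^bsub>tensor R M N\<^esub>" "pure R M N \<zero>\<^bsub>M\<^esub> y = \<zero>\<^bsub>tensor R M N\<^esub>"
  using lin_zero[OF pure_lin_right[OF assms(1-3)] assms(2) tensor_module]
    lin_zero[OF pure_lin_left[OF assms(1,2,4)] assms(1) tensor_module] assms by auto

context
  fixes R :: "('r, 'x) ring_scheme" and M :: "('r, 'a, 'y) module_scheme"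
    and N :: "('r, 'b, 'z) module_scheme"
    and M' :: "('r, 'c, 'v) module_scheme" and N' :: "('r, 'd, 'w) module_scheme"
  assumes M: "module R M" and N: "module R N" and M': "module R M'" and N': "module R N'"
begin

lemma
  assumes "f \<in> linear_maps R M M'" "g \<in> linear_maps R N N'"
  shows tensor_map_lin: "tensor_map R M' N' f g \<in> linear_maps R (tensor R M N) (tensor R M' N')"
    and tensor_map_pure: "\<And>x y. x \<in> carrier M \<Longrightarrow> y \<in> carrier N \<Longrightarrow>
      tensor_map R M' N' f g (pure R M N x y) = pure R M' N' (f x) (g y)"
proof -
  have *: "bilinear_map R M N (tensor R M' N') (\<lambda>x y. pure R M' N' (f x) (g y))"
    using assms
    by (intro bilinear_mapI)
      (auto intro: lin_comp[OF _ pure_lin_right[OF M' N']] lin_comp[OF _ pure_lin_left[OF M' N']] lin_closed)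
  show "tensor_map R M' N' f g \<in> linear_maps R (tensor R M N) (tensor R M' N')"
    unfolding tensor_map_def by (rule tensor_lift_lin[OF M N tensor_module[OF M' N'] *])
  show "tensor_map R M' N' f g (pure R M N x y) = pure R M' N' (f x) (g y)"
    if "x \<in> carrier M" "y \<in> carrier N" for x y
    unfolding tensor_map_def by (rule tensor_lift_pure[OF M N tensor_module[OF M' N'] * that])
qed

lemma tensor_map_cong:
  assumes f: "f \<in> linear_maps R M M'" and g: "g \<in> linear_maps R N N'"
    and eq: "\<And>x. x \<in> carrier M \<Longrightarrow> f' x = f x" "\<And>y. y \<in> carrier N \<Longrightarrow> g' y = g y"
    and u: "u \<in> carrier (tensor R M N)"
  shows "tensor_map R M' N' f' g' u = tensor_map R M' N' f g u"
proof -
  have f': "f' \<in> linear_maps R M M'" and g': "g' \<in> linear_maps R N N'"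
    by (rule lin_cong[OF f eq(1) M], simp) (rule lin_cong[OF g eq(2) N], simp)
  show ?thesis
    by (rule tensor_lin_eqI[OF M N tensor_map_lin[OF f' g'] tensor_map_lin[OF f g] _ u])
      (simp add: tensor_map_pure f g f' g' eq)
qed

lemma tensor_map_zero:
  assumes "g \<in> linear_maps R N N'" and u: "u \<in> carrier (tensor R M N)"
  shows "tensor_map R M' N' (\<lambda>x. \<zero>\<^bsub>M'\<^esub>) g u = \<zero>\<^bsub>tensor R M' N'\<^esub>"
proof -
  interpret M': module R M' by (rule M')
  have z: "(\<lambda>x. \<zero>\<^bsub>M'\<^esub>) \<in> linear_maps R M M'" by (rule lin_zero_map[OF M'])
  show ?thesis
    by (rule tensor_lin_eqI[OF M N tensor_map_lin[OF z assms(1)] lin_zero_map[OF tensor_module[OF M' N']] _ u])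
      (simp add: tensor_map_pure z assms tensor_zero[OF M' N' M'.zero_closed] lin_closed[OF assms(1)])
qed

text \<open>Additivity of the tensor functor on maps. Exactness is later proved by writing a map as
  a sum of two maps, for instance \<open>m\<close> as \<open>m - s (r m)\<close> plus
  \<open>s (r m)\<close>, and tensoring the decomposition.\<close>

lemma tensor_map_sum:
  assumes f: "f \<in> linear_maps R M M'" and f': "f' \<in> linear_maps R M M'" and g: "g \<in> linear_maps R N N'"
    and u: "u \<in> carrier (tensor R M N)"
  shows "tensor_map R M' N' (\<lambda>x. f x \<oplus>\<^bsub>M'\<^esub> f' x) g u =
    tensor_map R M' N' f g u \<oplus>\<^bsub>tensor R M' N'\<^esub> tensor_map R M' N' f' g u"
proof -
  note s = lin_sum[OF M' f f']
  show ?thesis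
    by (rule tensor_lin_eqI[OF M N tensor_map_lin[OF s g] lin_sum[OF tensor_module[OF M' N']
          tensor_map_lin[OF f g] tensor_map_lin[OF f' g]] _ u])
      (simp add: tensor_map_pure s f f' g lin_closed[OF g] lin_closed[OF f] lin_closed[OF f']
         lin_add[OF pure_lin_left[OF M' N']])
qed

lemma tensor_map_finsum:
  assumes "finite I" and f: "\<And>i. i \<in> I \<Longrightarrow> f i \<in> linear_maps R M M'" and g: "g \<in> linear_maps R N N'"
    and u: "u \<in> carrier (tensor R M N)"
  shows "tensor_map R M' N' (\<lambda>x. \<Oplus>\<^bsub>M'\<^esub>i\<in>I. f i x) g u =
    (\<Oplus>\<^bsub>tensor R M' N'\<^esub>i\<in>I. tensor_map R M' N' (f i) g u)"
  using assms(1,2)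
proof (induction I rule: finite_induct)
  case empty
  interpret M': module R M' by (rule M')
  interpret T: module R "tensor R M' N'" by (rule tensor_module[OF M' N'])
  show ?case by (simp add: tensor_map_zero[OF g u])
next
  case (insert i I)
  interpret M': module R M' by (rule M')
  interpret T: module R "tensor R M' N'" by (rule tensor_module[OF M' N'])
  have fi: "f i \<in> linear_maps R M M'" and fI: "\<And>i. i \<in> I \<Longrightarrow> f i \<in> linear_maps R M M'"
    using insert by auto
  note s = lin_sum[OF M' fi finsum_lin[OF M' M fI]]
  have "tensor_map R M' N' (\<lambda>x. \<Oplus>\<^bsub>M'\<^esub>i\<in>insert i I. f i x) g u =
      tensor_map R M' N' (\<lambda>x. f i x \<oplus>\<^bsub>M'\<^esub> (\<Oplus>\<^bsub>M'\<^esub>i\<in>I. f i x)) g u"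
  proof (rule tensor_map_cong[OF s g _ refl u])
    show "(\<Oplus>\<^bsub>M'\<^esub>i\<in>insert i I. f i x) = f i x \<oplus>\<^bsub>M'\<^esub> (\<Oplus>\<^bsub>M'\<^esub>i\<in>I. f i x)" if "x \<in> carrier M" for x
      using insert.hyps that by (intro M'.finsum_insert) (auto intro: lin_closed fi fI)
  qed
  also have "\<dots> = tensor_map R M' N' (f i) g u \<oplus>\<^bsub>tensor R M' N'\<^esub>
      (\<Oplus>\<^bsub>tensor R M' N'\<^esub>i\<in>I. tensor_map R M' N' (f i) g u)"
    using insert.IH[OF fI] by (simp add: tensor_map_sum[OF fi finsum_lin[OF M' M fI] g u])
  also have "\<dots> = (\<Oplus>\<^bsub>tensor R M' N'\<^esub>i\<in>insert i I. tensor_map R M' N' (f i) g u)"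
    using insert.hyps
    by (intro T.finsum_insert[symmetric]) (auto intro!: lin_closed[OF tensor_map_lin[OF _ g]] fi fI u)
  finally show ?case .
qed

end

lemma tensor_map_comp:
  assumes M: "module R M" and N: "module R N" and M': "module R M'" and N': "module R N'"
    and M'': "module R M''" and N'': "module R N''"
    and f: "f \<in> linear_maps R M M'" and g: "g \<in> linear_maps R N N'"
    and f': "f' \<in> linear_maps R M' M''" and g': "g' \<in> linear_maps R N' N''"
    and u: "u \<in> carrier (tensor R M N)"
  shows "tensor_map R M'' N'' f' g' (tensor_map R M' N' f g u) =
    tensor_map R M'' N'' (\<lambda>x. f' (f x)) (\<lambda>y. g' (g y)) u"
  using u
proof (induction rule: tensor_induct[OF M N, consumes 1, case_names pure add])
  case (pure x y)
  then show ?case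
    by (simp add: tensor_map_pure[OF M N M' N' f g] tensor_map_pure[OF M' N' M'' N'' f' g']
      tensor_map_pure[OF M N M'' N'' lin_comp[OF f f'] lin_comp[OF g g']] lin_closed[OF f] lin_closed[OF g])
next
  case (add u v)
  then show ?case
    by (simp add: lin_add[OF tensor_map_lin[OF M N M' N' f g]] lin_closed[OF tensor_map_lin[OF M N M' N' f g]]
      lin_add[OF tensor_map_lin[OF M' N' M'' N'' f' g']]
      lin_add[OF tensor_map_lin[OF M N M'' N'' lin_comp[OF f f'] lin_comp[OF g g']]])
qed

lemma tensor_map_id:
  assumes M: "module R M" and N: "module R N" and u: "u \<in> carrier (tensor R M N)"
  shows "tensor_map R M N (\<lambda>x. x) (\<lambda>y. y) u = u"
  by (rule tensor_lin_eqI[OF M N tensor_map_lin[OF M N M N lin_id lin_id] lin_id _ u])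
    (simp add: tensor_map_pure[OF M N M N lin_id lin_id])


subsection \<open>Multilinear maps\<close>

definition trilinear_map where
  "trilinear_map R A B C P f \<longleftrightarrow>
     (\<forall>c\<in>carrier C. bilinear_map R A B P (\<lambda>a b. f a b c)) \<and>
     (\<forall>a\<in>carrier A. \<forall>b\<in>carrier B. (\<lambda>c. f a b c) \<in> linear_maps R C P)"

definition quadrilinear_map where
  "quadrilinear_map R A B C D P f \<longleftrightarrow>
     (\<forall>d\<in>carrier D. trilinear_map R A B C P (\<lambda>a b c. f a b c d)) \<and>
     (\<forall>a\<in>carrier A. \<forall>b\<in>carrier B. \<forall>c\<in>carrier C. (\<lambda>d. f a b c d) \<in> linear_maps R D P)"

lemma trilinear_mapI:
  assumes "\<And>b c. b \<in> carrier B \<Longrightarrow> c \<in> carrier C \<Longrightarrow> (\<lambda>a. f a b c) \<in> linear_maps R A P"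
    and "\<And>a c. a \<in> carrier A \<Longrightarrow> c \<in> carrier C \<Longrightarrow> (\<lambda>b. f a b c) \<in> linear_maps R B P"
    and "\<And>a b. a \<in> carrier A \<Longrightarrow> b \<in> carrier B \<Longrightarrow> (\<lambda>c. f a b c) \<in> linear_maps R C P"
  shows "trilinear_map R A B C P f"
  using assms by (auto simp: trilinear_map_def bilinear_map_def)

lemma quadrilinear_mapI:
  assumes "\<And>b c d. b \<in> carrier B \<Longrightarrow> c \<in> carrier C \<Longrightarrow> d \<in> carrier D \<Longrightarrow> (\<lambda>a. f a b c d) \<in> linear_maps R A P"
    and "\<And>a c d. a \<in> carrier A \<Longrightarrow> c \<in> carrier C \<Longrightarrow> d \<in> carrier D \<Longrightarrow> (\<lambda>b. f a b c d) \<in> linear_maps R B P"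
    and "\<And>a b d. a \<in> carrier A \<Longrightarrow> b \<in> carrier B \<Longrightarrow> d \<in> carrier D \<Longrightarrow> (\<lambda>c. f a b c d) \<in> linear_maps R C P"
    and "\<And>a b c. a \<in> carrier A \<Longrightarrow> b \<in> carrier B \<Longrightarrow> c \<in> carrier C \<Longrightarrow> (\<lambda>d. f a b c d) \<in> linear_maps R D P"
  shows "quadrilinear_map R A B C D P f"
  using assms by (auto simp: quadrilinear_map_def intro!: trilinear_mapI)

lemma
  assumes "trilinear_map R A B C P f"
  shows trilin_1: "b \<in> carrier B \<Longrightarrow> c \<in> carrier C \<Longrightarrow> (\<lambda>a. f a b c) \<in> linear_maps R A P"
    and trilin_2: "a \<in> carrier A \<Longrightarrow> c \<in> carrier C \<Longrightarrow> (\<lambda>b. f a b c) \<in> linear_maps R B P"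
    and trilin_3: "a \<in> carrier A \<Longrightarrow> b \<in> carrier B \<Longrightarrow> (\<lambda>c. f a b c) \<in> linear_maps R C P"
  using assms by (auto simp: trilinear_map_def bilinear_map_def)

lemma trilin_closed:
  assumes "trilinear_map R A B C P f" "a \<in> carrier A" "b \<in> carrier B" "c \<in> carrier C"
  shows "f a b c \<in> carrier P"
  using lin_closed[OF trilin_1[OF assms(1,3,4)]] assms(2) .

lemma
  assumes "quadrilinear_map R A B C D P f"
  shows quadrilin_1: "b \<in> carrier B \<Longrightarrow> c \<in> carrier C \<Longrightarrow> d \<in> carrier D \<Longrightarrow> (\<lambda>a. f a b c d) \<in> linear_maps R A P"
    and quadrilin_2: "a \<in> carrier A \<Longrightarrow> c \<in> carrier C \<Longrightarrow> d \<in> carrier D \<Longrightarrow> (\<lambda>b. f a b c d) \<in> linear_maps R B P"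
    and quadrilin_3: "a \<in> carrier A \<Longrightarrow> b \<in> carrier B \<Longrightarrow> d \<in> carrier D \<Longrightarrow> (\<lambda>c. f a b c d) \<in> linear_maps R C P"
    and quadrilin_4: "a \<in> carrier A \<Longrightarrow> b \<in> carrier B \<Longrightarrow> c \<in> carrier C \<Longrightarrow> (\<lambda>d. f a b c d) \<in> linear_maps R D P"
    and quadrilin_trilin: "d \<in> carrier D \<Longrightarrow> trilinear_map R A B C P (\<lambda>a b c. f a b c d)"
  using assms by (auto simp: quadrilinear_map_def trilinear_map_def bilinear_map_def)

lemma quadrilin_closed:
  assumes "quadrilinear_map R A B C D P f" "a \<in> carrier A" "b \<in> carrier B" "c \<in> carrier C" "d \<in> carrier D"
  shows "f a b c d \<in> carrier P"
  using lin_closed[OF quadrilin_1[OF assms(1,3,4,5)]] assms(2) .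

context
  fixes R :: "('r, 'x) ring_scheme" and A :: "('r, 'a, 'y) module_scheme"
    and B :: "('r, 'b, 'z) module_scheme" and C :: "('r, 'c, 'v) module_scheme"
  assumes A: "module R A" and B: "module R B" and C: "module R C"
begin

lemma tensor3_module: "module R (tensor3 R A B C)"
  unfolding tensor3_def by (intro tensor_module A B C)

lemma pure3_trilinear: "trilinear_map R A B C (tensor3 R A B C) (pure3 R A B C)"
  unfolding pure3_def tensor3_def
  by (intro trilinear_mapI lin_comp[OF pure_lin_left[OF A B] pure_lin_left]
     lin_comp[OF pure_lin_right[OF A B] pure_lin_left] pure_lin_right tensor_module A B C pure_closed)

lemma tensor3_induct [consumes 1, case_names pure add]:
  assumes u: "u \<in> carrier (tensor3 R A B C)"
    and pure: "\<And>a b c. a \<in> carrier A \<Longrightarrow> b \<in> carrier B \<Longrightarrow> c \<in> carrier C \<Longrightarrow> P (pure3 R A B C a b c)"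
    and add: "\<And>u v. u \<in> carrier (tensor3 R A B C) \<Longrightarrow> v \<in> carrier (tensor3 R A B C) \<Longrightarrow> P u \<Longrightarrow> P v \<Longrightarrow>
      P (u \<oplus>\<^bsub>tensor3 R A B C\<^esub> v)"
  shows "P u"
  using u unfolding tensor3_def
proof (induction rule: tensor_induct[OF tensor_module[OF A B] C, consumes 1, case_names pure add])
  case (pure u c)
  note p = pure_lin_left[OF tensor_module[OF A B] C pure(2)]
  show ?case using pure(1)
  proof (induction rule: tensor_induct[OF A B, consumes 1, case_names pure add])
    case (pure x y)
    then show ?case using assms(2) \<open>c \<in> carrier C\<close> unfolding pure3_def by simp
  next
    case (add u v)
    then show ?case using assms(3) by (simp add: lin_add[OF p] lin_closed[OF p] tensor3_def)
  qed
next
  case (add u v)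
  then show ?case using assms(3) by (simp add: tensor3_def)
qed

context
  fixes P :: "('r, 'p, 'w) module_scheme"
  assumes P: "module R P"
begin

lemma
  assumes f: "trilinear_map R A B C P f"
  shows tensor_lift3_bilinear:
      "bilinear_map R (tensor R A B) C P (\<lambda>u c. tensor_lift R P (\<lambda>a b. f a b c) u)"
    and tensor_lift3_lin: "tensor_lift3 R P f \<in> linear_maps R (tensor3 R A B C) P"
    and tensor_lift3_pure: "\<And>a b c. a \<in> carrier A \<Longrightarrow> b \<in> carrier B \<Longrightarrow> c \<in> carrier C \<Longrightarrow>
      tensor_lift3 R P f (pure3 R A B C a b c) = f a b c"
proof -
  have f1: "bilinear_map R A B P (\<lambda>a b. f a b c)" if "c \<in> carrier C" for c
    using that f by (simp add: trilinear_map_def)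
  show *: "bilinear_map R (tensor R A B) C P (\<lambda>u c. tensor_lift R P (\<lambda>a b. f a b c) u)"
    by (rule bilinear_tensor_lift[OF A B C P f1 trilin_3[OF f]])
  show "tensor_lift3 R P f \<in> linear_maps R (tensor3 R A B C) P"
    unfolding tensor_lift3_def tensor3_def by (rule tensor_lift_lin[OF tensor_module[OF A B] C P *])
  show "tensor_lift3 R P f (pure3 R A B C a b c) = f a b c"
    if "a \<in> carrier A" "b \<in> carrier B" "c \<in> carrier C" for a b c
    using that unfolding tensor_lift3_def pure3_def
    by (simp add: tensor_lift_pure[OF tensor_module[OF A B] C P *] pure_closed[OF A B]
      tensor_lift_pure[OF A B P f1])
qed

end
end

context
  fixes R :: "('r, 'x) ring_scheme" and A :: "('r, 'a, 'y) module_scheme"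
    and B :: "('r, 'b, 'z) module_scheme" and C :: "('r, 'c, 'v) module_scheme"
    and D :: "('r, 'd, 'u) module_scheme"
  assumes A: "module R A" and B: "module R B" and C: "module R C" and D: "module R D"
begin

lemma tensor4_module: "module R (tensor4 R A B C D)"
  unfolding tensor4_def by (intro tensor_module tensor3_module A B C D)

lemma pure4_quadrilinear: "quadrilinear_map R A B C D (tensor4 R A B C D) (pure4 R A B C D)"
  unfolding pure4_def tensor4_def
  by (intro quadrilinear_mapI lin_comp[OF trilin_1[OF pure3_trilinear] pure_lin_left]
     lin_comp[OF trilin_2[OF pure3_trilinear] pure_lin_left]
     lin_comp[OF trilin_3[OF pure3_trilinear] pure_lin_left] pure_lin_right
     tensor3_module A B C D trilin_closed[OF pure3_trilinear])

lemma tensor4_induct [consumes 1, case_names pure add]: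
  assumes u: "u \<in> carrier (tensor4 R A B C D)"
    and pure: "\<And>a b c d. a \<in> carrier A \<Longrightarrow> b \<in> carrier B \<Longrightarrow> c \<in> carrier C \<Longrightarrow> d \<in> carrier D \<Longrightarrow>
      P (pure4 R A B C D a b c d)"
    and add: "\<And>u v. u \<in> carrier (tensor4 R A B C D) \<Longrightarrow> v \<in> carrier (tensor4 R A B C D) \<Longrightarrow> P u \<Longrightarrow> P v \<Longrightarrow>
      P (u \<oplus>\<^bsub>tensor4 R A B C D\<^esub> v)"
  shows "P u"
  using u unfolding tensor4_def
proof (induction rule: tensor_induct[OF tensor3_module[OF A B C] D, consumes 1, case_names pure add])
  case (pure u d)
  note p = pure_lin_left[OF tensor3_module[OF A B C] D pure(2)]
  show ?case using pure(1)
  proof (induction rule: tensor3_induct[OF A B C, consumes 1, case_names pure add])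
    case (pure a b c)
    then show ?case using assms(2) \<open>d \<in> carrier D\<close> unfolding pure4_def by simp
  next
    case (add u v)
    then show ?case using assms(3) by (simp add: lin_add[OF p] lin_closed[OF p] tensor4_def)
  qed
next
  case (add u v)
  then show ?case using assms(3) by (simp add: tensor4_def)
qed

context
  fixes P :: "('r, 'p, 'w) module_scheme"
  assumes P: "module R P"
begin

lemma
  assumes f: "quadrilinear_map R A B C D P f"
  shows tensor_lift4_lin: "tensor_lift4 R P f \<in> linear_maps R (tensor4 R A B C D) P"
    and tensor_lift4_pure: "\<And>a b c d. a \<in> carrier A \<Longrightarrow> b \<in> carrier B \<Longrightarrow> c \<in> carrier C \<Longrightarrow> d \<in> carrier D \<Longrightarrow>
      tensor_lift4 R P f (pure4 R A B C D a b c d) = f a b c d"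
proof -
  note f3 = quadrilin_trilin[OF f]
  have f2: "bilinear_map R A B P (\<lambda>a b. f a b c d)" if "c \<in> carrier C" "d \<in> carrier D" for c d
    using that f3 by (simp add: trilinear_map_def)
  have *: "bilinear_map R (tensor3 R A B C) D P (\<lambda>u d. tensor_lift3 R P (\<lambda>a b c. f a b c d) u)"
    unfolding tensor_lift3_def tensor3_def
    by (intro bilinear_tensor_lift[OF tensor_module[OF A B] C D P] tensor_lift3_bilinear[OF A B C P f3]
       tensor_lift_lin_param[OF A B D P] f2 quadrilin_4[OF f])
  show "tensor_lift4 R P f \<in> linear_maps R (tensor4 R A B C D) P"
    unfolding tensor_lift4_def tensor4_def by (rule tensor_lift_lin[OF tensor3_module[OF A B C] D P *])
  show "tensor_lift4 R P f (pure4 R A B C D a b c d) = f a b c d"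
    if "a \<in> carrier A" "b \<in> carrier B" "c \<in> carrier C" "d \<in> carrier D" for a b c d
    using that unfolding tensor_lift4_def pure4_def
    by (simp add: tensor_lift_pure[OF tensor3_module[OF A B C] D P *]
      trilin_closed[OF pure3_trilinear[OF A B C]] tensor_lift3_pure[OF A B C P f3])
qed

end
end


section \<open>Direct sums, modules of homomorphisms and restriction of scalars\<close>

lemma direct_sum_simps [simp]:
  "carrier (direct_sum M N) = carrier M \<times> carrier N" "\<zero>\<^bsub>direct_sum M N\<^esub> = (\<zero>\<^bsub>M\<^esub>, \<zero>\<^bsub>N\<^esub>)"
  "p \<oplus>\<^bsub>direct_sum M N\<^esub> q = (fst p \<oplus>\<^bsub>M\<^esub> fst q, snd p \<oplus>\<^bsub>N\<^esub> snd q)"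
  "r \<odot>\<^bsub>direct_sum M N\<^esub> p = (r \<odot>\<^bsub>M\<^esub> fst p, r \<odot>\<^bsub>N\<^esub> snd p)"
  by (simp_all add: direct_sum_def)

lemma direct_sum_module:
  assumes "module R M" "module R N" shows "module R (direct_sum M N)"
proof -
  interpret M: module R M by fact
  interpret N: module R N by fact
  show ?thesis unfolding direct_sum_def
  proof (rule module_plainI[OF M.R.is_cring])
    fix p assume "p \<in> carrier M \<times> carrier N"
    then show "\<exists>q\<in>carrier M \<times> carrier N. (fst q \<oplus>\<^bsub>M\<^esub> fst p, snd q \<oplus>\<^bsub>N\<^esub> snd p) = (\<zero>\<^bsub>M\<^esub>, \<zero>\<^bsub>N\<^esub>)"
      by (intro bexI[of _ "(\<ominus>\<^bsub>M\<^esub> fst p, \<ominus>\<^bsub>N\<^esub> snd p)"]) (auto simp: M.l_neg N.l_neg)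
  qed (auto simp: M.a_ac N.a_ac M.smult_l_distr N.smult_l_distr M.smult_r_distr N.smult_r_distr
      M.smult_assoc1 N.smult_assoc1)
qed

lemma direct_sum_proj:
  "fst \<in> linear_maps R (direct_sum M N) M" "snd \<in> linear_maps R (direct_sum M N) N"
  by (auto intro!: linear_mapsI)

lemma direct_sum_inj:
  assumes "module R M" "module R N"
  shows "(\<lambda>x. (x, \<zero>\<^bsub>N\<^esub>)) \<in> linear_maps R M (direct_sum M N)"
    and "(\<lambda>y. (\<zero>\<^bsub>M\<^esub>, y)) \<in> linear_maps R N (direct_sum M N)"
proof -
  interpret M: module R M by fact
  interpret N: module R N by fact
  show "(\<lambda>x. (x, \<zero>\<^bsub>N\<^esub>)) \<in> linear_maps R M (direct_sum M N)"
    and "(\<lambda>y. (\<zero>\<^bsub>M\<^esub>, y)) \<in> linear_maps R N (direct_sum M N)"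
    by (auto intro!: linear_mapsI)
qed

lemma lin_pair:
  assumes "f \<in> linear_maps R L M" "g \<in> linear_maps R L N"
  shows "(\<lambda>x. (f x, g x)) \<in> linear_maps R L (direct_sum M N)"
  using assms by (auto intro!: linear_mapsI simp: lin_closed lin_add lin_smult)

lemma Hom_module_simps [simp]:
  "carrier (Hom_module R M N) = linear_maps R M N \<inter> extensional (carrier M)"
  "\<zero>\<^bsub>Hom_module R M N\<^esub> = (\<lambda>x\<in>carrier M. \<zero>\<^bsub>N\<^esub>)"
  "f \<oplus>\<^bsub>Hom_module R M N\<^esub> g = (\<lambda>x\<in>carrier M. f x \<oplus>\<^bsub>N\<^esub> g x)"
  "r \<odot>\<^bsub>Hom_module R M N\<^esub> f = (\<lambda>x\<in>carrier M. r \<odot>\<^bsub>N\<^esub> f x)"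
  by (simp_all add: Hom_module_def)

lemma restrict_lin:
  assumes "module R M" "f \<in> linear_maps R M N"
  shows "(\<lambda>x\<in>carrier M. f x) \<in> carrier (Hom_module R M N)"
  using lin_cong[OF assms(2) _ assms(1), of "\<lambda>x\<in>carrier M. f x"] by simp

lemma Hom_module:
  assumes "module R M" "module R N" shows "module R (Hom_module R M N)"
proof -
  interpret M: module R M by fact
  interpret N: module R N by fact
  note r = restrict_lin[OF assms(1), unfolded Hom_module_simps]
  have c: "f x \<in> carrier N" if "f \<in> linear_maps R M N \<inter> extensional (carrier M)" "x \<in> carrier M" for f x
    using that by (auto dest: lin_closed)
  show ?thesis unfolding Hom_module_def
  proof (rule module_plainI[OF M.R.is_cring])
    fix f assume f: "f \<in> linear_maps R M N \<inter> extensional (carrier M)"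
    then have "(\<lambda>x\<in>carrier M. \<ominus>\<^bsub>N\<^esub> f x) \<in> linear_maps R M N \<inter> extensional (carrier M)"
      by (intro r lin_minus_map assms) auto
    then show "\<exists>g\<in>linear_maps R M N \<inter> extensional (carrier M). (\<lambda>x\<in>carrier M. g x \<oplus>\<^bsub>N\<^esub> f x) = (\<lambda>x\<in>carrier M. \<zero>\<^bsub>N\<^esub>)"
      by (rule bexI[rotated]) (auto intro!: restrict_ext simp: c[OF f] N.l_neg)
    show "(\<lambda>x\<in>carrier M. (q \<oplus>\<^bsub>R\<^esub> r) \<odot>\<^bsub>N\<^esub> f x) =
      (\<lambda>x\<in>carrier M. (\<lambda>x\<in>carrier M. q \<odot>\<^bsub>N\<^esub> f x) x \<oplus>\<^bsub>N\<^esub> (\<lambda>x\<in>carrier M. r \<odot>\<^bsub>N\<^esub> f x) x)"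
      if "q \<in> carrier R" "r \<in> carrier R" for q r
      using that by (intro restrict_ext) (simp add: c[OF f] N.smult_l_distr)
    show "(\<lambda>x\<in>carrier M. r \<odot>\<^bsub>N\<^esub> f x) \<in> linear_maps R M N \<inter> extensional (carrier M)"
      if "r \<in> carrier R" for r
      using f that by (intro r lin_scale assms) auto
    show "(\<lambda>x\<in>carrier M. (\<lambda>x\<in>carrier M. \<zero>\<^bsub>N\<^esub>) x \<oplus>\<^bsub>N\<^esub> f x) = f"
      "(\<lambda>x\<in>carrier M. \<one>\<^bsub>R\<^esub> \<odot>\<^bsub>N\<^esub> f x) = f"
      using f by (auto intro!: extensionalityI[where A = "carrier M"] simp: c[OF f])
    show "(\<lambda>x\<in>carrier M. (q \<otimes>\<^bsub>R\<^esub> r) \<odot>\<^bsub>N\<^esub> f x) = (\<lambda>x\<in>carrier M. q \<odot>\<^bsub>N\<^esub> (\<lambda>x\<in>carrier M. r \<odot>\<^bsub>N\<^esub> f x) x)"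
      if "q \<in> carrier R" "r \<in> carrier R" for q r
      using that by (intro restrict_ext) (simp add: c[OF f] N.smult_assoc1)
    fix g assume g: "g \<in> linear_maps R M N \<inter> extensional (carrier M)"
    show "(\<lambda>x\<in>carrier M. f x \<oplus>\<^bsub>N\<^esub> g x) \<in> linear_maps R M N \<inter> extensional (carrier M)"
      using f g by (intro r lin_sum assms) auto
    show "(\<lambda>x\<in>carrier M. f x \<oplus>\<^bsub>N\<^esub> g x) = (\<lambda>x\<in>carrier M. g x \<oplus>\<^bsub>N\<^esub> f x)"
      by (intro restrict_ext) (simp add: c[OF f] c[OF g] N.a_comm)
    show "(\<lambda>x\<in>carrier M. r \<odot>\<^bsub>N\<^esub> (\<lambda>x\<in>carrier M. f x \<oplus>\<^bsub>N\<^esub> g x) x) =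
      (\<lambda>x\<in>carrier M. (\<lambda>x\<in>carrier M. r \<odot>\<^bsub>N\<^esub> f x) x \<oplus>\<^bsub>N\<^esub> (\<lambda>x\<in>carrier M. r \<odot>\<^bsub>N\<^esub> g x) x)"
      if "r \<in> carrier R" for r
      using that by (intro restrict_ext) (simp add: c[OF f] c[OF g] N.smult_r_distr)
    fix h assume h: "h \<in> linear_maps R M N \<inter> extensional (carrier M)"
    show "(\<lambda>x\<in>carrier M. (\<lambda>x\<in>carrier M. f x \<oplus>\<^bsub>N\<^esub> g x) x \<oplus>\<^bsub>N\<^esub> h x) =
      (\<lambda>x\<in>carrier M. f x \<oplus>\<^bsub>N\<^esub> (\<lambda>x\<in>carrier M. g x \<oplus>\<^bsub>N\<^esub> h x) x)"
      by (intro restrict_ext) (simp add: c[OF f] c[OF g] c[OF h] N.a_assoc)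
  qed (rule r[OF lin_zero_map[OF assms(2)]])
qed

lemma Hom_eval_lin:
  assumes "x \<in> carrier M" shows "(\<lambda>f. f x) \<in> linear_maps R (Hom_module R M N) N"
  using assms by (auto intro!: linear_mapsI dest: lin_closed)

lemma lin_into_Hom:
  assumes "module R M" "module R L"
    and "\<And>y. y \<in> carrier L \<Longrightarrow> (\<lambda>x. f y x) \<in> linear_maps R M N"
    and "\<And>x. x \<in> carrier M \<Longrightarrow> (\<lambda>y. f y x) \<in> linear_maps R L N"
  shows "(\<lambda>y. \<lambda>x\<in>carrier M. f y x) \<in> linear_maps R L (Hom_module R M N)"
proof -
  interpret L: module R L by fact
  show ?thesis
  proof (rule linear_mapsI)
    show "(\<lambda>x\<in>carrier M. f y x) \<in> carrier (Hom_module R M N)" if "y \<in> carrier L" for y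
      by (rule restrict_lin[OF assms(1) assms(3)[OF that]])
  qed (auto intro!: restrict_ext simp: lin_add[OF assms(4)] lin_smult[OF assms(4)])
qed

lemma regular_module_simps [simp]:
  "carrier (regular_module R) = carrier R" "\<zero>\<^bsub>regular_module R\<^esub> = \<zero>\<^bsub>R\<^esub>"
  "x \<oplus>\<^bsub>regular_module R\<^esub> y = x \<oplus>\<^bsub>R\<^esub> y" "r \<odot>\<^bsub>regular_module R\<^esub> x = r \<otimes>\<^bsub>R\<^esub> x"
  by (simp_all add: regular_module_def ring.defs module.defs)

lemma regular_module:
  assumes "cring R" shows "module R (regular_module R)"
proof -
  interpret cring R by fact
  have "abelian_group (regular_module R)"
    by (rule abelian_groupI) (auto simp: a_ac intro: bexI[of _ "\<ominus>\<^bsub>R\<^esub> _"] l_neg)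
  then show ?thesis by (intro moduleI assms) (auto simp: l_distr r_distr m_assoc)
qed

lemma restrict_scalars_simps [simp]:
  "carrier (restrict_scalars h M) = carrier M" "\<zero>\<^bsub>restrict_scalars h M\<^esub> = \<zero>\<^bsub>M\<^esub>"
  "x \<oplus>\<^bsub>restrict_scalars h M\<^esub> y = x \<oplus>\<^bsub>M\<^esub> y" "r \<odot>\<^bsub>restrict_scalars h M\<^esub> x = h r \<odot>\<^bsub>M\<^esub> x"
  by (simp_all add: restrict_scalars_def ring.defs module.defs)

lemma restrict_scalars_module:
  assumes "cring R" "h \<in> ring_hom R S" "module S M"
  shows "module R (restrict_scalars h M)"
proof -
  interpret M: module S M by fact
  have "abelian_group (restrict_scalars h M)"
    by (rule abelian_groupI) (auto simp: M.a_ac intro: bexI[of _ "\<ominus>\<^bsub>M\<^esub> _"] M.l_neg)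
  then show ?thesis
    using assms(2) by (intro moduleI assms)
      (auto simp: ring_hom_closed ring_hom_add ring_hom_mult ring_hom_one M.smult_l_distr M.smult_r_distr M.smult_assoc1)
qed

lemma restrict_scalars_lin:
  assumes "h \<in> ring_hom R S" "f \<in> linear_maps S M N"
  shows "f \<in> linear_maps R (restrict_scalars h M) (restrict_scalars h N)"
  using assms by (auto intro!: linear_mapsI simp: lin_closed lin_add lin_smult ring_hom_closed)

section \<open>Base change from the integers\<close>

lemma int_hom_ring_hom:
  assumes "cring S" shows "int_hom S \<in> ring_hom \<Z> S"
proof -
  interpret S: cring S by fact
  show ?thesis
    by (rule ring_hom_memI)
      (auto simp: int_hom_def S.add.int_pow_mult S.add_pow_ldistr_int S.add.int_pow_pow mult.commute)
qed

text \<open>Integer multiples are iterated sums and differences, so additivity forces linearity. The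
  equivalence \<open>st\<close> between neighbouring integers serves both directions of the
  induction that starts at 1.\<close>

lemma int_additive_lin:
  assumes "module \<Z> M" "module \<Z> N" and cl: "\<And>x. x \<in> carrier M \<Longrightarrow> f x \<in> carrier N"
    and add: "\<And>x y. x \<in> carrier M \<Longrightarrow> y \<in> carrier M \<Longrightarrow> f (x \<oplus>\<^bsub>M\<^esub> y) = f x \<oplus>\<^bsub>N\<^esub> f y"
  shows "f \<in> linear_maps \<Z> M N"
proof (rule linear_mapsI[OF cl add])
  interpret M: module \<Z> M by fact
  interpret N: module \<Z> N by fact
  fix r x assume x: "x \<in> carrier M"
  have c: "i \<odot>\<^bsub>M\<^esub> x \<in> carrier M" "i \<odot>\<^bsub>N\<^esub> f x \<in> carrier N" for i
    using M.smult_closed[of i x] N.smult_closed[of i "f x"] x cl by auto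
  have M1: "1 \<odot>\<^bsub>M\<^esub> x = x" and N1: "1 \<odot>\<^bsub>N\<^esub> f x = f x"
    using M.smult_one[OF x] N.smult_one[OF cl[OF x]] by simp_all
  have Ms: "(i + j) \<odot>\<^bsub>M\<^esub> x = i \<odot>\<^bsub>M\<^esub> x \<oplus>\<^bsub>M\<^esub> j \<odot>\<^bsub>M\<^esub> x" for i j
    using M.smult_l_distr[of i j x] x by simp
  have Ns: "(i + j) \<odot>\<^bsub>N\<^esub> f x = i \<odot>\<^bsub>N\<^esub> f x \<oplus>\<^bsub>N\<^esub> j \<odot>\<^bsub>N\<^esub> f x" for i j
    using N.smult_l_distr[of i j "f x"] cl[OF x] by simp
  have st: "f ((i + 1) \<odot>\<^bsub>M\<^esub> x) = (i + 1) \<odot>\<^bsub>N\<^esub> f x \<longleftrightarrow> f (i \<odot>\<^bsub>M\<^esub> x) = i \<odot>\<^bsub>N\<^esub> f x" for i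
  proof -
    have "f ((i + 1) \<odot>\<^bsub>M\<^esub> x) = f (i \<odot>\<^bsub>M\<^esub> x) \<oplus>\<^bsub>N\<^esub> f x" using c x by (simp add: Ms M1 add)
    moreover have "(i + 1) \<odot>\<^bsub>N\<^esub> f x = i \<odot>\<^bsub>N\<^esub> f x \<oplus>\<^bsub>N\<^esub> f x" by (simp add: Ns N1)
    ultimately show ?thesis using c cl x by simp
  qed
  show "f (r \<odot>\<^bsub>M\<^esub> x) = r \<odot>\<^bsub>N\<^esub> f x"
  proof (induction r rule: int_induct[where k = 1])
    case base show ?case by (simp add: M1 N1)
  next
    case (step1 i) then show ?case by (simp add: st)
  next
    case (step2 i) then show ?case using st[of "i - 1"] by simp
  qed
qed

lemma int_alg_module: "cring S \<Longrightarrow> module \<Z> (int_alg S)"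
  by (rule restrict_scalars_module[OF int_is_cring int_hom_ring_hom regular_module])

lemma ring_hom_int_alg_lin:
  assumes "cring S" "cring S'" "h \<in> ring_hom S S'"
  shows "h \<in> linear_maps \<Z> (int_alg S) (int_alg S')"
  using assms(3) by (intro int_additive_lin int_alg_module assms) (auto simp: ring_hom_closed ring_hom_add)

lemma mult_int_alg_lin:
  assumes "cring S" "s \<in> carrier S"
  shows "(\<lambda>t. s \<otimes>\<^bsub>S\<^esub> t) \<in> linear_maps \<Z> (int_alg S) (int_alg S)"
proof -
  interpret cring S by fact
  show ?thesis using assms by (intro int_additive_lin int_alg_module) (auto simp: r_distr)
qed

lemma base_change_simps [simp]:
  "carrier (base_change M S) = carrier (tensor \<Z> M (int_alg S))"
  "\<zero>\<^bsub>base_change M S\<^esub> = \<zero>\<^bsub>tensor \<Z> M (int_alg S)\<^esub>"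
  "u \<oplus>\<^bsub>base_change M S\<^esub> v = u \<oplus>\<^bsub>tensor \<Z> M (int_alg S)\<^esub> v"
  "s \<odot>\<^bsub>base_change M S\<^esub> u = tensor_map \<Z> M (int_alg S) (\<lambda>x. x) (\<lambda>t. s \<otimes>\<^bsub>S\<^esub> t) u"
  by (simp_all add: base_change_def Let_def)

context
  fixes S :: "('s, 'x) ring_scheme" and M :: "(int, 'a, 'y) module_scheme"
  assumes S: "cring S" and M: "module \<Z> M"
begin

interpretation S: cring S by (rule S)
interpretation M: module \<Z> M by (rule M)

lemma base_change_smult_pure:
  assumes "s \<in> carrier S" "x \<in> carrier M" "t \<in> carrier S"
  shows "s \<odot>\<^bsub>base_change M S\<^esub> pure \<Z> M (int_alg S) x t = pure \<Z> M (int_alg S) x (s \<otimes>\<^bsub>S\<^esub> t)"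
  using assms tensor_map_pure[OF M int_alg_module[OF S] M int_alg_module[OF S] lin_id mult_int_alg_lin[OF S]] by simp

lemma base_change_pure_closed:
  "x \<in> carrier M \<Longrightarrow> s \<in> carrier S \<Longrightarrow> pure \<Z> M (int_alg S) x s \<in> carrier (base_change M S)"
  using pure_closed[OF M int_alg_module[OF S]] by simp

lemma base_change_induct [consumes 1, case_names pure add]:
  assumes "u \<in> carrier (base_change M S)"
    and "\<And>x s. x \<in> carrier M \<Longrightarrow> s \<in> carrier S \<Longrightarrow> P (pure \<Z> M (int_alg S) x s)"
    and "\<And>u v. u \<in> carrier (base_change M S) \<Longrightarrow> v \<in> carrier (base_change M S) \<Longrightarrow> P u \<Longrightarrow> P v \<Longrightarrow>
      P (u \<oplus>\<^bsub>base_change M S\<^esub> v)"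
  shows "P u"
proof -
  from assms(1) have "u \<in> carrier (tensor \<Z> M (int_alg S))" by simp
  then show ?thesis
  proof (induction rule: tensor_induct[OF M int_alg_module[OF S], consumes 1, case_names pure add])
    case (pure x y)
    then show ?case using assms(2) by simp
  next
    case (add u v)
    then show ?case using assms(3)[of u v] by simp
  qed
qed

text \<open>Each axiom that relates two scalars is an equality between additive endomorphisms of the
  integral tensor product, and on pure tensors it becomes a ring identity in the second
  factor.\<close>

lemma base_change_module: "module S (base_change M S)"
proof -
  interpret T: module \<Z> "tensor \<Z> M (int_alg S)" by (rule tensor_module[OF M int_alg_module[OF S]])
  let ?p = "pure \<Z> M (int_alg S)"
  note A = int_alg_module[OF S]
  have lin: "tensor_map \<Z> M (int_alg S) (\<lambda>x. x) (\<lambda>t. s \<otimes>\<^bsub>S\<^esub> t)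
      \<in> linear_maps \<Z> (tensor \<Z> M (int_alg S)) (tensor \<Z> M (int_alg S))" if "s \<in> carrier S" for s
    by (rule tensor_map_lin[OF M A M A lin_id mult_int_alg_lin[OF S that]])
  have pr: "tensor_map \<Z> M (int_alg S) (\<lambda>x. x) (\<lambda>t. s \<otimes>\<^bsub>S\<^esub> t) (?p x t) = ?p x (s \<otimes>\<^bsub>S\<^esub> t)"
    if "s \<in> carrier S" "x \<in> carrier M" "t \<in> carrier S" for s x t
    using tensor_map_pure[OF M A M A lin_id mult_int_alg_lin[OF S that(1)]] that by simp
  note pc = pure_closed[OF M A, simplified] and pa = lin_add[OF pure_lin_right[OF M A], simplified]
  show ?thesis
    unfolding base_change_def Let_def
  proof (rule module_plainI[OF S])
    show "\<exists>y\<in>carrier (tensor \<Z> M (int_alg S)). y \<oplus>\<^bsub>tensor \<Z> M (int_alg S)\<^esub> x = \<zero>\<^bsub>tensor \<Z> M (int_alg S)\<^esub>"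
      if "x \<in> carrier (tensor \<Z> M (int_alg S))" for x
      using that by (intro bexI[of _ "\<ominus>\<^bsub>tensor \<Z> M (int_alg S)\<^esub> x"]) (auto simp: T.l_neg)
    fix u assume u: "u \<in> carrier (tensor \<Z> M (int_alg S))"
    show "tensor_map \<Z> M (int_alg S) (\<lambda>x. x) (\<lambda>t. (q \<oplus>\<^bsub>S\<^esub> r) \<otimes>\<^bsub>S\<^esub> t) u =
        tensor_map \<Z> M (int_alg S) (\<lambda>x. x) (\<lambda>t. q \<otimes>\<^bsub>S\<^esub> t) u \<oplus>\<^bsub>tensor \<Z> M (int_alg S)\<^esub>
        tensor_map \<Z> M (int_alg S) (\<lambda>x. x) (\<lambda>t. r \<otimes>\<^bsub>S\<^esub> t) u"
      if "q \<in> carrier S" "r \<in> carrier S" for q r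
      by (rule tensor_lin_eqI[OF M A lin[OF S.add.m_closed[OF that]]
        lin_sum[OF T.module_axioms lin[OF that(1)] lin[OF that(2)]] _ u])
        (use that in \<open>simp add: pr S.l_distr pa\<close>)
    show "tensor_map \<Z> M (int_alg S) (\<lambda>x. x) (\<lambda>t. (q \<otimes>\<^bsub>S\<^esub> r) \<otimes>\<^bsub>S\<^esub> t) u =
        tensor_map \<Z> M (int_alg S) (\<lambda>x. x) (\<lambda>t. q \<otimes>\<^bsub>S\<^esub> t)
        (tensor_map \<Z> M (int_alg S) (\<lambda>x. x) (\<lambda>t. r \<otimes>\<^bsub>S\<^esub> t) u)"
      if "q \<in> carrier S" "r \<in> carrier S" for q r
      by (rule tensor_lin_eqI[OF M A lin[OF S.m_closed[OF that]]
        lin_comp[OF lin[OF that(2)] lin[OF that(1)]] _ u])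
        (use that in \<open>simp add: pr S.m_assoc\<close>)
    show "tensor_map \<Z> M (int_alg S) (\<lambda>x. x) (\<lambda>t. \<one>\<^bsub>S\<^esub> \<otimes>\<^bsub>S\<^esub> t) u = u"
      by (rule tensor_lin_eqI[OF M A lin[OF S.one_closed] lin_id _ u]) (simp add: pr)
  qed (auto simp: T.a_ac lin_closed[OF lin] lin_add[OF lin])
qed

text \<open>The base change has the elements and the addition of the integral tensor product. Only
  the action of \<open>S\<close> is new, and compatibility with it passes from pure tensors to their
  sums.\<close>

lemma additive_base_change_lin:
  assumes N: "module S N" and f: "f \<in> linear_maps \<Z> (tensor \<Z> M (int_alg S)) (restrict_scalars (int_hom S) N)"
    and sm: "\<And>s x t. s \<in> carrier S \<Longrightarrow> x \<in> carrier M \<Longrightarrow> t \<in> carrier S \<Longrightarrow>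
      f (pure \<Z> M (int_alg S) x (s \<otimes>\<^bsub>S\<^esub> t)) = s \<odot>\<^bsub>N\<^esub> f (pure \<Z> M (int_alg S) x t)"
  shows "f \<in> linear_maps S (base_change M S) N"
proof (rule linear_mapsI)
  interpret N: module S N by fact
  interpret B: module S "base_change M S" by (rule base_change_module)
  show c: "f u \<in> carrier N" if "u \<in> carrier (base_change M S)" for u
    using lin_closed[OF f] that by simp
  show a: "f (u \<oplus>\<^bsub>base_change M S\<^esub> v) = f u \<oplus>\<^bsub>N\<^esub> f v"
    if "u \<in> carrier (base_change M S)" "v \<in> carrier (base_change M S)" for u v
    using lin_add[OF f] that by simp
  show "f (s \<odot>\<^bsub>base_change M S\<^esub> u) = s \<odot>\<^bsub>N\<^esub> f u" if s: "s \<in> carrier S" and "u \<in> carrier (base_change M S)" for s u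
    using that(2)
  proof (induction rule: base_change_induct)
    case (pure x t)
    then show ?case using s sm by (simp only: base_change_smult_pure)
  next
    case (add u v)
    have "f (s \<odot>\<^bsub>base_change M S\<^esub> (u \<oplus>\<^bsub>base_change M S\<^esub> v)) =
      f (s \<odot>\<^bsub>base_change M S\<^esub> u \<oplus>\<^bsub>base_change M S\<^esub> s \<odot>\<^bsub>base_change M S\<^esub> v)"
      using add s by (simp only: B.smult_r_distr)
    also have "\<dots> = s \<odot>\<^bsub>N\<^esub> f u \<oplus>\<^bsub>N\<^esub> s \<odot>\<^bsub>N\<^esub> f v"
      using add s by (simp only: a B.smult_closed)
    also have "\<dots> = s \<odot>\<^bsub>N\<^esub> f (u \<oplus>\<^bsub>base_change M S\<^esub> v)"
      using add s c by (simp only: a N.smult_r_distr)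
    finally show ?case .
  qed
qed

lemma base_change_lift_bilinear:
  assumes N: "module S N" and f: "f \<in> linear_maps \<Z> M (restrict_scalars (int_hom S) N)"
  shows "bilinear_map \<Z> M (int_alg S) (restrict_scalars (int_hom S) N) (\<lambda>x s. s \<odot>\<^bsub>N\<^esub> f x)"
proof -
  interpret N: module S N by fact
  note NZ = restrict_scalars_module[OF int_is_cring int_hom_ring_hom[OF S] N]
  have c: "f x \<in> carrier N" if "x \<in> carrier M" for x using lin_closed[OF f that] by simp
  show ?thesis
    by (intro bilinear_mapI int_additive_lin M int_alg_module[OF S] NZ)
      (auto simp: c N.smult_l_distr N.smult_r_distr lin_add[OF f])
qed

text \<open>One half of the adjunction between extension and restriction of scalars: this is the
  \<open>S\<close>-linear map that corresponds to the integral map \<open>f\<close>. Uniqueness is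
  provided by \<open>base_change_lin_eqI\<close>.\<close>

lemma
  assumes N: "module S N" and f: "f \<in> linear_maps \<Z> M (restrict_scalars (int_hom S) N)"
  shows base_change_lift_lin: "tensor_lift \<Z> (restrict_scalars (int_hom S) N) (\<lambda>x s. s \<odot>\<^bsub>N\<^esub> f x)
      \<in> linear_maps S (base_change M S) N"
    and base_change_lift_pure: "\<And>x s. x \<in> carrier M \<Longrightarrow> s \<in> carrier S \<Longrightarrow>
      tensor_lift \<Z> (restrict_scalars (int_hom S) N) (\<lambda>x s. s \<odot>\<^bsub>N\<^esub> f x) (pure \<Z> M (int_alg S) x s) = s \<odot>\<^bsub>N\<^esub> f x"
proof -
  interpret N: module S N by fact
  note NZ = restrict_scalars_module[OF int_is_cring int_hom_ring_hom[OF S] N]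
  note b = base_change_lift_bilinear[OF assms]
  have c: "f x \<in> carrier N" if "x \<in> carrier M" for x using lin_closed[OF f that] by simp
  show p: "tensor_lift \<Z> (restrict_scalars (int_hom S) N) (\<lambda>x s. s \<odot>\<^bsub>N\<^esub> f x) (pure \<Z> M (int_alg S) x s) = s \<odot>\<^bsub>N\<^esub> f x"
    if "x \<in> carrier M" "s \<in> carrier S" for x s
    using tensor_lift_pure[OF M int_alg_module[OF S] NZ b] that by simp
  show "tensor_lift \<Z> (restrict_scalars (int_hom S) N) (\<lambda>x s. s \<odot>\<^bsub>N\<^esub> f x)
      \<in> linear_maps S (base_change M S) N"
    by (rule additive_base_change_lin[OF N tensor_lift_lin[OF M int_alg_module[OF S] NZ b]])
      (simp add: p c N.smult_assoc1)
qed

end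

context
  fixes S :: "('s, 'x) ring_scheme" and M :: "(int, 'a, 'y) module_scheme" and M' :: "(int, 'b, 'z) module_scheme"
  assumes S: "cring S" and M: "module \<Z> M" and M': "module \<Z> M'"
begin

lemma base_change_map_lin:
  assumes f: "f \<in> linear_maps \<Z> M M'"
  shows "tensor_map \<Z> M' (int_alg S) f (\<lambda>s. s) \<in> linear_maps S (base_change M S) (base_change M' S)"
proof (rule additive_base_change_lin[OF S M base_change_module[OF S M']])
  note A = int_alg_module[OF S]
  interpret S: cring S by (rule S)
  note l = tensor_map_lin[OF M A M' A f lin_id]
  note NZ = restrict_scalars_module[OF int_is_cring int_hom_ring_hom[OF S] base_change_module[OF S M']]
  show "tensor_map \<Z> M' (int_alg S) f (\<lambda>s. s)
      \<in> linear_maps \<Z> (tensor \<Z> M (int_alg S)) (restrict_scalars (int_hom S) (base_change M' S))"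
    by (rule int_additive_lin[OF tensor_module[OF M A] NZ]) (simp_all add: lin_closed[OF l] lin_add[OF l])
  fix s x t assume "s \<in> carrier S" "x \<in> carrier M" "t \<in> carrier S"
  then show "tensor_map \<Z> M' (int_alg S) f (\<lambda>s. s) (pure \<Z> M (int_alg S) x (s \<otimes>\<^bsub>S\<^esub> t)) =
      s \<odot>\<^bsub>base_change M' S\<^esub> tensor_map \<Z> M' (int_alg S) f (\<lambda>s. s) (pure \<Z> M (int_alg S) x t)"
    by (simp add: tensor_map_pure[OF M A M' A f lin_id] base_change_smult_pure[OF S M', simplified] lin_closed[OF f])
qed

end

context
  fixes S :: "('s, 'x) ring_scheme" and S' :: "('t, 'v) ring_scheme" and M :: "(int, 'a, 'y) module_scheme"
  assumes S: "cring S" and S': "cring S'" and M: "module \<Z> M"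
begin

lemma
  assumes h: "h \<in> ring_hom S S'"
  shows base_change_hom_lin: "base_change_hom M S' h \<in> linear_maps S (base_change M S) (restrict_scalars h (base_change M S'))"
    and base_change_hom_pure: "\<And>x s. x \<in> carrier M \<Longrightarrow> s \<in> carrier S \<Longrightarrow>
      base_change_hom M S' h (pure \<Z> M (int_alg S) x s) = pure \<Z> M (int_alg S') x (h s)"
proof -
  note A = int_alg_module[OF S] and A' = int_alg_module[OF S'] and hl = ring_hom_int_alg_lin[OF S S' h]
  note l = tensor_map_lin[OF M A M A' lin_id hl]
  note N = restrict_scalars_module[OF S h base_change_module[OF S' M]]
  interpret S: cring S by (rule S)
  show p: "base_change_hom M S' h (pure \<Z> M (int_alg S) x s) = pure \<Z> M (int_alg S') x (h s)"
    if "x \<in> carrier M" "s \<in> carrier S" for x s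
    using tensor_map_pure[OF M A M A' lin_id hl] that by (simp add: base_change_hom_def)
  show "base_change_hom M S' h \<in> linear_maps S (base_change M S) (restrict_scalars h (base_change M S'))"
  proof (rule additive_base_change_lin[OF S M N])
    show "base_change_hom M S' h \<in> linear_maps \<Z> (tensor \<Z> M (int_alg S))
        (restrict_scalars (int_hom S) (restrict_scalars h (base_change M S')))"
      unfolding base_change_hom_def
      by (rule int_additive_lin[OF tensor_module[OF M A] restrict_scalars_module[OF int_is_cring int_hom_ring_hom[OF S] N]])
        (simp_all add: lin_closed[OF l] lin_add[OF l])
    fix s x t assume "s \<in> carrier S" "x \<in> carrier M" "t \<in> carrier S"
    then show "base_change_hom M S' h (pure \<Z> M (int_alg S) x (s \<otimes>\<^bsub>S\<^esub> t)) =
        s \<odot>\<^bsub>restrict_scalars h (base_change M S')\<^esub> base_change_hom M S' h (pure \<Z> M (int_alg S) x t)"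
      by (simp add: p base_change_smult_pure[OF S' M, simplified] ring_hom_closed[OF h] ring_hom_mult[OF h])
  qed
qed

end

section \<open>Tor from a finite free presentation\<close>

lemma free_int_simps [simp]:
  "x \<oplus>\<^bsub>free_module \<Z> B\<^esub> y = (\<lambda>b. x b + y b)" "n \<odot>\<^bsub>free_module \<Z> B\<^esub> x = (\<lambda>b. n * x b)"
  "\<zero>\<^bsub>free_module \<Z> B\<^esub> = (\<lambda>_. 0)"
  by (simp_all add: free_module_def)

text \<open>Subgroups of \<open>\<int>\<^sup>n\<close> are projective: split off one coordinate at a time, choosing an
  element of \<open>M\<close> at which that coordinate is nonzero of least absolute value.\<close>

lemma lin_into_free_int_section:
  fixes M :: "(int, 'm, 'y) module_scheme" and B :: "'b set"
  assumes "finite A" "module \<Z> M" "r \<in> linear_maps \<Z> M (free_module \<Z> B)"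
    and "\<And>m b. m \<in> carrier M \<Longrightarrow> b \<notin> A \<Longrightarrow> r m b = 0"
  shows "\<exists>s. s \<in> linear_maps \<Z> ((free_module \<Z> B)\<lparr>carrier := r ` carrier M\<rparr>) M \<and>
    (\<forall>x\<in>r ` carrier M. r (s x) = x)"
  using assms
proof (induction A arbitrary: M rule: finite_induct)
  case empty
  interpret M: module \<Z> M by (rule empty.prems)
  have r0: "r m = (\<lambda>_. 0)" if "m \<in> carrier M" for m
    using empty.prems(3)[OF that] by auto
  have "r \<zero>\<^bsub>M\<^esub> = (\<lambda>_. 0)" by (rule r0) simp
  then show ?case
    by (intro exI[of _ "\<lambda>x. \<zero>\<^bsub>M\<^esub>"] conjI lin_zero_map empty.prems) (auto simp: r0)
next
  case (insert a A)
  interpret M: module \<Z> M by (rule insert.prems)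
  interpret F: module \<Z> "free_module \<Z> B" by (rule free_module[OF int_is_cring])
  note r = insert.prems(2)
  have ra: "r (m \<oplus>\<^bsub>M\<^esub> n) = (\<lambda>b. r m b + r n b)" if "m \<in> carrier M" "n \<in> carrier M" for m n
    using lin_add[OF r that] by simp
  have rs: "r (k \<odot>\<^bsub>M\<^esub> m) = (\<lambda>b. k * r m b)" if "m \<in> carrier M" for k m
    using lin_smult[OF r, of k m] that by simp
  have sc: "k \<odot>\<^bsub>M\<^esub> m \<in> carrier M" if "m \<in> carrier M" for k m
    using M.smult_closed[of k m] that by simp
  show ?case
  proof (cases "\<forall>m\<in>carrier M. r m a = 0")
    case True
    show ?thesis
    proof (rule insert.IH[OF insert.prems(1) r])
      show "r m b = 0" if "m \<in> carrier M" "b \<notin> A" for m b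
        using that insert.prems(3)[of m b] True by (cases "b = a") auto
    qed
  next
    case False
    then obtain m1 where m1: "m1 \<in> carrier M" "r m1 a \<noteq> 0" by auto
    obtain m0 where m0: "m0 \<in> carrier M" "r m0 a \<noteq> 0"
      and least: "\<And>m. m \<in> carrier M \<Longrightarrow> r m a \<noteq> 0 \<Longrightarrow> nat \<bar>r m0 a\<bar> \<le> nat \<bar>r m a\<bar>"
      using ex_has_least_nat[of "\<lambda>m. m \<in> carrier M \<and> r m a \<noteq> 0" m1 "\<lambda>m. nat \<bar>r m a\<bar>"] m1 by auto
    define d where "d = r m0 a"
    \<comment> \<open>Division with remainder: subtracting the right multiple of \<open>m0\<close>
      from \<open>m\<close> leaves the remainder as the coordinate at \<open>a\<close>, and a
      nonzero remainder would be smaller than the minimum \<open>d\<close>.\<close>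
    have dvd: "d dvd r m a" if m: "m \<in> carrier M" for m
    proof (rule ccontr)
      assume "\<not> d dvd r m a"
      then have nz: "r m a mod d \<noteq> 0" by (simp add: dvd_eq_mod_eq_0)
      let ?m = "m \<oplus>\<^bsub>M\<^esub> (- (r m a div d)) \<odot>\<^bsub>M\<^esub> m0"
      have "r ?m a = r m a - (r m a div d) * d"
        using m m0 by (simp add: ra rs sc d_def)
      then have eq: "r ?m a = r m a mod d" by (simp add: minus_div_mult_eq_mod)
      then have "nat \<bar>d\<bar> \<le> nat \<bar>r m a mod d\<bar>"
        using least[of ?m] nz m m0 sc d_def by simp
      moreover have "\<bar>r m a mod d\<bar> < \<bar>d\<bar>" using abs_mod_less m0 d_def by auto
      ultimately show False by simp
    qed
    let ?M' = "M\<lparr>carrier := {m \<in> carrier M. r m a = 0}\<rparr>"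
    let ?q = "\<lambda>x. x a div d"
    have sub: "submodule {m \<in> carrier M. r m a = 0} \<Z> M"
      using lin_zero[OF r insert.prems(1) F.module_axioms]
      by (intro submoduleI'[OF insert.prems(1)]) (auto simp: ra rs sc)
    have "\<exists>s. s \<in> linear_maps \<Z> ((free_module \<Z> B)\<lparr>carrier := r ` carrier ?M'\<rparr>) ?M' \<and>
      (\<forall>x\<in>r ` carrier ?M'. r (s x) = x)"
    proof (rule insert.IH[OF module_carrier_update[OF insert.prems(1) sub] lin_from_sub[OF r]])
      show "r m b = 0" if "m \<in> carrier ?M'" "b \<notin> A" for m b
        using that insert.prems(3)[of m b] by (cases "b = a") auto
    qed auto
    then obtain s where s: "s \<in> linear_maps \<Z> ((free_module \<Z> B)\<lparr>carrier := r ` carrier ?M'\<rparr>) ?M'"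
      and rss: "\<And>x. x \<in> r ` carrier ?M' \<Longrightarrow> r (s x) = x" by auto
    \<comment> \<open>\<open>p\<close> removes from \<open>x\<close> the multiple of
      \<open>r m0\<close> that accounts for its coordinate at \<open>a\<close>. What remains comes
      from the kernel of that coordinate, where the section \<open>s\<close> of the induction
      hypothesis is available; the removed part is lifted to the same multiple of
      \<open>m0\<close>.\<close>
    define p where "p x = (\<lambda>b. x b - ?q x * r m0 b)" for x
    have p: "p x \<in> r ` carrier ?M'" if x: "x \<in> r ` carrier M" for x
    proof -
      obtain m where m: "m \<in> carrier M" "x = r m" using x by auto
      let ?m = "m \<oplus>\<^bsub>M\<^esub> (- ?q x) \<odot>\<^bsub>M\<^esub> m0"
      have "r ?m = p x" using m m0 by (simp add: ra rs sc p_def fun_eq_iff)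
      moreover have "p x a = 0" using dvd m by (simp add: p_def d_def[symmetric])
      ultimately show ?thesis using m m0 sc by (intro image_eqI[of _ _ ?m]) auto
    qed
    \<comment> \<open>Integer division is additive here because \<open>d\<close> divides the
      coordinate at \<open>a\<close> of every element of the image.\<close>
    have qa: "?q (\<lambda>b. x b + y b) = ?q x + ?q y" if "x \<in> r ` carrier M" "y \<in> r ` carrier M" for x y
      using that dvd by (auto intro: div_plus_div_distrib_dvd_left)
    have qs: "?q (\<lambda>b. k * x b) = k * ?q x" if "x \<in> r ` carrier M" for k x
      using that dvd by (auto simp: div_mult_swap)
    have scl: "s x \<in> carrier M" if "x \<in> r ` carrier ?M'" for x
      using lin_closed[OF s, of x] that by simp
    let ?s = "\<lambda>x. s (p x) \<oplus>\<^bsub>M\<^esub> ?q x \<odot>\<^bsub>M\<^esub> m0"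
    have "?s \<in> linear_maps \<Z> ((free_module \<Z> B)\<lparr>carrier := r ` carrier M\<rparr>) M"
    proof (rule linear_mapsI)
      let ?J = "(free_module \<Z> B)\<lparr>carrier := r ` carrier M\<rparr>"
      fix x assume x: "x \<in> carrier ?J"
      then have x': "x \<in> r ` carrier M" by simp
      show "?s x \<in> carrier M" using p[OF x'] scl sc m0 by simp
      fix y assume y: "y \<in> carrier ?J"
      then have y': "y \<in> r ` carrier M" by simp
      have "p (\<lambda>b. x b + y b) = (\<lambda>b. p x b + p y b)"
        unfolding p_def qa[OF x' y'] by (simp add: algebra_simps)
      moreover have "s (\<lambda>b. p x b + p y b) = s (p x) \<oplus>\<^bsub>M\<^esub> s (p y)"
        using lin_add[OF s, of "p x" "p y"] p[OF x'] p[OF y'] by simp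
      moreover have "(?q x + ?q y) \<odot>\<^bsub>M\<^esub> m0 = ?q x \<odot>\<^bsub>M\<^esub> m0 \<oplus>\<^bsub>M\<^esub> ?q y \<odot>\<^bsub>M\<^esub> m0"
        using M.smult_l_distr[of "?q x" "?q y" m0] m0 by simp
      ultimately show "?s (x \<oplus>\<^bsub>?J\<^esub> y) = ?s x \<oplus>\<^bsub>M\<^esub> ?s y"
        using qa[OF x' y'] scl[OF p[OF x']] scl[OF p[OF y']] sc m0 by (simp add: M.a_ac)
    next
      let ?J = "(free_module \<Z> B)\<lparr>carrier := r ` carrier M\<rparr>"
      fix k x assume x: "x \<in> carrier ?J"
      then have x': "x \<in> r ` carrier M" by simp
      have "p (\<lambda>b. k * x b) = (\<lambda>b. k * p x b)"
        unfolding p_def qs[OF x'] by (simp add: algebra_simps)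
      moreover have "s (\<lambda>b. k * p x b) = k \<odot>\<^bsub>M\<^esub> s (p x)"
        using lin_smult[OF s, of k "p x"] p[OF x'] by simp
      moreover have "(k * ?q x) \<odot>\<^bsub>M\<^esub> m0 = k \<odot>\<^bsub>M\<^esub> (?q x \<odot>\<^bsub>M\<^esub> m0)"
        using M.smult_assoc1[of k "?q x" m0] m0 by simp
      ultimately show "?s (k \<odot>\<^bsub>?J\<^esub> x) = k \<odot>\<^bsub>M\<^esub> ?s x"
        using qs[OF x'] scl[OF p[OF x']] sc m0 M.smult_r_distr[of k "s (p x)" "?q x \<odot>\<^bsub>M\<^esub> m0"] by simp
    qed
    moreover have "r (?s x) = x" if x: "x \<in> r ` carrier M" for x
    proof -
      have "r (?s x) = (\<lambda>b. r (s (p x)) b + ?q x * r m0 b)"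
        using scl[OF p[OF x]] m0 sc by (simp add: ra rs)
      then show ?thesis using rss[OF p[OF x]] by (simp add: p_def)
    qed
    ultimately show ?thesis by blast
  qed
qed

lemma lin_id_sub: "K \<subseteq> carrier M \<Longrightarrow> (\<lambda>x. x) \<in> linear_maps R (M\<lparr>carrier := K\<rparr>) M"
  by (rule lin_from_sub[OF lin_id])

lemma finite_free_int_section:
  assumes "finite A" "module \<Z> M" "r \<in> linear_maps \<Z> M (free_module \<Z> A)"
  shows "\<exists>s. s \<in> linear_maps \<Z> ((free_module \<Z> A)\<lparr>carrier := r ` carrier M\<rparr>) M \<and>
    (\<forall>x\<in>r ` carrier M. r (s x) = x)"
proof -
  have "r m b = 0" if "m \<in> carrier M" "b \<notin> A" for m b
    using free_carrier_D(2)[OF int_is_cring lin_closed[OF assms(3) that(1)] that(2)] by simp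
  then show ?thesis by (rule lin_into_free_int_section[OF assms])
qed

lemma tensor_map_at_zero:
  assumes "module R M" "module R N" "module R M'" "module R N'"
    and "f \<in> linear_maps R M M'" "g \<in> linear_maps R N N'"
  shows "tensor_map R M' N' f g \<zero>\<^bsub>tensor R M N\<^esub> = \<zero>\<^bsub>tensor R M' N'\<^esub>"
  by (rule lin_zero[OF tensor_map_lin[OF assms] tensor_module[OF assms(1,2)] tensor_module[OF assms(3,4)]])

text \<open>In the decomposition of \<open>m\<close> as \<open>m - s (r m)\<close> plus
  \<open>s (r m)\<close>, the first summand lies in \<open>Ker\<close> and the second factors
  through \<open>r\<close>. After tensoring, the second one kills \<open>u\<close>. The assumption
  is vanishing in \<open>J \<otimes> N\<close>, not in the tensor product of \<open>N\<close> with
  the ambient free module; the gap between the two is exactly the Tor term.\<close>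

lemma image_Ker_tensorI:
  fixes M :: "(int, 'm, 'y) module_scheme" and N :: "(int, 'n, 'z) module_scheme" and B :: "'b set"
    and r :: "'m \<Rightarrow> 'b \<Rightarrow> int"
  defines "J \<equiv> (free_module \<Z> B)\<lparr>carrier := r ` carrier M\<rparr>"
    and "Ker \<equiv> M\<lparr>carrier := {m \<in> carrier M. r m = (\<lambda>_. 0)}\<rparr>"
  assumes M: "module \<Z> M" and r: "r \<in> linear_maps \<Z> M (free_module \<Z> B)"
    and s: "s \<in> linear_maps \<Z> J M" and rs: "\<And>x. x \<in> r ` carrier M \<Longrightarrow> r (s x) = x"
    and N: "module \<Z> N"
    and u: "u \<in> carrier (tensor \<Z> M N)" and z: "tensor_map \<Z> J N r (\<lambda>n. n) u = \<zero>\<^bsub>tensor \<Z> J N\<^esub>"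
  shows "u \<in> tensor_map \<Z> M N (\<lambda>x. x) (\<lambda>n. n) ` carrier (tensor \<Z> Ker N)"
proof (rule image_eqI)
  let ?P = "free_module \<Z> B"
  interpret M: module \<Z> M by (rule M)
  have P: "module \<Z> ?P" by (rule free_module[OF int_is_cring])
  interpret P: module \<Z> ?P by (rule P)
  have J: "module \<Z> J" unfolding J_def by (rule module_carrier_update[OF P submodule_image[OF r M P]])
  have Ker: "module \<Z> Ker" unfolding Ker_def using module_carrier_update[OF M submodule_kernel[OF r M P]] by simp
  have r_J: "r \<in> linear_maps \<Z> M J" unfolding J_def by (rule lin_into_sub[OF r]) simp
  have Ker_incl: "(\<lambda>x. x) \<in> linear_maps \<Z> Ker M" unfolding Ker_def by (rule lin_id_sub) auto
  have \<rho>: "(\<lambda>m. m \<ominus>\<^bsub>M\<^esub> s (r m)) \<in> linear_maps \<Z> M Ker"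
    unfolding Ker_def
  proof (rule lin_into_sub[OF lin_diff_map[OF M lin_id lin_comp[OF r_J s]]])
    fix m assume m: "m \<in> carrier M"
    moreover have "s (r m) \<in> carrier M" using lin_closed[OF s, of "r m"] m by (simp add: J_def)
    ultimately show "m \<ominus>\<^bsub>M\<^esub> s (r m) \<in> {m \<in> carrier M. r m = (\<lambda>_. 0)}"
      using rs[of "r m"] lin_closed[OF r m] P.r_neg[of "r m"] by (simp add: lin_diff[OF r M P] a_minus_def[of ?P])
  qed
  let ?v = "tensor_map \<Z> Ker N (\<lambda>m. m \<ominus>\<^bsub>M\<^esub> s (r m)) (\<lambda>n. n) u"
  show v: "?v \<in> carrier (tensor \<Z> Ker N)"
    by (rule lin_closed[OF tensor_map_lin[OF M N Ker N \<rho> lin_id] u])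
  interpret T: module \<Z> "tensor \<Z> M N" by (rule tensor_module[OF M N])
  note sr = lin_comp[OF r_J s]
  have "tensor_map \<Z> M N (\<lambda>m. s (r m)) (\<lambda>n. n) u = tensor_map \<Z> M N s (\<lambda>n. n) (tensor_map \<Z> J N r (\<lambda>n. n) u)" by (simp add: tensor_map_comp[OF M N J N M N r_J lin_id s lin_id u])
  also have "\<dots> = \<zero>\<^bsub>tensor \<Z> M N\<^esub>"
    by (simp add: z tensor_map_at_zero[OF J N M N s lin_id])
  finally have z': "tensor_map \<Z> M N (\<lambda>m. s (r m)) (\<lambda>n. n) u = \<zero>\<^bsub>tensor \<Z> M N\<^esub>" .
  have "u = tensor_map \<Z> M N (\<lambda>m. m) (\<lambda>n. n) u" by (rule tensor_map_id[OF M N u, symmetric])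
  also have "\<dots> = tensor_map \<Z> M N (\<lambda>m. (m \<ominus>\<^bsub>M\<^esub> s (r m)) \<oplus>\<^bsub>M\<^esub> s (r m)) (\<lambda>n. n) u"
    by (rule tensor_map_cong[OF M N M N lin_sum[OF M lin_diff_map[OF M lin_id sr] sr] lin_id _ refl u])
      (use lin_closed[OF sr] in \<open>simp add: a_minus_def M.a_assoc M.l_neg\<close>)
  also have "\<dots> = tensor_map \<Z> M N (\<lambda>m. m \<ominus>\<^bsub>M\<^esub> s (r m)) (\<lambda>n. n) u \<oplus>\<^bsub>tensor \<Z> M N\<^esub> tensor_map \<Z> M N (\<lambda>m. s (r m)) (\<lambda>n. n) u"
    by (rule tensor_map_sum[OF M N M N lin_diff_map[OF M lin_id sr] sr lin_id u])
  also have "\<dots> = tensor_map \<Z> M N (\<lambda>m. m \<ominus>\<^bsub>M\<^esub> s (r m)) (\<lambda>n. n) u"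
    using lin_closed[OF tensor_map_lin[OF M N M N lin_diff_map[OF M lin_id sr] lin_id] u] by (simp add: z')
  also have "\<dots> = tensor_map \<Z> M N (\<lambda>x. x) (\<lambda>n. n) ?v" by (rule tensor_map_comp[OF M N Ker N M N \<rho> lin_id Ker_incl lin_id u, symmetric])
  finally show "u = tensor_map \<Z> M N (\<lambda>x. x) (\<lambda>n. n) ?v" .
qed

section \<open>Comparing a finite free presentation with the standard resolution\<close>

context
  fixes M :: "(int, 'm) module" and C :: "(int, 'c) module" and A :: "'b set"
    and r :: "'m \<Rightarrow> 'b \<Rightarrow> int" and \<pi> :: "('b \<Rightarrow> int) \<Rightarrow> 'c"
  assumes M: "module \<Z> M" and C: "module \<Z> C" and A: "finite A"
    and r: "r \<in> linear_maps \<Z> M (free_module \<Z> A)"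
    and \<pi>: "\<pi> \<in> linear_maps \<Z> (free_module \<Z> A) C"
    and \<pi>_onto: "\<pi> ` carrier (free_module \<Z> A) = carrier C"
    and \<pi>_ker: "{x \<in> carrier (free_module \<Z> A). \<pi> x = \<zero>\<^bsub>C\<^esub>} = r ` carrier M"
begin

interpretation M: module \<Z> M by (rule M)
interpretation C: module \<Z> C by (rule C)

private abbreviation (input) "P \<equiv> free_module \<Z> A"
private abbreviation (input) "J \<equiv> P\<lparr>carrier := r ` carrier M\<rparr>"
private abbreviation (input) "F \<equiv> free_module \<Z> (carrier C)"
private abbreviation (input) "K \<equiv> resolution_kernel C"
private abbreviation (input) "\<epsilon> \<equiv> free_lift \<Z> C (\<lambda>x. x)"
private abbreviation (input) "Ker \<equiv> M\<lparr>carrier := {m \<in> carrier M. r m = (\<lambda>_. 0)}\<rparr>"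

private lemma P: "module \<Z> P" and F: "module \<Z> F" by (rule free_module[OF int_is_cring])+

interpretation P: module \<Z> P by (rule P)
interpretation F: module \<Z> F by (rule F)

private lemma \<epsilon>: "\<epsilon> \<in> linear_maps \<Z> F C"
  by (rule free_lift_lin[OF int_is_cring C])

private lemma K_eq: "K = F\<lparr>carrier := {y \<in> carrier F. \<epsilon> y = \<zero>\<^bsub>C\<^esub>}\<rparr>"
  by (simp add: resolution_kernel_def Let_def)

private lemma K_sub: "submodule {y \<in> carrier F. \<epsilon> y = \<zero>\<^bsub>C\<^esub>} \<Z> F"
  by (rule submodule_kernel[OF \<epsilon> F C])

private lemma K: "module \<Z> K"
  unfolding K_eq by (rule module_carrier_update[OF F K_sub])

private lemma J: "module \<Z> J"
  by (rule module_carrier_update[OF P submodule_image[OF r M P]])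

private lemma Ker: "module \<Z> Ker"
  using module_carrier_update[OF M submodule_kernel[OF r M P]] by simp

text \<open>\<open>P\<close> and \<open>F\<close> are both free and both map onto \<open>C\<close>,
  so the identity of \<open>C\<close> lifts in either direction: \<open>\<psi>\<close> sends a
  generator to the basis element of \<open>F\<close> labelled by its image, and
  \<open>\<phi>\<close> sends the basis element of \<open>c\<close> to a chosen preimage
  \<open>l c\<close>. No coefficient module enters, so the same three maps serve every ring
  \<open>S\<close>.\<close>

lemma Tor1_presentation_maps:
  obtains s \<psi> \<phi> where
    "s \<in> linear_maps \<Z> J M" "\<And>x. x \<in> r ` carrier M \<Longrightarrow> r (s x) = x"
    "\<psi> \<in> linear_maps \<Z> P F" "\<And>x. x \<in> carrier P \<Longrightarrow> \<epsilon> (\<psi> x) = \<pi> x"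
    "\<phi> \<in> linear_maps \<Z> F P" "\<And>y. y \<in> carrier F \<Longrightarrow> \<pi> (\<phi> y) = \<epsilon> y"
proof -
  obtain s where s: "s \<in> linear_maps \<Z> J M" "\<And>x. x \<in> r ` carrier M \<Longrightarrow> r (s x) = x"
    using finite_free_int_section[OF A M r] by auto
  have gP: "free_gen \<Z> a \<in> carrier P" if "a \<in> A" for a
    by (rule free_gen_closed[OF int_is_cring that])
  have gF: "free_gen \<Z> c \<in> carrier F" if "c \<in> carrier C" for c
    by (rule free_gen_closed[OF int_is_cring that])
  define \<psi> where "\<psi> = free_lift \<Z> F (\<lambda>a. free_gen \<Z> (\<pi> (free_gen \<Z> a)))"
  have \<pi>g: "\<pi> (free_gen \<Z> a) \<in> carrier C" if "a \<in> A" for a using lin_closed[OF \<pi> gP[OF that]] .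
  have \<psi>: "\<psi> \<in> linear_maps \<Z> P F"
    unfolding \<psi>_def by (rule free_lift_lin[OF int_is_cring F gF[OF \<pi>g]])
  have \<psi>g: "\<psi> (free_gen \<Z> a) = free_gen \<Z> (\<pi> (free_gen \<Z> a))" if "a \<in> A" for a
    unfolding \<psi>_def using free_lift_gen[OF int_is_cring F gF[OF \<pi>g] that] .
  have \<epsilon>g: "\<epsilon> (free_gen \<Z> c) = c" if "c \<in> carrier C" for c
    by (rule free_lift_gen[OF int_is_cring C _ that])
  have \<epsilon>\<psi>: "\<epsilon> (\<psi> x) = \<pi> x" if "x \<in> carrier P" for x
    by (rule free_lin_eqI[OF int_is_cring lin_comp[OF \<psi> \<epsilon>] \<pi> C _ that]) (simp add: \<psi>g \<epsilon>g \<pi>g)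
  define l where "l c = (SOME x. x \<in> carrier P \<and> \<pi> x = c)" for c
  have l: "l c \<in> carrier P" "\<pi> (l c) = c" if c: "c \<in> carrier C" for c
  proof -
    have "c \<in> \<pi> ` carrier P" using c \<pi>_onto by simp
    then obtain x where "x \<in> carrier P \<and> \<pi> x = c" by auto
    then have "l c \<in> carrier P \<and> \<pi> (l c) = c" unfolding l_def by (rule someI[where P = "\<lambda>x. x \<in> carrier P \<and> \<pi> x = c"])
    then show "l c \<in> carrier P" "\<pi> (l c) = c" by auto
  qed
  define \<phi> where "\<phi> = free_lift \<Z> P l"
  have \<phi>: "\<phi> \<in> linear_maps \<Z> F P"
    unfolding \<phi>_def by (rule free_lift_lin[OF int_is_cring P l(1)])
  have \<pi>\<phi>: "\<pi> (\<phi> y) = \<epsilon> y" if "y \<in> carrier F" for y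
    by (rule free_lin_eqI[OF int_is_cring lin_comp[OF \<phi> \<pi>] \<epsilon> C _ that])
      (simp add: \<phi>_def free_lift_gen[OF int_is_cring P l(1)] \<epsilon>g l)
  show thesis by (rule that[OF s \<psi> \<epsilon>\<psi> \<phi> \<pi>\<phi>])
qed

context
  fixes s :: "('b \<Rightarrow> int) \<Rightarrow> 'm" and \<psi> :: "('b \<Rightarrow> int) \<Rightarrow> 'c \<Rightarrow> int" and \<phi> and N :: "(int, 'n) module"
  assumes s: "s \<in> linear_maps \<Z> J M" and rs: "\<And>x. x \<in> r ` carrier M \<Longrightarrow> r (s x) = x"
    and \<psi>: "\<psi> \<in> linear_maps \<Z> P F" and \<epsilon>\<psi>: "\<And>x. x \<in> carrier P \<Longrightarrow> \<epsilon> (\<psi> x) = \<pi> x"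
    and \<phi>: "\<phi> \<in> linear_maps \<Z> F P" and \<pi>\<phi>: "\<And>y. y \<in> carrier F \<Longrightarrow> \<pi> (\<phi> y) = \<epsilon> y"
    and N: "module \<Z> N"
begin

private abbreviation (input) "tm M' f \<equiv> tensor_map \<Z> M' N f (\<lambda>n. n)"
private abbreviation (input) "\<kappa> \<equiv> \<lambda>m. \<psi> (r m)"

private lemma tm_comp:
  assumes "module \<Z> M1" "module \<Z> M2" "module \<Z> M3" "f \<in> linear_maps \<Z> M1 M2" "g \<in> linear_maps \<Z> M2 M3"
    and "u \<in> carrier (tensor \<Z> M1 N)"
  shows "tm M3 g (tm M2 f u) = tm M3 (\<lambda>x. g (f x)) u"
  using tensor_map_comp[OF assms(1) N assms(2) N assms(3) N assms(4) lin_id assms(5) lin_id assms(6)] .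

private lemma r_in_ker: "m \<in> carrier M \<Longrightarrow> \<pi> (r m) = \<zero>\<^bsub>C\<^esub>"
  using \<pi>_ker by (auto simp: set_eq_iff)

text \<open>The values lie in the kernel \<open>K\<close> because \<open>\<epsilon>\<close> after
  \<open>\<psi>\<close> is \<open>\<pi>\<close>, and \<open>\<pi>\<close> kills the image of
  \<open>r\<close>.\<close>

lemma connecting_lin: "\<kappa> \<in> linear_maps \<Z> M K"
  unfolding K_eq using lin_closed[OF \<psi>] lin_closed[OF r] r_in_ker \<epsilon>\<psi>
  by (intro lin_into_sub lin_comp[OF r \<psi>]) auto

private lemma \<phi>_K: "\<phi> \<in> linear_maps \<Z> K J"
proof -
  have "\<phi> y \<in> r ` carrier M" if "y \<in> carrier F" "\<epsilon> y = \<zero>\<^bsub>C\<^esub>" for y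
    using that lin_closed[OF \<phi>] \<pi>\<phi> by (auto simp flip: \<pi>_ker)
  then show ?thesis
    unfolding K_eq by (intro lin_into_sub lin_from_sub[OF \<phi>]) auto
qed

private lemma r_J: "r \<in> linear_maps \<Z> M J"
  by (rule lin_into_sub[OF r]) simp

private lemma K_incl: "(\<lambda>x. x) \<in> linear_maps \<Z> K F"
  unfolding K_eq by (rule lin_id_sub) auto

private lemma Ker_incl: "(\<lambda>x. x) \<in> linear_maps \<Z> Ker M"
  by (rule lin_id_sub) auto

text \<open>\<open>\<phi>\<close> after \<open>\<psi>\<close> and the identity of \<open>P\<close>
  both lift the identity of \<open>C\<close>, so their difference takes values in \<open>J\<close>,
  the kernel of \<open>\<pi>\<close>. Together with \<open>\<tau>\<close>, the same statement on the
  side of \<open>F\<close>, this is the homotopy by which the two resolutions of \<open>C\<close>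
  have the same homology after tensoring.\<close>

private lemma \<sigma>: "(\<lambda>x. \<phi> (\<psi> x) \<ominus>\<^bsub>P\<^esub> x) \<in> linear_maps \<Z> P J"
proof (rule lin_into_sub[OF lin_diff_map[OF P lin_comp[OF \<psi> \<phi>] lin_id]])
  fix x assume x: "x \<in> carrier P"
  then show "\<phi> (\<psi> x) \<ominus>\<^bsub>P\<^esub> x \<in> r ` carrier M"
    using lin_closed[OF \<psi>] lin_closed[OF \<phi>] lin_closed[OF \<pi>]
    by (simp flip: \<pi>_ker add: lin_diff[OF \<pi> P C] \<pi>\<phi> \<epsilon>\<psi> C.r_neg a_minus_def[of C])
qed

private lemma \<tau>: "(\<lambda>y. \<psi> (\<phi> y) \<ominus>\<^bsub>F\<^esub> y) \<in> linear_maps \<Z> F K"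
  unfolding K_eq
proof (rule lin_into_sub[OF lin_diff_map[OF F lin_comp[OF \<phi> \<psi>] lin_id]])
  fix y assume y: "y \<in> carrier F"
  then show "\<psi> (\<phi> y) \<ominus>\<^bsub>F\<^esub> y \<in> {y \<in> carrier F. \<epsilon> y = \<zero>\<^bsub>C\<^esub>}"
    using lin_closed[OF \<psi>] lin_closed[OF \<phi>] lin_closed[OF \<epsilon>]
    by (simp add: lin_diff[OF \<epsilon> F C] \<pi>\<phi> \<epsilon>\<psi> C.r_neg a_minus_def[of C])
qed

private lemma \<rho>: "(\<lambda>m. m \<ominus>\<^bsub>M\<^esub> s (r m)) \<in> linear_maps \<Z> M Ker"
proof (rule lin_into_sub[OF lin_diff_map[OF M lin_id lin_comp[OF r_J s]]])
  fix m assume m: "m \<in> carrier M"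
  moreover have "s (r m) \<in> carrier M" using lin_closed[OF s, of "r m"] m by simp
  ultimately show "m \<ominus>\<^bsub>M\<^esub> s (r m) \<in> {m \<in> carrier M. r m = (\<lambda>_. 0)}"
    using rs[of "r m"] lin_closed[OF r m] P.r_neg[of "r m"] by (simp add: lin_diff[OF r M P] a_minus_def[of P])
qed

text \<open>On \<open>Ker\<close> the map \<open>r\<close> is zero, so \<open>m - s (r m)\<close> is
  a left inverse of the inclusion. Left inverses survive tensoring with any
  \<open>N\<close>.\<close>

lemma Ker_tensor_inj: "inj_on (tm M (\<lambda>x. x)) (carrier (tensor \<Z> Ker N))"
proof (rule inj_on_inverseI)
  fix u assume u: "u \<in> carrier (tensor \<Z> Ker N)"
  have s0: "s (\<lambda>_. 0) = \<zero>\<^bsub>M\<^esub>" using lin_zero[OF s J M] by simp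
  have "tm Ker (\<lambda>m. m \<ominus>\<^bsub>M\<^esub> s (r m)) (tm M (\<lambda>x. x) u) = tm Ker (\<lambda>m. m \<ominus>\<^bsub>M\<^esub> s (r m)) u"
    by (rule tm_comp[OF Ker M Ker Ker_incl \<rho> u])
  also have "\<dots> = tm Ker (\<lambda>m. m) u"
    by (rule tensor_map_cong[OF Ker N Ker N lin_id lin_id _ refl u])
      (auto simp: s0 a_minus_def M.minus_equality[of "\<zero>\<^bsub>M\<^esub>" "\<zero>\<^bsub>M\<^esub>"])
  also have "\<dots> = u" by (rule tensor_map_id[OF Ker N u])
  finally show "tm Ker (\<lambda>m. m \<ominus>\<^bsub>M\<^esub> s (r m)) (tm M (\<lambda>x. x) u) = u" .
qed

lemma Ker_tensor_null:
  assumes u: "u \<in> carrier (tensor \<Z> Ker N)"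
  shows "tm P r (tm M (\<lambda>x. x) u) = \<zero>\<^bsub>tensor \<Z> P N\<^esub>" "tm K \<kappa> (tm M (\<lambda>x. x) u) = \<zero>\<^bsub>tensor \<Z> K N\<^esub>"
proof -
  have z: "\<psi> (\<lambda>_. 0) = \<zero>\<^bsub>K\<^esub>" using lin_zero[OF \<psi> P F] by (simp add: K_eq)
  have "tm P r (tm M (\<lambda>x. x) u) = tm P r u" by (rule tm_comp[OF Ker M P Ker_incl r u])
  also have "\<dots> = tm P (\<lambda>_. \<zero>\<^bsub>P\<^esub>) u"
    by (rule tensor_map_cong[OF Ker N P N lin_zero_map[OF P] lin_id _ refl u]) auto
  also have "\<dots> = \<zero>\<^bsub>tensor \<Z> P N\<^esub>" by (rule tensor_map_zero[OF Ker N P N lin_id u])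
  finally show "tm P r (tm M (\<lambda>x. x) u) = \<zero>\<^bsub>tensor \<Z> P N\<^esub>" .
  have "tm K \<kappa> (tm M (\<lambda>x. x) u) = tm K \<kappa> u" by (rule tm_comp[OF Ker M K Ker_incl connecting_lin u])
  also have "\<dots> = tm K (\<lambda>_. \<zero>\<^bsub>K\<^esub>) u"
    by (rule tensor_map_cong[OF Ker N K N lin_zero_map[OF K] lin_id _ refl u]) (auto simp: z)
  also have "\<dots> = \<zero>\<^bsub>tensor \<Z> K N\<^esub>" by (rule tensor_map_zero[OF Ker N K N lin_id u])
  finally show "tm K \<kappa> (tm M (\<lambda>x. x) u) = \<zero>\<^bsub>tensor \<Z> K N\<^esub>" .
qed

text \<open>Read inside \<open>F\<close>, the map \<open>\<kappa>\<close> is \<open>\<psi>\<close>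
  after \<open>r\<close>, so it vanishes on \<open>u\<close> together with \<open>r\<close>. The
  values of \<open>\<kappa>\<close> then lie in the kernel of \<open>K \<otimes> N\<close> mapping
  to \<open>F \<otimes> N\<close>, which is how \<open>Tor1\<close> is defined.\<close>

lemma connecting_in_Tor1:
  assumes u: "u \<in> carrier (tensor \<Z> M N)" and z: "tm P r u = \<zero>\<^bsub>tensor \<Z> P N\<^esub>"
  shows "tm F (\<lambda>x. x) (tm K \<kappa> u) = \<zero>\<^bsub>tensor \<Z> F N\<^esub>"
proof -
  have "tm F (\<lambda>x. x) (tm K \<kappa> u) = tm F \<psi> (tm P r u)"
    by (simp add: tm_comp[OF M K F connecting_lin K_incl u] tm_comp[OF M P F r \<psi> u])
  then show ?thesis
    by (simp add: z tensor_map_at_zero[OF P N F N \<psi> lin_id])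
qed

text \<open>As a map into \<open>J\<close>, \<open>r\<close> equals \<open>\<phi> \<kappa>\<close>
  minus \<open>\<sigma> r\<close>. On \<open>u\<close> the first term vanishes with
  \<open>\<kappa>\<close>, and the second because it factors through \<open>P\<close>, where
  \<open>r\<close> already vanishes. So \<open>r\<close> kills \<open>u\<close> in
  \<open>J \<otimes> N\<close> itself, and the splitting applies.\<close>

lemma connecting_zero:
  assumes u: "u \<in> carrier (tensor \<Z> M N)" and z: "tm P r u = \<zero>\<^bsub>tensor \<Z> P N\<^esub>"
    and "tm K \<kappa> u = \<zero>\<^bsub>tensor \<Z> K N\<^esub>"
  shows "u \<in> tm M (\<lambda>x. x) ` carrier (tensor \<Z> Ker N)"
proof (rule image_Ker_tensorI[OF M r s rs N u])
  interpret T: module \<Z> "tensor \<Z> J N" by (rule tensor_module[OF J N])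
  let ?\<sigma> = "\<lambda>x. \<phi> (\<psi> x) \<ominus>\<^bsub>P\<^esub> x"
  have "tm J (\<lambda>m. \<phi> (\<kappa> m)) u = tm J \<phi> (tm K \<kappa> u)" by (rule tm_comp[OF M K J connecting_lin \<phi>_K u, symmetric])
  also have "\<dots> = \<zero>\<^bsub>tensor \<Z> J N\<^esub>"
    by (simp add: assms(3) tensor_map_at_zero[OF K N J N \<phi>_K lin_id])
  finally have 1: "tm J (\<lambda>m. \<phi> (\<kappa> m)) u = \<zero>\<^bsub>tensor \<Z> J N\<^esub>" .
  have "tm J (\<lambda>m. ?\<sigma> (r m)) u = tm J ?\<sigma> (tm P r u)" by (rule tm_comp[OF M P J r \<sigma> u, symmetric])
  also have "\<dots> = \<zero>\<^bsub>tensor \<Z> J N\<^esub>"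
    by (simp add: z tensor_map_at_zero[OF P N J N \<sigma> lin_id])
  finally have 2: "tm J (\<lambda>m. ?\<sigma> (r m)) u = \<zero>\<^bsub>tensor \<Z> J N\<^esub>" .
  have "tm J (\<lambda>m. \<phi> (\<kappa> m)) u = tm J (\<lambda>m. ?\<sigma> (r m) \<oplus>\<^bsub>J\<^esub> r m) u"
  proof (rule tensor_map_cong[OF M N J N lin_sum[OF J lin_comp[OF r \<sigma>] r_J] lin_id _ refl u])
    fix m assume "m \<in> carrier M"
    then have c: "r m \<in> carrier P" "\<phi> (\<psi> (r m)) \<in> carrier P"
      using lin_closed[OF r] lin_closed[OF \<psi>] lin_closed[OF \<phi>] by blast+
    then have "(\<phi> (\<psi> (r m)) \<ominus>\<^bsub>P\<^esub> r m) \<oplus>\<^bsub>P\<^esub> r m = \<phi> (\<psi> (r m))"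
      by (simp only: a_minus_def P.a_assoc P.l_neg P.a_inv_closed P.r_zero)
    then show "\<phi> (\<kappa> m) = ?\<sigma> (r m) \<oplus>\<^bsub>J\<^esub> r m" by simp
  qed
  also have "\<dots> = tm J (\<lambda>m. ?\<sigma> (r m)) u \<oplus>\<^bsub>tensor \<Z> J N\<^esub> tm J r u"
    by (rule tensor_map_sum[OF M N J N lin_comp[OF r \<sigma>] r_J lin_id u])
  finally show "tm J r u = \<zero>\<^bsub>tensor \<Z> J N\<^esub>"
    using lin_closed[OF tensor_map_lin[OF M N J N r_J lin_id] u] by (simp add: 1 2)
qed

text \<open>The preimage of \<open>z\<close> is \<open>s (\<phi> z)\<close>. Applying
  \<open>r\<close> gives \<open>\<phi> z\<close>, which is zero since \<open>\<phi>\<close> factors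
  through \<open>F\<close>; applying \<open>\<kappa>\<close> gives \<open>\<psi> (\<phi> z)\<close>,
  which is \<open>\<tau> z\<close> plus \<open>z\<close>, and \<open>\<tau>\<close> factors through
  \<open>F\<close> as well.\<close>

lemma connecting_onto:
  assumes z: "z \<in> carrier (tensor \<Z> K N)" and "tm F (\<lambda>x. x) z = \<zero>\<^bsub>tensor \<Z> F N\<^esub>"
  shows "\<exists>u \<in> carrier (tensor \<Z> M N). tm P r u = \<zero>\<^bsub>tensor \<Z> P N\<^esub> \<and> tm K \<kappa> u = z"
proof (intro bexI conjI)
  interpret T: module \<Z> "tensor \<Z> K N" by (rule tensor_module[OF K N])
  let ?u = "tm M (\<lambda>y. s (\<phi> y)) z"
  let ?\<tau> = "\<lambda>y. \<psi> (\<phi> y) \<ominus>\<^bsub>F\<^esub> y"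
  note s\<phi> = lin_comp[OF \<phi>_K s]
  have rs\<phi>: "r (s (\<phi> y)) = \<phi> y" if "y \<in> carrier K" for y
    using rs lin_closed[OF \<phi>_K that] by simp
  show "?u \<in> carrier (tensor \<Z> M N)"
    by (rule lin_closed[OF tensor_map_lin[OF K N M N s\<phi> lin_id] z])
  have "tm P r ?u = tm P (\<lambda>y. r (s (\<phi> y))) z" by (rule tm_comp[OF K M P s\<phi> r z])
  also have "\<dots> = tm P \<phi> z"
    by (rule tensor_map_cong[OF K N P N lin_comp[OF K_incl \<phi>] lin_id rs\<phi> refl z])
  also have "\<dots> = tm P \<phi> (tm F (\<lambda>x. x) z)" by (rule tm_comp[OF K F P K_incl \<phi> z, symmetric])
  also have "\<dots> = \<zero>\<^bsub>tensor \<Z> P N\<^esub>"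
    by (simp add: assms(2) tensor_map_at_zero[OF F N P N \<phi> lin_id])
  finally show "tm P r ?u = \<zero>\<^bsub>tensor \<Z> P N\<^esub>" .
  have "tm K ?\<tau> z = tm K ?\<tau> (tm F (\<lambda>x. x) z)" by (rule tm_comp[OF K F K K_incl \<tau> z, symmetric])
  also have "\<dots> = \<zero>\<^bsub>tensor \<Z> K N\<^esub>"
    by (simp add: assms(2) tensor_map_at_zero[OF F N K N \<tau> lin_id])
  finally have 1: "tm K ?\<tau> z = \<zero>\<^bsub>tensor \<Z> K N\<^esub>" .
  have "tm K \<kappa> ?u = tm K (\<lambda>y. \<psi> (r (s (\<phi> y)))) z" by (rule tm_comp[OF K M K s\<phi> connecting_lin z])
  also have "\<dots> = tm K (\<lambda>y. ?\<tau> y \<oplus>\<^bsub>K\<^esub> y) z"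
  proof (rule tensor_map_cong[OF K N K N lin_sum[OF K lin_comp[OF K_incl \<tau>] lin_id] lin_id _ refl z])
    fix y assume y: "y \<in> carrier K"
    then have y': "y \<in> carrier F" by (simp add: K_eq)
    then have c: "y \<in> carrier F" "\<psi> (\<phi> y) \<in> carrier F"
      using lin_closed[OF \<psi>] lin_closed[OF \<phi>] by blast+
    then have "(\<psi> (\<phi> y) \<ominus>\<^bsub>F\<^esub> y) \<oplus>\<^bsub>F\<^esub> y = \<psi> (\<phi> y)"
      by (simp only: a_minus_def F.a_assoc F.l_neg F.a_inv_closed F.r_zero)
    then show "\<psi> (r (s (\<phi> y))) = ?\<tau> y \<oplus>\<^bsub>K\<^esub> y" by (simp add: K_eq rs\<phi>[OF y])
  qed
  also have "\<dots> = tm K ?\<tau> z \<oplus>\<^bsub>tensor \<Z> K N\<^esub> tm K (\<lambda>y. y) z"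
    by (rule tensor_map_sum[OF K N K N lin_comp[OF K_incl \<tau>] lin_id lin_id z])
  also have "\<dots> = z" by (simp add: 1 tensor_map_id[OF K N z] z)
  finally show "tm K \<kappa> ?u = z" .
qed

end
end

text \<open>Flatness makes \<open>J \<otimes> N\<close> a subgroup of the tensor product of
  \<open>N\<close> with the free module, so vanishing there gives vanishing in
  \<open>J \<otimes> N\<close>, and the splitting finishes. The index set consists of naturals so
  that both modules have the element type on which \<open>flat_module\<close> tests
  injections.\<close>

lemma flat_image_Ker_tensor:
  fixes M :: "(int, 'm) module" and k :: nat and N :: "(int, 'n) module"
  assumes M: "module \<Z> M" and r: "r \<in> linear_maps \<Z> M (free_module \<Z> {..<k})" and N: "flat_module \<Z> N"
    and u: "u \<in> carrier (tensor \<Z> M N)"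
    and z: "tensor_map \<Z> (free_module \<Z> {..<k}) N r (\<lambda>n. n) u = \<zero>\<^bsub>tensor \<Z> (free_module \<Z> {..<k}) N\<^esub>"
  shows "u \<in> tensor_map \<Z> M N (\<lambda>x. x) (\<lambda>n. n) ` carrier (tensor \<Z> (M\<lparr>carrier := {m \<in> carrier M. r m = (\<lambda>_. 0)}\<rparr>) N)"
proof -
  let ?P = "free_module \<Z> {..<k}"
  let ?J = "?P\<lparr>carrier := r ` carrier M\<rparr>"
  have NZ: "module \<Z> N" using N by (simp add: flat_module_def)
  have P: "module \<Z> ?P" by (rule free_module[OF int_is_cring])
  have sub: "submodule (r ` carrier M) \<Z> ?P" by (rule submodule_image[OF r M P])
  have J: "module \<Z> ?J" by (rule module_carrier_update[OF P sub])
  have incl: "(\<lambda>x. x) \<in> linear_maps \<Z> ?J ?P" by (rule lin_id_sub[OF submodule_mem(4)[OF sub]])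
  have rJ: "r \<in> linear_maps \<Z> M ?J" by (rule lin_into_sub[OF r]) simp
  note t = tensor_map_lin[OF J NZ P NZ incl lin_id]
  interpret T: module \<Z> "tensor \<Z> ?J N" by (rule tensor_module[OF J NZ])
  have "tensor_map \<Z> ?P N (\<lambda>x. x) (\<lambda>n. n) (tensor_map \<Z> ?J N r (\<lambda>n. n) u) = \<zero>\<^bsub>tensor \<Z> ?P N\<^esub>"
    using tensor_map_comp[OF M NZ J NZ P NZ rJ lin_id incl lin_id u] z by simp
  also have "\<dots> = tensor_map \<Z> ?P N (\<lambda>x. x) (\<lambda>n. n) \<zero>\<^bsub>tensor \<Z> ?J N\<^esub>"
    by (rule lin_zero[OF t tensor_module[OF J NZ] tensor_module[OF P NZ], symmetric])
  finally have eq: "tensor_map \<Z> ?P N (\<lambda>x. x) (\<lambda>n. n) (tensor_map \<Z> ?J N r (\<lambda>n. n) u) =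
    tensor_map \<Z> ?P N (\<lambda>x. x) (\<lambda>n. n) \<zero>\<^bsub>tensor \<Z> ?J N\<^esub>" .
  have "inj_on (tensor_map \<Z> ?P N (\<lambda>x. x) (\<lambda>n. n)) (carrier (tensor \<Z> ?J N))"
    using N J P incl unfolding flat_module_def by (metis inj_on_id2)
  then have z': "tensor_map \<Z> ?J N r (\<lambda>n. n) u = \<zero>\<^bsub>tensor \<Z> ?J N\<^esub>"
    using eq lin_closed[OF tensor_map_lin[OF M NZ J NZ rJ lin_id] u] by (auto dest: inj_onD)
  obtain s where s: "s \<in> linear_maps \<Z> ?J M" "\<And>x. x \<in> r ` carrier M \<Longrightarrow> r (s x) = x"
    using finite_free_int_section[OF finite_lessThan M r] by auto
  show ?thesis by (rule image_Ker_tensorI[OF M r s NZ u z'])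
qed

text \<open>The version of \<open>tensor_lift_lin_param\<close> for four factors. It is needed
  because \<open>op_mult\<close> nests one fourfold lift inside another.\<close>

lemma tensor_lift4_lin_param:
  assumes A: "module R A" and B: "module R B" and C: "module R C" and D: "module R D"
    and L: "module R L" and P: "module R P"
    and f: "\<And>l. l \<in> carrier L \<Longrightarrow> quadrilinear_map R A B C D P (\<lambda>a b c d. f a b c d l)"
    and fl: "\<And>a b c d. a \<in> carrier A \<Longrightarrow> b \<in> carrier B \<Longrightarrow> c \<in> carrier C \<Longrightarrow> d \<in> carrier D \<Longrightarrow>
      (\<lambda>l. f a b c d l) \<in> linear_maps R L P"
    and u: "u \<in> carrier (tensor4 R A B C D)"
  shows "(\<lambda>l. tensor_lift4 R P (\<lambda>a b c d. f a b c d l) u) \<in> linear_maps R L P"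
  using u
proof (induction rule: tensor4_induct[OF A B C D, consumes 1, case_names pure add])
  case (pure a b c d)
  show ?case
    by (rule lin_cong[OF fl[OF pure] _ L]) (simp add: tensor_lift4_pure[OF A B C D P f] pure)
next
  case (add u v)
  show ?case
    by (rule lin_cong[OF lin_sum[OF P add(3,4)] _ L]) (simp add: lin_add[OF tensor_lift4_lin[OF A B C D P f]] add)
qed


section \<open>The operator rng of a two-step system\<close>

lemma two_step_simps [simp]:
  "space (two_step R E W \<mu>) = direct_sum E W" "params (two_step R E W \<mu>) = regular_module R"
  by (simp_all add: two_step_def)

context
  fixes R :: "('r, 'x) ring_scheme" and E :: "('r, 'e) module" and W :: "('r, 'w) module"
    and \<mu> :: "('r, 'e) cube \<Rightarrow> 'w"
  assumes E: "module R E" and W: "module R W" and \<mu>: "\<mu> \<in> linear_maps R (tensor3 R E E E) W"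
begin

interpretation E: module R E by (rule E)
interpretation W: module R W by (rule W)

private abbreviation (input) "A \<equiv> two_step R E W \<mu>"
private abbreviation (input) "T \<equiv> direct_sum E W"
private abbreviation (input) "G \<equiv> regular_module R"
private abbreviation (input) "X \<equiv> tensor4 R T G T G"

private lemma T: "module R T" by (rule direct_sum_module[OF E W])
private lemma G: "module R G" by (rule regular_module[OF E.R.is_cring])
private lemma X: "module R X" by (rule tensor4_module[OF T G T G])

interpretation T: module R T by (rule T)
interpretation X: module R X by (rule X)

lemma tri_trilinear: "trilinear_map R E E E W (tri R E \<mu>)"
  unfolding tri_def
  by (intro trilinear_mapI lin_comp[OF trilin_1[OF pure3_trilinear[OF E E E]] \<mu>]
    lin_comp[OF trilin_2[OF pure3_trilinear[OF E E E]] \<mu>] lin_comp[OF trilin_3[OF pure3_trilinear[OF E E E]] \<mu>])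

lemmas tri_closed = trilin_closed[OF tri_trilinear]

lemma tri_zero:
  "y \<in> carrier E \<Longrightarrow> z \<in> carrier E \<Longrightarrow> tri R E \<mu> \<zero>\<^bsub>E\<^esub> y z = \<zero>\<^bsub>W\<^esub>"
  "x \<in> carrier E \<Longrightarrow> z \<in> carrier E \<Longrightarrow> tri R E \<mu> x \<zero>\<^bsub>E\<^esub> z = \<zero>\<^bsub>W\<^esub>"
  "x \<in> carrier E \<Longrightarrow> y \<in> carrier E \<Longrightarrow> tri R E \<mu> x y \<zero>\<^bsub>E\<^esub> = \<zero>\<^bsub>W\<^esub>"
  using lin_zero[OF trilin_1[OF tri_trilinear] E W] lin_zero[OF trilin_2[OF tri_trilinear] E W]
    lin_zero[OF trilin_3[OF tri_trilinear] E W] by auto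

lemma tprod_eq: "tprod A p n q m r = (\<zero>\<^bsub>E\<^esub>, (n \<otimes>\<^bsub>R\<^esub> m) \<odot>\<^bsub>W\<^esub> tri R E \<mu> (fst p) (fst q) (fst r))"
  by (simp add: two_step_def)

private lemma T_fst: "p \<in> carrier T \<Longrightarrow> fst p \<in> carrier E"
  by auto

lemma tprod_closed:
  assumes "p \<in> carrier T" "n \<in> carrier G" "q \<in> carrier T" "m \<in> carrier G" "r \<in> carrier T"
  shows "tprod A p n q m r \<in> carrier T"
  using assms by (auto simp: tprod_eq tri_closed)

lemma
  assumes "n \<in> carrier G" "m \<in> carrier G"
  shows tprod_lin_1: "q \<in> carrier T \<Longrightarrow> r \<in> carrier T \<Longrightarrow> (\<lambda>p. tprod A p n q m r) \<in> linear_maps R T T"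
    and tprod_lin_3: "p \<in> carrier T \<Longrightarrow> r \<in> carrier T \<Longrightarrow> (\<lambda>q. tprod A p n q m r) \<in> linear_maps R T T"
    and tprod_lin_5: "p \<in> carrier T \<Longrightarrow> q \<in> carrier T \<Longrightarrow> (\<lambda>r. tprod A p n q m r) \<in> linear_maps R T T"
  unfolding tprod_eq using assms
  by (intro lin_comp[OF lin_scale[OF W lin_comp[OF direct_sum_proj(1)]] direct_sum_inj(2)[OF E W]]
      trilin_1[OF tri_trilinear] trilin_2[OF tri_trilinear] trilin_3[OF tri_trilinear] T_fst; simp)+

lemma
  assumes "p \<in> carrier T" "q \<in> carrier T" "r \<in> carrier T"
  shows tprod_lin_2: "m \<in> carrier G \<Longrightarrow> (\<lambda>n. tprod A p n q m r) \<in> linear_maps R G T"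
    and tprod_lin_4: "n \<in> carrier G \<Longrightarrow> (\<lambda>m. tprod A p n q m r) \<in> linear_maps R G T"
  unfolding tprod_eq using tri_closed[OF assms[THEN T_fst]]
  by (auto intro!: linear_mapsI simp: E.R.l_distr E.R.r_distr W.smult_l_distr E.R.m_ac simp flip: W.smult_assoc1)

text \<open>A product sees only the \<open>E\<close>-components of its factors, and by
  \<open>fst_tprod\<close> its own \<open>E\<close>-component is zero. Hence every nested product
  vanishes, which is the computational core of all that follows on two-step systems.\<close>

lemma tprod_fst_zero:
  assumes "p \<in> carrier T" "n \<in> carrier G" "q \<in> carrier T" "m \<in> carrier G" "r \<in> carrier T"
    and "fst p = \<zero>\<^bsub>E\<^esub> \<or> fst q = \<zero>\<^bsub>E\<^esub> \<or> fst r = \<zero>\<^bsub>E\<^esub>"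
  shows "tprod A p n q m r = \<zero>\<^bsub>T\<^esub>"
  using assms T_fst[OF assms(1)] T_fst[OF assms(3)] T_fst[OF assms(5)] by (auto simp: tprod_eq tri_zero)

lemma fst_tprod: "fst (tprod A p n q m r) = \<zero>\<^bsub>E\<^esub>"
  by (simp add: tprod_eq)

private abbreviation (input) "opp \<equiv> pure4 R T G T G"

lemma opp_quadrilinear: "quadrilinear_map R T G T G X opp"
  by (rule pure4_quadrilinear[OF T G T G])

lemma opp_zero:
  "b \<in> carrier T \<Longrightarrow> \<alpha> \<in> carrier G \<Longrightarrow> \<beta> \<in> carrier G \<Longrightarrow> opp \<zero>\<^bsub>T\<^esub> \<alpha> b \<beta> = \<zero>\<^bsub>X\<^esub>"
  "a \<in> carrier T \<Longrightarrow> \<alpha> \<in> carrier G \<Longrightarrow> \<beta> \<in> carrier G \<Longrightarrow> opp a \<alpha> \<zero>\<^bsub>T\<^esub> \<beta> = \<zero>\<^bsub>X\<^esub>"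
  using lin_zero[OF quadrilin_1[OF opp_quadrilinear] T X] lin_zero[OF quadrilin_3[OF opp_quadrilinear] T X]
  by blast+

lemma op_alg_simps [simp]:
  "carrier (op_alg R A) = carrier X" "\<zero>\<^bsub>op_alg R A\<^esub> = \<zero>\<^bsub>X\<^esub>"
  "x \<oplus>\<^bsub>op_alg R A\<^esub> y = x \<oplus>\<^bsub>X\<^esub> y" "r \<odot>\<^bsub>op_alg R A\<^esub> x = r \<odot>\<^bsub>X\<^esub> x"
  "x \<ominus>\<^bsub>op_alg R A\<^esub> y = x \<ominus>\<^bsub>X\<^esub> y" "x \<otimes>\<^bsub>op_alg R A\<^esub> y = op_mult R A x y"
  by (simp_all add: op_alg_def a_minus_def a_inv_def)

lemma op_alg_module: "module R (op_alg R A)"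
  by (rule moduleI[OF E.R.is_cring])
    (auto intro!: abelian_groupI intro: bexI[of _ "\<ominus>\<^bsub>X\<^esub> _"] simp: X.a_ac X.l_neg X.smult_l_distr X.smult_r_distr X.smult_assoc1)

lemma op_mult_inner:
  assumes "a \<in> carrier T" "\<alpha> \<in> carrier G" "b \<in> carrier T" "\<beta> \<in> carrier G"
  shows "quadrilinear_map R T G T G X (\<lambda>c \<gamma> d \<delta>. opp (tprod A a \<alpha> b \<beta> c) \<gamma> d \<delta>)"
  using assms
  by (intro quadrilinear_mapI lin_comp[OF tprod_lin_5 quadrilin_1[OF opp_quadrilinear]]
    quadrilin_2[OF opp_quadrilinear] quadrilin_3[OF opp_quadrilinear] quadrilin_4[OF opp_quadrilinear] tprod_closed)

lemma op_mult_outer: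
  assumes "y \<in> carrier X"
  shows "quadrilinear_map R T G T G X
    (\<lambda>a \<alpha> b \<beta>. tensor_lift4 R X (\<lambda>c \<gamma> d \<delta>. opp (tprod A a \<alpha> b \<beta> c) \<gamma> d \<delta>) y)"
  by (intro quadrilinear_mapI tensor_lift4_lin_param[OF T G T G _ X _ _ assms] T G op_mult_inner
    lin_comp[OF tprod_lin_1 quadrilin_1[OF opp_quadrilinear]] lin_comp[OF tprod_lin_2 quadrilin_1[OF opp_quadrilinear]]
    lin_comp[OF tprod_lin_3 quadrilin_1[OF opp_quadrilinear]] lin_comp[OF tprod_lin_4 quadrilin_1[OF opp_quadrilinear]])

lemma op_mult_eq: "op_mult R A x y = tensor_lift4 R X (\<lambda>a \<alpha> b \<beta>.
    tensor_lift4 R X (\<lambda>c \<gamma> d \<delta>. opp (tprod A a \<alpha> b \<beta> c) \<gamma> d \<delta>) y) x"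
  by (simp add: op_mult_def Let_def op_pure_def)

text \<open>Linearity in the left factor is that of the outer lift. In the right factor it is the
  dependence of the outer lift on a parameter, the inner lift being linear in it.\<close>

lemma op_mult_bilinear: "bilinear_map R X X X (op_mult R A)"
  unfolding op_mult_eq
  by (intro bilinear_mapI tensor_lift4_lin[OF T G T G X] op_mult_outer
    tensor_lift4_lin_param[OF T G T G X X] op_mult_inner)

lemma op_mult_pure:
  assumes "a \<in> carrier T" "\<alpha> \<in> carrier G" "b \<in> carrier T" "\<beta> \<in> carrier G"
    and "c \<in> carrier T" "\<gamma> \<in> carrier G" "d \<in> carrier T" "\<delta> \<in> carrier G"
  shows "op_mult R A (opp a \<alpha> b \<beta>) (opp c \<gamma> d \<delta>) = opp (tprod A a \<alpha> b \<beta> c) \<gamma> d \<delta>"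
  using assms quadrilin_closed[OF opp_quadrilinear assms(5-8)]
  by (simp add: op_mult_eq tensor_lift4_pure[OF T G T G X op_mult_outer] tensor_lift4_pure[OF T G T G X op_mult_inner])

lemma op_rels_eq:
  "op_rels R A = {opp (tprod A a \<alpha> b \<beta> c) \<gamma> d \<delta> \<ominus>\<^bsub>X\<^esub> opp a \<alpha> (tprod A b \<beta> c \<gamma> d) \<delta> | a \<alpha> b \<beta> c \<gamma> d \<delta>.
     {a, b, c, d} \<subseteq> carrier T \<and> {\<alpha>, \<beta>, \<gamma>, \<delta>} \<subseteq> carrier G}"
  unfolding op_rels_def op_pure_def op_alg_simps two_step_simps by simp

lemma op_relsE:
  assumes "u \<in> op_rels R A"
  obtains a \<alpha> b \<beta> c \<gamma> d \<delta> where "a \<in> carrier T" "b \<in> carrier T" "c \<in> carrier T" "d \<in> carrier T"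
    "\<alpha> \<in> carrier G" "\<beta> \<in> carrier G" "\<gamma> \<in> carrier G" "\<delta> \<in> carrier G"
    "u = opp (tprod A a \<alpha> b \<beta> c) \<gamma> d \<delta> \<ominus>\<^bsub>X\<^esub> opp a \<alpha> (tprod A b \<beta> c \<gamma> d) \<delta>"
  using assms unfolding op_rels_eq mem_Collect_eq insert_subset by (elim exE conjE) (rule that)

lemma op_rels_subset: "op_rels R A \<subseteq> carrier X"
  unfolding op_rels_eq
  by (auto intro!: X.minus_closed quadrilin_closed[OF opp_quadrilinear] tprod_closed)

text \<open>A product that involves a generator of the ideal lands in \<open>W \<otimes> W\<close>, which the generators
  span already; hence the two-sided ideal is just the submodule spanned by the generators.\<close>

lemma op_ideal_eq: "op_ideal R A = (\<lambda>I. submodule I R (op_alg R A)) hull op_rels R A" (is "_ = ?N")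
proof
  let ?Q = "\<lambda>I. submodule I R (op_alg R A) \<and>
    (\<forall>x\<in>I. \<forall>y\<in>carrier (op_alg R A). x \<otimes>\<^bsub>op_alg R A\<^esub> y \<in> I \<and> y \<otimes>\<^bsub>op_alg R A\<^esub> x \<in> I)"
  have eq: "op_ideal R A = ?Q hull op_rels R A" by (simp only: op_ideal_def)
  have N: "submodule ?N R (op_alg R A)"
    by (rule submodule_hull[OF op_alg_module]) (simp add: op_rels_subset)
  note N' = submodule_mem[OF N, unfolded op_alg_simps]
  show "?N \<subseteq> op_ideal R A" unfolding eq by (rule hull_antimono) simp
  \<comment> \<open>\<open>op_alg\<close> differs from the tensor module only in its multiplication,
    which submodules do not see.\<close>
  have NX: "submodule I R (op_alg R A) \<longleftrightarrow> submodule I R X" for I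
    by (simp add: submodule_def subgroup_def submodule_axioms_def op_alg_def m_inv_def)
  \<comment> \<open>As a left factor, the span acts by zero: in both terms of a generator one of the
    two space entries is itself a product, and the multiplication forms a further product from
    it.\<close>
  have left: "op_mult R A x y = \<zero>\<^bsub>X\<^esub>" if x: "x \<in> ?N" and y: "y \<in> carrier X" for x y
  proof -
    have lin: "(\<lambda>x. op_mult R A x y) \<in> linear_maps R X X" by (rule bilin_left[OF op_mult_bilinear y])
    have z: "op_mult R A (opp a \<alpha> b \<beta>) y = \<zero>\<^bsub>X\<^esub>"
      if ab: "a \<in> carrier T" "\<alpha> \<in> carrier G" "b \<in> carrier T" "\<beta> \<in> carrier G" "fst a = \<zero>\<^bsub>E\<^esub> \<or> fst b = \<zero>\<^bsub>E\<^esub>" for a \<alpha> b \<beta>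
      using y
    proof (induction rule: tensor4_induct[OF T G T G, consumes 1, case_names pure add])
      case (pure c \<gamma> d \<delta>)
      have "tprod A a \<alpha> b \<beta> c = \<zero>\<^bsub>T\<^esub>" by (rule tprod_fst_zero) (use ab pure in auto)
      then show ?case using pure by (simp only: op_mult_pure[OF ab(1-4) pure] opp_zero)
    next
      case (add u v)
      then show ?case
        by (simp add: lin_add[OF bilin_right[OF op_mult_bilinear quadrilin_closed[OF opp_quadrilinear ab(1-4)]]])
    qed
    have "op_rels R A \<subseteq> {x \<in> carrier X. op_mult R A x y = \<zero>\<^bsub>X\<^esub>}"
    proof
      fix u assume "u \<in> op_rels R A"
      obtain a \<alpha> b \<beta> c \<gamma> d \<delta> where m: "a \<in> carrier T" "b \<in> carrier T" "c \<in> carrier T" "d \<in> carrier T"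
          "\<alpha> \<in> carrier G" "\<beta> \<in> carrier G" "\<gamma> \<in> carrier G" "\<delta> \<in> carrier G"
        and u: "u = opp (tprod A a \<alpha> b \<beta> c) \<gamma> d \<delta> \<ominus>\<^bsub>X\<^esub> opp a \<alpha> (tprod A b \<beta> c \<gamma> d) \<delta>"
        using \<open>u \<in> op_rels R A\<close> by (rule op_relsE)
      note c = quadrilin_closed[OF opp_quadrilinear] tprod_closed m
      have "op_mult R A u y = op_mult R A (opp (tprod A a \<alpha> b \<beta> c) \<gamma> d \<delta>) y \<ominus>\<^bsub>X\<^esub>
          op_mult R A (opp a \<alpha> (tprod A b \<beta> c \<gamma> d) \<delta>) y"
        unfolding u by (rule lin_diff[OF lin X X]) (intro c)+
      also have "\<dots> = \<zero>\<^bsub>X\<^esub> \<ominus>\<^bsub>X\<^esub> \<zero>\<^bsub>X\<^esub>"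
        by (subst (1 2) z) (intro c fst_tprod disjI1 disjI2 refl)+
      also have "\<dots> = \<zero>\<^bsub>X\<^esub>" by (simp add: a_minus_def X.r_neg)
      finally show "u \<in> {x \<in> carrier X. op_mult R A x y = \<zero>\<^bsub>X\<^esub>}"
        using \<open>u \<in> op_rels R A\<close> op_rels_subset by auto
    qed
    then have "?N \<subseteq> {x \<in> carrier X. op_mult R A x y = \<zero>\<^bsub>X\<^esub>}"
      by (rule hull_minimal) (rule NX[THEN iffD2, OF submodule_kernel[OF lin X X]])
    then show ?thesis using x by blast
  qed
  have right: "op_mult R A y x \<in> ?N" if x: "x \<in> ?N" and y: "y \<in> carrier X" for x y
    using y
  proof (induction rule: tensor4_induct[OF T G T G, consumes 1, case_names pure add])
    case (pure p \<eta> q \<theta>)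
    have lin: "op_mult R A (opp p \<eta> q \<theta>) \<in> linear_maps R X X"
      by (rule bilin_right[OF op_mult_bilinear quadrilin_closed[OF opp_quadrilinear pure]])
    let ?S = "{x \<in> carrier X. op_mult R A (opp p \<eta> q \<theta>) x \<in> ?N}"
    have S: "submodule ?S R X"
      by (rule submoduleI'[OF X])
        (auto simp: lin_add[OF lin] lin_smult[OF lin] lin_zero[OF lin X X] intro: N')
    have "op_rels R A \<subseteq> ?S"
    proof
      fix u assume "u \<in> op_rels R A"
      obtain a \<alpha> b \<beta> c \<gamma> d \<delta> where m: "a \<in> carrier T" "b \<in> carrier T" "c \<in> carrier T" "d \<in> carrier T"
          "\<alpha> \<in> carrier G" "\<beta> \<in> carrier G" "\<gamma> \<in> carrier G" "\<delta> \<in> carrier G"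
        and u: "u = opp (tprod A a \<alpha> b \<beta> c) \<gamma> d \<delta> \<ominus>\<^bsub>X\<^esub> opp a \<alpha> (tprod A b \<beta> c \<gamma> d) \<delta>"
        using \<open>u \<in> op_rels R A\<close> by (rule op_relsE)
      note c = quadrilin_closed[OF opp_quadrilinear] tprod_closed m pure
      \<comment> \<open>Multiplying a generator from the left replaces \<open>a\<close> by
        \<open>?a\<close> in its second term and gives a nested product in its first. That product
        is zero, and so is the one that the generator for \<open>?a\<close>, \<open>b\<close>,
        \<open>c\<close>, \<open>d\<close> has in its place, so the result is again a
        generator.\<close>
      let ?a = "tprod A p \<eta> q \<theta> a"
      have z: "tprod A p \<eta> q \<theta> (tprod A a \<alpha> b \<beta> c) = \<zero>\<^bsub>T\<^esub>" "tprod A ?a \<alpha> b \<beta> c = \<zero>\<^bsub>T\<^esub>"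
        by (rule tprod_fst_zero; (intro c fst_tprod disjI1 disjI2 refl)?; simp add: fst_tprod)+
      have "op_mult R A (opp p \<eta> q \<theta>) u = op_mult R A (opp p \<eta> q \<theta>) (opp (tprod A a \<alpha> b \<beta> c) \<gamma> d \<delta>) \<ominus>\<^bsub>X\<^esub>
          op_mult R A (opp p \<eta> q \<theta>) (opp a \<alpha> (tprod A b \<beta> c \<gamma> d) \<delta>)"
        unfolding u by (rule lin_diff[OF lin X X]) (intro c)+
      also have "\<dots> = opp (tprod A p \<eta> q \<theta> (tprod A a \<alpha> b \<beta> c)) \<gamma> d \<delta> \<ominus>\<^bsub>X\<^esub> opp ?a \<alpha> (tprod A b \<beta> c \<gamma> d) \<delta>"
        by (subst (1 2) op_mult_pure) (intro c refl)+
      also have "\<dots> = opp (tprod A ?a \<alpha> b \<beta> c) \<gamma> d \<delta> \<ominus>\<^bsub>X\<^esub> opp ?a \<alpha> (tprod A b \<beta> c \<gamma> d) \<delta>"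
        by (simp only: z)
      also have "\<dots> \<in> op_rels R A"
        unfolding op_rels_eq using m tprod_closed[OF pure m(1)] by blast
      finally show "u \<in> ?S"
        using \<open>u \<in> op_rels R A\<close> op_rels_subset by (auto intro: hull_inc)
    qed
    then have "?N \<subseteq> ?S"
      by (rule hull_minimal) (rule NX[THEN iffD2, OF S])
    then show ?case using x by blast
  next
    case (add u v)
    moreover have "x \<in> carrier X" using x N'(4) by blast
    ultimately show ?case by (simp add: lin_add[OF bilin_left[OF op_mult_bilinear]] N')
  qed
  show "op_ideal R A \<subseteq> ?N"
    unfolding eq
  proof (rule hull_minimal)
    show "?Q ?N" unfolding op_alg_simps using N left right N'(1) by simp
  qed (rule hull_subset)
qed

lemma op_ideal_submodule: "submodule (op_ideal R A) R (op_alg R A)"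
  unfolding op_ideal_eq by (rule submodule_hull[OF op_alg_module]) (simp add: op_rels_subset)

lemma operator_rng_module: "module R (operator_rng R A)"
  unfolding operator_rng_def by (rule quot_module[OF op_alg_module op_ideal_submodule])

lemma op_proj_lin: "(\<lambda>x. op_ideal R A +>\<^bsub>op_alg R A\<^esub> x) \<in> linear_maps R X (operator_rng R A)"
  using quot_proj_lin[OF op_alg_module op_ideal_submodule] unfolding operator_rng_def linear_maps_def by simp

lemma op_class_quadrilinear: "quadrilinear_map R T G T G (operator_rng R A) (op_class R A)"
  unfolding op_class_def op_pure_def two_step_simps
  by (intro quadrilinear_mapI lin_comp[OF _ op_proj_lin]
    quadrilin_1[OF opp_quadrilinear] quadrilin_2[OF opp_quadrilinear] quadrilin_3[OF opp_quadrilinear]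
    quadrilin_4[OF opp_quadrilinear])

lemma op_class_balanced:
  assumes "a \<in> carrier T" "b \<in> carrier T" "c \<in> carrier T" "d \<in> carrier T"
    "\<alpha> \<in> carrier G" "\<beta> \<in> carrier G" "\<gamma> \<in> carrier G" "\<delta> \<in> carrier G"
  shows "op_class R A (tprod A a \<alpha> b \<beta> c) \<gamma> d \<delta> = op_class R A a \<alpha> (tprod A b \<beta> c \<gamma> d) \<delta>"
proof -
  have "opp (tprod A a \<alpha> b \<beta> c) \<gamma> d \<delta> \<ominus>\<^bsub>X\<^esub> opp a \<alpha> (tprod A b \<beta> c \<gamma> d) \<delta> \<in> op_ideal R A"
    unfolding op_ideal_eq using assms by (intro hull_inc) (unfold op_rels_eq, blast)
  then show ?thesis
    unfolding op_class_def op_pure_def two_step_simps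
    by (subst quot_proj_eq_iff[OF op_alg_module op_ideal_submodule])
      (use assms in \<open>simp_all add: quadrilin_closed[OF opp_quadrilinear] tprod_closed del: direct_sum_simps regular_module_simps\<close>)
qed

lemma op_induct [consumes 1, case_names op_class add]:
  assumes u: "u \<in> carrier (operator_rng R A)"
    and cls: "\<And>a \<alpha> b \<beta>. a \<in> carrier T \<Longrightarrow> \<alpha> \<in> carrier G \<Longrightarrow> b \<in> carrier T \<Longrightarrow> \<beta> \<in> carrier G \<Longrightarrow> P (op_class R A a \<alpha> b \<beta>)"
    and add: "\<And>u v. u \<in> carrier (operator_rng R A) \<Longrightarrow> v \<in> carrier (operator_rng R A) \<Longrightarrow> P u \<Longrightarrow> P v \<Longrightarrow>
      P (u \<oplus>\<^bsub>operator_rng R A\<^esub> v)"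
  shows "P u"
proof -
  obtain x where x: "x \<in> carrier X" "u = op_ideal R A +>\<^bsub>op_alg R A\<^esub> x"
    using u unfolding operator_rng_def quot_carrier[OF op_alg_module op_ideal_submodule] by auto
  have "P (op_ideal R A +>\<^bsub>op_alg R A\<^esub> x)" using x(1)
  proof (induction rule: tensor4_induct[OF T G T G, consumes 1, case_names pure add])
    case (pure a \<alpha> b \<beta>)
    then show ?case using cls[OF pure] by (simp add: op_class_def op_pure_def)
  next
    case (add u v)
    then show ?case using assms(3) by (simp add: lin_add[OF op_proj_lin] lin_closed[OF op_proj_lin])
  qed
  then show ?thesis using x by simp
qed

lemma op_lin_eqI:
  assumes "f \<in> linear_maps R (operator_rng R A) P" "g \<in> linear_maps R (operator_rng R A) P"
    and "\<And>a \<alpha> b \<beta>. a \<in> carrier T \<Longrightarrow> \<alpha> \<in> carrier G \<Longrightarrow> b \<in> carrier T \<Longrightarrow> \<beta> \<in> carrier G \<Longrightarrow>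
      f (op_class R A a \<alpha> b \<beta>) = g (op_class R A a \<alpha> b \<beta>)"
    and "u \<in> carrier (operator_rng R A)"
  shows "f u = g u"
  using assms(4) by (induction rule: op_induct) (simp_all add: assms(3) lin_add[OF assms(1)] lin_add[OF assms(2)])

text \<open>The universal property of the operator rng as a module. As the two-sided ideal is the
  plain span of its generators, the kernel of the fourfold lift contains it as soon as
  \<open>f\<close> is balanced on generators; no compatibility with the multiplication is asked of
  \<open>f\<close>.\<close>

lemma
  assumes P: "module R P" and f: "quadrilinear_map R T G T G P f"
    and bal: "\<And>a b c d \<alpha> \<beta> \<gamma> \<delta>. a \<in> carrier T \<Longrightarrow> b \<in> carrier T \<Longrightarrow> c \<in> carrier T \<Longrightarrow> d \<in> carrier T \<Longrightarrow>
      \<alpha> \<in> carrier G \<Longrightarrow> \<beta> \<in> carrier G \<Longrightarrow> \<gamma> \<in> carrier G \<Longrightarrow> \<delta> \<in> carrier G \<Longrightarrow>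
      f (tprod A a \<alpha> b \<beta> c) \<gamma> d \<delta> = f a \<alpha> (tprod A b \<beta> c \<gamma> d) \<delta>"
  shows op_lift_lin: "op_lift R P f \<in> linear_maps R (operator_rng R A) P"
    and op_lift_class: "\<And>a \<alpha> b \<beta>. a \<in> carrier T \<Longrightarrow> \<alpha> \<in> carrier G \<Longrightarrow> b \<in> carrier T \<Longrightarrow> \<beta> \<in> carrier G \<Longrightarrow>
      op_lift R P f (op_class R A a \<alpha> b \<beta>) = f a \<alpha> b \<beta>"
proof -
  interpret P: module R P by fact
  let ?f = "tensor_lift4 R P f"
  have lin: "?f \<in> linear_maps R X P" by (rule tensor_lift4_lin[OF T G T G P f])
  have lin': "?f \<in> linear_maps R (op_alg R A) P" using lin by (simp add: linear_maps_def)
  note pure = tensor_lift4_pure[OF T G T G P f]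
  have "op_rels R A \<subseteq> {x \<in> carrier (op_alg R A). ?f x = \<zero>\<^bsub>P\<^esub>}"
  proof
    fix u assume "u \<in> op_rels R A"
    obtain a \<alpha> b \<beta> c \<gamma> d \<delta> where m: "a \<in> carrier T" "b \<in> carrier T" "c \<in> carrier T" "d \<in> carrier T"
        "\<alpha> \<in> carrier G" "\<beta> \<in> carrier G" "\<gamma> \<in> carrier G" "\<delta> \<in> carrier G"
      and u: "u = opp (tprod A a \<alpha> b \<beta> c) \<gamma> d \<delta> \<ominus>\<^bsub>X\<^esub> opp a \<alpha> (tprod A b \<beta> c \<gamma> d) \<delta>"
      using \<open>u \<in> op_rels R A\<close> by (rule op_relsE)
    note c = quadrilin_closed[OF opp_quadrilinear] tprod_closed m
    have "?f u = ?f (opp (tprod A a \<alpha> b \<beta> c) \<gamma> d \<delta>) \<ominus>\<^bsub>P\<^esub> ?f (opp a \<alpha> (tprod A b \<beta> c \<gamma> d) \<delta>)"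
      unfolding u by (rule lin_diff[OF lin X P]) (intro c)+
    also have "\<dots> = f (tprod A a \<alpha> b \<beta> c) \<gamma> d \<delta> \<ominus>\<^bsub>P\<^esub> f a \<alpha> (tprod A b \<beta> c \<gamma> d) \<delta>"
      by (subst (1 2) pure) (intro c refl)+
    also have "\<dots> = \<zero>\<^bsub>P\<^esub>"
      using quadrilin_closed[OF f m(1,5) tprod_closed[OF m(2,6,3,7,4)] m(8)]
      unfolding bal[OF m] a_minus_def by (rule P.r_neg)
    finally show "u \<in> {x \<in> carrier (op_alg R A). ?f x = \<zero>\<^bsub>P\<^esub>}"
      using \<open>u \<in> op_rels R A\<close> op_rels_subset by auto
  qed
  then have "op_ideal R A \<subseteq> {x \<in> carrier (op_alg R A). ?f x = \<zero>\<^bsub>P\<^esub>}"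
    unfolding op_ideal_eq by (rule hull_minimal) (rule submodule_kernel[OF lin' op_alg_module P])
  then have null: "?f x = \<zero>\<^bsub>P\<^esub>" if "x \<in> op_ideal R A" for x using that by blast
  show "op_lift R P f \<in> linear_maps R (operator_rng R A) P"
    using quot_lift_lin[OF op_alg_module op_ideal_submodule P lin' null]
    unfolding op_lift_def[abs_def] operator_rng_def .
  show "op_lift R P f (op_class R A a \<alpha> b \<beta>) = f a \<alpha> b \<beta>"
    if m: "a \<in> carrier T" "\<alpha> \<in> carrier G" "b \<in> carrier T" "\<beta> \<in> carrier G" for a \<alpha> b \<beta>
    using the_elem_coset[OF op_alg_module op_ideal_submodule P lin' null] quadrilin_closed[OF opp_quadrilinear m] pure[OF m]
    unfolding op_lift_def op_class_def op_pure_def two_step_simps op_alg_simps by simp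
qed

lemma regular_rep_bal:
  "quadrilinear_map R T G T G (Hom_module R T T) (\<lambda>a \<alpha> b \<beta>. \<lambda>x\<in>carrier T. tprod A a \<alpha> b \<beta> x)"
  by (intro quadrilinear_mapI lin_into_Hom T G tprod_lin_1 tprod_lin_2 tprod_lin_3 tprod_lin_4 tprod_lin_5)

lemma
  shows regular_rep_lin: "regular_rep R A \<in> linear_maps R (operator_rng R A) (Hom_module R T T)"
    and regular_rep_class: "\<And>a \<alpha> b \<beta>. a \<in> carrier T \<Longrightarrow> \<alpha> \<in> carrier G \<Longrightarrow> b \<in> carrier T \<Longrightarrow> \<beta> \<in> carrier G \<Longrightarrow>
      regular_rep R A (op_class R A a \<alpha> b \<beta>) = (\<lambda>x\<in>carrier T. tprod A a \<alpha> b \<beta> x)"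
proof -
  \<comment> \<open>Applied to \<open>x\<close>, both sides are nested products and therefore
    zero.\<close>
  have bal: "(\<lambda>x\<in>carrier T. tprod A (tprod A a \<alpha> b \<beta> c) \<gamma> d \<delta> x) = (\<lambda>x\<in>carrier T. tprod A a \<alpha> (tprod A b \<beta> c \<gamma> d) \<delta> x)"
    if m: "a \<in> carrier T" "b \<in> carrier T" "c \<in> carrier T" "d \<in> carrier T"
      "\<alpha> \<in> carrier G" "\<beta> \<in> carrier G" "\<gamma> \<in> carrier G" "\<delta> \<in> carrier G" for a b c d \<alpha> \<beta> \<gamma> \<delta>
  proof (rule restrict_ext)
    fix x assume x: "x \<in> carrier T"
    note c = tprod_closed m x
    have "tprod A (tprod A a \<alpha> b \<beta> c) \<gamma> d \<delta> x = \<zero>\<^bsub>T\<^esub>"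
      by (rule tprod_fst_zero) (intro c fst_tprod disjI1)+
    moreover have "tprod A a \<alpha> (tprod A b \<beta> c \<gamma> d) \<delta> x = \<zero>\<^bsub>T\<^esub>"
      by (rule tprod_fst_zero[OF _ _ _ _ _ disjI2[OF disjI1[OF fst_tprod]]]) (intro c)+
    ultimately show "tprod A (tprod A a \<alpha> b \<beta> c) \<gamma> d \<delta> x = tprod A a \<alpha> (tprod A b \<beta> c \<gamma> d) \<delta> x" by simp
  qed
  show "regular_rep R A \<in> linear_maps R (operator_rng R A) (Hom_module R T T)"
    unfolding regular_rep_def two_step_simps
    by (rule op_lift_lin[OF Hom_module[OF T T] regular_rep_bal bal])
  show "regular_rep R A (op_class R A a \<alpha> b \<beta>) = (\<lambda>x\<in>carrier T. tprod A a \<alpha> b \<beta> x)"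
    if "a \<in> carrier T" "\<alpha> \<in> carrier G" "b \<in> carrier T" "\<beta> \<in> carrier G" for a \<alpha> b \<beta>
    unfolding regular_rep_def two_step_simps
    by (rule op_lift_class[OF Hom_module[OF T T] regular_rep_bal bal that])
qed

lemma operator_defect_module: "module R (operator_defect R A)"
  unfolding operator_defect_def two_step_simps
  by (rule module_carrier_update[OF operator_rng_module
    submodule_kernel[OF regular_rep_lin operator_rng_module Hom_module[OF T T]]])

end

section \<open>Base change of multilinear maps\<close>

lemma lin_int_to_restrict:
  assumes "module \<Z> L" "cring S" "module \<Z> M" "f \<in> linear_maps \<Z> L (tensor \<Z> M (int_alg S))"
  shows "f \<in> linear_maps \<Z> L (restrict_scalars (int_hom S) (base_change M S))"
  using lin_closed[OF assms(4)] lin_add[OF assms(4)]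
  by (intro int_additive_lin assms restrict_scalars_module[OF int_is_cring int_hom_ring_hom base_change_module]) simp_all

lemma smult_lin:
  assumes "module R M" "r \<in> carrier R"
  shows "(\<lambda>x. r \<odot>\<^bsub>M\<^esub> x) \<in> linear_maps R M M"
  by (rule lin_scale[OF assms(1) lin_id assms(2)])

lemma lin_scalar_mult:
  assumes "module R M" "x \<in> carrier M"
  shows "(\<lambda>r. r \<odot>\<^bsub>M\<^esub> x) \<in> linear_maps R (regular_module R) M"
proof -
  interpret module R M by fact
  show ?thesis using assms(2) by (intro linear_mapsI) (simp_all add: smult_l_distr smult_assoc1)
qed

context
  fixes S :: "('s, 'x) ring_scheme" and M :: "(int, 'a, 'y) module_scheme"
  assumes S: "cring S" and M: "module \<Z> M"
begin

interpretation S: cring S by (rule S)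

lemma pure_eq_smult_one:
  assumes "x \<in> carrier M" "s \<in> carrier S"
  shows "pure \<Z> M (int_alg S) x s = s \<odot>\<^bsub>base_change M S\<^esub> pure \<Z> M (int_alg S) x \<one>\<^bsub>S\<^esub>"
  using base_change_smult_pure[OF S M assms(2,1) S.one_closed] assms by simp

text \<open>The elements \<open>x \<otimes> 1\<close> generate the base change over
  \<open>S\<close>, as \<open>x \<otimes> s\<close> is \<open>s\<close> times
  \<open>x \<otimes> 1\<close>. Multilinear identities over \<open>S\<close> are reduced to integral
  ones by applying this to one argument after another.\<close>

lemma base_change_lin_eqI:
  assumes f: "f \<in> linear_maps S (base_change M S) P" and g: "g \<in> linear_maps S (base_change M S) P"
    and eq: "\<And>x. x \<in> carrier M \<Longrightarrow> f (pure \<Z> M (int_alg S) x \<one>\<^bsub>S\<^esub>) = g (pure \<Z> M (int_alg S) x \<one>\<^bsub>S\<^esub>)"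
    and u: "u \<in> carrier (base_change M S)"
  shows "f u = g u"
  using u
proof (induction rule: base_change_induct[OF S M, consumes 1, case_names pure add])
  case (pure x s)
  note c = base_change_pure_closed[OF S M pure(1) S.one_closed]
  show ?case
    by (simp only: pure_eq_smult_one[OF pure] lin_smult[OF f pure(2) c] lin_smult[OF g pure(2) c] eq[OF pure(1)])
next
  case (add u v)
  then show ?case by (simp only: lin_add[OF f] lin_add[OF g])
qed

lemma pure_one_lin:
  "(\<lambda>x. pure \<Z> M (int_alg S) x \<one>\<^bsub>S\<^esub>) \<in> linear_maps \<Z> M (restrict_scalars (int_hom S) (base_change M S))"
  by (rule lin_int_to_restrict[OF M S M pure_lin_left[OF M int_alg_module[OF S]]]) simp

end

text \<open>The \<open>S\<close>-bilinear extension of an integral bilinear map \<open>b\<close>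
  with values in an \<open>S\<close>-module, obtained by extending scalars in one variable and then
  in the other.\<close>

definition base_change_bilinear where
  "base_change_bilinear S P b X Y =
    (let V = restrict_scalars (int_hom S) P in
     tensor_lift \<Z> V (\<lambda>x s. s \<odot>\<^bsub>P\<^esub> tensor_lift \<Z> V (\<lambda>y t. t \<odot>\<^bsub>P\<^esub> b x y) Y) X)"

context
  fixes S :: "('s, 'x) ring_scheme" and M :: "(int, 'a, 'y) module_scheme" and N :: "(int, 'b, 'z) module_scheme"
    and P :: "('s, 'p, 'w) module_scheme" and b :: "'a \<Rightarrow> 'b \<Rightarrow> 'p"
  assumes S: "cring S" and M: "module \<Z> M" and N: "module \<Z> N" and P: "module S P"
    and b: "bilinear_map \<Z> M N (restrict_scalars (int_hom S) P) b"
begin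

interpretation S: cring S by (rule S)
interpretation P: module S P by (rule P)

private abbreviation (input) "V \<equiv> restrict_scalars (int_hom S) P"

private lemma V: "module \<Z> V"
  by (rule restrict_scalars_module[OF int_is_cring int_hom_ring_hom[OF S] P])

private lemma inner_left:
  assumes "Y \<in> carrier (base_change N S)"
  shows "(\<lambda>x. tensor_lift \<Z> V (\<lambda>y t. t \<odot>\<^bsub>P\<^esub> b x y) Y) \<in> linear_maps \<Z> M V"
proof (rule tensor_lift_lin_param[OF N int_alg_module[OF S] M V])
  show "bilinear_map \<Z> N (int_alg S) V (\<lambda>y t. t \<odot>\<^bsub>P\<^esub> b x y)" if "x \<in> carrier M" for x
    by (rule base_change_lift_bilinear[OF S N P bilin_right[OF b that]])
  show "(\<lambda>x. t \<odot>\<^bsub>P\<^esub> b x y) \<in> linear_maps \<Z> M V" if "y \<in> carrier N" "t \<in> carrier (int_alg S)" for y t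
    using lin_comp[OF bilin_left[OF b that(1)] restrict_scalars_lin[OF int_hom_ring_hom[OF S] smult_lin[OF P, of t]]] that
    by simp
qed (use assms in simp)

lemma base_change_bilinear_bilinear:
  "bilinear_map S (base_change M S) (base_change N S) P (base_change_bilinear S P b)"
proof (rule bilinear_mapI)
  have l: "base_change_bilinear S P b = (\<lambda>X Y. tensor_lift \<Z> V (\<lambda>x s. s \<odot>\<^bsub>P\<^esub> tensor_lift \<Z> V (\<lambda>y t. t \<odot>\<^bsub>P\<^esub> b x y) Y) X)"
    by (simp add: base_change_bilinear_def[abs_def] Let_def)
  show X: "(\<lambda>X. base_change_bilinear S P b X Y) \<in> linear_maps S (base_change M S) P"
    if "Y \<in> carrier (base_change N S)" for Y
    unfolding l by (rule base_change_lift_lin[OF S M P inner_left[OF that]])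
  show "(\<lambda>Y. base_change_bilinear S P b X Y) \<in> linear_maps S (base_change N S) P"
    if "X \<in> carrier (base_change M S)" for X
    using that
  proof (induction rule: base_change_induct[OF S M, consumes 1, case_names pure add])
    case (pure x s)
    show ?case
      unfolding l
      by (rule lin_cong[OF lin_scale[OF P base_change_lift_lin[OF S N P bilin_right[OF b pure(1)]] pure(2)] _
          base_change_module[OF S N]])
        (rule base_change_lift_pure[OF S M P inner_left pure])
  next
    case (add u v)
    show ?case
      by (rule lin_cong[OF lin_sum[OF P add(3,4)] _ base_change_module[OF S N]])
        (rule lin_add[OF X add(1,2)])
  qed
qed

lemma base_change_bilinear_pure:
  assumes "x \<in> carrier M" "y \<in> carrier N"
  shows "base_change_bilinear S P b (pure \<Z> M (int_alg S) x \<one>\<^bsub>S\<^esub>) (pure \<Z> N (int_alg S) y \<one>\<^bsub>S\<^esub>) = b x y"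
proof -
  have c: "b x y \<in> carrier P" using bilin_closed[OF b assms] by simp
  have "tensor_lift \<Z> V (\<lambda>y t. t \<odot>\<^bsub>P\<^esub> b x y) (pure \<Z> N (int_alg S) y \<one>\<^bsub>S\<^esub>) = b x y"
    using base_change_lift_pure[OF S N P bilin_right[OF b assms(1)] assms(2) S.one_closed] c by simp
  moreover have "tensor_lift \<Z> V (\<lambda>x s. s \<odot>\<^bsub>P\<^esub> tensor_lift \<Z> V (\<lambda>y t. t \<odot>\<^bsub>P\<^esub> b x y) (pure \<Z> N (int_alg S) y \<one>\<^bsub>S\<^esub>))
      (pure \<Z> M (int_alg S) x \<one>\<^bsub>S\<^esub>) =
    \<one>\<^bsub>S\<^esub> \<odot>\<^bsub>P\<^esub> tensor_lift \<Z> V (\<lambda>y t. t \<odot>\<^bsub>P\<^esub> b x y) (pure \<Z> N (int_alg S) y \<one>\<^bsub>S\<^esub>)"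
    by (rule base_change_lift_pure[OF S M P inner_left assms(1) S.one_closed])
      (rule base_change_pure_closed[OF S N assms(2) S.one_closed])
  ultimately show ?thesis using c by (simp add: base_change_bilinear_def Let_def)
qed

end

context
  fixes S :: "('s, 'x) ring_scheme" and M1 :: "(int, 'a, 'y) module_scheme" and M2 :: "(int, 'b, 'z) module_scheme"
    and M3 :: "(int, 'c, 'v) module_scheme" and M :: "(int, 'd, 'w) module_scheme"
    and m :: "('a \<times> 's \<Rightarrow> int) set \<Rightarrow> ('b \<times> 's \<Rightarrow> int) set \<Rightarrow> ('c \<times> 's \<Rightarrow> int) set \<Rightarrow> ('d \<times> 's \<Rightarrow> int) set"
    and t :: "'a \<Rightarrow> 'b \<Rightarrow> 'c \<Rightarrow> 'd"
  assumes S: "cring S" and M1: "module \<Z> M1" and M2: "module \<Z> M2" and M3: "module \<Z> M3" and M: "module \<Z> M"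
    and t: "\<And>x y z. x \<in> carrier M1 \<Longrightarrow> y \<in> carrier M2 \<Longrightarrow> z \<in> carrier M3 \<Longrightarrow> t x y z \<in> carrier M"
    and m: "trilinear_map \<Z> (tensor \<Z> M1 (int_alg S)) (tensor \<Z> M2 (int_alg S)) (tensor \<Z> M3 (int_alg S))
      (tensor \<Z> M (int_alg S)) m"
    and mp: "\<And>x y z r s u. x \<in> carrier M1 \<Longrightarrow> y \<in> carrier M2 \<Longrightarrow> z \<in> carrier M3 \<Longrightarrow>
      r \<in> carrier S \<Longrightarrow> s \<in> carrier S \<Longrightarrow> u \<in> carrier S \<Longrightarrow>
      m (pure \<Z> M1 (int_alg S) x r) (pure \<Z> M2 (int_alg S) y s) (pure \<Z> M3 (int_alg S) z u) =
        pure \<Z> M (int_alg S) (t x y z) (r \<otimes>\<^bsub>S\<^esub> s \<otimes>\<^bsub>S\<^esub> u)"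
begin

interpretation S: cring S by (rule S)

text \<open>Additivity is given, so only homogeneity over \<open>S\<close> has to be shown, one
  variable at a time. The remaining two arguments are reduced to pure tensors, where the factor
  \<open>k\<close> moves through the product of the three ring elements by commutativity.\<close>

lemma int_trilinear_base_change:
  "trilinear_map S (base_change M1 S) (base_change M2 S) (base_change M3 S) (base_change M S) m"
proof -
  note I = int_alg_module[OF S]
  note T1 = tensor_module[OF M1 I] and T2 = tensor_module[OF M2 I] and T3 = tensor_module[OF M3 I]
  note B = base_change_module[OF S M]
  have sl: "(\<lambda>u. k \<odot>\<^bsub>base_change M S\<^esub> u) \<in> linear_maps \<Z> (tensor \<Z> M (int_alg S)) (tensor \<Z> M (int_alg S))"
    if "k \<in> carrier S" for k
    using tensor_map_lin[OF M I M I lin_id mult_int_alg_lin[OF S that]] by simp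
  note p1 = pure_closed[OF M1 I] and p2 = pure_closed[OF M2 I] and p3 = pure_closed[OF M3 I]
  note l1 = trilin_1[OF m] and l2 = trilin_2[OF m] and l3 = trilin_3[OF m]
  note sp = base_change_smult_pure[OF S M]
  show ?thesis
  proof (rule trilinear_mapI)
    fix Y Z assume "Y \<in> carrier (base_change M2 S)" "Z \<in> carrier (base_change M3 S)"
    then have Y: "Y \<in> carrier (tensor \<Z> M2 (int_alg S))" and Z: "Z \<in> carrier (tensor \<Z> M3 (int_alg S))" by auto
    show "(\<lambda>X. m X Y Z) \<in> linear_maps S (base_change M1 S) (base_change M S)"
    proof (rule additive_base_change_lin[OF S M1 B lin_int_to_restrict[OF T1 S M l1[OF Y Z]]])
      fix k x r assume x: "k \<in> carrier S" "x \<in> carrier M1" "r \<in> carrier S"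
      then have c: "pure \<Z> M1 (int_alg S) x r \<in> carrier (tensor \<Z> M1 (int_alg S))"
        "pure \<Z> M1 (int_alg S) x (k \<otimes>\<^bsub>S\<^esub> r) \<in> carrier (tensor \<Z> M1 (int_alg S))" by (auto intro: p1)
      show "m (pure \<Z> M1 (int_alg S) x (k \<otimes>\<^bsub>S\<^esub> r)) Y Z =
        k \<odot>\<^bsub>base_change M S\<^esub> m (pure \<Z> M1 (int_alg S) x r) Y Z"
      proof (rule tensor_lin_eqI[OF M2 I l2[OF c(2) Z] lin_comp[OF l2[OF c(1) Z] sl[OF x(1)]] _ Y])
        fix y s assume y: "y \<in> carrier M2" "s \<in> carrier (int_alg S)"
        note d = p2[OF y]
        show "m (pure \<Z> M1 (int_alg S) x (k \<otimes>\<^bsub>S\<^esub> r)) (pure \<Z> M2 (int_alg S) y s) Z =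
          k \<odot>\<^bsub>base_change M S\<^esub> m (pure \<Z> M1 (int_alg S) x r) (pure \<Z> M2 (int_alg S) y s) Z"
          by (rule tensor_lin_eqI[OF M3 I l3[OF c(2) d] lin_comp[OF l3[OF c(1) d] sl[OF x(1)]] _ Z])
            (use x y in \<open>simp add: mp t sp S.m_assoc del: base_change_simps\<close>)
      qed
    qed
  next
    fix X Z assume "X \<in> carrier (base_change M1 S)" "Z \<in> carrier (base_change M3 S)"
    then have X: "X \<in> carrier (tensor \<Z> M1 (int_alg S))" and Z: "Z \<in> carrier (tensor \<Z> M3 (int_alg S))" by auto
    show "(\<lambda>Y. m X Y Z) \<in> linear_maps S (base_change M2 S) (base_change M S)"
    proof (rule additive_base_change_lin[OF S M2 B lin_int_to_restrict[OF T2 S M l2[OF X Z]]])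
      fix k y s assume y: "k \<in> carrier S" "y \<in> carrier M2" "s \<in> carrier S"
      then have c: "pure \<Z> M2 (int_alg S) y s \<in> carrier (tensor \<Z> M2 (int_alg S))"
        "pure \<Z> M2 (int_alg S) y (k \<otimes>\<^bsub>S\<^esub> s) \<in> carrier (tensor \<Z> M2 (int_alg S))" by (auto intro: p2)
      show "m X (pure \<Z> M2 (int_alg S) y (k \<otimes>\<^bsub>S\<^esub> s)) Z =
        k \<odot>\<^bsub>base_change M S\<^esub> m X (pure \<Z> M2 (int_alg S) y s) Z"
      proof (rule tensor_lin_eqI[OF M1 I l1[OF c(2) Z] lin_comp[OF l1[OF c(1) Z] sl[OF y(1)]] _ X])
        fix x r assume x: "x \<in> carrier M1" "r \<in> carrier (int_alg S)"
        note d = p1[OF x]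
        show "m (pure \<Z> M1 (int_alg S) x r) (pure \<Z> M2 (int_alg S) y (k \<otimes>\<^bsub>S\<^esub> s)) Z =
          k \<odot>\<^bsub>base_change M S\<^esub> m (pure \<Z> M1 (int_alg S) x r) (pure \<Z> M2 (int_alg S) y s) Z"
          by (rule tensor_lin_eqI[OF M3 I l3[OF d c(2)] lin_comp[OF l3[OF d c(1)] sl[OF y(1)]] _ Z])
            (use x y in \<open>simp add: mp t sp S.m_ac del: base_change_simps\<close>)
      qed
    qed
  next
    fix X Y assume "X \<in> carrier (base_change M1 S)" "Y \<in> carrier (base_change M2 S)"
    then have X: "X \<in> carrier (tensor \<Z> M1 (int_alg S))" and Y: "Y \<in> carrier (tensor \<Z> M2 (int_alg S))" by auto
    show "(\<lambda>Z. m X Y Z) \<in> linear_maps S (base_change M3 S) (base_change M S)"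
    proof (rule additive_base_change_lin[OF S M3 B lin_int_to_restrict[OF T3 S M l3[OF X Y]]])
      fix k z u assume z: "k \<in> carrier S" "z \<in> carrier M3" "u \<in> carrier S"
      then have c: "pure \<Z> M3 (int_alg S) z u \<in> carrier (tensor \<Z> M3 (int_alg S))"
        "pure \<Z> M3 (int_alg S) z (k \<otimes>\<^bsub>S\<^esub> u) \<in> carrier (tensor \<Z> M3 (int_alg S))" by (auto intro: p3)
      show "m X Y (pure \<Z> M3 (int_alg S) z (k \<otimes>\<^bsub>S\<^esub> u)) =
        k \<odot>\<^bsub>base_change M S\<^esub> m X Y (pure \<Z> M3 (int_alg S) z u)"
      proof (rule tensor_lin_eqI[OF M1 I l1[OF Y c(2)] lin_comp[OF l1[OF Y c(1)] sl[OF z(1)]] _ X])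
        fix x r assume x: "x \<in> carrier M1" "r \<in> carrier (int_alg S)"
        note d = p1[OF x]
        show "m (pure \<Z> M1 (int_alg S) x r) Y (pure \<Z> M3 (int_alg S) z (k \<otimes>\<^bsub>S\<^esub> u)) =
          k \<odot>\<^bsub>base_change M S\<^esub> m (pure \<Z> M1 (int_alg S) x r) Y (pure \<Z> M3 (int_alg S) z u)"
          by (rule tensor_lin_eqI[OF M2 I l2[OF d c(2)] lin_comp[OF l2[OF d c(1)] sl[OF z(1)]] _ Y])
            (use x z in \<open>simp add: mp t sp S.m_ac del: base_change_simps\<close>)
      qed
    qed
  qed
qed

end

context
  fixes E :: "(int, 'e) module" and W :: "(int, 'w) module" and \<mu> :: "(int, 'e) cube \<Rightarrow> 'w"
    and S :: "('s, 'x) ring_scheme"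
  assumes E: "module \<Z> E" and W: "module \<Z> W" and \<mu>: "\<mu> \<in> linear_maps \<Z> (tensor3 \<Z> E E E) W"
    and S: "cring S"
begin

interpretation S: cring S by (rule S)

private abbreviation (input) "IS \<equiv> int_alg S"
private abbreviation (input) "WI \<equiv> tensor \<Z> W IS"
private abbreviation (input) "EI \<equiv> tensor \<Z> E IS"
text \<open>The stages of the definition of \<open>base_change_mu\<close>. In \<open>f0\<close> all
  six entries are explicit; \<open>f1\<close>, \<open>f2\<close> and \<open>f3\<close> replace the
  pairs \<open>z u\<close>, \<open>y t\<close> and \<open>x s\<close> in turn by one tensor. At each
  stage linearity is recorded in every variable that the later lifts involve.\<close>

private abbreviation (input) "f0 \<equiv> \<lambda>x s y t z u. pure \<Z> W IS (tri \<Z> E \<mu> x y z) (s \<otimes>\<^bsub>S\<^esub> t \<otimes>\<^bsub>S\<^esub> u)"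
private abbreviation (input) "f1 \<equiv> \<lambda>x s y t Z. tensor_lift \<Z> WI (\<lambda>z u. f0 x s y t z u) Z"
private abbreviation (input) "f2 \<equiv> \<lambda>x s Y Z. tensor_lift \<Z> WI (\<lambda>y t. f1 x s y t Z) Y"
private abbreviation (input) "f3 \<equiv> \<lambda>X Y Z. tensor_lift \<Z> WI (\<lambda>x s. f2 x s Y Z) X"

private lemma IS: "module \<Z> IS" by (rule int_alg_module[OF S])
private lemma WI: "module \<Z> WI" by (rule tensor_module[OF W IS])
private lemma EI: "module \<Z> EI" by (rule tensor_module[OF E IS])

private lemma f_lin:
  "\<lbrakk>y \<in> carrier E; z \<in> carrier E; s \<in> carrier IS; t \<in> carrier IS; u \<in> carrier IS\<rbrakk> \<Longrightarrow> (\<lambda>x. f0 x s y t z u) \<in> linear_maps \<Z> E WI"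
  "\<lbrakk>x \<in> carrier E; z \<in> carrier E; s \<in> carrier IS; t \<in> carrier IS; u \<in> carrier IS\<rbrakk> \<Longrightarrow> (\<lambda>y. f0 x s y t z u) \<in> linear_maps \<Z> E WI"
  "\<lbrakk>x \<in> carrier E; y \<in> carrier E; s \<in> carrier IS; t \<in> carrier IS; u \<in> carrier IS\<rbrakk> \<Longrightarrow> (\<lambda>z. f0 x s y t z u) \<in> linear_maps \<Z> E WI"
  "\<lbrakk>x \<in> carrier E; y \<in> carrier E; z \<in> carrier E; t \<in> carrier IS; u \<in> carrier IS\<rbrakk> \<Longrightarrow> (\<lambda>s. f0 x s y t z u) \<in> linear_maps \<Z> IS WI"
  "\<lbrakk>x \<in> carrier E; y \<in> carrier E; z \<in> carrier E; s \<in> carrier IS; u \<in> carrier IS\<rbrakk> \<Longrightarrow> (\<lambda>t. f0 x s y t z u) \<in> linear_maps \<Z> IS WI"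
  "\<lbrakk>x \<in> carrier E; y \<in> carrier E; z \<in> carrier E; s \<in> carrier IS; t \<in> carrier IS\<rbrakk> \<Longrightarrow> (\<lambda>u. f0 x s y t z u) \<in> linear_maps \<Z> IS WI"
proof -
  note tri = tri_trilinear[OF E W \<mu>]
  have c: "s \<otimes>\<^bsub>S\<^esub> t \<otimes>\<^bsub>S\<^esub> u \<in> carrier IS" if "s \<in> carrier IS" "t \<in> carrier IS" "u \<in> carrier IS" for s t u
    using that by simp
  have m: "(\<lambda>s. s \<otimes>\<^bsub>S\<^esub> t \<otimes>\<^bsub>S\<^esub> u) \<in> linear_maps \<Z> IS IS" "(\<lambda>s. t \<otimes>\<^bsub>S\<^esub> s \<otimes>\<^bsub>S\<^esub> u) \<in> linear_maps \<Z> IS IS"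
    "(\<lambda>s. t \<otimes>\<^bsub>S\<^esub> u \<otimes>\<^bsub>S\<^esub> s) \<in> linear_maps \<Z> IS IS" if "t \<in> carrier IS" "u \<in> carrier IS" for t u
    using that by (auto intro!: int_additive_lin IS simp: S.l_distr S.r_distr)
  note pl = pure_lin_left[OF W IS c] and pr = pure_lin_right[OF W IS trilin_closed[OF tri]]
  show "\<lbrakk>y \<in> carrier E; z \<in> carrier E; s \<in> carrier IS; t \<in> carrier IS; u \<in> carrier IS\<rbrakk> \<Longrightarrow> (\<lambda>x. f0 x s y t z u) \<in> linear_maps \<Z> E WI"
    by (rule lin_comp[OF trilin_1[OF tri] pl])
  show "\<lbrakk>x \<in> carrier E; z \<in> carrier E; s \<in> carrier IS; t \<in> carrier IS; u \<in> carrier IS\<rbrakk> \<Longrightarrow> (\<lambda>y. f0 x s y t z u) \<in> linear_maps \<Z> E WI"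
    by (rule lin_comp[OF trilin_2[OF tri] pl])
  show "\<lbrakk>x \<in> carrier E; y \<in> carrier E; s \<in> carrier IS; t \<in> carrier IS; u \<in> carrier IS\<rbrakk> \<Longrightarrow> (\<lambda>z. f0 x s y t z u) \<in> linear_maps \<Z> E WI"
    by (rule lin_comp[OF trilin_3[OF tri] pl])
  show "\<lbrakk>x \<in> carrier E; y \<in> carrier E; z \<in> carrier E; t \<in> carrier IS; u \<in> carrier IS\<rbrakk> \<Longrightarrow> (\<lambda>s. f0 x s y t z u) \<in> linear_maps \<Z> IS WI"
    by (rule lin_comp[OF m(1) pr])
  show "\<lbrakk>x \<in> carrier E; y \<in> carrier E; z \<in> carrier E; s \<in> carrier IS; u \<in> carrier IS\<rbrakk> \<Longrightarrow> (\<lambda>t. f0 x s y t z u) \<in> linear_maps \<Z> IS WI"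
    by (rule lin_comp[OF m(2) pr])
  show "\<lbrakk>x \<in> carrier E; y \<in> carrier E; z \<in> carrier E; s \<in> carrier IS; t \<in> carrier IS\<rbrakk> \<Longrightarrow> (\<lambda>u. f0 x s y t z u) \<in> linear_maps \<Z> IS WI"
    by (rule lin_comp[OF m(3) pr])
qed

private lemma f_bil:
  "\<lbrakk>x \<in> carrier E; y \<in> carrier E; s \<in> carrier IS; t \<in> carrier IS\<rbrakk> \<Longrightarrow> bilinear_map \<Z> E IS WI (\<lambda>z u. f0 x s y t z u)"
  by (intro bilinear_mapI f_lin)

private lemma f1_lin:
  "\<lbrakk>y \<in> carrier E; Z \<in> carrier EI; s \<in> carrier IS; t \<in> carrier IS\<rbrakk> \<Longrightarrow> (\<lambda>x. f1 x s y t Z) \<in> linear_maps \<Z> E WI"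
  "\<lbrakk>x \<in> carrier E; Z \<in> carrier EI; s \<in> carrier IS; t \<in> carrier IS\<rbrakk> \<Longrightarrow> (\<lambda>y. f1 x s y t Z) \<in> linear_maps \<Z> E WI"
  "\<lbrakk>x \<in> carrier E; y \<in> carrier E; s \<in> carrier IS; t \<in> carrier IS\<rbrakk> \<Longrightarrow> (\<lambda>Z. f1 x s y t Z) \<in> linear_maps \<Z> EI WI"
  "\<lbrakk>x \<in> carrier E; y \<in> carrier E; Z \<in> carrier EI; t \<in> carrier IS\<rbrakk> \<Longrightarrow> (\<lambda>s. f1 x s y t Z) \<in> linear_maps \<Z> IS WI"
  "\<lbrakk>x \<in> carrier E; y \<in> carrier E; Z \<in> carrier EI; s \<in> carrier IS\<rbrakk> \<Longrightarrow> (\<lambda>t. f1 x s y t Z) \<in> linear_maps \<Z> IS WI"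
  by (rule tensor_lift_lin_param[OF E IS E WI f_bil f_lin(1)]; assumption)
    ((rule tensor_lift_lin_param[OF E IS E WI f_bil f_lin(2)]; assumption),
     (rule tensor_lift_lin[OF E IS WI f_bil]; assumption),
     (rule tensor_lift_lin_param[OF E IS IS WI f_bil f_lin(4)]; assumption),
     (rule tensor_lift_lin_param[OF E IS IS WI f_bil f_lin(5)]; assumption))

private lemma f1_bil:
  "\<lbrakk>x \<in> carrier E; Z \<in> carrier EI; s \<in> carrier IS\<rbrakk> \<Longrightarrow> bilinear_map \<Z> E IS WI (\<lambda>y t. f1 x s y t Z)"
  by (intro bilinear_mapI f1_lin)

private lemma f2_lin:
  "\<lbrakk>Y \<in> carrier EI; Z \<in> carrier EI; s \<in> carrier IS\<rbrakk> \<Longrightarrow> (\<lambda>x. f2 x s Y Z) \<in> linear_maps \<Z> E WI"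
  "\<lbrakk>x \<in> carrier E; Z \<in> carrier EI; s \<in> carrier IS\<rbrakk> \<Longrightarrow> (\<lambda>Y. f2 x s Y Z) \<in> linear_maps \<Z> EI WI"
  "\<lbrakk>x \<in> carrier E; Y \<in> carrier EI; s \<in> carrier IS\<rbrakk> \<Longrightarrow> (\<lambda>Z. f2 x s Y Z) \<in> linear_maps \<Z> EI WI"
  "\<lbrakk>x \<in> carrier E; Y \<in> carrier EI; Z \<in> carrier EI\<rbrakk> \<Longrightarrow> (\<lambda>s. f2 x s Y Z) \<in> linear_maps \<Z> IS WI"
  by (rule tensor_lift_lin_param[OF E IS E WI f1_bil f1_lin(1)]; assumption)
    ((rule tensor_lift_lin[OF E IS WI f1_bil]; assumption),
     (rule tensor_lift_lin_param[OF E IS EI WI f1_bil f1_lin(3)]; assumption),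
     (rule tensor_lift_lin_param[OF E IS IS WI f1_bil f1_lin(4)]; assumption))

private lemma f2_bil:
  "\<lbrakk>Y \<in> carrier EI; Z \<in> carrier EI\<rbrakk> \<Longrightarrow> bilinear_map \<Z> E IS WI (\<lambda>x s. f2 x s Y Z)"
  by (intro bilinear_mapI f2_lin)

private lemma f3_tri: "trilinear_map \<Z> EI EI EI WI f3"
  by (rule trilinear_mapI)
    ((rule tensor_lift_lin[OF E IS WI f2_bil]; assumption),
     (rule tensor_lift_lin_param[OF E IS EI WI f2_bil f2_lin(2)]; assumption),
     (rule tensor_lift_lin_param[OF E IS EI WI f2_bil f2_lin(3)]; assumption))

private lemma f3_pure:
  assumes "x \<in> carrier E" "y \<in> carrier E" "z \<in> carrier E" "s \<in> carrier S" "t \<in> carrier S" "u \<in> carrier S"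
  shows "f3 (pure \<Z> E IS x s) (pure \<Z> E IS y t) (pure \<Z> E IS z u) = f0 x s y t z u"
proof -
  have I: "s \<in> carrier IS" "t \<in> carrier IS" "u \<in> carrier IS" using assms by auto
  note p = pure_closed[OF E IS]
  note pp = p[OF assms(2) I(2)] p[OF assms(3) I(3)]
  show ?thesis
    by (simp only: tensor_lift_pure[OF E IS WI f2_bil[OF pp] assms(1) I(1)]
      tensor_lift_pure[OF E IS WI f1_bil[OF assms(1) pp(2) I(1)] assms(2) I(2)]
      tensor_lift_pure[OF E IS WI f_bil[OF assms(1,2) I(1,2)] assms(3) I(3)])
qed

private lemma f3_trilinear: "trilinear_map S (base_change E S) (base_change E S) (base_change E S) (base_change W S) f3"
  by (rule int_trilinear_base_change[OF S E E E W tri_closed[OF E W \<mu>] f3_tri f3_pure])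

lemma base_change_mu_lin:
  "base_change_mu E W \<mu> S \<in> linear_maps S (tensor3 S (base_change E S) (base_change E S) (base_change E S)) (base_change W S)"
  unfolding base_change_mu_def Let_def
  by (intro tensor_lift3_lin base_change_module S E W f3_trilinear)

lemma tri_base_change_mu:
  assumes "x \<in> carrier E" "y \<in> carrier E" "z \<in> carrier E" "s \<in> carrier S" "t \<in> carrier S" "u \<in> carrier S"
  shows "tri S (base_change E S) (base_change_mu E W \<mu> S) (pure \<Z> E (int_alg S) x s) (pure \<Z> E (int_alg S) y t)
      (pure \<Z> E (int_alg S) z u) = pure \<Z> W (int_alg S) (tri \<Z> E \<mu> x y z) (s \<otimes>\<^bsub>S\<^esub> t \<otimes>\<^bsub>S\<^esub> u)"
proof -
  note b = base_change_module[OF S E] and p = base_change_pure_closed[OF S E]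
  show ?thesis
    unfolding tri_def[of S] base_change_mu_def Let_def
    by (subst tensor_lift3_pure[OF b b b base_change_module[OF S W] f3_trilinear p[OF assms(1,4)] p[OF assms(2,5)] p[OF assms(3,6)]])
      (rule f3_pure[OF assms])
qed

end

section \<open>Homomorphisms of operator rngs\<close>

context
  fixes R :: "('r, 'x) ring_scheme" and E :: "('r, 'e) module" and W :: "('r, 'w) module"
    and \<mu> :: "('r, 'e) cube \<Rightarrow> 'w"
    and R' :: "('s, 'y) ring_scheme" and E' :: "('s, 'f) module" and W' :: "('s, 'v) module"
    and \<mu>' :: "('s, 'f) cube \<Rightarrow> 'v" and h f
  assumes E: "module R E" and W: "module R W" and \<mu>: "\<mu> \<in> linear_maps R (tensor3 R E E E) W"
    and E': "module R' E'" and W': "module R' W'" and \<mu>': "\<mu>' \<in> linear_maps R' (tensor3 R' E' E' E') W'"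
    and h: "h \<in> ring_hom R R'"
    and f: "f \<in> linear_maps R (direct_sum E W) (restrict_scalars h (direct_sum E' W'))"
    and ft: "\<And>a \<alpha> b \<beta> c. a \<in> carrier (direct_sum E W) \<Longrightarrow> b \<in> carrier (direct_sum E W) \<Longrightarrow> c \<in> carrier (direct_sum E W) \<Longrightarrow>
      \<alpha> \<in> carrier R \<Longrightarrow> \<beta> \<in> carrier R \<Longrightarrow>
      f (tprod (two_step R E W \<mu>) a \<alpha> b \<beta> c) = tprod (two_step R' E' W' \<mu>') (f a) (h \<alpha>) (f b) (h \<beta>) (f c)"
begin

interpretation E: module R E by (rule E)

private abbreviation (input) "A1 \<equiv> two_step R E W \<mu>"
private abbreviation (input) "A2 \<equiv> two_step R' E' W' \<mu>'"
private abbreviation (input) "T1 \<equiv> direct_sum E W"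
private abbreviation (input) "T2 \<equiv> direct_sum E' W'"
private abbreviation (input) "O2 \<equiv> restrict_scalars h (operator_rng R' A2)"

private lemma O2: "module R O2"
  by (rule restrict_scalars_module[OF E.R.is_cring h operator_rng_module[OF E' W' \<mu>']])

private lemma fc: "a \<in> carrier T1 \<Longrightarrow> f a \<in> carrier T2"
  using lin_closed[OF f] by simp

private lemma hc: "\<alpha> \<in> carrier (regular_module R) \<Longrightarrow> h \<alpha> \<in> carrier (regular_module R')"
  using ring_hom_closed[OF h] by simp

private lemma hl: "h \<in> linear_maps R (regular_module R) (restrict_scalars h (regular_module R'))"
  using h by (intro linear_mapsI) (auto simp: ring_hom_closed ring_hom_add ring_hom_mult)

private lemma quad: "quadrilinear_map R T1 (regular_module R) T1 (regular_module R) O2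
    (\<lambda>a \<alpha> b \<beta>. op_class R' A2 (f a) (h \<alpha>) (f b) (h \<beta>))"
proof -
  note q = op_class_quadrilinear[OF E' W' \<mu>']
  show ?thesis
    by (intro quadrilinear_mapI lin_comp[OF f restrict_scalars_lin[OF h quadrilin_1[OF q]]]
      lin_comp[OF hl restrict_scalars_lin[OF h quadrilin_2[OF q]]]
      lin_comp[OF f restrict_scalars_lin[OF h quadrilin_3[OF q]]]
      lin_comp[OF hl restrict_scalars_lin[OF h quadrilin_4[OF q]]] fc hc)
qed

private lemma bal:
  assumes m: "a \<in> carrier T1" "b \<in> carrier T1" "c \<in> carrier T1" "d \<in> carrier T1"
      "\<alpha> \<in> carrier (regular_module R)" "\<beta> \<in> carrier (regular_module R)"
      "\<gamma> \<in> carrier (regular_module R)" "\<delta> \<in> carrier (regular_module R)"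
  shows "op_class R' A2 (f (tprod A1 a \<alpha> b \<beta> c)) (h \<gamma>) (f d) (h \<delta>) =
    op_class R' A2 (f a) (h \<alpha>) (f (tprod A1 b \<beta> c \<gamma> d)) (h \<delta>)"
proof -
  have r: "\<alpha> \<in> carrier R" "\<beta> \<in> carrier R" "\<gamma> \<in> carrier R" "\<delta> \<in> carrier R" using m by auto
  show ?thesis
    unfolding ft[OF m(1-3) r(1,2)] ft[OF m(2-4) r(2,3)]
    by (intro op_class_balanced[OF E' W' \<mu>'] fc hc m)
qed

text \<open>Since \<open>f\<close> intertwines the triple products along \<open>h\<close>, it
  carries the balancing relations of the source to those of the target. The target is regarded as a
  module over \<open>R\<close> through \<open>h\<close>, so the universal property applies.\<close>

lemma operator_hom_lin: "operator_hom R h f h R' A2 \<in> linear_maps R (operator_rng R A1) O2"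
  unfolding operator_hom_def by (rule op_lift_lin[OF E W \<mu> O2 quad bal])

lemma operator_hom_class:
  assumes "a \<in> carrier T1" "\<alpha> \<in> carrier (regular_module R)" "b \<in> carrier T1" "\<beta> \<in> carrier (regular_module R)"
  shows "operator_hom R h f h R' A2 (op_class R A1 a \<alpha> b \<beta>) = op_class R' A2 (f a) (h \<alpha>) (f b) (h \<beta>)"
  unfolding operator_hom_def by (rule op_lift_class[OF E W \<mu> O2 quad bal assms])

end

section \<open>Base change of the operator rng\<close>

lemma int_hom_natural:
  assumes "cring S" "cring S'" "h \<in> ring_hom S S'"
  shows "h (int_hom S n) = int_hom S' n"
proof -
  interpret S: cring S by fact
  interpret S': cring S' by fact
  have c: "int_hom S n \<in> carrier S" "int_hom S' n \<in> carrier S'" by (simp_all add: int_hom_def)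
  have "h (int_hom S n \<otimes>\<^bsub>S\<^esub> \<one>\<^bsub>S\<^esub>) = int_hom S' n \<otimes>\<^bsub>S'\<^esub> h \<one>\<^bsub>S\<^esub>"
    using lin_smult[OF ring_hom_int_alg_lin[OF assms], of n "\<one>\<^bsub>S\<^esub>"] by simp
  then show ?thesis using c by (simp add: ring_hom_one[OF assms(3)])
qed

text \<open>The parameters of a two-step system are ring elements, and classes are linear in them,
  so both can be moved in front. The operator rng is thereby generated by the values of one bilinear
  map in \<open>a\<close> and \<open>b\<close>, and this is the map that base change
  extends.\<close>

lemma op_class_scalars:
  assumes E: "module R E" and W: "module R W" and \<mu>: "\<mu> \<in> linear_maps R (tensor3 R E E E) W"
    and m: "a \<in> carrier (direct_sum E W)" "\<alpha> \<in> carrier R" "b \<in> carrier (direct_sum E W)" "\<beta> \<in> carrier R"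
  shows "op_class R (two_step R E W \<mu>) a \<alpha> b \<beta> =
    (\<alpha> \<otimes>\<^bsub>R\<^esub> \<beta>) \<odot>\<^bsub>operator_rng R (two_step R E W \<mu>)\<^esub> op_class R (two_step R E W \<mu>) a \<one>\<^bsub>R\<^esub> b \<one>\<^bsub>R\<^esub>"
proof -
  interpret E: module R E by fact
  interpret O: module R "operator_rng R (two_step R E W \<mu>)" by (rule operator_rng_module[OF E W \<mu>])
  note q = op_class_quadrilinear[OF E W \<mu>]
  have g: "\<alpha> \<in> carrier (regular_module R)" "\<beta> \<in> carrier (regular_module R)" "\<one>\<^bsub>R\<^esub> \<in> carrier (regular_module R)"
    using m by auto
  show ?thesis
    using lin_smult[OF quadrilin_2[OF q m(1,3) g(2)] m(2) g(3)] lin_smult[OF quadrilin_4[OF q m(1) g(3) m(3)] m(4) g(3)]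
      m quadrilin_closed[OF q m(1) g(3) m(3) g(3)] by (simp add: O.smult_assoc1)
qed

context
  fixes E :: "(int, 'e) module" and W :: "(int, 'w) module" and \<mu> :: "(int, 'e) cube \<Rightarrow> 'w"
  assumes E: "module \<Z> E" and W: "module \<Z> W" and \<mu>: "\<mu> \<in> linear_maps \<Z> (tensor3 \<Z> E E E) W"
begin

private abbreviation (input) "TZ \<equiv> direct_sum E W"
private abbreviation (input) "AZ \<equiv> two_step \<Z> E W \<mu>"
private abbreviation (input) "OZ \<equiv> operator_rng \<Z> AZ"

interpretation E: module \<Z> E by (rule E)
interpretation W: module \<Z> W by (rule W)

private lemma TZ: "module \<Z> TZ" by (rule direct_sum_module[OF E W])
private lemma OZ: "module \<Z> OZ" by (rule operator_rng_module[OF E W \<mu>])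

text \<open>The regular representation kills \<open>W\<close> and takes values in \<open>W\<close>,
  so nothing is lost by recording only the induced map from \<open>E\<close> to \<open>W\<close>. In
  this form it can be compared with \<open>Theta\<close>.\<close>

definition "visible_rep X = (\<lambda>e\<in>carrier E. snd (regular_rep \<Z> AZ X (e, \<zero>\<^bsub>W\<^esub>)))"

private lemma rep_T: "X \<in> carrier OZ \<Longrightarrow> regular_rep \<Z> AZ X \<in> linear_maps \<Z> TZ TZ"
  using lin_closed[OF regular_rep_lin[OF E W \<mu>]] by simp

lemma visible_rep_lin: "visible_rep \<in> linear_maps \<Z> OZ (Hom_module \<Z> E W)"
  unfolding visible_rep_def
proof (rule lin_into_Hom[OF E OZ])
  show "(\<lambda>e. snd (regular_rep \<Z> AZ X (e, \<zero>\<^bsub>W\<^esub>))) \<in> linear_maps \<Z> E W" if "X \<in> carrier OZ" for X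
    by (rule lin_comp[OF lin_comp[OF direct_sum_inj(1)[OF E W] rep_T[OF that]] direct_sum_proj(2)])
  show "(\<lambda>X. snd (regular_rep \<Z> AZ X (e, \<zero>\<^bsub>W\<^esub>))) \<in> linear_maps \<Z> OZ W" if "e \<in> carrier E" for e
    by (rule lin_comp[OF lin_comp[OF regular_rep_lin[OF E W \<mu>] Hom_eval_lin] direct_sum_proj(2)]) (use that in simp)
qed

lemma visible_rep_class:
  assumes "a \<in> carrier TZ" "b \<in> carrier TZ" "e \<in> carrier E"
  shows "visible_rep (op_class \<Z> AZ a \<alpha> b \<beta>) e = (\<alpha> * \<beta>) \<odot>\<^bsub>W\<^esub> tri \<Z> E \<mu> (fst a) (fst b) e"
  using assms regular_rep_class[OF E W \<mu> assms(1) _ assms(2), of \<alpha> \<beta>]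
  by (simp add: visible_rep_def tprod_eq[OF E W \<mu>])

lemma visible_rep_eval_lin:
  assumes "e \<in> carrier E" shows "(\<lambda>X. visible_rep X e) \<in> linear_maps \<Z> OZ W"
  by (rule lin_comp[OF visible_rep_lin Hom_eval_lin[OF assms]])

lemma regular_rep_eq:
  assumes "X \<in> carrier OZ" "e \<in> carrier E" "w \<in> carrier W"
  shows "regular_rep \<Z> AZ X (e, w) = (\<zero>\<^bsub>E\<^esub>, visible_rep X e)"
proof -
  have ew: "(e, w) \<in> carrier TZ" using assms by simp
  show ?thesis
    by (rule op_lin_eqI[OF E W \<mu> lin_comp[OF regular_rep_lin[OF E W \<mu>] Hom_eval_lin[OF ew]]
          lin_comp[OF visible_rep_eval_lin[OF assms(2)] direct_sum_inj(2)[OF E W]] _ assms(1)])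
      (use assms in \<open>auto simp: regular_rep_class[OF E W \<mu>] visible_rep_class tprod_eq[OF E W \<mu>]\<close>)
qed

lemma regular_rep_zero_iff:
  assumes X: "X \<in> carrier OZ"
  shows "regular_rep \<Z> AZ X = \<zero>\<^bsub>Hom_module \<Z> TZ TZ\<^esub> \<longleftrightarrow> visible_rep X = \<zero>\<^bsub>Hom_module \<Z> E W\<^esub>"
proof
  assume "regular_rep \<Z> AZ X = \<zero>\<^bsub>Hom_module \<Z> TZ TZ\<^esub>"
  then show "visible_rep X = \<zero>\<^bsub>Hom_module \<Z> E W\<^esub>"
    by (auto simp: visible_rep_def intro!: restrict_ext)
next
  assume z: "visible_rep X = \<zero>\<^bsub>Hom_module \<Z> E W\<^esub>"
  show "regular_rep \<Z> AZ X = \<zero>\<^bsub>Hom_module \<Z> TZ TZ\<^esub>"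
  proof (rule extensionalityI)
    show "regular_rep \<Z> AZ X \<in> extensional (carrier TZ)"
      using lin_closed[OF regular_rep_lin[OF E W \<mu>] X] by simp
    show "regular_rep \<Z> AZ X p = \<zero>\<^bsub>Hom_module \<Z> TZ TZ\<^esub> p" if "p \<in> carrier TZ" for p
      using that by (cases p) (simp add: regular_rep_eq[OF X] z)
  qed simp
qed

section \<open>The operator rng commutes with base change\<close>

context
  fixes S :: "'s ring"
  assumes S: "cring S"
begin

private abbreviation (input) "I0 \<equiv> int_alg S"
private abbreviation (input) "ES \<equiv> base_change E S"
private abbreviation (input) "WS \<equiv> base_change W S"
private abbreviation (input) "TS \<equiv> direct_sum ES WS"
private abbreviation (input) "mS \<equiv> base_change_mu E W \<mu> S"
private abbreviation (input) "AS \<equiv> two_step S ES WS mS"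
private abbreviation (input) "OS \<equiv> operator_rng S AS"
private abbreviation (input) "h0 \<equiv> int_hom S"
private abbreviation (input) "c0 \<equiv> (\<lambda>p. (pure \<Z> E I0 (fst p) \<one>\<^bsub>S\<^esub>, pure \<Z> W I0 (snd p) \<one>\<^bsub>S\<^esub>))"
private abbreviation (input) "H0 \<equiv> operator_hom \<Z> h0 c0 h0 S AS"
private abbreviation (input) "B0 \<equiv> operator_base_change E W \<mu> S"

interpretation S: cring S by (rule S)

private lemma I0: "module \<Z> I0" by (rule int_alg_module[OF S])
private lemma ES: "module S ES" by (rule base_change_module[OF S E])
private lemma WS: "module S WS" by (rule base_change_module[OF S W])
private lemma TS: "module S TS" by (rule direct_sum_module[OF ES WS])
private lemma mS: "mS \<in> linear_maps S (tensor3 S ES ES ES) WS" by (rule base_change_mu_lin[OF E W \<mu> S])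
private lemma OS: "module S OS" by (rule operator_rng_module[OF ES WS mS])
private lemma OI: "module S (base_change OZ S)" by (rule base_change_module[OF S OZ])
private lemma h0: "h0 \<in> ring_hom \<Z> S" by (rule int_hom_ring_hom[OF S])
private lemma h0_closed: "h0 n \<in> carrier S" using ring_hom_closed[OF h0] by simp
private lemma h0_mult: "h0 (m * n) = h0 m \<otimes>\<^bsub>S\<^esub> h0 n" using ring_hom_mult[OF h0, of m n] by simp
private lemma one_G: "\<one>\<^bsub>S\<^esub> \<in> carrier (regular_module S)" by simp

lemma two_step_over_eq: "two_step_over E W \<mu> S = AS"
  by (simp add: two_step_over_def)

private lemma pE: "x \<in> carrier E \<Longrightarrow> pure \<Z> E I0 x \<one>\<^bsub>S\<^esub> \<in> carrier ES"
  by (rule base_change_pure_closed[OF S E _ S.one_closed])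

private lemma pW: "x \<in> carrier W \<Longrightarrow> pure \<Z> W I0 x \<one>\<^bsub>S\<^esub> \<in> carrier WS"
  by (rule base_change_pure_closed[OF S W _ S.one_closed])

lemma unit_map_closed: "p \<in> carrier TZ \<Longrightarrow> c0 p \<in> carrier TS"
  using pE pW by (auto simp: mem_Times_iff simp del: base_change_simps)

lemma unit_map_lin: "c0 \<in> linear_maps \<Z> TZ (restrict_scalars h0 TS)"
proof (rule int_additive_lin[OF TZ restrict_scalars_module[OF int_is_cring h0 TS]])
  show "c0 p \<in> carrier (restrict_scalars h0 TS)" if "p \<in> carrier TZ" for p
    using unit_map_closed[OF that] by simp
  show "c0 (p \<oplus>\<^bsub>TZ\<^esub> q) = c0 p \<oplus>\<^bsub>restrict_scalars h0 TS\<^esub> c0 q"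
    if "p \<in> carrier TZ" "q \<in> carrier TZ" for p q
    using that lin_add[OF pure_one_lin[OF S E]] lin_add[OF pure_one_lin[OF S W]] by auto
qed

text \<open>Over \<open>S\<close> the product of unit vectors is the unit vector of the integral
  product. Only the \<open>E\<close>-component of \<open>r\<close> is prescribed, since the
  \<open>W\<close>-component does not enter; this allows the arbitrary second component
  \<open>y\<close> in \<open>regular_rep_base_change\<close>.\<close>

lemma base_change_tprod:
  assumes "fst p \<in> carrier E" "fst q \<in> carrier E" "e \<in> carrier E" "fst r = pure \<Z> E I0 e \<one>\<^bsub>S\<^esub>"
  shows "tprod AS (c0 p) (h0 m) (c0 q) (h0 n) r =
    (\<zero>\<^bsub>ES\<^esub>, pure \<Z> W I0 ((m * n) \<odot>\<^bsub>W\<^esub> tri \<Z> E \<mu> (fst p) (fst q) e) \<one>\<^bsub>S\<^esub>)"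
proof -
  have t: "tri \<Z> E \<mu> (fst p) (fst q) e \<in> carrier W" by (rule tri_closed[OF E W \<mu> assms(1-3)])
  have "pure \<Z> W I0 ((m * n) \<odot>\<^bsub>W\<^esub> tri \<Z> E \<mu> (fst p) (fst q) e) \<one>\<^bsub>S\<^esub> =
      h0 (m * n) \<odot>\<^bsub>WS\<^esub> pure \<Z> W I0 (tri \<Z> E \<mu> (fst p) (fst q) e) \<one>\<^bsub>S\<^esub>"
    using lin_smult[OF pure_one_lin[OF S W], of "m * n", OF _ t] by simp
  moreover have "tri S ES mS (pure \<Z> E I0 (fst p) \<one>\<^bsub>S\<^esub>) (pure \<Z> E I0 (fst q) \<one>\<^bsub>S\<^esub>) (pure \<Z> E I0 e \<one>\<^bsub>S\<^esub>) =
      pure \<Z> W I0 (tri \<Z> E \<mu> (fst p) (fst q) e) \<one>\<^bsub>S\<^esub>"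
    using tri_base_change_mu[OF E W \<mu> S assms(1-3) S.one_closed S.one_closed S.one_closed] by simp
  ultimately show ?thesis
    by (simp add: tprod_eq[OF ES WS mS] assms(4) h0_mult del: base_change_simps)
qed

lemma unit_map_tprod:
  assumes "a \<in> carrier TZ" "b \<in> carrier TZ" "x \<in> carrier TZ" "\<alpha> \<in> carrier \<Z>" "\<beta> \<in> carrier \<Z>"
  shows "c0 (tprod AZ a \<alpha> b \<beta> x) = tprod AS (c0 a) (h0 \<alpha>) (c0 b) (h0 \<beta>) (c0 x)"
proof -
  have m: "fst a \<in> carrier E" "fst b \<in> carrier E" "fst x \<in> carrier E" using assms by auto
  have "pure \<Z> E I0 \<zero>\<^bsub>E\<^esub> \<one>\<^bsub>S\<^esub> = \<zero>\<^bsub>ES\<^esub>"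
    using tensor_zero(2)[OF E I0 E.zero_closed, of "\<one>\<^bsub>S\<^esub>"] by simp
  then show ?thesis
    by (simp add: base_change_tprod[OF m] tprod_eq[OF E W \<mu>] del: base_change_simps)
qed

lemma unit_hom_lin: "H0 \<in> linear_maps \<Z> OZ (restrict_scalars h0 OS)"
  by (rule operator_hom_lin[OF E W \<mu> ES WS mS h0 unit_map_lin unit_map_tprod])

lemma unit_hom_class:
  assumes "a \<in> carrier TZ" "b \<in> carrier TZ"
  shows "H0 (op_class \<Z> AZ a \<alpha> b \<beta>) = op_class S AS (c0 a) (h0 \<alpha>) (c0 b) (h0 \<beta>)"
  by (rule operator_hom_class[OF E W \<mu> ES WS mS h0 unit_map_lin unit_map_tprod assms(1) _ assms(2)]) simp_all

lemma operator_base_change_lin: "B0 \<in> linear_maps S (base_change OZ S) OS"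
  unfolding operator_base_change_def Let_def two_step_over_eq by (rule base_change_lift_lin[OF S OZ OS unit_hom_lin])

lemma operator_base_change_pure:
  "X \<in> carrier OZ \<Longrightarrow> s \<in> carrier S \<Longrightarrow> B0 (pure \<Z> OZ I0 X s) = s \<odot>\<^bsub>OS\<^esub> H0 X"
  unfolding operator_base_change_def Let_def two_step_over_eq by (rule base_change_lift_pure[OF S OZ OS unit_hom_lin])

lemma operator_base_change_unit:
  assumes "X \<in> carrier OZ" shows "B0 (pure \<Z> OZ I0 X \<one>\<^bsub>S\<^esub>) = H0 X"
proof -
  interpret OS: module S OS by (rule OS)
  show ?thesis
    using operator_base_change_pure[OF assms S.one_closed] lin_closed[OF unit_hom_lin assms] by simp
qed

text \<open>The space over \<open>S\<close> is the sum of two base changes and not itself a base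
  change, so generation by the unit vectors \<open>c0 p\<close> is shown on each summand, testing
  with \<open>p\<close> of the form \<open>(x, 0)\<close> and \<open>(0, y)\<close>.\<close>

lemma direct_sum_base_change_lin_eqI:
  assumes f: "f \<in> linear_maps S TS P" and g: "g \<in> linear_maps S TS P" and P: "module S P"
    and eq: "\<And>p. p \<in> carrier TZ \<Longrightarrow> f (c0 p) = g (c0 p)" and A: "A \<in> carrier TS"
  shows "f A = g A"
proof -
  obtain X Y where XY: "A = (X, Y)" "X \<in> carrier ES" "Y \<in> carrier WS" using A by (cases A) auto
  interpret ES: module S ES by (rule ES)
  interpret WS: module S WS by (rule WS)
  have zE: "pure \<Z> E I0 \<zero>\<^bsub>E\<^esub> \<one>\<^bsub>S\<^esub> = \<zero>\<^bsub>ES\<^esub>" and zW: "pure \<Z> W I0 \<zero>\<^bsub>W\<^esub> \<one>\<^bsub>S\<^esub> = \<zero>\<^bsub>WS\<^esub>"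
    using tensor_zero(2)[OF E I0 E.zero_closed, of "\<one>\<^bsub>S\<^esub>"] tensor_zero(2)[OF W I0 W.zero_closed, of "\<one>\<^bsub>S\<^esub>"] by simp_all
  have 1: "f (X, \<zero>\<^bsub>WS\<^esub>) = g (X, \<zero>\<^bsub>WS\<^esub>)"
    by (rule base_change_lin_eqI[OF S E lin_comp[OF direct_sum_inj(1)[OF ES WS] f]
      lin_comp[OF direct_sum_inj(1)[OF ES WS] g] _ XY(2)])
      (use eq[of "(_, \<zero>\<^bsub>W\<^esub>)"] in \<open>simp add: zW del: base_change_simps\<close>)
  have 2: "f (\<zero>\<^bsub>ES\<^esub>, Y) = g (\<zero>\<^bsub>ES\<^esub>, Y)"
    by (rule base_change_lin_eqI[OF S W lin_comp[OF direct_sum_inj(2)[OF ES WS] f]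
      lin_comp[OF direct_sum_inj(2)[OF ES WS] g] _ XY(3)])
      (use eq[of "(\<zero>\<^bsub>E\<^esub>, _)"] in \<open>simp add: zE del: base_change_simps\<close>)
  have A': "A = (X, \<zero>\<^bsub>WS\<^esub>) \<oplus>\<^bsub>TS\<^esub> (\<zero>\<^bsub>ES\<^esub>, Y)"
    using XY by (simp del: base_change_simps)
  have c: "(X, \<zero>\<^bsub>WS\<^esub>) \<in> carrier TS" "(\<zero>\<^bsub>ES\<^esub>, Y) \<in> carrier TS"
    using XY by (simp_all del: base_change_simps)
  show ?thesis
    unfolding A' lin_add[OF f c] lin_add[OF g c] 1 2 ..
qed

text \<open>The identification of \<open>(E \<otimes> S) \<oplus> (W \<otimes> S)\<close> with
  \<open>(E \<oplus> W) \<otimes> S\<close>, in the direction that the inverse of \<open>B0\<close>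
  requires.\<close>

private abbreviation (input) "sum_map \<equiv> \<lambda>A. tensor_map \<Z> TZ I0 (\<lambda>x. (x, \<zero>\<^bsub>W\<^esub>)) (\<lambda>s. s) (fst A) \<oplus>\<^bsub>base_change TZ S\<^esub>
    tensor_map \<Z> TZ I0 (\<lambda>y. (\<zero>\<^bsub>E\<^esub>, y)) (\<lambda>s. s) (snd A)"

private lemma sum_map_lin: "sum_map \<in> linear_maps S TS (base_change TZ S)"
  by (intro lin_sum base_change_module S TZ lin_comp[OF direct_sum_proj(1)] lin_comp[OF direct_sum_proj(2)]
    base_change_map_lin E W direct_sum_inj)

private lemma sum_map_unit:
  assumes "p \<in> carrier TZ" shows "sum_map (c0 p) = pure \<Z> TZ I0 p \<one>\<^bsub>S\<^esub>"
proof -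
  have m: "fst p \<in> carrier E" "snd p \<in> carrier W" using assms by auto
  have one: "\<one>\<^bsub>S\<^esub> \<in> carrier I0" by simp
  have c: "(fst p, \<zero>\<^bsub>W\<^esub>) \<in> carrier TZ" "(\<zero>\<^bsub>E\<^esub>, snd p) \<in> carrier TZ" using m by auto
  have "sum_map (c0 p) = pure \<Z> TZ I0 (fst p, \<zero>\<^bsub>W\<^esub>) \<one>\<^bsub>S\<^esub> \<oplus>\<^bsub>base_change TZ S\<^esub> pure \<Z> TZ I0 (\<zero>\<^bsub>E\<^esub>, snd p) \<one>\<^bsub>S\<^esub>"
    by (simp only: fst_conv snd_conv tensor_map_pure[OF E I0 TZ I0 direct_sum_inj(1)[OF E W] lin_id m(1) one]
      tensor_map_pure[OF W I0 TZ I0 direct_sum_inj(2)[OF E W] lin_id m(2) one])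
  also have "\<dots> = pure \<Z> TZ I0 ((fst p, \<zero>\<^bsub>W\<^esub>) \<oplus>\<^bsub>TZ\<^esub> (\<zero>\<^bsub>E\<^esub>, snd p)) \<one>\<^bsub>S\<^esub>"
    using lin_add[OF pure_one_lin[OF S TZ] c] by simp
  also have "\<dots> = pure \<Z> TZ I0 p \<one>\<^bsub>S\<^esub>" using m by simp
  finally show ?thesis .
qed

text \<open>Construction of the inverse of \<open>B0\<close>. The integral bilinear map
  \<open>cls\<close> is extended to \<open>S\<close> as \<open>G0\<close>, moved to the space over
  \<open>S\<close> as \<open>g0\<close>, and given its parameters back as scalars in
  \<open>g4\<close>; once \<open>g4\<close> is known to be balanced it descends to the operator rng
  over \<open>S\<close>.\<close>

private abbreviation (input) "cls \<equiv> \<lambda>p q. pure \<Z> OZ I0 (op_class \<Z> AZ p 1 q 1) \<one>\<^bsub>S\<^esub>"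
private abbreviation (input) "G0 \<equiv> base_change_bilinear S (base_change OZ S) cls"
private abbreviation (input) "g0 \<equiv> \<lambda>A B. G0 (sum_map A) (sum_map B)"
private abbreviation (input) "g4 \<equiv> \<lambda>A \<alpha> B \<beta>. (\<alpha> \<otimes>\<^bsub>S\<^esub> \<beta>) \<odot>\<^bsub>base_change OZ S\<^esub> g0 A B"
private abbreviation (input) "inv0 \<equiv> op_lift S (base_change OZ S) g4"

private lemma cls_bil: "bilinear_map \<Z> TZ TZ (restrict_scalars h0 (base_change OZ S)) cls"
  by (intro bilinear_mapI lin_comp[OF quadrilin_1[OF op_class_quadrilinear[OF E W \<mu>]] pure_one_lin[OF S OZ]]
    lin_comp[OF quadrilin_3[OF op_class_quadrilinear[OF E W \<mu>]] pure_one_lin[OF S OZ]]) simp_all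

private lemma g0_bil: "bilinear_map S TS TS (base_change OZ S) g0"
proof -
  note b = base_change_bilinear_bilinear[OF S TZ TZ OI cls_bil]
  show ?thesis
    by (intro bilinear_mapI lin_comp[OF sum_map_lin bilin_right[OF b]] lin_comp[OF sum_map_lin bilin_left[OF b]]
      lin_closed[OF sum_map_lin])
qed

private lemma g0_unit:
  assumes "p \<in> carrier TZ" "q \<in> carrier TZ"
  shows "g0 (c0 p) (c0 q) = cls p q"
  unfolding sum_map_unit[OF assms(1)] sum_map_unit[OF assms(2)]
  by (rule base_change_bilinear_pure[OF S TZ TZ OI cls_bil assms])

private lemma mult_regular_lin:
  assumes "\<beta> \<in> carrier S"
  shows "(\<lambda>\<alpha>. \<alpha> \<otimes>\<^bsub>S\<^esub> \<beta>) \<in> linear_maps S (regular_module S) (regular_module S)"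
    "(\<lambda>\<alpha>. \<beta> \<otimes>\<^bsub>S\<^esub> \<alpha>) \<in> linear_maps S (regular_module S) (regular_module S)"
  using assms by (auto intro!: linear_mapsI simp: S.l_distr S.r_distr S.m_ac)

private lemma g4_quad: "quadrilinear_map S TS (regular_module S) TS (regular_module S) (base_change OZ S) g4"
proof (rule quadrilinear_mapI)
  show "(\<lambda>A. g4 A \<alpha> B \<beta>) \<in> linear_maps S TS (base_change OZ S)"
    if "\<alpha> \<in> carrier (regular_module S)" "B \<in> carrier TS" "\<beta> \<in> carrier (regular_module S)" for \<alpha> B \<beta>
    by (rule lin_scale[OF OI bilin_left[OF g0_bil that(2)]]) (use that in simp)
  show "(\<lambda>B. g4 A \<alpha> B \<beta>) \<in> linear_maps S TS (base_change OZ S)"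
    if "A \<in> carrier TS" "\<alpha> \<in> carrier (regular_module S)" "\<beta> \<in> carrier (regular_module S)" for A \<alpha> \<beta>
    by (rule lin_scale[OF OI bilin_right[OF g0_bil that(1)]]) (use that in simp)
  show "(\<lambda>\<alpha>. g4 A \<alpha> B \<beta>) \<in> linear_maps S (regular_module S) (base_change OZ S)"
    if "A \<in> carrier TS" "B \<in> carrier TS" "\<beta> \<in> carrier (regular_module S)" for A B \<beta>
    by (rule lin_comp[OF mult_regular_lin(1) lin_scalar_mult[OF OI bilin_closed[OF g0_bil that(1,2)]]]) (use that in simp)
  show "(\<lambda>\<beta>. g4 A \<alpha> B \<beta>) \<in> linear_maps S (regular_module S) (base_change OZ S)"
    if "A \<in> carrier TS" "\<alpha> \<in> carrier (regular_module S)" "B \<in> carrier TS" for A \<alpha> B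
    by (rule lin_comp[OF mult_regular_lin(2) lin_scalar_mult[OF OI bilin_closed[OF g0_bil that(1,3)]]]) (use that in simp)
qed

text \<open>Both sides are linear over \<open>S\<close> in each of the four arguments. With unit
  vectors everywhere the identity is \<open>op_class_balanced\<close> over the integers, and the
  facts \<open>0\<close> to \<open>3\<close> together with the final step release the arguments one
  by one.\<close>

private lemma g0_tprod_swap:
  assumes m: "A \<in> carrier TS" "B \<in> carrier TS" "C \<in> carrier TS" "D \<in> carrier TS"
  shows "g0 (tprod AS A \<one>\<^bsub>S\<^esub> B \<one>\<^bsub>S\<^esub> C) D = g0 A (tprod AS B \<one>\<^bsub>S\<^esub> C \<one>\<^bsub>S\<^esub> D)"
proof -
  note t1 = tprod_lin_1[OF ES WS mS one_G one_G] and t3 = tprod_lin_3[OF ES WS mS one_G one_G]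
    and t5 = tprod_lin_5[OF ES WS mS one_G one_G]
  have tc: "tprod AS A \<one>\<^bsub>S\<^esub> B \<one>\<^bsub>S\<^esub> C \<in> carrier TS"
    if "A \<in> carrier TS" "B \<in> carrier TS" "C \<in> carrier TS" for A B C
    by (rule tprod_closed[OF ES WS mS that(1) one_G that(2) one_G that(3)])
  note gl = bilin_left[OF g0_bil] and gr = bilin_right[OF g0_bil] and u = unit_map_closed
  have ct: "tprod AS (c0 p) \<one>\<^bsub>S\<^esub> (c0 q) \<one>\<^bsub>S\<^esub> (c0 r) = c0 (tprod AZ p 1 q 1 r)"
    if "p \<in> carrier TZ" "q \<in> carrier TZ" "r \<in> carrier TZ" for p q r
    using unit_map_tprod[OF that, of 1 1] ring_hom_one[OF h0] by simp
  have tz: "tprod AZ p 1 q 1 r \<in> carrier TZ"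
    if "p \<in> carrier TZ" "q \<in> carrier TZ" "r \<in> carrier TZ" for p q r
    by (rule tprod_closed[OF E W \<mu> that(1) _ that(2) _ that(3)]) simp_all
  have 0: "g0 (tprod AS (c0 p) \<one>\<^bsub>S\<^esub> (c0 q) \<one>\<^bsub>S\<^esub> (c0 r)) (c0 d) = g0 (c0 p) (tprod AS (c0 q) \<one>\<^bsub>S\<^esub> (c0 r) \<one>\<^bsub>S\<^esub> (c0 d))"
    if m: "p \<in> carrier TZ" "q \<in> carrier TZ" "r \<in> carrier TZ" "d \<in> carrier TZ" for p q r d
  proof -
    have "op_class \<Z> AZ (tprod AZ p 1 q 1 r) 1 d 1 = op_class \<Z> AZ p 1 (tprod AZ q 1 r 1 d) 1"
      by (rule op_class_balanced[OF E W \<mu> m]) simp_all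
    then show ?thesis
      by (simp only: ct[OF m(1-3)] ct[OF m(2-4)] g0_unit[OF tz[OF m(1-3)] m(4)] g0_unit[OF m(1) tz[OF m(2-4)]])
  qed
  have 1: "g0 (tprod AS A \<one>\<^bsub>S\<^esub> (c0 q) \<one>\<^bsub>S\<^esub> (c0 r)) (c0 d) = g0 A (tprod AS (c0 q) \<one>\<^bsub>S\<^esub> (c0 r) \<one>\<^bsub>S\<^esub> (c0 d))"
    if m: "A \<in> carrier TS" "q \<in> carrier TZ" "r \<in> carrier TZ" "d \<in> carrier TZ" for A q r d
    by (rule direct_sum_base_change_lin_eqI[OF lin_comp[OF t1[OF u[OF m(2)] u[OF m(3)]] gl[OF u[OF m(4)]]]
      gl[OF tc[OF u[OF m(2)] u[OF m(3)] u[OF m(4)]]] OI 0[OF _ m(2-4)] m(1)])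
  have 2: "g0 (tprod AS A \<one>\<^bsub>S\<^esub> B \<one>\<^bsub>S\<^esub> (c0 r)) (c0 d) = g0 A (tprod AS B \<one>\<^bsub>S\<^esub> (c0 r) \<one>\<^bsub>S\<^esub> (c0 d))"
    if m: "A \<in> carrier TS" "B \<in> carrier TS" "r \<in> carrier TZ" "d \<in> carrier TZ" for A B r d
    by (rule direct_sum_base_change_lin_eqI[OF lin_comp[OF t3[OF m(1) u[OF m(3)]] gl[OF u[OF m(4)]]]
      lin_comp[OF t1[OF u[OF m(3)] u[OF m(4)]] gr[OF m(1)]] OI 1[OF m(1) _ m(3-4)] m(2)])
  have 3: "g0 (tprod AS A \<one>\<^bsub>S\<^esub> B \<one>\<^bsub>S\<^esub> C) (c0 d) = g0 A (tprod AS B \<one>\<^bsub>S\<^esub> C \<one>\<^bsub>S\<^esub> (c0 d))"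
    if m: "A \<in> carrier TS" "B \<in> carrier TS" "C \<in> carrier TS" "d \<in> carrier TZ" for A B C d
    by (rule direct_sum_base_change_lin_eqI[OF lin_comp[OF t5[OF m(1,2)] gl[OF u[OF m(4)]]]
      lin_comp[OF t3[OF m(2) u[OF m(4)]] gr[OF m(1)]] OI 2[OF m(1,2) _ m(4)] m(3)])
  show ?thesis
    by (rule direct_sum_base_change_lin_eqI[OF gr[OF tc[OF m(1-3)]]
      lin_comp[OF t5[OF m(2,3)] gr[OF m(1)]] OI 3[OF m(1-3)] m(4)])
qed

private lemma tprod_scalars:
  assumes "A \<in> carrier TS" "\<alpha> \<in> carrier S" "B \<in> carrier TS" "\<beta> \<in> carrier S" "C \<in> carrier TS"
  shows "tprod AS A \<alpha> B \<beta> C = (\<alpha> \<otimes>\<^bsub>S\<^esub> \<beta>) \<odot>\<^bsub>TS\<^esub> tprod AS A \<one>\<^bsub>S\<^esub> B \<one>\<^bsub>S\<^esub> C"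
proof -
  interpret WS: module S WS by (rule WS)
  interpret ES: module S ES by (rule ES)
  have "fst A \<in> carrier ES" "fst B \<in> carrier ES" "fst C \<in> carrier ES" using assms by auto
  then have "tri S ES mS (fst A) (fst B) (fst C) \<in> carrier WS" by (rule tri_closed[OF ES WS mS])
  then show ?thesis using assms(2,4) by (simp add: tprod_eq[OF ES WS mS] del: base_change_simps)
qed

text \<open>On the left \<open>\<gamma> \<delta>\<close> stands in front and
  \<open>\<alpha> \<beta>\<close> comes out of the product; on the right these are
  \<open>\<alpha> \<delta>\<close> and \<open>\<beta> \<gamma>\<close>. Commutativity of
  \<open>S\<close> makes the totals agree, and what remains is \<open>g0_tprod_swap\<close>.\<close>

private lemma g4_bal:
  assumes m: "a \<in> carrier TS" "b \<in> carrier TS" "c \<in> carrier TS" "d \<in> carrier TS"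
    "\<alpha> \<in> carrier (regular_module S)" "\<beta> \<in> carrier (regular_module S)"
    "\<gamma> \<in> carrier (regular_module S)" "\<delta> \<in> carrier (regular_module S)"
  shows "g4 (tprod AS a \<alpha> b \<beta> c) \<gamma> d \<delta> = g4 a \<alpha> (tprod AS b \<beta> c \<gamma> d) \<delta>"
proof -
  interpret OI: module S "base_change OZ S" by (rule OI)
  have s: "\<alpha> \<in> carrier S" "\<beta> \<in> carrier S" "\<gamma> \<in> carrier S" "\<delta> \<in> carrier S" using m by auto
  have tc: "tprod AS A \<one>\<^bsub>S\<^esub> B \<one>\<^bsub>S\<^esub> C \<in> carrier TS"
    if "A \<in> carrier TS" "B \<in> carrier TS" "C \<in> carrier TS" for A B C
    by (rule tprod_closed[OF ES WS mS that(1) one_G that(2) one_G that(3)])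
  note c = bilin_closed[OF g0_bil m(1) tc[OF m(2-4)]]
  have "g4 (tprod AS a \<alpha> b \<beta> c) \<gamma> d \<delta> = (\<gamma> \<otimes>\<^bsub>S\<^esub> \<delta>) \<odot>\<^bsub>base_change OZ S\<^esub> ((\<alpha> \<otimes>\<^bsub>S\<^esub> \<beta>) \<odot>\<^bsub>base_change OZ S\<^esub>
      g0 (tprod AS a \<one>\<^bsub>S\<^esub> b \<one>\<^bsub>S\<^esub> c) d)"
    unfolding tprod_scalars[OF m(1) s(1) m(2) s(2) m(3)]
    by (subst lin_smult[OF bilin_left[OF g0_bil m(4)] _ tc[OF m(1-3)]]) (use s in simp_all)
  also have "\<dots> = (\<gamma> \<otimes>\<^bsub>S\<^esub> \<delta>) \<odot>\<^bsub>base_change OZ S\<^esub> ((\<alpha> \<otimes>\<^bsub>S\<^esub> \<beta>) \<odot>\<^bsub>base_change OZ S\<^esub>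
      g0 a (tprod AS b \<one>\<^bsub>S\<^esub> c \<one>\<^bsub>S\<^esub> d))"
    unfolding g0_tprod_swap[OF m(1-4)] ..
  also have "\<dots> = ((\<gamma> \<otimes>\<^bsub>S\<^esub> \<delta>) \<otimes>\<^bsub>S\<^esub> (\<alpha> \<otimes>\<^bsub>S\<^esub> \<beta>)) \<odot>\<^bsub>base_change OZ S\<^esub> g0 a (tprod AS b \<one>\<^bsub>S\<^esub> c \<one>\<^bsub>S\<^esub> d)"
    by (rule OI.smult_assoc1[symmetric]) (use s c in simp_all)
  also have "(\<gamma> \<otimes>\<^bsub>S\<^esub> \<delta>) \<otimes>\<^bsub>S\<^esub> (\<alpha> \<otimes>\<^bsub>S\<^esub> \<beta>) = (\<alpha> \<otimes>\<^bsub>S\<^esub> \<delta>) \<otimes>\<^bsub>S\<^esub> (\<beta> \<otimes>\<^bsub>S\<^esub> \<gamma>)"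
    using s by (simp add: S.m_ac)
  also have "\<dots> \<odot>\<^bsub>base_change OZ S\<^esub> g0 a (tprod AS b \<one>\<^bsub>S\<^esub> c \<one>\<^bsub>S\<^esub> d) =
      (\<alpha> \<otimes>\<^bsub>S\<^esub> \<delta>) \<odot>\<^bsub>base_change OZ S\<^esub> ((\<beta> \<otimes>\<^bsub>S\<^esub> \<gamma>) \<odot>\<^bsub>base_change OZ S\<^esub> g0 a (tprod AS b \<one>\<^bsub>S\<^esub> c \<one>\<^bsub>S\<^esub> d))"
    by (rule OI.smult_assoc1) (use s c in simp_all)
  also have "\<dots> = g4 a \<alpha> (tprod AS b \<beta> c \<gamma> d) \<delta>"
    unfolding tprod_scalars[OF m(2) s(2) m(3) s(3) m(4)]
    by (subst lin_smult[OF bilin_right[OF g0_bil m(1)] _ tc[OF m(2-4)]]) (use s in simp_all)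
  finally show ?thesis .
qed

private lemma inv0_lin: "inv0 \<in> linear_maps S OS (base_change OZ S)"
  by (rule op_lift_lin[OF ES WS mS OI g4_quad g4_bal])

private lemma inv0_class:
  assumes "A \<in> carrier TS" "\<alpha> \<in> carrier S" "B \<in> carrier TS" "\<beta> \<in> carrier S"
  shows "inv0 (op_class S AS A \<alpha> B \<beta>) = g4 A \<alpha> B \<beta>"
  by (rule op_lift_class[OF ES WS mS OI g4_quad g4_bal]) (use assms in \<open>simp_all del: direct_sum_simps\<close>)

text \<open>Two generating sets are used in succession: the elements \<open>X \<otimes> 1\<close>,
  and then the integral classes for \<open>X\<close>. Their integral parameters reappear as the
  scalar \<open>h0 (\<alpha> * \<beta>)\<close>, which the tensor product moves back to the left
  factor.\<close>

private lemma inv0_B0: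
  assumes "Y \<in> carrier (base_change OZ S)" shows "inv0 (B0 Y) = Y"
proof (rule base_change_lin_eqI[OF S OZ lin_comp[OF operator_base_change_lin inv0_lin] lin_id _ assms])
  fix X assume X: "X \<in> carrier OZ"
  have "inv0 (H0 X) = pure \<Z> OZ I0 X \<one>\<^bsub>S\<^esub>"
  proof (rule op_lin_eqI[OF E W \<mu> lin_comp[OF unit_hom_lin restrict_scalars_lin[OF h0 inv0_lin]] pure_one_lin[OF S OZ] _ X])
    fix a \<alpha> b \<beta> assume m: "a \<in> carrier TZ" "\<alpha> \<in> carrier (regular_module \<Z>)" "b \<in> carrier TZ" "\<beta> \<in> carrier (regular_module \<Z>)"
    have oc: "op_class \<Z> AZ a 1 b 1 \<in> carrier OZ"
      by (rule quadrilin_closed[OF op_class_quadrilinear[OF E W \<mu>] m(1) _ m(3)]) simp_all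
    have "inv0 (H0 (op_class \<Z> AZ a \<alpha> b \<beta>)) = g4 (c0 a) (h0 \<alpha>) (c0 b) (h0 \<beta>)"
      unfolding unit_hom_class[OF m(1,3)]
      by (rule inv0_class[OF unit_map_closed[OF m(1)] h0_closed unit_map_closed[OF m(3)] h0_closed])
    also have "\<dots> = h0 (\<alpha> * \<beta>) \<odot>\<^bsub>base_change OZ S\<^esub> cls a b"
      unfolding g0_unit[OF m(1,3)] h0_mult ..
    also have "\<dots> = pure \<Z> OZ I0 ((\<alpha> * \<beta>) \<odot>\<^bsub>OZ\<^esub> op_class \<Z> AZ a 1 b 1) \<one>\<^bsub>S\<^esub>"
      using lin_smult[OF pure_one_lin[OF S OZ] _ oc, of "\<alpha> * \<beta>"] by simp
    also have "(\<alpha> * \<beta>) \<odot>\<^bsub>OZ\<^esub> op_class \<Z> AZ a 1 b 1 = op_class \<Z> AZ a \<alpha> b \<beta>"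
      using op_class_scalars[OF E W \<mu> m(1) _ m(3), of \<alpha> \<beta>] by simp
    finally show "inv0 (H0 (op_class \<Z> AZ a \<alpha> b \<beta>)) = pure \<Z> OZ I0 (op_class \<Z> AZ a \<alpha> b \<beta>) \<one>\<^bsub>S\<^esub>" .
  qed
  then show "inv0 (B0 (pure \<Z> OZ I0 X \<one>\<^bsub>S\<^esub>)) = pure \<Z> OZ I0 X \<one>\<^bsub>S\<^esub>"
    unfolding operator_base_change_unit[OF X] .
qed

text \<open>A class over \<open>S\<close> has arbitrary vectors \<open>A\<close>, \<open>B\<close>
  and parameters. The parameters come out as scalars on both sides, and linearity in
  \<open>A\<close> and in \<open>B\<close> reduces the rest to unit vectors.\<close>

private lemma B0_inv0:
  assumes "Y \<in> carrier OS" shows "B0 (inv0 Y) = Y"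
proof (rule op_lin_eqI[OF ES WS mS lin_comp[OF inv0_lin operator_base_change_lin] lin_id _ assms])
  fix A \<alpha> B \<beta> assume m: "A \<in> carrier TS" "\<alpha> \<in> carrier (regular_module S)" "B \<in> carrier TS" "\<beta> \<in> carrier (regular_module S)"
  then have s: "\<alpha> \<in> carrier S" "\<beta> \<in> carrier S" by auto
  note q = op_class_quadrilinear[OF ES WS mS]
  note q1 = quadrilin_1[OF q one_G _ one_G] and q3 = quadrilin_3[OF q _ one_G one_G] and u = unit_map_closed
  note gl = lin_comp[OF bilin_left[OF g0_bil] operator_base_change_lin]
    and gr = lin_comp[OF bilin_right[OF g0_bil] operator_base_change_lin]
  have 0: "B0 (g0 (c0 p) (c0 q)) = op_class S AS (c0 p) \<one>\<^bsub>S\<^esub> (c0 q) \<one>\<^bsub>S\<^esub>"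
    if m: "p \<in> carrier TZ" "q \<in> carrier TZ" for p q
  proof -
    have "op_class \<Z> AZ p 1 q 1 \<in> carrier OZ"
      by (rule quadrilin_closed[OF op_class_quadrilinear[OF E W \<mu>] m(1) _ m(2)]) simp_all
    then show ?thesis
      using unit_hom_class[OF m, of 1 1] ring_hom_one[OF h0]
      by (simp only: g0_unit[OF m] operator_base_change_unit) simp
  qed
  have 1: "B0 (g0 A (c0 q)) = op_class S AS A \<one>\<^bsub>S\<^esub> (c0 q) \<one>\<^bsub>S\<^esub>" if "A \<in> carrier TS" "q \<in> carrier TZ" for A q
    by (rule direct_sum_base_change_lin_eqI[OF gl[OF u[OF that(2)]] q1[OF u[OF that(2)]] OS 0[OF _ that(2)] that(1)])
  have 2: "B0 (g0 A B) = op_class S AS A \<one>\<^bsub>S\<^esub> B \<one>\<^bsub>S\<^esub>"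
    by (rule direct_sum_base_change_lin_eqI[OF gr[OF m(1)] q3[OF m(1)] OS 1[OF m(1)] m(3)])
  have "B0 (inv0 (op_class S AS A \<alpha> B \<beta>)) = (\<alpha> \<otimes>\<^bsub>S\<^esub> \<beta>) \<odot>\<^bsub>OS\<^esub> B0 (g0 A B)"
    unfolding inv0_class[OF m(1) s(1) m(3) s(2)]
    by (rule lin_smult[OF operator_base_change_lin _ bilin_closed[OF g0_bil m(1,3)]]) (use s in simp)
  also have "\<dots> = op_class S AS A \<alpha> B \<beta>"
    unfolding 2 by (rule op_class_scalars[OF ES WS mS m(1) s(1) m(3) s(2), symmetric])
  finally show "B0 (inv0 (op_class S AS A \<alpha> B \<beta>)) = op_class S AS A \<alpha> B \<beta>" .
qed

lemma operator_base_change_bij: "bij_betw B0 (carrier (base_change OZ S)) (carrier OS)"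
  by (rule bij_betwI[where g = inv0])
    (auto simp del: base_change_simps simp: inv0_B0 B0_inv0 lin_closed[OF operator_base_change_lin] lin_closed[OF inv0_lin])

text \<open>The link between the representation over \<open>S\<close> and the integral one. It is
  stated at each \<open>e \<otimes> 1\<close> separately, because
  \<open>Hom(E, W) \<otimes> S\<close> and the homomorphisms over \<open>S\<close> are never
  compared as modules; evaluations suffice to detect zero.\<close>

lemma regular_rep_base_change:
  assumes Y: "Y \<in> carrier (base_change OZ S)" and e: "e \<in> carrier E" and y: "y \<in> carrier WS"
  shows "regular_rep S AS (B0 Y) (pure \<Z> E I0 e \<one>\<^bsub>S\<^esub>, y) =
    (\<zero>\<^bsub>ES\<^esub>, tensor_map \<Z> W I0 (\<lambda>X. visible_rep X e) (\<lambda>s. s) Y)"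
proof -
  have ey: "(pure \<Z> E I0 e \<one>\<^bsub>S\<^esub>, y) \<in> carrier TS" using pE[OF e] y by simp
  note v = visible_rep_eval_lin[OF e]
  note l = lin_comp[OF regular_rep_lin[OF ES WS mS] Hom_eval_lin[OF ey]]
  note inj = direct_sum_inj(2)[OF ES WS]
  show ?thesis
  proof (rule base_change_lin_eqI[OF S OZ lin_comp[OF operator_base_change_lin l]
        lin_comp[OF base_change_map_lin[OF S OZ W v] inj] _ Y])
    fix X assume X: "X \<in> carrier OZ"
    have "regular_rep S AS (H0 X) (pure \<Z> E I0 e \<one>\<^bsub>S\<^esub>, y) = (\<zero>\<^bsub>ES\<^esub>, pure \<Z> W I0 (visible_rep X e) \<one>\<^bsub>S\<^esub>)"
    proof (rule op_lin_eqI[OF E W \<mu> lin_comp[OF unit_hom_lin restrict_scalars_lin[OF h0 l]]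
          lin_comp[OF lin_comp[OF v pure_one_lin[OF S W]] restrict_scalars_lin[OF h0 inj]] _ X])
      fix a \<alpha> b \<beta> assume m: "a \<in> carrier TZ" "\<alpha> \<in> carrier (regular_module \<Z>)" "b \<in> carrier TZ" "\<beta> \<in> carrier (regular_module \<Z>)"
      have f: "fst a \<in> carrier E" "fst b \<in> carrier E" using m by auto
      have g: "h0 \<alpha> \<in> carrier (regular_module S)" "h0 \<beta> \<in> carrier (regular_module S)" using h0_closed by auto
      show "regular_rep S AS (H0 (op_class \<Z> AZ a \<alpha> b \<beta>)) (pure \<Z> E I0 e \<one>\<^bsub>S\<^esub>, y) =
          (\<zero>\<^bsub>ES\<^esub>, pure \<Z> W I0 (visible_rep (op_class \<Z> AZ a \<alpha> b \<beta>) e) \<one>\<^bsub>S\<^esub>)"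
        unfolding unit_hom_class[OF m(1,3)] visible_rep_class[OF m(1,3) e]
          regular_rep_class[OF ES WS mS unit_map_closed[OF m(1)] g(1) unit_map_closed[OF m(3)] g(2)] restrict_apply'[OF ey]
        by (rule base_change_tprod[OF f e]) simp
    qed
    moreover have "tensor_map \<Z> W I0 (\<lambda>X. visible_rep X e) (\<lambda>s. s) (pure \<Z> OZ I0 X \<one>\<^bsub>S\<^esub>) = pure \<Z> W I0 (visible_rep X e) \<one>\<^bsub>S\<^esub>"
      by (rule tensor_map_pure[OF OZ I0 W I0 v lin_id X]) simp
    ultimately show "regular_rep S AS (B0 (pure \<Z> OZ I0 X \<one>\<^bsub>S\<^esub>)) (pure \<Z> E I0 e \<one>\<^bsub>S\<^esub>, y) =
        (\<zero>\<^bsub>ES\<^esub>, tensor_map \<Z> W I0 (\<lambda>X. visible_rep X e) (\<lambda>s. s) (pure \<Z> OZ I0 X \<one>\<^bsub>S\<^esub>))"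
      unfolding operator_base_change_unit[OF X] by simp
  qed
qed

text \<open>One direction evaluates at \<open>(e \<otimes> 1, 0)\<close>. For the other, a linear
  map on the space over \<open>S\<close> is zero once it vanishes on the unit vectors, and there
  only the \<open>W\<close>-component of the value could survive.\<close>

lemma regular_rep_base_change_zero_iff:
  assumes Y: "Y \<in> carrier (base_change OZ S)"
  shows "regular_rep S AS (B0 Y) = \<zero>\<^bsub>Hom_module S TS TS\<^esub> \<longleftrightarrow>
    (\<forall>e\<in>carrier E. tensor_map \<Z> W I0 (\<lambda>X. visible_rep X e) (\<lambda>s. s) Y = \<zero>\<^bsub>WS\<^esub>)" (is "?l \<longleftrightarrow> ?r")
proof
  interpret WS: module S WS by (rule WS)
  assume z: ?l
  show ?r
  proof
    fix e assume e: "e \<in> carrier E"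
    have ey: "(pure \<Z> E I0 e \<one>\<^bsub>S\<^esub>, \<zero>\<^bsub>WS\<^esub>) \<in> carrier TS"
      unfolding direct_sum_simps mem_Times_iff fst_conv snd_conv using pE[OF e] WS.zero_closed ..
    have "(\<zero>\<^bsub>ES\<^esub>, tensor_map \<Z> W I0 (\<lambda>X. visible_rep X e) (\<lambda>s. s) Y) =
        regular_rep S AS (B0 Y) (pure \<Z> E I0 e \<one>\<^bsub>S\<^esub>, \<zero>\<^bsub>WS\<^esub>)"
      by (rule regular_rep_base_change[OF Y e WS.zero_closed, symmetric])
    also have "\<dots> = \<zero>\<^bsub>TS\<^esub>" unfolding z Hom_module_simps restrict_apply'[OF ey] ..
    finally show "tensor_map \<Z> W I0 (\<lambda>X. visible_rep X e) (\<lambda>s. s) Y = \<zero>\<^bsub>WS\<^esub>" by simp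
  qed
next
  assume r: ?r
  have f: "regular_rep S AS (B0 Y) \<in> carrier (Hom_module S TS TS)"
    by (rule lin_closed[OF regular_rep_lin[OF ES WS mS] lin_closed[OF operator_base_change_lin Y]])
  then have fl: "regular_rep S AS (B0 Y) \<in> linear_maps S TS TS" by simp
  show ?l
  proof (rule extensionalityI)
    show "regular_rep S AS (B0 Y) \<in> extensional (carrier TS)" using f by simp
    fix A assume A: "A \<in> carrier TS"
    have "regular_rep S AS (B0 Y) A = \<zero>\<^bsub>TS\<^esub>"
    proof (rule direct_sum_base_change_lin_eqI[OF fl lin_zero_map[OF TS] TS _ A])
      fix p assume p: "p \<in> carrier TZ"
      then have m: "fst p \<in> carrier E" "snd p \<in> carrier W" by auto
      show "regular_rep S AS (B0 Y) (c0 p) = \<zero>\<^bsub>TS\<^esub>"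
        unfolding regular_rep_base_change[OF Y m(1) pW[OF m(2)]] using r m(1) by (simp del: base_change_simps)
    qed
    then show "regular_rep S AS (B0 Y) A = \<zero>\<^bsub>Hom_module S TS TS\<^esub> A"
      unfolding Hom_module_simps restrict_apply'[OF A] .
  qed simp
qed

end

section \<open>Naturality of the operator rng in the base ring\<close>

context
  fixes S S' :: "'s ring" and h
  assumes S: "cring S" and S': "cring S'" and h: "h \<in> ring_hom S S'"
begin

interpretation S: cring S by (rule S)
interpretation S': cring S' by (rule S')

private abbreviation (input) "bE \<equiv> base_change_hom E S' h"
private abbreviation (input) "bW \<equiv> base_change_hom W S' h"
private abbreviation (input) "EB U \<equiv> base_change E U"
private abbreviation (input) "WB U \<equiv> base_change W U"
private abbreviation (input) "TB U \<equiv> direct_sum (EB U) (WB U)"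
private abbreviation (input) "mB U \<equiv> base_change_mu E W \<mu> U"
private abbreviation (input) "AB U \<equiv> two_step U (EB U) (WB U) (mB U)"
private abbreviation (input) "OB U \<equiv> operator_rng U (AB U)"

private lemma XB: "cring R \<Longrightarrow> module R (EB R)" "cring R \<Longrightarrow> module R (WB R)"
    "cring R \<Longrightarrow> mB R \<in> linear_maps R (tensor3 R (EB R) (EB R) (EB R)) (WB R)"
  by (auto intro: base_change_module E W base_change_mu_lin[OF E W \<mu>] simp del: base_change_simps)

private lemma OB: "cring R \<Longrightarrow> module R (OB R)"
  by (rule operator_rng_module[OF XB])

private lemma bl: "bE \<in> linear_maps S (EB S) (restrict_scalars h (EB S'))"
    "bW \<in> linear_maps S (WB S) (restrict_scalars h (WB S'))"
  by (rule base_change_hom_lin[OF S S' _ h], rule E W)+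

private lemma be: "X \<in> carrier (EB S) \<Longrightarrow> bE X \<in> carrier (EB S')"
  using lin_closed[OF bl(1)] by (simp del: base_change_simps)

private lemma b_one: "x \<in> carrier E \<Longrightarrow> bE (pure \<Z> E (int_alg S) x \<one>\<^bsub>S\<^esub>) = pure \<Z> E (int_alg S') x \<one>\<^bsub>S'\<^esub>"
  "y \<in> carrier W \<Longrightarrow> bW (pure \<Z> W (int_alg S) y \<one>\<^bsub>S\<^esub>) = pure \<Z> W (int_alg S') y \<one>\<^bsub>S'\<^esub>"
  using base_change_hom_pure[OF S S' E h, of x "\<one>\<^bsub>S\<^esub>"] base_change_hom_pure[OF S S' W h, of y "\<one>\<^bsub>S\<^esub>"] ring_hom_one[OF h]
  by simp_all

text \<open>On unit vectors both sides are the unit vector of the integral product. Linearity over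
  \<open>S\<close>, with the targets restricted along \<open>h\<close>, then frees the three
  arguments in turn.\<close>

private lemma tri_natural:
  assumes "X \<in> carrier (EB S)" "Y \<in> carrier (EB S)" "Z \<in> carrier (EB S)"
  shows "bW (tri S (EB S) (mB S) X Y Z) = tri S' (EB S') (mB S') (bE X) (bE Y) (bE Z)"
proof -
  note t = tri_trilinear[OF XB[OF S]] and t' = tri_trilinear[OF XB[OF S']]
  note r = restrict_scalars_lin[OF h]
  note p = base_change_pure_closed[OF S E _ S.one_closed]
  have 0: "bW (tri S (EB S) (mB S) (pure \<Z> E (int_alg S) x \<one>\<^bsub>S\<^esub>) (pure \<Z> E (int_alg S) y \<one>\<^bsub>S\<^esub>) (pure \<Z> E (int_alg S) z \<one>\<^bsub>S\<^esub>)) =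
      tri S' (EB S') (mB S') (bE (pure \<Z> E (int_alg S) x \<one>\<^bsub>S\<^esub>)) (bE (pure \<Z> E (int_alg S) y \<one>\<^bsub>S\<^esub>)) (bE (pure \<Z> E (int_alg S) z \<one>\<^bsub>S\<^esub>))"
    if m: "x \<in> carrier E" "y \<in> carrier E" "z \<in> carrier E" for x y z
    using tri_base_change_mu[OF E W \<mu> S m S.one_closed S.one_closed S.one_closed]
      tri_base_change_mu[OF E W \<mu> S' m S'.one_closed S'.one_closed S'.one_closed] tri_closed[OF E W \<mu> m]
    by (simp add: b_one m)
  have 1: "bW (tri S (EB S) (mB S) X (pure \<Z> E (int_alg S) y \<one>\<^bsub>S\<^esub>) (pure \<Z> E (int_alg S) z \<one>\<^bsub>S\<^esub>)) =
      tri S' (EB S') (mB S') (bE X) (bE (pure \<Z> E (int_alg S) y \<one>\<^bsub>S\<^esub>)) (bE (pure \<Z> E (int_alg S) z \<one>\<^bsub>S\<^esub>))"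
    if m: "X \<in> carrier (EB S)" "y \<in> carrier E" "z \<in> carrier E" for X y z
    by (rule base_change_lin_eqI[OF S E lin_comp[OF trilin_1[OF t p[OF m(2)] p[OF m(3)]] bl(2)]
      lin_comp[OF bl(1) r[OF trilin_1[OF t' be[OF p[OF m(2)]] be[OF p[OF m(3)]]]]] 0[OF _ m(2,3)] m(1)])
  have 2: "bW (tri S (EB S) (mB S) X Y (pure \<Z> E (int_alg S) z \<one>\<^bsub>S\<^esub>)) =
      tri S' (EB S') (mB S') (bE X) (bE Y) (bE (pure \<Z> E (int_alg S) z \<one>\<^bsub>S\<^esub>))"
    if m: "X \<in> carrier (EB S)" "Y \<in> carrier (EB S)" "z \<in> carrier E" for X Y z
    by (rule base_change_lin_eqI[OF S E lin_comp[OF trilin_2[OF t m(1) p[OF m(3)]] bl(2)]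
      lin_comp[OF bl(1) r[OF trilin_2[OF t' be[OF m(1)] be[OF p[OF m(3)]]]]] 1[OF m(1) _ m(3)] m(2)])
  show ?thesis
    by (rule base_change_lin_eqI[OF S E lin_comp[OF trilin_3[OF t assms(1,2)] bl(2)]
      lin_comp[OF bl(1) r[OF trilin_3[OF t' be[OF assms(1)] be[OF assms(2)]]]] 2[OF assms(1,2)] assms(3)])
qed

private lemma bp_lin: "map_prod bE bW \<in> linear_maps S (TB S) (restrict_scalars h (TB S'))"
  using lin_closed[OF bl(1)] lin_closed[OF bl(2)] lin_add[OF bl(1)] lin_add[OF bl(2)] lin_smult[OF bl(1)] lin_smult[OF bl(2)]
  by (intro linear_mapsI) (auto simp del: base_change_simps)

private lemma bp_tprod:
  assumes "a \<in> carrier (TB S)" "b \<in> carrier (TB S)" "c \<in> carrier (TB S)" "\<alpha> \<in> carrier S" "\<beta> \<in> carrier S"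
  shows "map_prod bE bW (tprod (AB S) a \<alpha> b \<beta> c) =
    tprod (AB S') (map_prod bE bW a) (h \<alpha>) (map_prod bE bW b) (h \<beta>) (map_prod bE bW c)"
proof -
  have m: "fst a \<in> carrier (EB S)" "fst b \<in> carrier (EB S)" "fst c \<in> carrier (EB S)" using assms by auto
  have z: "bE \<zero>\<^bsub>EB S\<^esub> = \<zero>\<^bsub>EB S'\<^esub>"
    using lin_zero[OF bl(1) XB(1)[OF S] restrict_scalars_module[OF S h XB(1)[OF S']]] by simp
  have "bW ((\<alpha> \<otimes>\<^bsub>S\<^esub> \<beta>) \<odot>\<^bsub>WB S\<^esub> tri S (EB S) (mB S) (fst a) (fst b) (fst c)) =
      h (\<alpha> \<otimes>\<^bsub>S\<^esub> \<beta>) \<odot>\<^bsub>WB S'\<^esub> bW (tri S (EB S) (mB S) (fst a) (fst b) (fst c))"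
    using lin_smult[OF bl(2) S.m_closed[OF assms(4,5)] tri_closed[OF XB[OF S] m]] unfolding restrict_scalars_simps .
  then show ?thesis
    by (simp only: tprod_eq[OF XB[OF S]] tprod_eq[OF XB[OF S']] map_prod_def case_prod_unfold fst_conv snd_conv z
      tri_natural[OF m] ring_hom_mult[OF h assms(4,5)])
qed

lemma operator_scalar_hom_lin: "operator_scalar_hom E W \<mu> S h S' \<in> linear_maps S (OB S) (restrict_scalars h (OB S'))"
  unfolding operator_scalar_hom_def two_step_over_def
  by (rule operator_hom_lin[OF XB[OF S] XB[OF S'] h bp_lin bp_tprod])

private lemma operator_scalar_hom_class:
  assumes "a \<in> carrier (TB S)" "\<alpha> \<in> carrier S" "b \<in> carrier (TB S)" "\<beta> \<in> carrier S"
  shows "operator_scalar_hom E W \<mu> S h S' (op_class S (AB S) a \<alpha> b \<beta>) =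
    op_class S' (AB S') (map_prod bE bW a) (h \<alpha>) (map_prod bE bW b) (h \<beta>)"
  unfolding operator_scalar_hom_def two_step_over_def
  by (rule operator_hom_class[OF XB[OF S] XB[OF S'] h bp_lin bp_tprod assms(1) _ assms(3)]) (use assms in simp_all)

text \<open>Both composites are linear over \<open>S\<close> once the target is restricted along
  \<open>h\<close>, so they are compared on \<open>U \<otimes> 1\<close>. For \<open>U\<close> a
  class, both give the class of its unit vectors over \<open>S'\<close>, with the parameters matched
  by \<open>int_hom_natural\<close>.\<close>

lemma operator_base_change_natural:
  assumes Y: "Y \<in> carrier (base_change OZ S)"
  shows "operator_scalar_hom E W \<mu> S h S' (operator_base_change E W \<mu> S Y) =
    operator_base_change E W \<mu> S' (base_change_hom OZ S' h Y)"
proof (rule base_change_lin_eqI[OF S OZ lin_comp[OF operator_base_change_lin[OF S] operator_scalar_hom_lin]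
      lin_comp[OF base_change_hom_lin[OF S S' OZ h] restrict_scalars_lin[OF h operator_base_change_lin[OF S']]] _ Y])
  fix U assume U: "U \<in> carrier OZ"
  let ?c = "\<lambda>S p. (pure \<Z> E (int_alg S) (fst p) \<one>\<^bsub>S\<^esub>, pure \<Z> W (int_alg S) (snd p) \<one>\<^bsub>S\<^esub>)"
  let ?H = "\<lambda>S. operator_hom \<Z> (int_hom S) (?c S) (int_hom S) S (AB S)"
  have "operator_scalar_hom E W \<mu> S h S' (?H S U) = ?H S' U"
    using U
  proof (induction rule: op_induct[OF E W \<mu>, consumes 1, case_names op_class add])
    case (op_class a \<alpha> b \<beta>)
    have c: "map_prod bE bW (?c S p) = ?c S' p" if "p \<in> carrier TZ" for p
      using that by (auto simp: b_one)
    have i: "int_hom S n \<in> carrier S" for n using ring_hom_closed[OF int_hom_ring_hom[OF S]] by simp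
    show ?case
      unfolding unit_hom_class[OF S op_class(1,3)] unit_hom_class[OF S' op_class(1,3)]
        operator_scalar_hom_class[OF unit_map_closed[OF S op_class(1)] i unit_map_closed[OF S op_class(3)] i]
        c[OF op_class(1)] c[OF op_class(3)] int_hom_natural[OF S S' h] ..
  next
    case (add u v)
    then show ?case
      using lin_add[OF lin_comp[OF unit_hom_lin[OF S] restrict_scalars_lin[OF int_hom_ring_hom[OF S] operator_scalar_hom_lin]] add(1,2)]
        lin_add[OF unit_hom_lin[OF S'] add(1,2)] by simp
  qed
  then show "operator_scalar_hom E W \<mu> S h S' (operator_base_change E W \<mu> S (pure \<Z> OZ (int_alg S) U \<one>\<^bsub>S\<^esub>)) =
      operator_base_change E W \<mu> S' (base_change_hom OZ S' h (pure \<Z> OZ (int_alg S) U \<one>\<^bsub>S\<^esub>))"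
    unfolding operator_base_change_unit[OF S U] base_change_hom_pure[OF S S' OZ h U S.one_closed] ring_hom_one[OF h]
      operator_base_change_unit[OF S' U] .
qed

end

end

section \<open>The middle-relation quotient\<close>

text \<open>Together with \<open>middle_right\<close> this is the universal pair of bilinear maps:
  the quotient represents pairs \<open>f\<close>, \<open>g\<close> with
  \<open>f (\<mu>(a, b, c)) d = g a (\<mu>(b, c, d))\<close>, and \<open>middle_lift\<close> is the
  map that such a pair induces.\<close>

definition middle_left where
  "middle_left R E W \<mu> w e = (middle_map R E W \<mu> ` carrier (tensor4 R E E E E))
     +>\<^bsub>direct_sum (tensor R W E) (tensor R E W)\<^esub> (pure R W E w e, \<zero>\<^bsub>tensor R E W\<^esub>)"

definition middle_right where
  "middle_right R E W \<mu> e w = (middle_map R E W \<mu> ` carrier (tensor4 R E E E E))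
     +>\<^bsub>direct_sum (tensor R W E) (tensor R E W)\<^esub> (\<zero>\<^bsub>tensor R W E\<^esub>, pure R E W e w)"

definition middle_lift where
  "middle_lift R P f g X =
     the_elem ((\<lambda>p. tensor_lift R P f (fst p) \<oplus>\<^bsub>P\<^esub> tensor_lift R P g (snd p)) ` X)"

context
  fixes R :: "('r, 'x) ring_scheme" and E :: "('r, 'e) module" and W :: "('r, 'w) module"
    and \<mu> :: "('r, 'e) cube \<Rightarrow> 'w"
  assumes E: "module R E" and W: "module R W" and \<mu>: "\<mu> \<in> linear_maps R (tensor3 R E E E) W"
begin

private abbreviation (input) "WE \<equiv> tensor R W E"
private abbreviation (input) "EW \<equiv> tensor R E W"
private abbreviation (input) "Y0 \<equiv> direct_sum WE EW"
private abbreviation (input) "mm \<equiv> \<lambda>a b c d. (pure R W E (tri R E \<mu> a b c) d, \<ominus>\<^bsub>EW\<^esub> pure R E W a (tri R E \<mu> b c d))"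
private abbreviation (input) "N0 \<equiv> middle_map R E W \<mu> ` carrier (tensor4 R E E E E)"
private abbreviation (input) "Q0 \<equiv> middle_quotient R E W \<mu>"

private lemma WE: "module R WE" by (rule tensor_module[OF W E])
private lemma EW: "module R EW" by (rule tensor_module[OF E W])
private lemma Y0: "module R Y0" by (rule direct_sum_module[OF WE EW])
private lemma E4: "module R (tensor4 R E E E E)" by (rule tensor4_module[OF E E E E])

interpretation WE: module R WE by (rule WE)
interpretation EW: module R EW by (rule EW)

private lemma mm_quad: "quadrilinear_map R E E E E Y0 mm"
proof -
  note t = tri_trilinear[OF E W \<mu>]
  note n = lin_minus_map[OF EW]
  have tc: "tri R E \<mu> a b c \<in> carrier W" if "a \<in> carrier E" "b \<in> carrier E" "c \<in> carrier E" for a b c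
    by (rule tri_closed[OF E W \<mu> that])
  note l = pure_lin_left[OF W E] and l' = pure_lin_right[OF W E] and r = pure_lin_left[OF E W] and r' = pure_lin_right[OF E W]
  show ?thesis
  proof (rule quadrilinear_mapI; rule lin_pair)
    fix b c d assume m: "b \<in> carrier E" "c \<in> carrier E" "d \<in> carrier E"
    show "(\<lambda>a. pure R W E (tri R E \<mu> a b c) d) \<in> linear_maps R E WE" by (rule lin_comp[OF trilin_1[OF t m(1,2)] l[OF m(3)]])
    show "(\<lambda>a. \<ominus>\<^bsub>EW\<^esub> pure R E W a (tri R E \<mu> b c d)) \<in> linear_maps R E EW" by (rule n[OF r[OF tc[OF m]]])
    show "(\<lambda>a. pure R W E (tri R E \<mu> b a c) d) \<in> linear_maps R E WE" by (rule lin_comp[OF trilin_2[OF t m(1,2)] l[OF m(3)]])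
    show "(\<lambda>a. \<ominus>\<^bsub>EW\<^esub> pure R E W b (tri R E \<mu> a c d)) \<in> linear_maps R E EW"
      by (rule n[OF lin_comp[OF trilin_1[OF t m(2,3)] r'[OF m(1)]]])
    show "(\<lambda>a. pure R W E (tri R E \<mu> b c a) d) \<in> linear_maps R E WE" by (rule lin_comp[OF trilin_3[OF t m(1,2)] l[OF m(3)]])
    show "(\<lambda>a. \<ominus>\<^bsub>EW\<^esub> pure R E W b (tri R E \<mu> c a d)) \<in> linear_maps R E EW"
      by (rule n[OF lin_comp[OF trilin_2[OF t m(2,3)] r'[OF m(1)]]])
    show "(\<lambda>a. pure R W E (tri R E \<mu> b c d) a) \<in> linear_maps R E WE" by (rule l'[OF tc[OF m]])
    show "(\<lambda>a. \<ominus>\<^bsub>EW\<^esub> pure R E W b (tri R E \<mu> c d a)) \<in> linear_maps R E EW"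
      by (rule n[OF lin_comp[OF trilin_3[OF t m(2,3)] r'[OF m(1)]]])
  qed
qed

lemma middle_map_lin: "middle_map R E W \<mu> \<in> linear_maps R (tensor4 R E E E E) Y0"
  unfolding middle_map_def by (rule tensor_lift4_lin[OF E E E E Y0 mm_quad])

lemma middle_map_pure:
  assumes "a \<in> carrier E" "b \<in> carrier E" "c \<in> carrier E" "d \<in> carrier E"
  shows "middle_map R E W \<mu> (pure4 R E E E E a b c d) = mm a b c d"
  unfolding middle_map_def by (rule tensor_lift4_pure[OF E E E E Y0 mm_quad assms])

private lemma N0: "submodule N0 R Y0"
  by (rule submodule_image[OF middle_map_lin E4 Y0])

lemma middle_quotient_module: "module R Q0"
  unfolding middle_quotient_def by (rule quot_module[OF Y0 N0])

interpretation Q0: module R Q0 by (rule middle_quotient_module)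

private lemma proj: "(\<lambda>x. N0 +>\<^bsub>Y0\<^esub> x) \<in> linear_maps R Y0 Q0"
  unfolding middle_quotient_def by (rule quot_proj_lin[OF Y0 N0])

lemma middle_left_bilinear: "bilinear_map R W E Q0 (middle_left R E W \<mu>)"
  unfolding middle_left_def
  by (intro bilinear_mapI lin_comp[OF lin_comp[OF pure_lin_left[OF W E] direct_sum_inj(1)[OF WE EW]] proj]
    lin_comp[OF lin_comp[OF pure_lin_right[OF W E] direct_sum_inj(1)[OF WE EW]] proj])

lemma middle_right_bilinear: "bilinear_map R E W Q0 (middle_right R E W \<mu>)"
  unfolding middle_right_def
  by (intro bilinear_mapI lin_comp[OF lin_comp[OF pure_lin_left[OF E W] direct_sum_inj(2)[OF WE EW]] proj]
    lin_comp[OF lin_comp[OF pure_lin_right[OF E W] direct_sum_inj(2)[OF WE EW]] proj])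

text \<open>The minus sign in the second component of the middle map makes the left element equal to
  a relation plus the right element, and the relation has class zero.\<close>

lemma middle_relation:
  assumes m: "a \<in> carrier E" "b \<in> carrier E" "c \<in> carrier E" "d \<in> carrier E"
  shows "middle_left R E W \<mu> (tri R E \<mu> a b c) d = middle_right R E W \<mu> a (tri R E \<mu> b c d)"
proof -
  have c: "pure R W E (tri R E \<mu> a b c) d \<in> carrier WE" "pure R E W a (tri R E \<mu> b c d) \<in> carrier EW"
    using pure_closed[OF W E tri_closed[OF E W \<mu> m(1-3)] m(4)] pure_closed[OF E W m(1) tri_closed[OF E W \<mu> m(2-4)]] .
  let ?l = "(pure R W E (tri R E \<mu> a b c) d, \<zero>\<^bsub>EW\<^esub>)" and ?r = "(\<zero>\<^bsub>WE\<^esub>, pure R E W a (tri R E \<mu> b c d))"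
  have lr: "?l \<in> carrier Y0" "?r \<in> carrier Y0" using c by auto
  have "mm a b c d \<in> N0"
    using middle_map_pure[OF m] quadrilin_closed[OF pure4_quadrilinear[OF E E E E] m] by (metis imageI)
  moreover have cm: "mm a b c d \<in> carrier Y0" by (rule quadrilin_closed[OF mm_quad m])
  ultimately have z: "N0 +>\<^bsub>Y0\<^esub> mm a b c d = \<zero>\<^bsub>Q0\<^esub>"
    unfolding middle_quotient_def using quot_proj_zero_iff[OF Y0 N0 cm] by simp
  have "?l = mm a b c d \<oplus>\<^bsub>Y0\<^esub> ?r" using c by (simp add: EW.l_neg)
  then have "N0 +>\<^bsub>Y0\<^esub> ?l = (N0 +>\<^bsub>Y0\<^esub> mm a b c d) \<oplus>\<^bsub>Q0\<^esub> (N0 +>\<^bsub>Y0\<^esub> ?r)"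
    using lin_add[OF proj cm lr(2)] by simp
  then show ?thesis
    unfolding middle_left_def middle_right_def z using lin_closed[OF proj lr(2)] by simp
qed

lemma middle_lin_eqI:
  assumes f: "f \<in> linear_maps R Q0 P" and g: "g \<in> linear_maps R Q0 P"
    and l: "\<And>w e. w \<in> carrier W \<Longrightarrow> e \<in> carrier E \<Longrightarrow> f (middle_left R E W \<mu> w e) = g (middle_left R E W \<mu> w e)"
    and r: "\<And>e w. e \<in> carrier E \<Longrightarrow> w \<in> carrier W \<Longrightarrow> f (middle_right R E W \<mu> e w) = g (middle_right R E W \<mu> e w)"
    and u: "u \<in> carrier Q0"
  shows "f u = g u"
proof -
  obtain x where x: "x \<in> carrier Y0" "u = N0 +>\<^bsub>Y0\<^esub> x"
    using u unfolding middle_quotient_def quot_carrier[OF Y0 N0] by blast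
  obtain x1 x2 where x12: "x = (x1, x2)" "x1 \<in> carrier WE" "x2 \<in> carrier EW" using x(1) by (cases x) auto
  note lf = lin_comp[OF direct_sum_inj(1)[OF WE EW] lin_comp[OF proj f]]
    and lg = lin_comp[OF direct_sum_inj(1)[OF WE EW] lin_comp[OF proj g]]
    and rf = lin_comp[OF direct_sum_inj(2)[OF WE EW] lin_comp[OF proj f]]
    and rg = lin_comp[OF direct_sum_inj(2)[OF WE EW] lin_comp[OF proj g]]
  have 1: "f (N0 +>\<^bsub>Y0\<^esub> (x1, \<zero>\<^bsub>EW\<^esub>)) = g (N0 +>\<^bsub>Y0\<^esub> (x1, \<zero>\<^bsub>EW\<^esub>))"
    by (rule tensor_lin_eqI[OF W E lf lg l[unfolded middle_left_def] x12(2)])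
  have 2: "f (N0 +>\<^bsub>Y0\<^esub> (\<zero>\<^bsub>WE\<^esub>, x2)) = g (N0 +>\<^bsub>Y0\<^esub> (\<zero>\<^bsub>WE\<^esub>, x2))"
    by (rule tensor_lin_eqI[OF E W rf rg r[unfolded middle_right_def] x12(3)])
  have c: "(x1, \<zero>\<^bsub>EW\<^esub>) \<in> carrier Y0" "(\<zero>\<^bsub>WE\<^esub>, x2) \<in> carrier Y0" using x12 by auto
  have "x = (x1, \<zero>\<^bsub>EW\<^esub>) \<oplus>\<^bsub>Y0\<^esub> (\<zero>\<^bsub>WE\<^esub>, x2)" using x12 by simp
  then have u': "u = (N0 +>\<^bsub>Y0\<^esub> (x1, \<zero>\<^bsub>EW\<^esub>)) \<oplus>\<^bsub>Q0\<^esub> (N0 +>\<^bsub>Y0\<^esub> (\<zero>\<^bsub>WE\<^esub>, x2))"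
    using lin_add[OF proj c] x(2) by simp
  note d = lin_closed[OF proj c(1)] lin_closed[OF proj c(2)]
  show ?thesis unfolding u' lin_add[OF f d] lin_add[OF g d] 1 2 ..
qed

context
  fixes P :: "('r, 'p, 'y) module_scheme" and f g
  assumes P: "module R P" and f: "bilinear_map R W E P f" and g: "bilinear_map R E W P g"
    and fg: "\<And>a b c d. a \<in> carrier E \<Longrightarrow> b \<in> carrier E \<Longrightarrow> c \<in> carrier E \<Longrightarrow> d \<in> carrier E \<Longrightarrow>
      f (tri R E \<mu> a b c) d = g a (tri R E \<mu> b c d)"
begin

interpretation P: module R P by (rule P)

private abbreviation (input) "l0 \<equiv> \<lambda>p. tensor_lift R P f (fst p) \<oplus>\<^bsub>P\<^esub> tensor_lift R P g (snd p)"

private lemma l0: "l0 \<in> linear_maps R Y0 P"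
  by (intro lin_sum P lin_comp[OF direct_sum_proj(1) tensor_lift_lin[OF W E P f]]
    lin_comp[OF direct_sum_proj(2) tensor_lift_lin[OF E W P g]])

private lemma l0_null: "x \<in> N0 \<Longrightarrow> l0 x = \<zero>\<^bsub>P\<^esub>"
proof -
  assume "x \<in> N0"
  then obtain u where u: "u \<in> carrier (tensor4 R E E E E)" "x = middle_map R E W \<mu> u" by auto
  have "l0 (middle_map R E W \<mu> u) = \<zero>\<^bsub>P\<^esub>" using u(1)
  proof (induction rule: tensor4_induct[OF E E E E, consumes 1, case_names pure add])
    case (pure a b c d)
    note tc = tri_closed[OF E W \<mu> pure(1-3)] tri_closed[OF E W \<mu> pure(2-4)]
    have "tensor_lift R P g (\<ominus>\<^bsub>EW\<^esub> pure R E W a (tri R E \<mu> b c d)) = \<ominus>\<^bsub>P\<^esub> g a (tri R E \<mu> b c d)"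
      using lin_neg[OF tensor_lift_lin[OF E W P g] EW P pure_closed[OF E W pure(1) tc(2)]]
        tensor_lift_pure[OF E W P g pure(1) tc(2)] by simp
    then show ?case
      using bilin_closed[OF g pure(1) tc(2)]
      by (simp add: middle_map_pure[OF pure] tensor_lift_pure[OF W E P f tc(1) pure(4)] fg[OF pure] P.r_neg)
  next
    case (add u v)
    note l = lin_comp[OF middle_map_lin l0]
    show ?case unfolding lin_add[OF l add(1,2)] add(3,4) by simp
  qed
  then show "l0 x = \<zero>\<^bsub>P\<^esub>" using u by simp
qed

lemma middle_lift_lin: "middle_lift R P f g \<in> linear_maps R Q0 P"
  unfolding middle_lift_def[abs_def] middle_quotient_def by (rule quot_lift_lin[OF Y0 N0 P l0 l0_null])

lemma middle_lift_left:
  assumes "w \<in> carrier W" "e \<in> carrier E"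
  shows "middle_lift R P f g (middle_left R E W \<mu> w e) = f w e"
proof -
  have c: "(pure R W E w e, \<zero>\<^bsub>EW\<^esub>) \<in> carrier Y0" using pure_closed[OF W E assms] by simp
  have "middle_lift R P f g (middle_left R E W \<mu> w e) = l0 (pure R W E w e, \<zero>\<^bsub>EW\<^esub>)"
    unfolding middle_lift_def middle_left_def by (rule the_elem_coset[OF Y0 N0 P l0 l0_null c])
  then show ?thesis
    using bilin_closed[OF f assms]
    by (simp add: tensor_lift_pure[OF W E P f assms] lin_zero[OF tensor_lift_lin[OF E W P g] EW P])
qed

lemma middle_lift_right:
  assumes "e \<in> carrier E" "w \<in> carrier W"
  shows "middle_lift R P f g (middle_right R E W \<mu> e w) = g e w"
proof -
  have c: "(\<zero>\<^bsub>WE\<^esub>, pure R E W e w) \<in> carrier Y0" using pure_closed[OF E W assms] by simp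
  have "middle_lift R P f g (middle_right R E W \<mu> e w) = l0 (\<zero>\<^bsub>WE\<^esub>, pure R E W e w)"
    unfolding middle_lift_def middle_right_def by (rule the_elem_coset[OF Y0 N0 P l0 l0_null c])
  then show ?thesis
    using bilin_closed[OF g assms]
    by (simp add: tensor_lift_pure[OF E W P g assms] lin_zero[OF tensor_lift_lin[OF W E P f] WE P])
qed

end
end

section \<open>Base change of the middle-relation quotient\<close>

context
  fixes E :: "(int, 'e) module" and W :: "(int, 'w) module" and \<mu> :: "(int, 'e) cube \<Rightarrow> 'w"
    and S :: "'s ring"
  assumes E: "module \<Z> E" and W: "module \<Z> W" and \<mu>: "\<mu> \<in> linear_maps \<Z> (tensor3 \<Z> E E E) W"
    and S: "cring S"
begin

interpretation S: cring S by (rule S)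

private abbreviation (input) "E1 \<equiv> base_change E S"
private abbreviation (input) "W1 \<equiv> base_change W S"
private abbreviation (input) "m1 \<equiv> base_change_mu E W \<mu> S"
private abbreviation (input) "QZ \<equiv> middle_quotient \<Z> E W \<mu>"
private abbreviation (input) "QS \<equiv> middle_quotient S E1 W1 m1"
private abbreviation (input) "pe x \<equiv> pure \<Z> E (int_alg S) x \<one>\<^bsub>S\<^esub>"
private abbreviation (input) "pw x \<equiv> pure \<Z> W (int_alg S) x \<one>\<^bsub>S\<^esub>"
private abbreviation (input) "pq x \<equiv> pure \<Z> QZ (int_alg S) x \<one>\<^bsub>S\<^esub>"
private abbreviation (input) "lZ \<equiv> middle_left \<Z> E W \<mu>"
private abbreviation (input) "rZ \<equiv> middle_right \<Z> E W \<mu>"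
private abbreviation (input) "lS \<equiv> middle_left S E1 W1 m1"
private abbreviation (input) "rS \<equiv> middle_right S E1 W1 m1"
private abbreviation (input) "VS \<equiv> restrict_scalars (int_hom S) QS"

private lemma E1: "module S E1" by (rule base_change_module[OF S E])
private lemma W1: "module S W1" by (rule base_change_module[OF S W])
private lemma m1: "m1 \<in> linear_maps S (tensor3 S E1 E1 E1) W1" by (rule base_change_mu_lin[OF E W \<mu> S])
private lemma QZ: "module \<Z> QZ" by (rule middle_quotient_module[OF E W \<mu>])
private lemma QS: "module S QS" by (rule middle_quotient_module[OF E1 W1 m1])
private lemma Q1: "module S (base_change QZ S)" by (rule base_change_module[OF S QZ])
private lemma VS: "module \<Z> VS" by (rule restrict_scalars_module[OF int_is_cring int_hom_ring_hom[OF S] QS])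

private lemma p_closed: "x \<in> carrier E \<Longrightarrow> pe x \<in> carrier E1" "w \<in> carrier W \<Longrightarrow> pw w \<in> carrier W1"
  by (rule base_change_pure_closed[OF S E _ S.one_closed], assumption)
    (rule base_change_pure_closed[OF S W _ S.one_closed])

private lemma tri_p:
  assumes "x \<in> carrier E" "y \<in> carrier E" "z \<in> carrier E"
  shows "tri S E1 m1 (pe x) (pe y) (pe z) = pw (tri \<Z> E \<mu> x y z)"
  using tri_base_change_mu[OF E W \<mu> S assms S.one_closed S.one_closed S.one_closed] by simp

text \<open>The universal pair over \<open>S\<close>, restricted to unit vectors, is an integral
  pair that satisfies the middle relation, because \<open>\<mu>\<close> over \<open>S\<close> sends
  unit vectors to unit vectors. It therefore induces a map on the integral quotient.\<close>

private abbreviation (input) "fw \<equiv> middle_lift \<Z> VS (\<lambda>w e. lS (pw w) (pe e)) (\<lambda>e w. rS (pe e) (pw w))"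

private lemma fw_maps:
  "bilinear_map \<Z> W E VS (\<lambda>w e. lS (pw w) (pe e))" "bilinear_map \<Z> E W VS (\<lambda>e w. rS (pe e) (pw w))"
proof -
  note L = middle_left_bilinear[OF E1 W1 m1] and R = middle_right_bilinear[OF E1 W1 m1]
  note r = restrict_scalars_lin[OF int_hom_ring_hom[OF S]]
  show "bilinear_map \<Z> W E VS (\<lambda>w e. lS (pw w) (pe e))"
    by (intro bilinear_mapI lin_comp[OF pure_one_lin[OF S W] r[OF bilin_left[OF L]]]
      lin_comp[OF pure_one_lin[OF S E] r[OF bilin_right[OF L]]] p_closed)
  show "bilinear_map \<Z> E W VS (\<lambda>e w. rS (pe e) (pw w))"
    by (intro bilinear_mapI lin_comp[OF pure_one_lin[OF S E] r[OF bilin_left[OF R]]]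
      lin_comp[OF pure_one_lin[OF S W] r[OF bilin_right[OF R]]] p_closed)
qed

private lemma fw_rel:
  assumes "a \<in> carrier E" "b \<in> carrier E" "c \<in> carrier E" "d \<in> carrier E"
  shows "lS (pw (tri \<Z> E \<mu> a b c)) (pe d) = rS (pe a) (pw (tri \<Z> E \<mu> b c d))"
  using middle_relation[OF E1 W1 m1 p_closed(1)[OF assms(1)] p_closed(1)[OF assms(2)] p_closed(1)[OF assms(3)]
      p_closed(1)[OF assms(4)]]
  unfolding tri_p[OF assms(1-3)] tri_p[OF assms(2-4)] .

private lemma fw_lin: "fw \<in> linear_maps \<Z> QZ VS"
  by (rule middle_lift_lin[OF E W \<mu> VS fw_maps fw_rel])

private lemma fw_left: "w \<in> carrier W \<Longrightarrow> e \<in> carrier E \<Longrightarrow> fw (lZ w e) = lS (pw w) (pe e)"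
  by (rule middle_lift_left[OF E W \<mu> VS fw_maps fw_rel])

private lemma fw_right: "e \<in> carrier E \<Longrightarrow> w \<in> carrier W \<Longrightarrow> fw (rZ e w) = rS (pe e) (pw w)"
  by (rule middle_lift_right[OF E W \<mu> VS fw_maps fw_rel])

private abbreviation (input) "forth \<equiv> tensor_lift \<Z> VS (\<lambda>X s. s \<odot>\<^bsub>QS\<^esub> fw X)"

private lemma forth_lin: "forth \<in> linear_maps S (base_change QZ S) QS"
  by (rule base_change_lift_lin[OF S QZ QS fw_lin])

private lemma forth_unit: "X \<in> carrier QZ \<Longrightarrow> forth (pq X) = fw X"
proof -
  interpret QS: module S QS by (rule QS)
  assume X: "X \<in> carrier QZ"
  then show ?thesis
    using base_change_lift_pure[OF S QZ QS fw_lin X S.one_closed] lin_closed[OF fw_lin X] by simp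
qed

text \<open>For the inverse, the integral universal pair is pushed into the base change of the
  quotient and extended to two \<open>S\<close>-bilinear maps \<open>bl1\<close> and
  \<open>br1\<close>.\<close>

private abbreviation (input) "bl1 \<equiv> base_change_bilinear S (base_change QZ S) (\<lambda>w e. pq (lZ w e))"
private abbreviation (input) "br1 \<equiv> base_change_bilinear S (base_change QZ S) (\<lambda>e w. pq (rZ e w))"
private abbreviation (input) "back \<equiv> middle_lift S (base_change QZ S) bl1 br1"

private lemma b_maps:
  "bilinear_map \<Z> W E (restrict_scalars (int_hom S) (base_change QZ S)) (\<lambda>w e. pq (lZ w e))"
  "bilinear_map \<Z> E W (restrict_scalars (int_hom S) (base_change QZ S)) (\<lambda>e w. pq (rZ e w))"
proof -
  note L = middle_left_bilinear[OF E W \<mu>] and R = middle_right_bilinear[OF E W \<mu>] and p = pure_one_lin[OF S QZ]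
  show "bilinear_map \<Z> W E (restrict_scalars (int_hom S) (base_change QZ S)) (\<lambda>w e. pq (lZ w e))"
    by (intro bilinear_mapI lin_comp[OF bilin_left[OF L] p] lin_comp[OF bilin_right[OF L] p])
  show "bilinear_map \<Z> E W (restrict_scalars (int_hom S) (base_change QZ S)) (\<lambda>e w. pq (rZ e w))"
    by (intro bilinear_mapI lin_comp[OF bilin_left[OF R] p] lin_comp[OF bilin_right[OF R] p])
qed

private lemmas bl1 = base_change_bilinear_bilinear[OF S W E Q1 b_maps(1)]
  and br1 = base_change_bilinear_bilinear[OF S E W Q1 b_maps(2)]
  and bl1_unit = base_change_bilinear_pure[OF S W E Q1 b_maps(1)]
  and br1_unit = base_change_bilinear_pure[OF S E W Q1 b_maps(2)]

text \<open>Linearity over \<open>S\<close> in all four arguments reduces the relation to unit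
  vectors, where it is the integral \<open>middle_relation\<close>; the facts \<open>0\<close> to
  \<open>3\<close> and the last step free one argument each.\<close>

private lemma back_rel:
  assumes m: "a \<in> carrier E1" "b \<in> carrier E1" "c \<in> carrier E1" "d \<in> carrier E1"
  shows "bl1 (tri S E1 m1 a b c) d = br1 a (tri S E1 m1 b c d)"
proof -
  note t = tri_trilinear[OF E1 W1 m1] and tc = tri_closed[OF E1 W1 m1] and tz = tri_closed[OF E W \<mu>]
  note ll = bilin_left[OF bl1] and lr = bilin_right[OF bl1] and rl = bilin_left[OF br1] and rr = bilin_right[OF br1]
  note p = p_closed(1)
  have 0: "bl1 (tri S E1 m1 (pe a) (pe b) (pe c)) (pe d) = br1 (pe a) (tri S E1 m1 (pe b) (pe c) (pe d))"
    if m: "a \<in> carrier E" "b \<in> carrier E" "c \<in> carrier E" "d \<in> carrier E" for a b c d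
    unfolding tri_p[OF m(1-3)] tri_p[OF m(2-4)] bl1_unit[OF tz[OF m(1-3)] m(4)] br1_unit[OF m(1) tz[OF m(2-4)]]
      middle_relation[OF E W \<mu> m] ..
  have 1: "bl1 (tri S E1 m1 a (pe b) (pe c)) (pe d) = br1 a (tri S E1 m1 (pe b) (pe c) (pe d))"
    if m: "a \<in> carrier E1" "b \<in> carrier E" "c \<in> carrier E" "d \<in> carrier E" for a b c d
    by (rule base_change_lin_eqI[OF S E lin_comp[OF trilin_1[OF t p[OF m(2)] p[OF m(3)]] ll[OF p[OF m(4)]]]
      rl[OF tc[OF p[OF m(2)] p[OF m(3)] p[OF m(4)]]] 0[OF _ m(2-4)] m(1)])
  have 2: "bl1 (tri S E1 m1 a b (pe c)) (pe d) = br1 a (tri S E1 m1 b (pe c) (pe d))"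
    if m: "a \<in> carrier E1" "b \<in> carrier E1" "c \<in> carrier E" "d \<in> carrier E" for a b c d
    by (rule base_change_lin_eqI[OF S E lin_comp[OF trilin_2[OF t m(1) p[OF m(3)]] ll[OF p[OF m(4)]]]
      lin_comp[OF trilin_1[OF t p[OF m(3)] p[OF m(4)]] rr[OF m(1)]] 1[OF m(1) _ m(3,4)] m(2)])
  have 3: "bl1 (tri S E1 m1 a b c) (pe d) = br1 a (tri S E1 m1 b c (pe d))"
    if m: "a \<in> carrier E1" "b \<in> carrier E1" "c \<in> carrier E1" "d \<in> carrier E" for a b c d
    by (rule base_change_lin_eqI[OF S E lin_comp[OF trilin_3[OF t m(1,2)] ll[OF p[OF m(4)]]]
      lin_comp[OF trilin_2[OF t m(2) p[OF m(4)]] rr[OF m(1)]] 2[OF m(1,2) _ m(4)] m(3)])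
  show ?thesis
    by (rule base_change_lin_eqI[OF S E lr[OF tc[OF m(1-3)]]
      lin_comp[OF trilin_3[OF t m(2,3)] rr[OF m(1)]] 3[OF m(1-3)] m(4)])
qed

private lemma back_lin: "back \<in> linear_maps S QS (base_change QZ S)"
  by (rule middle_lift_lin[OF E1 W1 m1 Q1 bl1 br1 back_rel])

private lemma back_left: "w \<in> carrier W1 \<Longrightarrow> e \<in> carrier E1 \<Longrightarrow> back (lS w e) = bl1 w e"
  by (rule middle_lift_left[OF E1 W1 m1 Q1 bl1 br1 back_rel])

private lemma back_right: "e \<in> carrier E1 \<Longrightarrow> w \<in> carrier W1 \<Longrightarrow> back (rS e w) = br1 e w"
  by (rule middle_lift_right[OF E1 W1 m1 Q1 bl1 br1 back_rel])

private lemma back_forth: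
  assumes "u \<in> carrier (base_change QZ S)" shows "back (forth u) = u"
proof (rule base_change_lin_eqI[OF S QZ lin_comp[OF forth_lin back_lin] lin_id _ assms])
  fix X assume X: "X \<in> carrier QZ"
  have "back (fw X) = pq X"
    by (rule middle_lin_eqI[OF E W \<mu> lin_comp[OF fw_lin restrict_scalars_lin[OF int_hom_ring_hom[OF S] back_lin]]
          pure_one_lin[OF S QZ] _ _ X])
      (simp_all only: fw_left fw_right back_left back_right p_closed bl1_unit br1_unit)
  then show "back (forth (pq X)) = pq X" unfolding forth_unit[OF X] .
qed

text \<open>The generators of the quotient over \<open>S\<close> have arbitrary entries
  \<open>w\<close> and \<open>e\<close>, so the comparison is reduced to unit vectors in each of the
  two entries before the maps can be evaluated.\<close>

private lemma forth_back:
  assumes "u \<in> carrier QS" shows "forth (back u) = u"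
proof (rule middle_lin_eqI[OF E1 W1 m1 lin_comp[OF back_lin forth_lin] lin_id _ _ assms])
  note L = middle_left_bilinear[OF E1 W1 m1] and R = middle_right_bilinear[OF E1 W1 m1]
  have lz: "lZ w e \<in> carrier QZ" "rZ e w \<in> carrier QZ" if "w \<in> carrier W" "e \<in> carrier E" for w e
    using bilin_closed[OF middle_left_bilinear[OF E W \<mu>] that] bilin_closed[OF middle_right_bilinear[OF E W \<mu>] that(2,1)] .
  show "forth (back (lS w e)) = lS w e" if m: "w \<in> carrier W1" "e \<in> carrier E1" for w e
    unfolding back_left[OF m]
  proof (rule base_change_lin_eqI[OF S E lin_comp[OF bilin_right[OF bl1 m(1)] forth_lin] bilin_right[OF L m(1)] _ m(2)])
    fix e assume e: "e \<in> carrier E"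
    show "forth (bl1 w (pe e)) = lS w (pe e)"
      by (rule base_change_lin_eqI[OF S W lin_comp[OF bilin_left[OF bl1 p_closed(1)[OF e]] forth_lin]
            bilin_left[OF L p_closed(1)[OF e]] _ m(1)])
        (simp only: bl1_unit e forth_unit lz fw_left)
  qed
  show "forth (back (rS e w)) = rS e w" if m: "e \<in> carrier E1" "w \<in> carrier W1" for e w
    unfolding back_right[OF m]
  proof (rule base_change_lin_eqI[OF S E lin_comp[OF bilin_left[OF br1 m(2)] forth_lin] bilin_left[OF R m(2)] _ m(1)])
    fix e assume e: "e \<in> carrier E"
    show "forth (br1 (pe e) w) = rS (pe e) w"
      by (rule base_change_lin_eqI[OF S W lin_comp[OF bilin_right[OF br1 p_closed(1)[OF e]] forth_lin]
            bilin_right[OF R p_closed(1)[OF e]] _ m(2)])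
        (simp only: br1_unit e forth_unit lz fw_right)
  qed
qed

lemma middle_quotient_base_change:
  "\<exists>f. f \<in> module_iso S (base_change (middle_quotient \<Z> E W \<mu>) S)
     (middle_quotient S (base_change E S) (base_change W S) (base_change_mu E W \<mu> S))"
proof (rule exI)
  have "bij_betw forth (carrier (base_change QZ S)) (carrier QS)"
    by (rule bij_betwI[where g = "back"])
      (auto simp del: base_change_simps simp: back_forth forth_back lin_closed[OF forth_lin] lin_closed[OF back_lin])
  then show "forth \<in> module_iso S (base_change QZ S) QS"
    unfolding module_iso_def using forth_lin Q1 QS by blast
qed

end

section \<open>Homomorphisms from finite free modules\<close>

lemma finsum_regular_int:
  "(\<Oplus>\<^bsub>regular_module \<Z>\<^esub>a\<in>A. g a) = (\<Sum>a\<in>A. g a)"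
proof -
  interpret G: module \<Z> "regular_module \<Z>" by (rule regular_module[OF int_is_cring])
  show ?thesis by (induction A rule: infinite_finite_induct) auto
qed

text \<open>The sum of two coordinate vectors represents the sum of the elements, so uniqueness of
  coordinates makes each coordinate additive. The same uniqueness yields the dual basis
  property.\<close>

lemma finite_free_coordinates:
  fixes M :: "(int, 'm, 'y) module_scheme"
  assumes "finite_free \<Z> M"
  obtains B \<epsilon> where "finite B" "B \<subseteq> carrier M" "\<And>b. b \<in> B \<Longrightarrow> \<epsilon> b \<in> linear_maps \<Z> M (regular_module \<Z>)"
    "\<And>x. x \<in> carrier M \<Longrightarrow> (\<Oplus>\<^bsub>M\<^esub>b\<in>B. \<epsilon> b x \<odot>\<^bsub>M\<^esub> b) = x"
    "\<And>b b'. b \<in> B \<Longrightarrow> b' \<in> B \<Longrightarrow> \<epsilon> b b' = (if b = b' then 1 else 0)"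
proof -
  have M: "module \<Z> M" using assms by (simp add: finite_free_def)
  interpret M: module \<Z> M by (rule M)
  obtain B where B: "finite B" "B \<subseteq> carrier M"
    and ex: "\<forall>x\<in>carrier M. \<exists>!c. c \<in> B \<rightarrow>\<^sub>E carrier \<Z> \<and> x = (\<Oplus>\<^bsub>M\<^esub>b\<in>B. c b \<odot>\<^bsub>M\<^esub> b)"
    using assms unfolding finite_free_def by blast
  define c where "c x = (THE c. c \<in> B \<rightarrow>\<^sub>E carrier \<Z> \<and> x = (\<Oplus>\<^bsub>M\<^esub>b\<in>B. c b \<odot>\<^bsub>M\<^esub> b))" for x
  have c: "c x \<in> B \<rightarrow>\<^sub>E carrier \<Z>" "x = (\<Oplus>\<^bsub>M\<^esub>b\<in>B. c x b \<odot>\<^bsub>M\<^esub> b)" if "x \<in> carrier M" for x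
    using theI'[OF bspec[OF ex that]] unfolding c_def by blast+
  have uniq: "c x = d" if "x \<in> carrier M" "d \<in> B \<rightarrow>\<^sub>E carrier \<Z>" "(\<Oplus>\<^bsub>M\<^esub>b\<in>B. d b \<odot>\<^bsub>M\<^esub> b) = x" for x d
    unfolding c_def by (rule the1_equality[OF bspec[OF ex that(1)]], rule conjI[OF that(2) that(3)[symmetric]])
  have sc: "k \<odot>\<^bsub>M\<^esub> b \<in> carrier M" if "b \<in> B" for k b
    using M.smult_closed[of k b] that B by auto
  have lin: "(\<lambda>x. c x b) \<in> linear_maps \<Z> M (regular_module \<Z>)" if b: "b \<in> B" for b
  proof (rule int_additive_lin[OF M regular_module[OF int_is_cring]])
    fix x y assume xy: "x \<in> carrier M" "y \<in> carrier M"
    have "c (x \<oplus>\<^bsub>M\<^esub> y) = (\<lambda>b\<in>B. c x b + c y b)"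
    proof (rule uniq)
      have "(\<Oplus>\<^bsub>M\<^esub>b\<in>B. (\<lambda>b\<in>B. c x b + c y b) b \<odot>\<^bsub>M\<^esub> b) = (\<Oplus>\<^bsub>M\<^esub>b\<in>B. c x b \<odot>\<^bsub>M\<^esub> b \<oplus>\<^bsub>M\<^esub> c y b \<odot>\<^bsub>M\<^esub> b)"
      proof (rule M.finsum_cong'[OF refl])
        show "(\<lambda>b. c x b \<odot>\<^bsub>M\<^esub> b \<oplus>\<^bsub>M\<^esub> c y b \<odot>\<^bsub>M\<^esub> b) \<in> B \<rightarrow> carrier M" using sc by auto
        show "(\<lambda>b\<in>B. c x b + c y b) b \<odot>\<^bsub>M\<^esub> b = c x b \<odot>\<^bsub>M\<^esub> b \<oplus>\<^bsub>M\<^esub> c y b \<odot>\<^bsub>M\<^esub> b" if "b \<in> B" for b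
          using M.smult_l_distr[of "c x b" "c y b" b] that B by auto
      qed
      also have "\<dots> = (\<Oplus>\<^bsub>M\<^esub>b\<in>B. c x b \<odot>\<^bsub>M\<^esub> b) \<oplus>\<^bsub>M\<^esub> (\<Oplus>\<^bsub>M\<^esub>b\<in>B. c y b \<odot>\<^bsub>M\<^esub> b)"
        by (rule M.finsum_addf) (use sc in auto)
      also have "\<dots> = x \<oplus>\<^bsub>M\<^esub> y" using c(2)[OF xy(1)] c(2)[OF xy(2)] by simp
      finally show "(\<Oplus>\<^bsub>M\<^esub>b\<in>B. (\<lambda>b\<in>B. c x b + c y b) b \<odot>\<^bsub>M\<^esub> b) = x \<oplus>\<^bsub>M\<^esub> y" .
    qed (use xy in auto)
    then show "c (x \<oplus>\<^bsub>M\<^esub> y) b = c x b \<oplus>\<^bsub>regular_module \<Z>\<^esub> c y b" using b by simp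
  qed simp
  have basis: "c b' = (\<lambda>b\<in>B. if b = b' then 1 else 0)" if b': "b' \<in> B" for b'
  proof (rule uniq)
    have "(\<Oplus>\<^bsub>M\<^esub>b\<in>B. (\<lambda>b\<in>B. if b = b' then 1 else 0) b \<odot>\<^bsub>M\<^esub> b) = (\<Oplus>\<^bsub>M\<^esub>b\<in>B. if b' = b then b else \<zero>\<^bsub>M\<^esub>)"
    proof (rule M.finsum_cong'[OF refl])
      show "(\<lambda>b\<in>B. if b = b' then 1 else 0) b \<odot>\<^bsub>M\<^esub> b = (if b' = b then b else \<zero>\<^bsub>M\<^esub>)" if "b \<in> B" for b
        using that B M.smult_one[of b] M.smult_l_null[of b] by auto
    qed (use B in auto)
    also have "\<dots> = b'" using M.finsum_singleton[OF b' B(1), of "\<lambda>b. b"] B by auto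
    finally show "(\<Oplus>\<^bsub>M\<^esub>b\<in>B. (\<lambda>b\<in>B. if b = b' then 1 else 0) b \<odot>\<^bsub>M\<^esub> b) = b'" .
  qed (use b' B in auto)
  show thesis
  proof (rule that[of B "\<lambda>b x. c x b"])
    show "(\<Oplus>\<^bsub>M\<^esub>b\<in>B. c x b \<odot>\<^bsub>M\<^esub> b) = x" if "x \<in> carrier M" for x using c(2)[OF that] by simp
    show "c b' b = (if b = b' then 1 else 0)" if "b \<in> B" "b' \<in> B" for b b' using basis[OF that(2)] that by simp
  qed (use B lin in auto)
qed

text \<open>Matrix coefficients with respect to two bases. The enumeration \<open>h\<close> of pairs
  of basis elements by naturals below \<open>k\<close> gives the coordinates the type
  \<open>nat \<Rightarrow> int\<close>, the one for which the flatness hypothesis can be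
  used.\<close>

lemma Hom_finite_free:
  fixes M :: "(int, 'm) module" and N :: "(int, 'n) module"
  assumes "finite_free \<Z> M" "finite_free \<Z> N"
  obtains k :: nat and \<Psi> \<Phi> where
    "\<Psi> \<in> linear_maps \<Z> (free_module \<Z> {..<k}) (Hom_module \<Z> M N)"
    "\<Phi> \<in> linear_maps \<Z> (Hom_module \<Z> M N) (free_module \<Z> {..<k})"
    "\<And>f. f \<in> carrier (Hom_module \<Z> M N) \<Longrightarrow> \<Psi> (\<Phi> f) = f"
    "\<And>c. c \<in> carrier (free_module \<Z> {..<k}) \<Longrightarrow> \<Phi> (\<Psi> c) = c"
proof -
  have M: "module \<Z> M" and N: "module \<Z> N" using assms by (simp_all add: finite_free_def)
  interpret M: module \<Z> M by (rule M)
  interpret N: module \<Z> N by (rule N)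
  obtain B \<epsilon> where B: "finite B" "B \<subseteq> carrier M" and \<epsilon>: "\<And>b. b \<in> B \<Longrightarrow> \<epsilon> b \<in> linear_maps \<Z> M (regular_module \<Z>)"
    and Bs: "\<And>x. x \<in> carrier M \<Longrightarrow> (\<Oplus>\<^bsub>M\<^esub>b\<in>B. \<epsilon> b x \<odot>\<^bsub>M\<^esub> b) = x"
    and B\<delta>: "\<And>b b'. b \<in> B \<Longrightarrow> b' \<in> B \<Longrightarrow> \<epsilon> b b' = (if b = b' then 1 else 0)"
    using finite_free_coordinates[OF assms(1)] by blast
  obtain C \<eta> where C: "finite C" "C \<subseteq> carrier N" and \<eta>: "\<And>b. b \<in> C \<Longrightarrow> \<eta> b \<in> linear_maps \<Z> N (regular_module \<Z>)"
    and Cs: "\<And>x. x \<in> carrier N \<Longrightarrow> (\<Oplus>\<^bsub>N\<^esub>b\<in>C. \<eta> b x \<odot>\<^bsub>N\<^esub> b) = x"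
    and C\<delta>: "\<And>b b'. b \<in> C \<Longrightarrow> b' \<in> C \<Longrightarrow> \<eta> b b' = (if b = b' then 1 else 0)"
    using finite_free_coordinates[OF assms(2)] by blast
  let ?H = "Hom_module \<Z> M N"
  obtain h where h: "bij_betw h {0..<card (B \<times> C)} (B \<times> C)"
    using ex_bij_betw_nat_finite[of "B \<times> C"] B C by auto
  define k where "k = card (B \<times> C)"
  let ?P = "free_module \<Z> {..<k}"
  have hB: "fst (h t) \<in> B" "snd (h t) \<in> C" if "t < k" for t
    using bij_betwE[OF h] that unfolding k_def by (auto simp: mem_Times_iff)
  have hinj: "h t = h t' \<longleftrightarrow> t = t'" if "t < k" "t' < k" for t t'
    using bij_betw_imp_inj_on[OF h] that unfolding k_def by (auto dest: inj_onD)
  have H: "module \<Z> ?H" by (rule Hom_module[OF M N])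
  have P: "module \<Z> ?P" by (rule free_module[OF int_is_cring])
  have ncl: "r \<odot>\<^bsub>N\<^esub> c \<in> carrier N" if "c \<in> C" for r c using N.smult_closed[of r c] that C by auto
  define \<Psi> where "\<Psi> c = (\<lambda>x\<in>carrier M. \<Oplus>\<^bsub>N\<^esub>t\<in>{..<k}. (c t * \<epsilon> (fst (h t)) x) \<odot>\<^bsub>N\<^esub> snd (h t))" for c
  have \<Psi>: "\<Psi> \<in> linear_maps \<Z> ?P ?H"
    unfolding \<Psi>_def
  proof (rule lin_into_Hom[OF M P])
    have sl: "(\<lambda>r. r \<odot>\<^bsub>N\<^esub> snd (h t)) \<in> linear_maps \<Z> (regular_module \<Z>) N" if "t \<in> {..<k}" for t
      by (rule lin_scalar_mult[OF N]) (use hB that C in auto)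
    have ml: "(\<lambda>r. a * r) \<in> linear_maps \<Z> (regular_module \<Z>) (regular_module \<Z>)"
      "(\<lambda>r. r * a) \<in> linear_maps \<Z> (regular_module \<Z>) (regular_module \<Z>)" for a :: int
      by (auto intro!: linear_mapsI simp: algebra_simps)
    have ev: "(\<lambda>c. c t) \<in> linear_maps \<Z> ?P (regular_module \<Z>)" for t
      by (auto intro!: linear_mapsI)
    show "(\<lambda>x. \<Oplus>\<^bsub>N\<^esub>t\<in>{..<k}. (c t * \<epsilon> (fst (h t)) x) \<odot>\<^bsub>N\<^esub> snd (h t)) \<in> linear_maps \<Z> M N"
      for c :: "nat \<Rightarrow> int"
      by (rule finsum_lin[OF N M], rule lin_comp[OF lin_comp[OF \<epsilon> ml(1)] sl]) (use hB in auto)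
    show "(\<lambda>c. \<Oplus>\<^bsub>N\<^esub>t\<in>{..<k}. (c t * \<epsilon> (fst (h t)) x) \<odot>\<^bsub>N\<^esub> snd (h t)) \<in> linear_maps \<Z> ?P N" for x
      by (rule finsum_lin[OF N P], rule lin_comp[OF lin_comp[OF ev ml(2)] sl])
  qed
  define \<Phi> where "\<Phi> f = (\<lambda>t. if t < k then \<eta> (snd (h t)) (f (fst (h t))) else 0)" for f
  have \<eta>ev: "(\<lambda>f. \<eta> c (f b)) \<in> linear_maps \<Z> ?H (regular_module \<Z>)" if "b \<in> B" "c \<in> C" for b c
    by (rule lin_comp[OF Hom_eval_lin \<eta>[OF that(2)]]) (use that B in auto)
  have \<Phi>: "\<Phi> \<in> linear_maps \<Z> ?H ?P"
  proof (rule linear_mapsI)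
    fix f assume f: "f \<in> carrier ?H"
    show "\<Phi> f \<in> carrier ?P"
      by (auto simp: free_module_def \<Phi>_def intro: finite_subset[of _ "{..<k}"])
    show "\<Phi> (f \<oplus>\<^bsub>?H\<^esub> g) = \<Phi> f \<oplus>\<^bsub>?P\<^esub> \<Phi> g" if "g \<in> carrier ?H" for g
      using lin_add[OF \<eta>ev[OF hB] f that] unfolding \<Phi>_def free_int_simps regular_module_simps by (auto simp del: Hom_module_simps)
    show "\<Phi> (r \<odot>\<^bsub>?H\<^esub> f) = r \<odot>\<^bsub>?P\<^esub> \<Phi> f" for r
      using lin_smult[OF \<eta>ev[OF hB] _ f, of _ _ r] unfolding \<Phi>_def free_int_simps regular_module_simps by (auto simp del: Hom_module_simps)
  qed
  have \<Phi>0: "f = \<zero>\<^bsub>?H\<^esub>" if f: "f \<in> carrier ?H" and z: "\<Phi> f = (\<lambda>_. 0)" for f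
  proof (rule extensionalityI)
    have fl: "f \<in> linear_maps \<Z> M N" using f by simp
    have fb: "f b = \<zero>\<^bsub>N\<^esub>" if b: "b \<in> B" for b
    proof -
      have "\<eta> c (f b) = 0" if c: "c \<in> C" for c
      proof -
        have "(b, c) \<in> h ` {0..<k}" unfolding k_def bij_betw_imp_surj_on[OF h] using b c by blast
        then obtain t where "t < k" "h t = (b, c)" by (metis atLeastLessThan_iff imageE)
        then show ?thesis using fun_cong[OF z, of t] by (simp add: \<Phi>_def)
      qed
      then have "(\<Oplus>\<^bsub>N\<^esub>c\<in>C. \<eta> c (f b) \<odot>\<^bsub>N\<^esub> c) = (\<Oplus>\<^bsub>N\<^esub>c\<in>C. \<zero>\<^bsub>N\<^esub>)"
        using C N.smult_l_null by (intro N.finsum_cong') auto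
      moreover have "f b \<in> carrier N" using lin_closed[OF fl] b B by auto
      ultimately show ?thesis using Cs[of "f b"] by simp
    qed
    show "f x = \<zero>\<^bsub>?H\<^esub> x" if x: "x \<in> carrier M" for x
    proof -
      have "f x = f (\<Oplus>\<^bsub>M\<^esub>b\<in>B. \<epsilon> b x \<odot>\<^bsub>M\<^esub> b)" using Bs[OF x] by simp
      also have "\<dots> = (\<Oplus>\<^bsub>N\<^esub>b\<in>B. f (\<epsilon> b x \<odot>\<^bsub>M\<^esub> b))"
        by (rule lin_finsum[OF fl M N]) (use B M.smult_closed in auto)
      also have "\<dots> = (\<Oplus>\<^bsub>N\<^esub>b\<in>B. \<zero>\<^bsub>N\<^esub>)"
        using B fb M.smult_closed lin_smult[OF fl] N.smult_r_null by (intro N.finsum_cong') (auto simp: subset_eq)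
      finally show ?thesis using x by simp
    qed
  qed (use f in auto)
  have \<Phi>\<Psi>: "\<Phi> (\<Psi> c) = c" if c: "c \<in> carrier ?P" for c
  proof
    fix t0 show "\<Phi> (\<Psi> c) t0 = c t0"
    proof (cases "t0 < k")
      case False
      then show ?thesis using free_carrier_D(2)[OF int_is_cring c, of t0] by (simp add: \<Phi>_def)
    next
      case True
      note h0 = hB[OF True]
      have x: "fst (h t0) \<in> carrier M" using h0 B by auto
      have "\<Phi> (\<Psi> c) t0 = \<eta> (snd (h t0)) (\<Oplus>\<^bsub>N\<^esub>t\<in>{..<k}. (c t * \<epsilon> (fst (h t)) (fst (h t0))) \<odot>\<^bsub>N\<^esub> snd (h t))"
        using True x by (simp add: \<Phi>_def \<Psi>_def)
      also have "\<dots> = (\<Sum>t\<in>{..<k}. \<eta> (snd (h t0)) ((c t * \<epsilon> (fst (h t)) (fst (h t0))) \<odot>\<^bsub>N\<^esub> snd (h t)))"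
        unfolding finsum_regular_int[symmetric]
        by (rule lin_finsum[OF \<eta>[OF h0(2)] N regular_module[OF int_is_cring]]) (use hB ncl in auto)
      also have "\<dots> = (\<Sum>t\<in>{..<k}. if t0 = t then c t else 0)"
      proof (rule sum.cong[OF refl])
        fix t assume "t \<in> {..<k}"
        then have t: "t < k" by simp
        have "snd (h t) \<in> carrier N" using hB[OF t] C by auto
        then have "\<eta> (snd (h t0)) ((c t * \<epsilon> (fst (h t)) (fst (h t0))) \<odot>\<^bsub>N\<^esub> snd (h t)) =
          c t * \<epsilon> (fst (h t)) (fst (h t0)) * \<eta> (snd (h t0)) (snd (h t))"
          using lin_smult[OF \<eta>[OF h0(2)], of "c t * \<epsilon> (fst (h t)) (fst (h t0))" "snd (h t)"] by simp
        also have "\<dots> = (if t0 = t then c t else 0)"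
          using hinj[OF True t] hB[OF t] h0 by (auto simp: B\<delta> C\<delta> prod_eq_iff)
        finally show "\<eta> (snd (h t0)) ((c t * \<epsilon> (fst (h t)) (fst (h t0))) \<odot>\<^bsub>N\<^esub> snd (h t)) = (if t0 = t then c t else 0)" .
      qed
      also have "\<dots> = c t0" using True by simp
      finally show ?thesis .
    qed
  qed
  \<comment> \<open>A homomorphism whose matrix coefficients all vanish is zero by
    \<open>\<Phi>0\<close>. The difference of the two sides has this property because
    \<open>\<Phi>\<close> after \<open>\<Psi>\<close> is already known to be the identity.\<close>
  have \<Psi>\<Phi>: "\<Psi> (\<Phi> f) = f" if f: "f \<in> carrier ?H" for f
  proof -
    interpret H: module \<Z> ?H by (rule H)
    interpret P: module \<Z> ?P by (rule P)
    note cf = lin_closed[OF \<Phi> f] and cg = lin_closed[OF \<Psi> lin_closed[OF \<Phi> f]]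
    have "\<Phi> (\<Psi> (\<Phi> f) \<ominus>\<^bsub>?H\<^esub> f) = \<Phi> f \<ominus>\<^bsub>?P\<^esub> \<Phi> f"
      unfolding lin_diff[OF \<Phi> H P cg f] \<Phi>\<Psi>[OF cf] ..
    also have "\<dots> = (\<lambda>_. 0)" using P.r_neg[OF cf] by (simp add: a_minus_def)
    finally have "\<Psi> (\<Phi> f) \<ominus>\<^bsub>?H\<^esub> f = \<zero>\<^bsub>?H\<^esub>"
      using cg f by (intro \<Phi>0 H.minus_closed)
    moreover have "\<Psi> (\<Phi> f) = (\<Psi> (\<Phi> f) \<ominus>\<^bsub>?H\<^esub> f) \<oplus>\<^bsub>?H\<^esub> f"
      using cg f by (simp only: a_minus_def H.a_assoc H.a_inv_closed H.l_neg H.r_zero)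
    ultimately show ?thesis using H.l_zero[OF f] by (simp only:)
  qed
  show thesis by (rule that[OF \<Psi> \<Phi> \<Psi>\<Phi> \<Phi>\<Psi>])
qed

text \<open>With a finite basis \<open>B\<close> of \<open>M\<close>, the identity of
  \<open>Hom(M, N)\<close> is the sum over \<open>b\<close> of evaluation at \<open>b\<close>
  followed by \<open>q b\<close>, which turns \<open>w\<close> into the map sending \<open>x\<close>
  to \<open>\<epsilon> b x\<close> times \<open>w\<close>. After tensoring with \<open>L\<close>,
  every summand factors through an evaluation and so kills \<open>Z\<close>.\<close>

lemma Hom_tensor_eval_eq_zero:
  fixes M :: "(int, 'm) module" and N :: "(int, 'n) module" and L :: "(int, 'l) module"
  assumes "finite_free \<Z> M" and N: "module \<Z> N" and L: "module \<Z> L"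
    and Z: "Z \<in> carrier (tensor \<Z> (Hom_module \<Z> M N) L)"
    and zero: "\<And>e. e \<in> carrier M \<Longrightarrow> tensor_map \<Z> N L (\<lambda>f. f e) (\<lambda>s. s) Z = \<zero>\<^bsub>tensor \<Z> N L\<^esub>"
  shows "Z = \<zero>\<^bsub>tensor \<Z> (Hom_module \<Z> M N) L\<^esub>"
proof -
  let ?H = "Hom_module \<Z> M N"
  have M: "module \<Z> M" using assms by (simp add: finite_free_def)
  interpret M: module \<Z> M by (rule M)
  interpret N: module \<Z> N by (rule N)
  obtain B \<epsilon> where B: "finite B" "B \<subseteq> carrier M" and \<epsilon>: "\<And>b. b \<in> B \<Longrightarrow> \<epsilon> b \<in> linear_maps \<Z> M (regular_module \<Z>)"
    and Bs: "\<And>x. x \<in> carrier M \<Longrightarrow> (\<Oplus>\<^bsub>M\<^esub>b\<in>B. \<epsilon> b x \<odot>\<^bsub>M\<^esub> b) = x"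
    and "\<And>b b'. b \<in> B \<Longrightarrow> b' \<in> B \<Longrightarrow> \<epsilon> b b' = (if b = b' then 1 else 0)"
    using finite_free_coordinates[OF assms(1)] by blast
  have H: "module \<Z> ?H" by (rule Hom_module[OF M N])
  interpret H: module \<Z> ?H by (rule H)
  define q where "q b w = (\<lambda>x\<in>carrier M. \<epsilon> b x \<odot>\<^bsub>N\<^esub> w)" for b w
  have q: "q b \<in> linear_maps \<Z> N ?H" if "b \<in> B" for b
    unfolding q_def
    by (rule lin_into_Hom[OF M N], rule lin_comp[OF \<epsilon>[OF that] lin_scalar_mult[OF N]], assumption)
      (rule lin_scale[OF N lin_id], simp)
  have ev: "(\<lambda>f. f b) \<in> linear_maps \<Z> ?H N" if "b \<in> B" for b
    by (rule Hom_eval_lin) (use that B in auto)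
  note qe = lin_comp[OF ev q]
  have id: "(\<Oplus>\<^bsub>?H\<^esub>b\<in>B. q b (f b)) = f" if f: "f \<in> carrier ?H" for f
  proof (rule extensionalityI)
    have fl: "f \<in> linear_maps \<Z> M N" using f by simp
    have qc: "(\<lambda>b. q b (f b)) \<in> B \<rightarrow> carrier ?H" using lin_closed[OF qe _ ] f by blast
    show "(\<Oplus>\<^bsub>?H\<^esub>b\<in>B. q b (f b)) \<in> extensional (carrier M)" using H.finsum_closed[OF qc] by simp
    show "f \<in> extensional (carrier M)" using f by simp
    fix x assume x: "x \<in> carrier M"
    have "(\<Oplus>\<^bsub>?H\<^esub>b\<in>B. q b (f b)) x = (\<Oplus>\<^bsub>N\<^esub>b\<in>B. q b (f b) x)"
      by (rule lin_finsum[OF Hom_eval_lin[OF x] H N qc])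
    also have "\<dots> = (\<Oplus>\<^bsub>N\<^esub>b\<in>B. f (\<epsilon> b x \<odot>\<^bsub>M\<^esub> b))"
      using B x M.smult_closed lin_closed[OF fl] lin_smult[OF fl] by (intro N.finsum_cong') (auto simp: q_def subset_eq)
    also have "\<dots> = f (\<Oplus>\<^bsub>M\<^esub>b\<in>B. \<epsilon> b x \<odot>\<^bsub>M\<^esub> b)"
      by (rule lin_finsum[OF fl M N, symmetric]) (use B M.smult_closed in auto)
    finally show "(\<Oplus>\<^bsub>?H\<^esub>b\<in>B. q b (f b)) x = f x" using Bs[OF x] by simp
  qed
  interpret TH: module \<Z> "tensor \<Z> ?H L" by (rule tensor_module[OF H L])
  have "Z = tensor_map \<Z> ?H L (\<lambda>f. f) (\<lambda>s. s) Z" by (rule tensor_map_id[OF H L Z, symmetric])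
  also have "\<dots> = tensor_map \<Z> ?H L (\<lambda>f. \<Oplus>\<^bsub>?H\<^esub>b\<in>B. q b (f b)) (\<lambda>s. s) Z"
    by (rule tensor_map_cong[OF H L H L finsum_lin[OF H H qe] lin_id _ refl Z]) (simp_all only: id)
  also have "\<dots> = (\<Oplus>\<^bsub>tensor \<Z> ?H L\<^esub>b\<in>B. tensor_map \<Z> ?H L (\<lambda>f. q b (f b)) (\<lambda>s. s) Z)"
    by (rule tensor_map_finsum[OF H L H L B(1) qe lin_id Z])
  also have "\<dots> = (\<Oplus>\<^bsub>tensor \<Z> ?H L\<^esub>b\<in>B. \<zero>\<^bsub>tensor \<Z> ?H L\<^esub>)"
  proof (rule TH.finsum_cong'[OF refl])
    fix b assume b: "b \<in> B"
    have "tensor_map \<Z> ?H L (\<lambda>f. q b (f b)) (\<lambda>s. s) Z =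
        tensor_map \<Z> ?H L (q b) (\<lambda>s. s) (tensor_map \<Z> N L (\<lambda>f. f b) (\<lambda>s. s) Z)"
      by (rule tensor_map_comp[OF H L N L H L ev[OF b] lin_id q[OF b] lin_id Z, symmetric])
    also have "\<dots> = \<zero>\<^bsub>tensor \<Z> ?H L\<^esub>"
      using zero[of b] b B tensor_map_at_zero[OF N L H L q[OF b] lin_id] by auto
    finally show "tensor_map \<Z> ?H L (\<lambda>f. q b (f b)) (\<lambda>s. s) Z = \<zero>\<^bsub>tensor \<Z> ?H L\<^esub>" .
  qed simp
  finally show ?thesis by simp
qed

section \<open>The base change sequence of the operator defect\<close>

lemma inv_into_lin:
  assumes f: "f \<in> linear_maps R M N" and bij: "bij_betw f (carrier M) (carrier N)" and M: "module R M"
  shows "inv_into (carrier M) f \<in> linear_maps R N M"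
proof -
  interpret M: module R M by (rule M)
  let ?g = "inv_into (carrier M) f"
  have g: "?g y \<in> carrier M" "f (?g y) = y" if "y \<in> carrier N" for y
    using that bij by (auto simp: bij_betw_def inv_into_into f_inv_into_f)
  have inv: "?g (f x) = x" if "x \<in> carrier M" for x
    using that bij by (simp add: bij_betw_def)
  show ?thesis
  proof (rule linear_mapsI)
    fix y assume y: "y \<in> carrier N"
    show "?g y \<in> carrier M" using g y by simp
    show "?g (y \<oplus>\<^bsub>N\<^esub> z) = ?g y \<oplus>\<^bsub>M\<^esub> ?g z" if "z \<in> carrier N" for z
      using inv[of "?g y \<oplus>\<^bsub>M\<^esub> ?g z"] g[OF y] g[OF that] by (simp add: lin_add[OF f])
    show "?g (r \<odot>\<^bsub>N\<^esub> y) = r \<odot>\<^bsub>M\<^esub> ?g y" if "r \<in> carrier R" for r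
      using inv[of "r \<odot>\<^bsub>M\<^esub> ?g y"] g[OF y] that by (simp add: lin_smult[OF f])
  qed
qed

text \<open>The maps \<open>f\<close> and \<open>h\<close> act on different tensor factors and hence
  commute. Every square in the naturality statement is of this kind, apart from those that involve
  the operator rng over \<open>S\<close>.\<close>

lemma base_change_hom_map:
  assumes S: "cring S" and S': "cring S'" and h: "h \<in> ring_hom S S'"
    and M: "module \<Z> M" and N: "module \<Z> N" and f: "f \<in> linear_maps \<Z> M N" and u: "u \<in> carrier (base_change M S)"
  shows "tensor_map \<Z> N (int_alg S') f (\<lambda>s. s) (base_change_hom M S' h u) =
    base_change_hom N S' h (tensor_map \<Z> N (int_alg S) f (\<lambda>s. s) u)"
proof -
  note I = int_alg_module[OF S] and I' = int_alg_module[OF S'] and hl = ring_hom_int_alg_lin[OF S S' h]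
  have u: "u \<in> carrier (tensor \<Z> M (int_alg S))" using u by simp
  show ?thesis
    unfolding base_change_hom_def
    using tensor_map_comp[OF M I M I' N I' lin_id hl f lin_id u] tensor_map_comp[OF M I N I N I' f lin_id lin_id hl u] by simp
qed

lemma base_change_hom_closed:
  assumes S: "cring S" and S': "cring S'" and h: "h \<in> ring_hom S S'"
    and M: "module \<Z> M" and u: "u \<in> carrier (base_change M S)"
  shows "base_change_hom M S' h u \<in> carrier (base_change M S')"
  using lin_closed[OF base_change_hom_lin[OF S S' M h] u] by simp

lemma base_change_hom_zero:
  assumes S: "cring S" and S': "cring S'" and h: "h \<in> ring_hom S S'" and M: "module \<Z> M"
  shows "base_change_hom M S' h \<zero>\<^bsub>tensor \<Z> M (int_alg S)\<^esub> = \<zero>\<^bsub>tensor \<Z> M (int_alg S')\<^esub>"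
  unfolding base_change_hom_def
  by (rule tensor_map_at_zero[OF M int_alg_module[OF S] M int_alg_module[OF S'] lin_id ring_hom_int_alg_lin[OF S S' h]])

lemma Tor1_eq:
  "Tor1 C S = (base_change (resolution_kernel C) S)\<lparr>carrier := {X \<in> carrier (base_change (resolution_kernel C) S).
     tensor_map \<Z> (free_module \<Z> (carrier C)) (int_alg S) (\<lambda>x. x) (\<lambda>s. s) X =
       \<zero>\<^bsub>tensor \<Z> (free_module \<Z> (carrier C)) (int_alg S)\<^esub>}\<rparr>"
  by (simp add: Tor1_def Let_def)

lemma resolution_kernel_module:
  assumes C: "module \<Z> C"
  shows "module \<Z> (resolution_kernel C)"
    and "(\<lambda>x. x) \<in> linear_maps \<Z> (resolution_kernel C) (free_module \<Z> (carrier C))"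
proof -
  have F: "module \<Z> (free_module \<Z> (carrier C))" by (rule free_module[OF int_is_cring])
  have l: "free_lift \<Z> C (\<lambda>x. x) \<in> linear_maps \<Z> (free_module \<Z> (carrier C)) C"
    by (rule free_lift_lin[OF int_is_cring C])
  show "module \<Z> (resolution_kernel C)"
    unfolding resolution_kernel_def Let_def by (rule module_carrier_update[OF F submodule_kernel[OF l F C]])
  show "(\<lambda>x. x) \<in> linear_maps \<Z> (resolution_kernel C) (free_module \<Z> (carrier C))"
    unfolding resolution_kernel_def Let_def by (rule lin_id_sub) auto
qed

text \<open>\<open>Tor1\<close> is cut out by a condition on integral tensor products, but the map
  in that condition is linear over \<open>S\<close> too, so its kernel is stable under
  \<open>S\<close>.\<close>

lemma Tor1_submodule:
  assumes S: "cring S" and C: "module \<Z> C"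
  shows "submodule (carrier (Tor1 C S)) S (base_change (resolution_kernel C) S)"
proof -
  note K = resolution_kernel_module[OF C]
  have F: "module \<Z> (free_module \<Z> (carrier C))" by (rule free_module[OF int_is_cring])
  show ?thesis
    using submodule_kernel[OF base_change_map_lin[OF S K(1) F K(2)] base_change_module[OF S K(1)] base_change_module[OF S F]]
    by (simp add: Tor1_eq)
qed

lemma Tor1_module:
  assumes "cring S" "module \<Z> C" shows "module S (Tor1 C S)"
  using module_carrier_update[OF base_change_module[OF assms(1) resolution_kernel_module(1)[OF assms(2)]]
      Tor1_submodule[OF assms]] by (simp add: Tor1_eq)

section \<open>The exact sequence, its naturality, and flat base change\<close>

context
  fixes E :: "(int, 'e) module" and W :: "(int, 'w) module" and \<mu> :: "(int, 'e) cube \<Rightarrow> 'w"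
    and k :: nat and \<Psi> \<Phi>
  assumes E: "finite_free \<Z> E" and W: "finite_free \<Z> W"
    and \<mu>: "\<mu> \<in> linear_maps \<Z> (tensor3 \<Z> E E E) W"
    and \<Psi>: "\<Psi> \<in> linear_maps \<Z> (free_module \<Z> {..<k}) (Hom_module \<Z> E W)"
    and \<Phi>: "\<Phi> \<in> linear_maps \<Z> (Hom_module \<Z> E W) (free_module \<Z> {..<k})"
    and \<Psi>\<Phi>: "\<And>f. f \<in> carrier (Hom_module \<Z> E W) \<Longrightarrow> \<Psi> (\<Phi> f) = f"
    and \<Phi>\<Psi>: "\<And>c. c \<in> carrier (free_module \<Z> {..<k}) \<Longrightarrow> \<Phi> (\<Psi> c) = c"
begin

private abbreviation (input) "Tz \<equiv> direct_sum E W"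
private abbreviation (input) "Az \<equiv> two_step \<Z> E W \<mu>"
private abbreviation (input) "Oz \<equiv> operator_rng \<Z> Az"
private abbreviation (input) "Dz \<equiv> operator_defect \<Z> Az"
private abbreviation (input) "Hz \<equiv> Hom_module \<Z> E W"
private abbreviation (input) "Pz \<equiv> free_module \<Z> {..<k}"
private abbreviation (input) "Cz \<equiv> C_vis \<Z> E W \<mu>"
private abbreviation (input) "Kz \<equiv> resolution_kernel Cz"
private abbreviation (input) "Fz \<equiv> free_module \<Z> (carrier Cz)"
private abbreviation (input) "vis \<equiv> visible_rep E W \<mu>"
private abbreviation (input) "rz \<equiv> \<lambda>X. \<Phi> (vis X)"
private abbreviation (input) "im_Theta \<equiv> Theta \<Z> E W \<mu> ` carrier (tensor \<Z> E E)"
private abbreviation (input) "\<pi>z \<equiv> \<lambda>c. im_Theta +>\<^bsub>Hz\<^esub> \<Psi> c"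

private lemma Em: "module \<Z> E" and Wm: "module \<Z> W"
  using E W by (simp_all add: finite_free_def)

interpretation E: module \<Z> E by (rule Em)
interpretation W: module \<Z> W by (rule Wm)

private lemma Oz: "module \<Z> Oz" by (rule operator_rng_module[OF Em Wm \<mu>])
private lemma Dz: "module \<Z> Dz" by (rule operator_defect_module[OF Em Wm \<mu>])
private lemma Hz: "module \<Z> Hz" by (rule Hom_module[OF Em Wm])
private lemma Pz: "module \<Z> Pz" by (rule free_module[OF int_is_cring])
private lemma Fz: "module \<Z> Fz" by (rule free_module[OF int_is_cring])

private lemmas vis = visible_rep_lin[OF Em Wm \<mu>]

private lemma rz: "rz \<in> linear_maps \<Z> Oz Pz"
  by (rule lin_comp[OF vis \<Phi>])

private lemma Theta_bilinear: "bilinear_map \<Z> E E Hz (\<lambda>a b. \<lambda>c\<in>carrier E. tri \<Z> E \<mu> a b c)"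
  using tri_trilinear[OF Em Wm \<mu>]
  by (intro bilinear_mapI lin_into_Hom Em) (auto intro: trilin_1 trilin_2 trilin_3)

private lemma Theta_lin: "Theta \<Z> E W \<mu> \<in> linear_maps \<Z> (tensor \<Z> E E) Hz"
  unfolding Theta_def by (rule tensor_lift_lin[OF Em Em Hz Theta_bilinear])

private lemma Theta_pure:
  "a \<in> carrier E \<Longrightarrow> b \<in> carrier E \<Longrightarrow> Theta \<Z> E W \<mu> (pure \<Z> E E a b) = (\<lambda>c\<in>carrier E. tri \<Z> E \<mu> a b c)"
  unfolding Theta_def by (rule tensor_lift_pure[OF Em Em Hz Theta_bilinear])

private lemma im_sub: "submodule im_Theta \<Z> Hz"
  by (rule submodule_image[OF Theta_lin tensor_module[OF Em Em] Hz])

private lemma vis_class_eq: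
  assumes "a \<in> carrier Tz" "b \<in> carrier Tz"
  shows "vis (op_class \<Z> Az a \<alpha> b \<beta>) = (\<alpha> * \<beta>) \<odot>\<^bsub>Hz\<^esub> Theta \<Z> E W \<mu> (pure \<Z> E E (fst a) (fst b))"
proof (rule extensionalityI)
  have "op_class \<Z> Az a \<alpha> b \<beta> \<in> carrier Oz"
    by (rule quadrilin_closed[OF op_class_quadrilinear[OF Em Wm \<mu>] assms(1) _ assms(2)]) simp_all
  then show "vis (op_class \<Z> Az a \<alpha> b \<beta>) \<in> extensional (carrier E)" using lin_closed[OF vis] by simp
  show "(\<alpha> * \<beta>) \<odot>\<^bsub>Hz\<^esub> Theta \<Z> E W \<mu> (pure \<Z> E E (fst a) (fst b)) \<in> extensional (carrier E)" by simp
  show "vis (op_class \<Z> Az a \<alpha> b \<beta>) e = ((\<alpha> * \<beta>) \<odot>\<^bsub>Hz\<^esub> Theta \<Z> E W \<mu> (pure \<Z> E E (fst a) (fst b))) e"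
    if "e \<in> carrier E" for e
    using assms that by (auto simp: visible_rep_class[OF Em Wm \<mu>] Theta_pure)
qed

text \<open>Both sides are submodules of \<open>Hom(E, W)\<close>, so generators suffice. A class
  goes to a multiple of \<open>Theta\<close> of a pure tensor, and conversely \<open>Theta\<close>
  of \<open>a \<otimes> b\<close> is the value at the class of \<open>(a, 0)\<close>, 1,
  \<open>(b, 0)\<close>, 1.\<close>

private lemma vis_image: "vis ` carrier Oz = im_Theta"
proof
  have "vis X \<in> im_Theta" if "X \<in> carrier Oz" for X
    using that
  proof (induction rule: op_induct[OF Em Wm \<mu>, consumes 1, case_names op_class add])
    case (op_class a \<alpha> b \<beta>)
    then have "pure \<Z> E E (fst a) (fst b) \<in> carrier (tensor \<Z> E E)" by (intro pure_closed[OF Em Em]) auto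
    then show ?case
      unfolding vis_class_eq[OF op_class(1,3)] by (intro submodule_mem(3)[OF im_sub]) auto
  next
    case (add u v)
    then show ?case unfolding lin_add[OF vis add(1,2)] by (intro submodule_mem(2)[OF im_sub])
  qed
  then show "vis ` carrier Oz \<subseteq> im_Theta" by auto
  have sub: "submodule (vis ` carrier Oz) \<Z> Hz" by (rule submodule_image[OF vis Oz Hz])
  have "Theta \<Z> E W \<mu> u \<in> vis ` carrier Oz" if "u \<in> carrier (tensor \<Z> E E)" for u
    using that
  proof (induction rule: tensor_induct[OF Em Em, consumes 1, case_names pure add])
    case (pure a b)
    have ab: "(a, \<zero>\<^bsub>W\<^esub>) \<in> carrier Tz" "(b, \<zero>\<^bsub>W\<^esub>) \<in> carrier Tz" using pure by auto
    have "op_class \<Z> Az (a, \<zero>\<^bsub>W\<^esub>) 1 (b, \<zero>\<^bsub>W\<^esub>) 1 \<in> carrier Oz"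
      by (rule quadrilin_closed[OF op_class_quadrilinear[OF Em Wm \<mu>] ab(1) _ ab(2)]) simp_all
    moreover have "vis (op_class \<Z> Az (a, \<zero>\<^bsub>W\<^esub>) 1 (b, \<zero>\<^bsub>W\<^esub>) 1) = Theta \<Z> E W \<mu> (pure \<Z> E E a b)"
      using module.smult_one[OF Hz lin_closed[OF Theta_lin pure_closed[OF Em Em pure]]]
      by (simp add: vis_class_eq[OF ab] del: Hom_module_simps)
    ultimately show ?case by (metis imageI)
  next
    case (add u v)
    then show ?case unfolding lin_add[OF Theta_lin add(1,2)] by (intro submodule_mem(2)[OF sub])
  qed
  then show "im_Theta \<subseteq> vis ` carrier Oz" by auto
qed

private lemma Cz: "module \<Z> Cz"
  unfolding C_vis_def by (rule quot_module[OF Hz im_sub])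

private lemma \<pi>z: "\<pi>z \<in> linear_maps \<Z> Pz Cz"
  unfolding C_vis_def by (rule lin_comp[OF \<Psi> quot_proj_lin[OF Hz im_sub]])

private lemma \<pi>z_onto: "\<pi>z ` carrier Pz = carrier Cz"
proof
  show "\<pi>z ` carrier Pz \<subseteq> carrier Cz" using lin_closed[OF \<pi>z] by blast
  show "carrier Cz \<subseteq> \<pi>z ` carrier Pz"
  proof
    fix x assume "x \<in> carrier Cz"
    then obtain f where f: "f \<in> carrier Hz" "x = im_Theta +>\<^bsub>Hz\<^esub> f"
      unfolding C_vis_def quot_carrier[OF Hz im_sub] by blast
    show "x \<in> \<pi>z ` carrier Pz"
      by (rule image_eqI[of _ _ "\<Phi> f"]) (use f \<Psi>\<Phi>[OF f(1)] lin_closed[OF \<Phi> f(1)] in simp_all)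
  qed
qed

text \<open>Exactness at the middle of the presentation of \<open>Cz\<close>: the image of
  \<open>vis\<close> is that of \<open>Theta\<close>, and the mutually inverse maps
  \<open>\<Psi>\<close> and \<open>\<Phi>\<close> carry the statement from \<open>Hom(E, W)\<close>
  to the coordinates. This is the presentation to which the general Tor lemmas are applied.\<close>

private lemma \<pi>z_ker: "{x \<in> carrier Pz. \<pi>z x = \<zero>\<^bsub>Cz\<^esub>} = rz ` carrier Oz"
proof -
  have "\<pi>z x = \<zero>\<^bsub>Cz\<^esub> \<longleftrightarrow> \<Psi> x \<in> vis ` carrier Oz" if "x \<in> carrier Pz" for x
    unfolding C_vis_def vis_image by (rule quot_proj_zero_iff[OF Hz im_sub lin_closed[OF \<Psi> that]])
  moreover have "\<Psi> x \<in> vis ` carrier Oz \<longleftrightarrow> x \<in> rz ` carrier Oz" if x: "x \<in> carrier Pz" for x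
  proof
    assume "\<Psi> x \<in> vis ` carrier Oz"
    then obtain X where "X \<in> carrier Oz" "\<Psi> x = vis X" by blast
    then show "x \<in> rz ` carrier Oz" using \<Phi>\<Psi>[OF x] by (intro image_eqI[of _ _ X]) simp_all
  next
    assume "x \<in> rz ` carrier Oz"
    then obtain X where "X \<in> carrier Oz" "x = rz X" by blast
    then show "\<Psi> x \<in> vis ` carrier Oz" using \<Psi>\<Phi>[OF lin_closed[OF vis]] by simp
  qed
  moreover have "rz ` carrier Oz \<subseteq> carrier Pz" using lin_closed[OF rz] by blast
  ultimately show ?thesis by blast
qed

text \<open>The regular and the visible representation have the same kernel, and
  \<open>\<Phi>\<close> is injective. In this form the defect is literally the module
  \<open>Ker\<close> of the general Tor lemmas.\<close>

private lemma Dz_eq: "Dz = Oz\<lparr>carrier := {m \<in> carrier Oz. rz m = (\<lambda>_. 0)}\<rparr>"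
proof -
  have "regular_rep \<Z> Az X = \<zero>\<^bsub>Hom_module \<Z> Tz Tz\<^esub> \<longleftrightarrow> rz X = (\<lambda>_. 0)" if X: "X \<in> carrier Oz" for X
  proof -
    have "rz X = (\<lambda>_. 0) \<longleftrightarrow> vis X = \<zero>\<^bsub>Hz\<^esub>"
    proof
      assume "rz X = (\<lambda>_. 0)"
      then have "\<Psi> (rz X) = \<Psi> \<zero>\<^bsub>Pz\<^esub>" by simp
      then show "vis X = \<zero>\<^bsub>Hz\<^esub>" unfolding \<Psi>\<Phi>[OF lin_closed[OF vis X]] lin_zero[OF \<Psi> Pz Hz] .
    next
      assume "vis X = \<zero>\<^bsub>Hz\<^esub>"
      then have "rz X = \<zero>\<^bsub>Pz\<^esub>" using lin_zero[OF \<Phi> Hz Pz] by simp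
      then show "rz X = (\<lambda>_. 0)" by simp
    qed
    then show ?thesis using regular_rep_zero_iff[OF Em Wm \<mu> X] by simp
  qed
  then have "{X \<in> carrier Oz. regular_rep \<Z> Az X = \<zero>\<^bsub>Hom_module \<Z> Tz Tz\<^esub>} = {m \<in> carrier Oz. rz m = (\<lambda>_. 0)}"
    by blast
  then show ?thesis unfolding operator_defect_def two_step_simps by simp
qed

private lemma D_incl: "(\<lambda>x. x) \<in> linear_maps \<Z> Dz Oz"
  unfolding Dz_eq by (rule lin_id_sub) auto

private abbreviation (input) "Bz U \<equiv> operator_base_change E W \<mu> U"
private abbreviation (input) "As S \<equiv> two_step S (base_change E S) (base_change W S) (base_change_mu E W \<mu> S)"
private abbreviation (input) "Os S \<equiv> operator_rng S (As S)"
private abbreviation (input) "Ds S \<equiv> operator_defect S (two_step_over E W \<mu> S)"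
private abbreviation (input) "incl S \<equiv> tensor_map \<Z> Oz (int_alg S) (\<lambda>x. x) (\<lambda>s. s)"
private abbreviation (input) "rT S \<equiv> tensor_map \<Z> Pz (int_alg S) rz (\<lambda>s. s)"

private lemma S_mods:
  assumes S: "cring S"
  shows "module S (base_change E S)" "module S (base_change W S)"
    "base_change_mu E W \<mu> S \<in> linear_maps S (tensor3 S (base_change E S) (base_change E S) (base_change E S)) (base_change W S)"
  by (intro base_change_module S Em Wm base_change_mu_lin \<mu>)+

private lemma Os: "cring S \<Longrightarrow> module S (Os S)"
  by (rule operator_rng_module[OF S_mods])

private lemma Ds_module: "cring S \<Longrightarrow> module S (Ds S)"
  unfolding two_step_over_def by (rule operator_defect_module[OF S_mods])

text \<open>The representation over \<open>S\<close> vanishes when all evaluations at elements of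
  \<open>E\<close> do. A finite basis of \<open>E\<close> turns this into vanishing in
  \<open>Hom(E, W) \<otimes> S\<close>, and the coordinates \<open>\<Phi>\<close>, invertible after
  tensoring as before, into vanishing of \<open>rT\<close>.\<close>

private lemma rS_zero_iff:
  fixes S :: "'s ring"
  assumes S: "cring S" and Y: "Y \<in> carrier (base_change Oz S)"
  shows "regular_rep S (As S) (Bz S Y) = \<zero>\<^bsub>Hom_module S (space (As S)) (space (As S))\<^esub> \<longleftrightarrow>
    rT S Y = \<zero>\<^bsub>tensor \<Z> Pz (int_alg S)\<^esub>" (is "?l \<longleftrightarrow> ?r")
proof -
  note I = int_alg_module[OF S]
  have Y': "Y \<in> carrier (tensor \<Z> Oz (int_alg S))" using Y by simp
  let ?t = "\<lambda>M f. tensor_map \<Z> M (int_alg S) f (\<lambda>s. s)"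
  have ev: "(\<lambda>f. f e) \<in> linear_maps \<Z> Hz W" if "e \<in> carrier E" for e by (rule Hom_eval_lin[OF that])
  have e: "?t W (\<lambda>f. f e) (?t Hz vis Y) = ?t W (\<lambda>X. vis X e) Y" if "e \<in> carrier E" for e
    by (rule tensor_map_comp[OF Oz I Hz I Wm I vis lin_id ev[OF that] lin_id Y'])
  have P: "?t Pz \<Phi> (?t Hz vis Y) = rT S Y"
    by (rule tensor_map_comp[OF Oz I Hz I Pz I vis lin_id \<Phi> lin_id Y'])
  have "?t Hz \<Psi> (rT S Y) = ?t Hz (\<lambda>X. \<Psi> (rz X)) Y"
    by (rule tensor_map_comp[OF Oz I Pz I Hz I rz lin_id \<Psi> lin_id Y'])
  also have "\<dots> = ?t Hz vis Y"
    by (rule tensor_map_cong[OF Oz I Hz I vis lin_id _ refl Y']) (rule \<Psi>\<Phi>[OF lin_closed[OF vis]])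
  finally have H: "?t Hz \<Psi> (rT S Y) = ?t Hz vis Y" .
  have "?l \<longleftrightarrow> (\<forall>e\<in>carrier E. ?t W (\<lambda>X. vis X e) Y = \<zero>\<^bsub>base_change W S\<^esub>)"
    unfolding two_step_simps by (rule regular_rep_base_change_zero_iff[OF Em Wm \<mu> S Y])
  also have "\<dots> \<longleftrightarrow> ?t Hz vis Y = \<zero>\<^bsub>tensor \<Z> Hz (int_alg S)\<^esub>"
  proof
    assume z: "\<forall>e\<in>carrier E. ?t W (\<lambda>X. vis X e) Y = \<zero>\<^bsub>base_change W S\<^esub>"
    show "?t Hz vis Y = \<zero>\<^bsub>tensor \<Z> Hz (int_alg S)\<^esub>"
    proof (rule Hom_tensor_eval_eq_zero[OF E Wm I])
      show "?t Hz vis Y \<in> carrier (tensor \<Z> Hz (int_alg S))"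
        by (rule lin_closed[OF tensor_map_lin[OF Oz I Hz I vis lin_id] Y'])
      show "?t W (\<lambda>f. f e) (?t Hz vis Y) = \<zero>\<^bsub>tensor \<Z> W (int_alg S)\<^esub>" if "e \<in> carrier E" for e
        unfolding e[OF that] using z that by simp
    qed
  next
    assume z: "?t Hz vis Y = \<zero>\<^bsub>tensor \<Z> Hz (int_alg S)\<^esub>"
    show "\<forall>e\<in>carrier E. ?t W (\<lambda>X. vis X e) Y = \<zero>\<^bsub>base_change W S\<^esub>"
      using e tensor_map_at_zero[OF Hz I Wm I ev lin_id] by (simp add: z)
  qed
  also have "\<dots> \<longleftrightarrow> ?r"
    using P H tensor_map_at_zero[OF Hz I Pz I \<Phi> lin_id] tensor_map_at_zero[OF Pz I Hz I \<Psi> lin_id] by metis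
  finally show ?thesis .
qed

private lemma Bz_facts:
  fixes S :: "'s ring"
  assumes S: "cring S"
  shows "Bz S \<in> linear_maps S (base_change Oz S) (Os S)" "bij_betw (Bz S) (carrier (base_change Oz S)) (carrier (Os S))"
  by (rule operator_base_change_lin[OF Em Wm \<mu> S], rule operator_base_change_bij[OF Em Wm \<mu> S])

private lemma Ds_carrier:
  fixes S :: "'s ring"
  assumes S: "cring S"
  shows "carrier (Ds S) = Bz S ` {Y \<in> carrier (base_change Oz S). rT S Y = \<zero>\<^bsub>tensor \<Z> Pz (int_alg S)\<^esub>}"
proof -
  note im = bij_betw_imp_surj_on[OF Bz_facts(2)[OF S], symmetric]
  have "carrier (Ds S) = {X \<in> carrier (Os S). regular_rep S (As S) X = \<zero>\<^bsub>Hom_module S (space (As S)) (space (As S))\<^esub>}"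
    by (simp add: operator_defect_def two_step_over_def)
  also have "\<dots> = Bz S ` {Y \<in> carrier (base_change Oz S). regular_rep S (As S) (Bz S Y) = \<zero>\<^bsub>Hom_module S (space (As S)) (space (As S))\<^esub>}"
    unfolding im by blast
  also have "\<dots> = Bz S ` {Y \<in> carrier (base_change Oz S). rT S Y = \<zero>\<^bsub>tensor \<Z> Pz (int_alg S)\<^esub>}"
    using rS_zero_iff[OF S] by (metis (no_types, lifting) Collect_cong)
  finally show ?thesis .
qed

private lemma Ds_eq: "Ds S = (Os S)\<lparr>carrier := carrier (Ds S)\<rparr>"
  by (simp add: operator_defect_def two_step_over_def)

private lemma Ds_sub: "carrier (Ds S) \<subseteq> carrier (Os S)"
  by (auto simp: operator_defect_def two_step_over_def)

private lemma dbc_eq: "defect_base_change E W \<mu> S = (\<lambda>u. Bz S (incl S u))"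
  by (simp add: defect_base_change_def fun_eq_iff)

private lemma incl_lin: "cring S \<Longrightarrow> incl S \<in> linear_maps S (base_change Dz S) (base_change Oz S)"
  by (rule base_change_map_lin[OF _ Dz Oz D_incl])

context
  fixes s \<psi> \<phi>
  assumes s: "s \<in> linear_maps \<Z> (Pz\<lparr>carrier := rz ` carrier Oz\<rparr>) Oz" and rs: "\<And>x. x \<in> rz ` carrier Oz \<Longrightarrow> rz (s x) = x"
    and \<psi>: "\<psi> \<in> linear_maps \<Z> Pz Fz" and \<epsilon>\<psi>: "\<And>x. x \<in> carrier Pz \<Longrightarrow> free_lift \<Z> Cz (\<lambda>x. x) (\<psi> x) = \<pi>z x"
    and \<phi>: "\<phi> \<in> linear_maps \<Z> Fz Pz" and \<pi>\<phi>: "\<And>y. y \<in> carrier Fz \<Longrightarrow> \<pi>z (\<phi> y) = free_lift \<Z> Cz (\<lambda>x. x) y"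
begin

private lemmas pres = Oz Cz finite_lessThan rz \<pi>z \<pi>z_onto \<pi>z_ker s rs \<psi> \<epsilon>\<psi> \<phi> \<pi>\<phi>

private abbreviation (input) "\<kappa>z \<equiv> \<lambda>m. \<psi> (rz m)"
private abbreviation (input) "\<kappa>S S \<equiv> tensor_map \<Z> Kz (int_alg S) \<kappa>z (\<lambda>s. s)"
text \<open>The connecting map: an element of the operator rng over \<open>S\<close> is pulled back
  along the bijection \<open>Bz\<close>, and the integral map \<open>\<kappa>z\<close> is applied in
  the first tensor factor. On the defect its values satisfy the condition that defines
  \<open>Tor1\<close>.\<close>

private abbreviation (input) "\<delta>z S \<equiv> \<lambda>\<eta>. \<kappa>S S (inv_into (carrier (base_change Oz S)) (Bz S) \<eta>)"

private lemma Kz: "module \<Z> Kz" by (rule resolution_kernel_module(1)[OF Cz])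

private lemma \<kappa>z: "\<kappa>z \<in> linear_maps \<Z> Oz Kz"
  by (rule connecting_lin[where r = rz and \<pi> = \<pi>z and s = s and \<psi> = \<psi> and \<phi> = \<phi>, OF pres int_alg_module[OF int_is_cring]])

private lemma \<delta>z_Bz:
  fixes S :: "'s ring"
  assumes "cring S" "Y \<in> carrier (base_change Oz S)"
  shows "\<delta>z S (Bz S Y) = \<kappa>S S Y"
  using bij_betw_imp_inj_on[OF Bz_facts(2)[OF assms(1)]] assms(2) by (simp del: base_change_simps)

private lemma \<delta>z_lin:
  fixes S :: "'s ring"
  assumes S: "cring S"
  shows "\<delta>z S \<in> linear_maps S (Ds S) (Tor1 Cz S)"
proof -
  have "\<delta>z S \<in> linear_maps S (Os S) (base_change Kz S)"
    by (rule lin_comp[OF inv_into_lin[OF Bz_facts[OF S] base_change_module[OF S Oz]] base_change_map_lin[OF S Oz Kz \<kappa>z]])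
  then have l: "\<delta>z S \<in> linear_maps S (Ds S) (base_change Kz S)"
    by (subst Ds_eq) (rule lin_from_sub[OF _ Ds_sub])
  have "\<delta>z S \<eta> \<in> carrier (Tor1 Cz S)" if \<eta>: "\<eta> \<in> carrier (Ds S)" for \<eta>
  proof -
    obtain Y where Y: "Y \<in> carrier (base_change Oz S)" "rT S Y = \<zero>\<^bsub>tensor \<Z> Pz (int_alg S)\<^esub>" "\<eta> = Bz S Y"
      using \<eta> unfolding Ds_carrier[OF S] by blast
    have "\<kappa>S S Y \<in> carrier (base_change Kz S)"
      by (rule lin_closed[OF base_change_map_lin[OF S Oz Kz \<kappa>z] Y(1)])
    then show ?thesis
      unfolding Y(3) \<delta>z_Bz[OF S Y(1)] Tor1_eq
      using connecting_in_Tor1[where r = rz and \<pi> = \<pi>z and s = s and \<psi> = \<psi> and \<phi> = \<phi>, OF pres int_alg_module[OF S] _ Y(2)] Y(1) by simp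
  qed
  then show ?thesis unfolding Tor1_eq using l by (intro lin_into_sub) (auto simp: Tor1_eq)
qed

text \<open>Under \<open>Bz\<close> the defect over \<open>S\<close> becomes the kernel of
  \<open>rT\<close>. There \<open>Ker_tensor_inj\<close> gives injectivity on the left,
  \<open>Ker_tensor_null\<close> and \<open>connecting_zero\<close> give exactness in the middle,
  and \<open>connecting_onto\<close> gives surjectivity on the right.\<close>

lemma operator_defect_exact:
  fixes S :: "'s ring"
  assumes S: "cring S"
  shows "short_exact S (base_change Dz S) (defect_base_change E W \<mu> S) (Ds S) (\<delta>z S) (Tor1 Cz S)"
proof -
  note I = int_alg_module[OF S]
  note B = Bz_facts[OF S]
  have inj: "inj_on (incl S) (carrier (tensor \<Z> Dz (int_alg S)))"
    unfolding Dz_eq by (rule Ker_tensor_inj[where r = rz and \<pi> = \<pi>z and s = s and \<psi> = \<psi> and \<phi> = \<phi>, OF pres I])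
  have null: "rT S (incl S u) = \<zero>\<^bsub>tensor \<Z> Pz (int_alg S)\<^esub>" "\<kappa>S S (incl S u) = \<zero>\<^bsub>tensor \<Z> Kz (int_alg S)\<^esub>"
    if "u \<in> carrier (tensor \<Z> Dz (int_alg S))" for u
    using Ker_tensor_null[where r = rz and \<pi> = \<pi>z and s = s and \<psi> = \<psi> and \<phi> = \<phi>, OF pres I] that unfolding Dz_eq by blast+
  have ex: "Y \<in> incl S ` carrier (tensor \<Z> Dz (int_alg S))"
    if "Y \<in> carrier (tensor \<Z> Oz (int_alg S))" "rT S Y = \<zero>\<^bsub>tensor \<Z> Pz (int_alg S)\<^esub>" "\<kappa>S S Y = \<zero>\<^bsub>tensor \<Z> Kz (int_alg S)\<^esub>" for Y
    unfolding Dz_eq by (rule connecting_zero[where r = rz and \<pi> = \<pi>z and s = s and \<psi> = \<psi> and \<phi> = \<phi>, OF pres I that])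
  have ic: "incl S u \<in> carrier (base_change Oz S)" if "u \<in> carrier (base_change Dz S)" for u
    by (rule lin_closed[OF incl_lin[OF S] that])
  have dc: "defect_base_change E W \<mu> S u \<in> carrier (Ds S)" if u: "u \<in> carrier (base_change Dz S)" for u
    unfolding dbc_eq Ds_carrier[OF S] using ic[OF u] null(1)[of u] u by (intro imageI) simp
  have dl: "defect_base_change E W \<mu> S \<in> linear_maps S (base_change Dz S) (Ds S)"
    by (subst Ds_eq, rule lin_into_sub[OF _ dc]) (unfold dbc_eq, rule lin_comp[OF incl_lin[OF S] B(1)])
  have binj: "inj_on (Bz S) (carrier (base_change Oz S))" by (rule bij_betw_imp_inj_on[OF B(2)])
  have "inj_on (defect_base_change E W \<mu> S) (carrier (base_change Dz S))"
    unfolding dbc_eq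
    by (rule inj_onI) (use inj_onD[OF binj _ ic ic] inj_onD[OF inj] in simp)
  moreover have "defect_base_change E W \<mu> S ` carrier (base_change Dz S) = {y \<in> carrier (Ds S). \<delta>z S y = \<zero>\<^bsub>Tor1 Cz S\<^esub>}"
  proof (intro equalityI subsetI)
    fix y assume "y \<in> defect_base_change E W \<mu> S ` carrier (base_change Dz S)"
    then obtain u where u: "u \<in> carrier (base_change Dz S)" "y = defect_base_change E W \<mu> S u" by blast
    have "\<delta>z S y = \<kappa>S S (incl S u)" unfolding u(2) dbc_eq by (rule \<delta>z_Bz[OF S ic[OF u(1)]])
    also have "\<dots> = \<zero>\<^bsub>Tor1 Cz S\<^esub>" using null(2)[of u] u(1) by (simp add: Tor1_eq)
    finally show "y \<in> {y \<in> carrier (Ds S). \<delta>z S y = \<zero>\<^bsub>Tor1 Cz S\<^esub>}" using dc[OF u(1)] u(2) by blast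
  next
    fix y assume "y \<in> {y \<in> carrier (Ds S). \<delta>z S y = \<zero>\<^bsub>Tor1 Cz S\<^esub>}"
    then obtain Y where Y: "Y \<in> carrier (base_change Oz S)" "rT S Y = \<zero>\<^bsub>tensor \<Z> Pz (int_alg S)\<^esub>" "y = Bz S Y"
      and z: "\<delta>z S (Bz S Y) = \<zero>\<^bsub>Tor1 Cz S\<^esub>"
      unfolding Ds_carrier[OF S] by blast
    have "\<kappa>S S Y = \<zero>\<^bsub>tensor \<Z> Kz (int_alg S)\<^esub>" using z unfolding \<delta>z_Bz[OF S Y(1)] by (simp add: Tor1_eq)
    then obtain u where "u \<in> carrier (tensor \<Z> Dz (int_alg S))" "Y = incl S u"
      using ex[OF _ Y(2)] Y(1) by auto
    then show "y \<in> defect_base_change E W \<mu> S ` carrier (base_change Dz S)"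
      unfolding Y(3) dbc_eq by simp
  qed
  moreover have "\<delta>z S ` carrier (Ds S) = carrier (Tor1 Cz S)"
  proof
    show "\<delta>z S ` carrier (Ds S) \<subseteq> carrier (Tor1 Cz S)" using lin_closed[OF \<delta>z_lin[OF S]] by blast
    show "carrier (Tor1 Cz S) \<subseteq> \<delta>z S ` carrier (Ds S)"
    proof
      fix z assume "z \<in> carrier (Tor1 Cz S)"
      then obtain Y where Y: "Y \<in> carrier (tensor \<Z> Oz (int_alg S))" "rT S Y = \<zero>\<^bsub>tensor \<Z> Pz (int_alg S)\<^esub>" "\<kappa>S S Y = z"
        using connecting_onto[where r = rz and \<pi> = \<pi>z and s = s and \<psi> = \<psi> and \<phi> = \<phi>, OF pres I, of z] by (auto simp: Tor1_eq)
      have Y': "Y \<in> carrier (base_change Oz S)" using Y(1) by simp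
      have "z = \<delta>z S (Bz S Y)" using \<delta>z_Bz[OF S Y'] Y(3) by simp
      then show "z \<in> \<delta>z S ` carrier (Ds S)" using Y' Y(2) unfolding Ds_carrier[OF S] by blast
    qed
  qed
  ultimately show ?thesis
    unfolding short_exact_def
    using base_change_module[OF S Dz] Ds_module[OF S] Tor1_module[OF S Cz] dl \<delta>z_lin[OF S] by blast
qed

text \<open>Write an element of the defect as \<open>Bz S Y\<close> with \<open>rT S Y\<close> zero.
  By \<open>operator_base_change_natural\<close> its transport along \<open>h\<close> is
  \<open>Bz S'\<close> of the transport of \<open>Y\<close>, and the integral maps
  \<open>rz\<close>, \<open>\<kappa>z\<close> and the inclusions commute with the change of ring by
  \<open>base_change_hom_map\<close>.\<close>

lemma operator_defect_natural:
  fixes S S' :: "'s ring"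
  assumes S: "cring S" and S': "cring S'" and h: "h \<in> ring_hom S S'"
  shows "base_change_hom Dz S' h \<in> carrier (base_change Dz S) \<rightarrow> carrier (base_change Dz S')" (is ?a)
    and "operator_scalar_hom E W \<mu> S h S' \<in> carrier (Ds S) \<rightarrow> carrier (Ds S')" (is ?b)
    and "Tor1_hom Cz S' h \<in> carrier (Tor1 Cz S) \<rightarrow> carrier (Tor1 Cz S')" (is ?c)
    and "\<forall>\<xi> \<in> carrier (base_change Dz S). operator_scalar_hom E W \<mu> S h S' (defect_base_change E W \<mu> S \<xi>) =
      defect_base_change E W \<mu> S' (base_change_hom Dz S' h \<xi>)" (is ?d)
    and "\<forall>\<eta> \<in> carrier (Ds S). Tor1_hom Cz S' h (\<delta>z S \<eta>) = \<delta>z S' (operator_scalar_hom E W \<mu> S h S' \<eta>)" (is ?e)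
proof -
  note sq = base_change_hom_map[OF S S' h] and bc = base_change_hom_closed[OF S S' h] and bz = base_change_hom_zero[OF S S' h]
  note nat = operator_base_change_natural[OF Em Wm \<mu> S S' h]
  show ?a using bc[OF Dz] by blast
  show ?d
  proof
    fix \<xi> assume \<xi>: "\<xi> \<in> carrier (base_change Dz S)"
    show "operator_scalar_hom E W \<mu> S h S' (defect_base_change E W \<mu> S \<xi>) =
      defect_base_change E W \<mu> S' (base_change_hom Dz S' h \<xi>)"
      unfolding dbc_eq nat[OF lin_closed[OF incl_lin[OF S] \<xi>]] sq[OF Dz Oz D_incl \<xi>] ..
  qed
  have rel: "operator_scalar_hom E W \<mu> S h S' (Bz S Y) = Bz S' (base_change_hom Oz S' h Y)"
      "base_change_hom Oz S' h Y \<in> carrier (base_change Oz S')"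
      "rT S' (base_change_hom Oz S' h Y) = \<zero>\<^bsub>tensor \<Z> Pz (int_alg S')\<^esub>"
    if Y: "Y \<in> carrier (base_change Oz S)" "rT S Y = \<zero>\<^bsub>tensor \<Z> Pz (int_alg S)\<^esub>" for Y
    using nat[OF Y(1)] bc[OF Oz Y(1)] sq[OF Oz Pz rz Y(1)] bz[OF Pz] Y(2) by simp_all
  show ?b
  proof
    fix \<eta> assume "\<eta> \<in> carrier (Ds S)"
    then obtain Y where Y: "Y \<in> carrier (base_change Oz S)" "rT S Y = \<zero>\<^bsub>tensor \<Z> Pz (int_alg S)\<^esub>" "\<eta> = Bz S Y"
      unfolding Ds_carrier[OF S] by blast
    show "operator_scalar_hom E W \<mu> S h S' \<eta> \<in> carrier (Ds S')"
      unfolding Y(3) rel(1)[OF Y(1,2)] Ds_carrier[OF S'] using rel(2,3)[OF Y(1,2)] by blast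
  qed
  show ?e
  proof
    fix \<eta> assume "\<eta> \<in> carrier (Ds S)"
    then obtain Y where Y: "Y \<in> carrier (base_change Oz S)" "rT S Y = \<zero>\<^bsub>tensor \<Z> Pz (int_alg S)\<^esub>" "\<eta> = Bz S Y"
      unfolding Ds_carrier[OF S] by blast
    show "Tor1_hom Cz S' h (\<delta>z S \<eta>) = \<delta>z S' (operator_scalar_hom E W \<mu> S h S' \<eta>)"
      unfolding Y(3) rel(1)[OF Y(1,2)] \<delta>z_Bz[OF S Y(1)] \<delta>z_Bz[OF S' rel(2)[OF Y(1,2)]] Tor1_hom_def
      by (rule sq[OF Oz Kz \<kappa>z Y(1), symmetric])
  qed
  show ?c
  proof
    fix z assume z: "z \<in> carrier (Tor1 Cz S)"
    then have z1: "z \<in> carrier (base_change Kz S)"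
      and z2: "tensor_map \<Z> Fz (int_alg S) (\<lambda>x. x) (\<lambda>s. s) z = \<zero>\<^bsub>tensor \<Z> Fz (int_alg S)\<^esub>" by (auto simp: Tor1_eq)
    show "Tor1_hom Cz S' h z \<in> carrier (Tor1 Cz S')"
      unfolding Tor1_hom_def Tor1_eq
      using bc[OF Kz z1] sq[OF Kz Fz resolution_kernel_module(2)[OF Cz] z1] bz[OF Fz] z2 by simp
  qed
qed

end

text \<open>Injectivity and linearity are read off the exact sequence. For surjectivity flatness is
  applied to the inclusion of the image of \<open>rz\<close> in the free module on
  \<open>{..<k}\<close>, instead of proving \<open>Tor1\<close> to vanish: the standard resolution
  has elements of a type on which \<open>flat_module\<close> makes no statement.\<close>

lemma operator_defect_flat_base_change:
  fixes S :: "'s ring"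
  assumes S: "cring S" and flat: "flat_module \<Z> (int_alg S)"
    and exact: "short_exact S (base_change Dz S) (defect_base_change E W \<mu> S) (Ds S) \<delta> C"
  shows "defect_base_change E W \<mu> S \<in> module_iso S (base_change Dz S) (Ds S)"
proof -
  have "carrier (Ds S) \<subseteq> defect_base_change E W \<mu> S ` carrier (base_change Dz S)"
  proof
    fix \<eta> assume "\<eta> \<in> carrier (Ds S)"
    then obtain Y where Y: "Y \<in> carrier (base_change Oz S)" "rT S Y = \<zero>\<^bsub>tensor \<Z> Pz (int_alg S)\<^esub>" "\<eta> = Bz S Y"
      unfolding Ds_carrier[OF S] by blast
    have "Y \<in> incl S ` carrier (tensor \<Z> Dz (int_alg S))"
      unfolding Dz_eq by (rule flat_image_Ker_tensor[OF Oz rz flat _ Y(2)]) (use Y(1) in simp)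
    then show "\<eta> \<in> defect_base_change E W \<mu> S ` carrier (base_change Dz S)"
      unfolding Y(3) dbc_eq by auto
  qed
  then show ?thesis
    using exact unfolding short_exact_def module_iso_def bij_betw_def by (auto dest: lin_closed)
qed

text \<open>The order of quantifiers carries the naturality: one family \<open>\<delta>\<close>
  serves all rings, which is possible since the section and the comparison maps are obtained before
  any \<open>S\<close> is mentioned.\<close>

lemma ex_natural_exact_sequence:
  "\<exists>\<delta> :: 's ring \<Rightarrow> _ \<Rightarrow> _.
     (\<forall>S. cring S \<longrightarrow> short_exact S (base_change Dz S) (defect_base_change E W \<mu> S) (Ds S) (\<delta> S) (Tor1 Cz S)) \<and>
     (\<forall>S S' h. cring S \<and> cring S' \<and> h \<in> ring_hom S S' \<longrightarrow>
        base_change_hom Dz S' h \<in> carrier (base_change Dz S) \<rightarrow> carrier (base_change Dz S') \<and>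
        operator_scalar_hom E W \<mu> S h S' \<in> carrier (Ds S) \<rightarrow> carrier (Ds S') \<and>
        Tor1_hom Cz S' h \<in> carrier (Tor1 Cz S) \<rightarrow> carrier (Tor1 Cz S') \<and>
        (\<forall>\<xi> \<in> carrier (base_change Dz S). operator_scalar_hom E W \<mu> S h S' (defect_base_change E W \<mu> S \<xi>) =
           defect_base_change E W \<mu> S' (base_change_hom Dz S' h \<xi>)) \<and>
        (\<forall>\<eta> \<in> carrier (Ds S). Tor1_hom Cz S' h (\<delta> S \<eta>) = \<delta> S' (operator_scalar_hom E W \<mu> S h S' \<eta>)))"
proof (rule Tor1_presentation_maps[where r = rz and \<pi> = \<pi>z, OF Oz Cz finite_lessThan rz \<pi>z \<pi>z_onto \<pi>z_ker])
  fix s \<psi> \<phi>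
  assume *: "s \<in> linear_maps \<Z> (Pz\<lparr>carrier := rz ` carrier Oz\<rparr>) Oz" "\<And>x. x \<in> rz ` carrier Oz \<Longrightarrow> rz (s x) = x"
    "\<psi> \<in> linear_maps \<Z> Pz Fz" "\<And>x. x \<in> carrier Pz \<Longrightarrow> free_lift \<Z> Cz (\<lambda>x. x) (\<psi> x) = \<pi>z x"
    "\<phi> \<in> linear_maps \<Z> Fz Pz" "\<And>y. y \<in> carrier Fz \<Longrightarrow> \<pi>z (\<phi> y) = free_lift \<Z> Cz (\<lambda>x. x) y"
  show ?thesis
    by (intro exI[of _ "\<lambda>S \<eta>. tensor_map \<Z> Kz (int_alg S) (\<lambda>m. \<psi> (rz m)) (\<lambda>s. s)
          (inv_into (carrier (base_change Oz S)) (Bz S) \<eta>)"] conjI allI impI operator_defect_exact[where s = s and \<psi> = \<psi> and \<phi> = \<phi>, OF *]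
        operator_defect_natural[where s = s and \<psi> = \<psi> and \<phi> = \<phi>, OF *]) auto
qed

end

theorem theorem13p1:
  fixes E :: "(int, 'e) module" and W :: "(int, 'w) module"
    and \<mu> :: "(int, 'e) cube \<Rightarrow> 'w"
  assumes "finite_free \<Z> E" and "carrier E \<noteq> {\<zero>\<^bsub>E\<^esub>}"
    and "finite_free \<Z> W" and "carrier W \<noteq> {\<zero>\<^bsub>W\<^esub>}"
    and "\<mu> \<in> linear_maps \<Z> (tensor3 \<Z> E E E) W"
    and "\<mu> ` carrier (tensor3 \<Z> E E E) = carrier W"
  defines "D \<equiv> operator_defect \<Z> (two_step \<Z> E W \<mu>)"
    and "D\<^sub>S \<equiv> (\<lambda>S :: 's ring. operator_defect S (two_step_over E W \<mu> S))"
    and "C \<equiv> C_vis \<Z> E W \<mu>"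
  shows "(\<exists>\<delta> :: 's ring \<Rightarrow> _ \<Rightarrow> _.
           (\<forall>S. cring S \<longrightarrow>
              short_exact S (base_change D S) (defect_base_change E W \<mu> S) (D\<^sub>S S) (\<delta> S) (Tor1 C S)) \<and>
           (\<forall>S S' h. cring S \<and> cring S' \<and> h \<in> ring_hom S S' \<longrightarrow>
              base_change_hom D S' h \<in> carrier (base_change D S) \<rightarrow> carrier (base_change D S') \<and>
              operator_scalar_hom E W \<mu> S h S' \<in> carrier (D\<^sub>S S) \<rightarrow> carrier (D\<^sub>S S') \<and>
              Tor1_hom C S' h \<in> carrier (Tor1 C S) \<rightarrow> carrier (Tor1 C S') \<and>
              (\<forall>\<xi> \<in> carrier (base_change D S).
                 operator_scalar_hom E W \<mu> S h S' (defect_base_change E W \<mu> S \<xi>) =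
                 defect_base_change E W \<mu> S' (base_change_hom D S' h \<xi>)) \<and>
              (\<forall>\<eta> \<in> carrier (D\<^sub>S S).
                 Tor1_hom C S' h (\<delta> S \<eta>) = \<delta> S' (operator_scalar_hom E W \<mu> S h S' \<eta>)))) \<and>
         (\<forall>S :: 's ring. cring S \<and> flat_module \<Z> (int_alg S) \<longrightarrow>
            defect_base_change E W \<mu> S \<in> module_iso S (base_change D S) (D\<^sub>S S)) \<and>
         (\<forall>S :: 's ring. cring S \<longrightarrow>
            (\<exists>f. f \<in> module_iso S (base_change (middle_quotient \<Z> E W \<mu>) S)
                   (middle_quotient S (base_change E S) (base_change W S) (base_change_mu E W \<mu> S))))"
proof (rule Hom_finite_free[OF assms(1,3)])
  have E: "module \<Z> E" and W: "module \<Z> W" using assms(1,3) by (simp_all add: finite_free_def)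
  fix k :: nat and \<Psi> \<Phi>
  assume H: "\<Psi> \<in> linear_maps \<Z> (free_module \<Z> {..<k}) (Hom_module \<Z> E W)"
    "\<Phi> \<in> linear_maps \<Z> (Hom_module \<Z> E W) (free_module \<Z> {..<k})"
    "\<And>f. f \<in> carrier (Hom_module \<Z> E W) \<Longrightarrow> \<Psi> (\<Phi> f) = f"
    "\<And>c. c \<in> carrier (free_module \<Z> {..<k}) \<Longrightarrow> \<Phi> (\<Psi> c) = c"
  note ex = ex_natural_exact_sequence[OF assms(1,3,5) H, where ?'s = 's, folded D_def C_def]
  have flat: "defect_base_change E W \<mu> S \<in> module_iso S (base_change D S) (D\<^sub>S S)"
    if "cring S" "flat_module \<Z> (int_alg S)" for S :: "'s ring"
    using ex operator_defect_flat_base_change[OF assms(1,3,5) H that] that(1) unfolding D_def D\<^sub>S_def C_def by blast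
  show ?thesis
    using ex flat middle_quotient_base_change[OF E W assms(5)] unfolding D\<^sub>S_def by blast
qed

end
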